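(* Let $0<\varepsilon<1$ and assume $(1-\varepsilon)\lambda_{\min}(\mathbf{A})-\frac14 C_{\mathcal K}>0$. Then for all $\mathbf{v}=(v,\psi)\in\mathcal{H}=H^1(\Omega)\times H^{-1/2}(\Gamma)$ there holds $$\mathcal{B}(\mathbf{v};\mathbf{v})\ \ge\ \min\{\varepsilon,C_{\rm harm}\}\,\big(|||v|||_{\Omega}^2+\|\psi\|_{\mathcal V}^2\big)$$ with the constant $$C_{\rm harm}=\frac12\Big[(1-\varepsilon)\lambda_{\min}(\mathbf{A})+1-\sqrt{\big((1-\varepsilon)\lambda_{\min}(\mathbf{A})-1\big)^2+C_{\mathcal K}}\Big]$$ and the contraction constant $C_{\mathcal K}\in[1/2,1)$ of the double layer operator.
   Context: Domain: $\Omega\subset\mathbb{R}^d$, $d\in\{2,3\}$, is a bounded domain with connected polygonal (polyhedral) Lipschitz boundary $\Gamma$, with outward unit normal $\mathbf{n}$; if $d=2$, additionally $\operatorname{diam}(\Omega)<1$. $(\cdot,\cdot)_\Omega$ is the $L^2(\Omega)$ scalar product and $\langle\cdot,\cdot\rangle_\Gamma$ is the duality between $H^{m}(\Gamma)$ and $H^{-m}(\Gamma)$ extending the $L^2(\Gamma)$ scalar product. Coefficients: $\mathcal T$ is a triangulation of $\Omega$ into closed non-degenerate triangles ($d=2$) or tetrahedra ($d=3$). $\mathbf{A}:\Omega\to\mathbb{R}^{d\times d}$ is symmetric, bounded and uniformly positive definite, with entries in $W^{1,\infty}(T)$ for every $T\in\mathcal T$. $\lambda_{\min}(\mathbf{A})>0$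 is the infimum over $x\in\Omega$ of the minimal eigenvalue of $\mathbf{A}(x)$. Moreover $\mathbf{b}\in W^{1,\infty}(\Omega)^d$ and $c\in L^\infty(\Omega)$ satisfy $\frac12\operatorname{div}\mathbf{b}(x)+c(x)\ge0$ for almost every $x\in\Omega$. The inflow and outflow boundaries are $\Gamma^{in}=\{x\in\Gamma:\mathbf{b}(x)\cdot\mathbf{n}(x)<0\}$ and $\Gamma^{out}=\{x\in\Gamma:\mathbf{b}(x)\cdot\mathbf{n}(x)\ge0\}$. Boundary integral operators: with $G(z)=-\frac1{2\pi}\log|z|$ for $d=2$ and $G(z)=\frac1{4\pi|z|}$ for $d=3$, the single and double layer operators are, for smooth enough input, $$(\mathcal V\psi)(x)=\int_\Gamma\psi(y)G(x-y)\,ds_y,\qquad(\mathcal K\theta)(x)=\int_\Gamma\theta(y)\frac{\partial}{\partial\mathbf{n}_y}G(x-y)\,ds_y,\qquad x\in\Gamma,$$ and they extend to bounded operators $\mathcal V:H^{s-1/2}(\Gamma)\to H^{s+1/2}(\Gamma)$ and $\mathcal K:H^{s+1/2}(\Gamma)\to H^{s+1/2}(\Gamma)$, $s\in[-\frac12,\frac12]$. $\mathcal V$ is symmetric and $H^{-1/2}(\Gamma)$-elliptic, and $\|\psi\|_{\mathcal V}^2:=\langle\mathcal V\psi,\psi\rangle_\Gamma$ is a norm on $H^{-1/2}(\Gamma)$ equivalent to $\|\cdot\|_{H^{-1/2}(\Gamma)}$. The contraction constant $C_{\mathcal K}\in[1/2,1)$ of Steinbach and Wendland is the constant, depending only on $\Gamma$,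 with $\|(\frac12+\mathcal K)v\|_{\mathcal V^{-1}}\le C_{\mathcal K}\|v\|_{\mathcal V^{-1}}$ for all $v\in H^{1/2}(\Gamma)$, where $\|v\|_{\mathcal V^{-1}}^2=\langle\mathcal V^{-1}v,v\rangle_\Gamma$. Forms and norms: for $u,v\in H^1(\Omega)$, $$\mathcal A(u,v)=(\mathbf{A}\nabla u-\mathbf{b}u,\nabla v)_\Omega+(cu,v)_\Omega+\langle\mathbf{b}\cdot\mathbf{n}\,u,v\rangle_{\Gamma^{out}},$$ and for $(u,\phi),(v,\psi)\in\mathcal{H}$, $$\mathcal B((u,\phi);(v,\psi))=\mathcal A(u,v)-\langle\phi,v\rangle_\Gamma+\langle\psi,(1/2-\mathcal K)u\rangle_\Gamma+\langle\psi,\mathcal V\phi\rangle_\Gamma$$ (functions on $\Omega$ are identified with their traces on $\Gamma$). The energy (semi)norm is $$|||v|||_\Omega^2=\|\mathbf{A}^{1/2}\nabla v\|_{L^2(\Omega)}^2+\big\|(\tfrac12\operatorname{div}\mathbf{b}+c)^{1/2}v\big\|_{L^2(\Omega)}^2,\qquad v\in H^1(\Omega).$$ *)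

theory Defs
  imports "HOL-Analysis.Analysis"
begin

section \<open>Surface measure and outward normal of a polyhedral boundary\<close>

text \<open>
  The \<open>(d - 1)\<close>-dimensional Lebesgue measure on a hyperplane \<open>h\<close>: a subset of \<open>h\<close> has the
  \<open>d\<close>-dimensional volume of the right prism of height 1 over it. The prism is taken symmetric to \<open>h\<close>,
  so no choice of a normal is needed; \<open>closest_point h\<close> is the orthogonal projection onto \<open>h\<close>.
\<close>

definition hyperplane_measure :: "(real^'n) set \<Rightarrow> (real^'n) measure" where
  "hyperplane_measure h =
     distr (lebesgue_on {z. infdist z h \<le> 1/2}) borel (closest_point h)"

definition hyperplanes :: "(real^'n) set set" where
  "hyperplanes = {h. \<exists>a b. a \<noteq> 0 \<and> h = {x. a \<bullet> x = b}}"

lemma emeasure_hyperplane_measure: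
  fixes h S :: "(real^'n) set"
  assumes "h \<in> hyperplanes" "S \<in> sets borel"
  shows "emeasure (hyperplane_measure h) S =
    emeasure lebesgue {z. infdist z h \<le> 1/2 \<and> closest_point h z \<in> S}"
proof -
  obtain a b where a: "a \<noteq> 0" and h: "h = {x. a \<bullet> x = b}"
    using assms(1) by (auto simp: hyperplanes_def)
  have "(b / (a \<bullet> a)) *\<^sub>R a \<in> h"
    using a by (simp add: h)
  then have ne: "h \<noteq> {}"
    by blast
  have "continuous_on UNIV (closest_point h)"
    using ne by (intro continuous_on_closest_point) (auto simp: h convex_hyperplane closed_hyperplane)
  then have cp: "closest_point h \<in> borel_measurable borel"
    by (rule borel_measurable_continuous_onI)
  have "closed {z. infdist z h \<le> 1/2}"
    by (intro closed_Collect_le continuous_intros)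
  then have strip: "{z. infdist z h \<le> 1/2} \<in> sets lebesgue"
    by simp
  have *: "closest_point h \<in> measurable (lebesgue_on {z. infdist z h \<le> 1/2}) borel"
    using cp by (intro measurable_restrict_space1 measurable_completion) simp
  have "emeasure (hyperplane_measure h) S =
      emeasure (lebesgue_on {z. infdist z h \<le> 1/2})
        (closest_point h -` S \<inter> space (lebesgue_on {z. infdist z h \<le> 1/2}))"
    unfolding hyperplane_measure_def by (rule emeasure_distr[OF * assms(2)])
  also have "\<dots> = emeasure lebesgue (closest_point h -` S \<inter> {z. infdist z h \<le> 1/2})"
    using strip by (subst emeasure_restrict_space) auto
  finally show ?thesis
    by (simp add: Int_def conj_commute)
qed

text \<open>
  If \<open>\<Gamma>\<close> lies in finitely many hyperplanes, only these contribute to the integral over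
  \<open>count_space hyperplanes\<close> (any other hyperplane meets \<open>\<Gamma>\<close> in a null set), and no part is counted
  twice. So this is the usual surface measure of a polyhedral \<open>\<Gamma>\<close>, extended by 0 outside \<open>\<Gamma>\<close>.
\<close>

definition surface_measure :: "(real^'n) set \<Rightarrow> (real^'n) measure" where
  "surface_measure \<Gamma> = measure_of UNIV (sets borel)
     (\<lambda>S. \<integral>\<^sup>+h. emeasure (hyperplane_measure h) (S \<inter> \<Gamma>) \<partial>count_space hyperplanes)"

lemma sets_surface_measure [simp, measurable_cong]: "sets (surface_measure \<Gamma>) = sets borel"
  using sets.sigma_sets_eq[of borel] by (simp add: surface_measure_def)

lemma space_surface_measure [simp]: "space (surface_measure \<Gamma>) = UNIV"
  by (simp add: surface_measure_def space_measure_of_conv)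

lemma emeasure_surface_measure:
  fixes \<Gamma> S :: "(real^'n) set"
  assumes "\<Gamma> \<in> sets borel" "S \<in> sets borel"
  shows "emeasure (surface_measure \<Gamma>) S =
    (\<integral>\<^sup>+h. emeasure (hyperplane_measure h) (S \<inter> \<Gamma>) \<partial>count_space hyperplanes)"
proof (rule emeasure_measure_of[OF surface_measure_def])
  show "S \<in> sets (surface_measure \<Gamma>)"
    using assms by simp
  show "positive (sets (surface_measure \<Gamma>))
      (\<lambda>S. \<integral>\<^sup>+h. emeasure (hyperplane_measure h) (S \<inter> \<Gamma>) \<partial>count_space hyperplanes)"
    by (simp add: positive_def)
  show "countably_additive (sets (surface_measure \<Gamma>))
      (\<lambda>S. \<integral>\<^sup>+h. emeasure (hyperplane_measure h) (S \<inter> \<Gamma>) \<partial>count_space hyperplanes)"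
  proof (rule countably_additiveI)
    fix F :: "nat \<Rightarrow> (real^'n) set"
    assume F: "range F \<subseteq> sets (surface_measure \<Gamma>)" "disjoint_family F"
    have "(\<Sum>i. emeasure (hyperplane_measure h) (F i \<inter> \<Gamma>))
        = emeasure (hyperplane_measure h) ((\<Union>i. F i) \<inter> \<Gamma>)" for h
    proof -
      have "range (\<lambda>i. F i \<inter> \<Gamma>) \<subseteq> sets (hyperplane_measure h)"
        using F(1) assms(1) by (auto simp: hyperplane_measure_def)
      moreover have "disjoint_family (\<lambda>i. F i \<inter> \<Gamma>)"
        using F(2) by (auto simp: disjoint_family_on_def)
      ultimately show ?thesis
        using suminf_emeasure[of "\<lambda>i. F i \<inter> \<Gamma>" "hyperplane_measure h"] by simp
    qed
    then show "(\<Sum>i. \<integral>\<^sup>+h. emeasure (hyperplane_measure h) (F i \<inter> \<Gamma>) \<partial>count_space hyperplanes)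
        = (\<integral>\<^sup>+h. emeasure (hyperplane_measure h) ((\<Union>i. F i) \<inter> \<Gamma>) \<partial>count_space hyperplanes)"
      by (subst nn_integral_suminf[symmetric]) auto
  qed
qed simp

text \<open>
  The outward unit normal at a boundary point near which \<open>\<Omega>\<close> is a half-space; 0 at all other points
  (edges and vertices, which form a null set).
\<close>

definition is_outward_normal :: "(real^'n) set \<Rightarrow> real^'n \<Rightarrow> real^'n \<Rightarrow> bool" where
  "is_outward_normal \<Omega> x \<nu> \<longleftrightarrow>
     norm \<nu> = 1 \<and> (\<exists>r>0. \<forall>y\<in>ball x r. y \<in> \<Omega> \<longleftrightarrow> \<nu> \<bullet> (y - x) < 0)"

definition outward_normal :: "(real^'n) set \<Rightarrow> real^'n \<Rightarrow> real^'n" where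
  "outward_normal \<Omega> x =
     (if \<exists>\<nu>. is_outward_normal \<Omega> x \<nu> then THE \<nu>. is_outward_normal \<Omega> x \<nu> else 0)"


section \<open>Domains and meshes\<close>

definition lipschitz_boundary :: "(real^'n) set \<Rightarrow> bool" where
  "lipschitz_boundary \<Omega> \<longleftrightarrow>
     (\<forall>p\<in>frontier \<Omega>. \<exists>e r (f :: real^'n \<Rightarrow> real) L. norm e = 1 \<and> r > 0 \<and> L-lipschitz_on UNIV f \<and>
        (\<forall>y\<in>ball p r. y \<in> \<Omega> \<longleftrightarrow> y \<bullet> e < f (y - (y \<bullet> e) *\<^sub>R e)))"

definition polyhedral_boundary :: "(real^'n) set \<Rightarrow> bool" where
  "polyhedral_boundary \<Omega> \<longleftrightarrow>
     (\<exists>F. finite F \<and> (\<forall>f\<in>F. polytope f \<and> aff_dim f = int CARD('n) - 1) \<and> frontier \<Omega> = \<Union>F)"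

definition polyhedral_lipschitz_domain :: "(real^'n) set \<Rightarrow> bool" where
  "polyhedral_lipschitz_domain \<Omega> \<longleftrightarrow>
     open \<Omega> \<and> connected \<Omega> \<and> \<Omega> \<noteq> {} \<and> bounded \<Omega> \<and> connected (frontier \<Omega>) \<and>
     lipschitz_boundary \<Omega> \<and> polyhedral_boundary \<Omega>"

definition mesh_of :: "(real^'n) set \<Rightarrow> (real^'n) set set \<Rightarrow> bool" where
  "mesh_of \<Omega> \<T> \<longleftrightarrow>
     triangulation \<T> \<and> (\<forall>T\<in>\<T>. int CARD('n) simplex T) \<and> \<Union>\<T> = closure \<Omega>"


section \<open>Function spaces\<close>

text \<open>
  Elements of function spaces are represented by functions; equality in these spaces is equality
  almost everywhere.
\<close>

definition L2 :: "'a measure \<Rightarrow> ('a \<Rightarrow> real) set" where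
  "L2 M = {f \<in> borel_measurable M. integrable M (\<lambda>x. (f x)\<^sup>2)}"

definition Linf :: "'a measure \<Rightarrow> ('a \<Rightarrow> real) set" where
  "Linf M = {f \<in> borel_measurable M. \<exists>C. AE x in M. \<bar>f x\<bar> \<le> C}"

text \<open>
  \<open>C\<^sup>\<infinity>\<close> functions on the whole space: \<open>D [i\<^sub>1, \<dots>, i\<^sub>k]\<close> is the iterated partial derivative
  in the directions \<open>i\<^sub>k, \<dots>, i\<^sub>1\<close>.
\<close>

definition smooth :: "(real^'n \<Rightarrow> real) \<Rightarrow> bool" where
  "smooth \<phi> \<longleftrightarrow> (\<exists>D :: 'n list \<Rightarrow> real^'n \<Rightarrow> real. D [] = \<phi> \<and>
     (\<forall>is x. (D is has_derivative (\<lambda>h. \<Sum>i\<in>UNIV. D (i # is) x * h $ i)) (at x)))"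

definition test_function :: "(real^'n) set \<Rightarrow> (real^'n \<Rightarrow> real) \<Rightarrow> bool" where
  "test_function U \<phi> \<longleftrightarrow> smooth \<phi> \<and> (\<exists>K. compact K \<and> K \<subseteq> U \<and> (\<forall>x. x \<notin> K \<longrightarrow> \<phi> x = 0))"

definition partial :: "'n \<Rightarrow> (real^'n \<Rightarrow> real) \<Rightarrow> real^'n \<Rightarrow> real" where
  "partial i \<phi> x = frechet_derivative \<phi> (at x) (axis i 1)"

definition locally_integrable :: "(real^'n) set \<Rightarrow> (real^'n \<Rightarrow> real) \<Rightarrow> bool" where
  "locally_integrable U f \<longleftrightarrow> (\<forall>K. compact K \<and> K \<subseteq> U \<longrightarrow> integrable (lebesgue_on K) f)"

definition has_weak_grad :: "(real^'n) set \<Rightarrow> (real^'n \<Rightarrow> real) \<Rightarrow> (real^'n \<Rightarrow> real^'n) \<Rightarrow> bool" where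
  "has_weak_grad U v g \<longleftrightarrow>
     locally_integrable U v \<and> (\<forall>i. locally_integrable U (\<lambda>x. g x $ i)) \<and>
     (\<forall>\<phi> i. test_function U \<phi> \<longrightarrow>
        (\<integral>x. v x * partial i \<phi> x \<partial>lebesgue_on U) = - (\<integral>x. g x $ i * \<phi> x \<partial>lebesgue_on U))"

definition weak_grad :: "(real^'n) set \<Rightarrow> (real^'n \<Rightarrow> real) \<Rightarrow> real^'n \<Rightarrow> real^'n" where
  "weak_grad U v = (SOME g. has_weak_grad U v g)"

definition weak_div :: "(real^'n) set \<Rightarrow> (real^'n \<Rightarrow> real^'n) \<Rightarrow> real^'n \<Rightarrow> real" where
  "weak_div U b x = (\<Sum>i\<in>UNIV. weak_grad U (\<lambda>y. b y $ i) x $ i)"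

definition H1 :: "(real^'n) set \<Rightarrow> (real^'n \<Rightarrow> real) set" where
  "H1 U = {v \<in> L2 (lebesgue_on U).
     \<exists>g. has_weak_grad U v g \<and> (\<forall>i. (\<lambda>x. g x $ i) \<in> L2 (lebesgue_on U))}"

definition H1_norm :: "(real^'n) set \<Rightarrow> (real^'n \<Rightarrow> real) \<Rightarrow> real" where
  "H1_norm U v = sqrt ((\<integral>x. (v x)\<^sup>2 \<partial>lebesgue_on U) + (\<integral>x. (norm (weak_grad U v x))\<^sup>2 \<partial>lebesgue_on U))"

definition W1inf :: "(real^'n) set \<Rightarrow> (real^'n \<Rightarrow> real) set" where
  "W1inf U = {v \<in> Linf (lebesgue_on U).
     \<exists>g. has_weak_grad U v g \<and> (\<forall>i. (\<lambda>x. g x $ i) \<in> Linf (lebesgue_on U))}"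

text \<open>
  The trace is the continuous extension of restriction to the boundary, from functions smooth up to
  the boundary to \<open>H\<^sup>1(\<Omega>)\<close>.
\<close>

definition is_trace :: "(real^'n) set \<Rightarrow> (real^'n \<Rightarrow> real) \<Rightarrow> (real^'n \<Rightarrow> real) \<Rightarrow> bool" where
  "is_trace \<Omega> v g \<longleftrightarrow> g \<in> L2 (surface_measure (frontier \<Omega>)) \<and>
     (\<exists>\<phi> :: nat \<Rightarrow> real^'n \<Rightarrow> real. (\<forall>k. smooth (\<phi> k)) \<and>
        (\<lambda>k. H1_norm \<Omega> (\<lambda>x. \<phi> k x - v x)) \<longlonglongrightarrow> 0 \<and>
        (\<lambda>k. \<integral>x. (\<phi> k x - g x)\<^sup>2 \<partial>surface_measure (frontier \<Omega>)) \<longlonglongrightarrow> 0)"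

definition bd_trace :: "(real^'n) set \<Rightarrow> (real^'n \<Rightarrow> real) \<Rightarrow> real^'n \<Rightarrow> real" where
  "bd_trace \<Omega> v = (SOME g. is_trace \<Omega> v g)"

text \<open>
  \<open>H\<^sup>1\<^sup>/\<^sup>2(\<Gamma>)\<close> is the trace space of \<open>H\<^sup>1(\<Omega>)\<close> with the quotient norm, and \<open>H\<^sup>-\<^sup>1\<^sup>/\<^sup>2(\<Gamma>)\<close> is its
  dual. An element \<open>\<psi>\<close> of the dual is a functional, so the duality \<open>\<langle>\<psi>, g\<rangle>\<close> is application \<open>\<psi> g\<close>;
  values of \<open>\<psi>\<close> outside \<open>H\<^sup>1\<^sup>/\<^sup>2(\<Gamma>)\<close> are irrelevant. Boundedness makes \<open>\<psi>\<close> respect equality almost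
  everywhere.
\<close>

definition Hhalf :: "(real^'n) set \<Rightarrow> (real^'n \<Rightarrow> real) set" where
  "Hhalf \<Omega> = {g \<in> borel_measurable borel.
     \<exists>v\<in>H1 \<Omega>. AE x in surface_measure (frontier \<Omega>). bd_trace \<Omega> v x = g x}"

definition Hhalf_norm :: "(real^'n) set \<Rightarrow> (real^'n \<Rightarrow> real) \<Rightarrow> real" where
  "Hhalf_norm \<Omega> g =
     Inf {H1_norm \<Omega> v | v. v \<in> H1 \<Omega> \<and> (AE x in surface_measure (frontier \<Omega>). bd_trace \<Omega> v x = g x)}"

definition Hmhalf :: "(real^'n) set \<Rightarrow> ((real^'n \<Rightarrow> real) \<Rightarrow> real) set" where
  "Hmhalf \<Omega> = {\<psi>.
     (\<forall>g\<in>Hhalf \<Omega>. \<forall>h\<in>Hhalf \<Omega>. \<forall>a. \<psi> (\<lambda>x. a * g x + h x) = a * \<psi> g + \<psi> h) \<and>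
     (\<exists>C. \<forall>g\<in>Hhalf \<Omega>. \<bar>\<psi> g\<bar> \<le> C * Hhalf_norm \<Omega> g)}"

definition Hmhalf_norm :: "(real^'n) set \<Rightarrow> ((real^'n \<Rightarrow> real) \<Rightarrow> real) \<Rightarrow> real" where
  "Hmhalf_norm \<Omega> \<psi> = (SUP g\<in>{g \<in> Hhalf \<Omega>. Hhalf_norm \<Omega> g \<le> 1}. \<bar>\<psi> g\<bar>)"


section \<open>Boundary integral operators\<close>

definition G_kernel :: "real^'n \<Rightarrow> real" where
  "G_kernel z = (if CARD('n) = 2 then - ln (norm z) / (2 * pi) else 1 / (4 * pi * norm z))"

definition single_layer_integral ::
  "(real^'n) set \<Rightarrow> (real^'n \<Rightarrow> real) \<Rightarrow> real^'n \<Rightarrow> real" where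
  "single_layer_integral \<Omega> f x =
     (\<integral>y. f y * G_kernel (x - y) \<partial>surface_measure (frontier \<Omega>))"

definition double_layer_integral ::
  "(real^'n) set \<Rightarrow> (real^'n \<Rightarrow> real) \<Rightarrow> real^'n \<Rightarrow> real" where
  "double_layer_integral \<Omega> \<theta> x =
     (\<integral>y. \<theta> y * frechet_derivative (\<lambda>y. G_kernel (x - y)) (at y) (outward_normal \<Omega> y)
        \<partial>surface_measure (frontier \<Omega>))"

text \<open>
  \<open>V\<close> is the bounded linear extension, from bounded densities to \<open>H\<^sup>-\<^sup>1\<^sup>/\<^sup>2(\<Gamma>)\<close>, of the single layer
  integral; a density \<open>f\<close> is identified with the functional \<open>g \<mapsto> \<integral> f g ds\<close>.
\<close>

definition single_layer_operator ::
  "(real^'n) set \<Rightarrow> (((real^'n \<Rightarrow> real) \<Rightarrow> real) \<Rightarrow> real^'n \<Rightarrow> real) \<Rightarrow> bool" where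
  "single_layer_operator \<Omega> V \<longleftrightarrow>
     (\<forall>\<psi>\<in>Hmhalf \<Omega>. V \<psi> \<in> Hhalf \<Omega>) \<and>
     (\<forall>\<phi>\<in>Hmhalf \<Omega>. \<forall>\<psi>\<in>Hmhalf \<Omega>. \<forall>a. AE x in surface_measure (frontier \<Omega>).
        V (\<lambda>g. a * \<phi> g + \<psi> g) x = a * V \<phi> x + V \<psi> x) \<and>
     (\<exists>C. \<forall>\<psi>\<in>Hmhalf \<Omega>. Hhalf_norm \<Omega> (V \<psi>) \<le> C * Hmhalf_norm \<Omega> \<psi>) \<and>
     (\<forall>f\<in>Linf (surface_measure (frontier \<Omega>)). AE x in surface_measure (frontier \<Omega>).
        V (\<lambda>g. \<integral>y. f y * g y \<partial>surface_measure (frontier \<Omega>)) x = single_layer_integral \<Omega> f x)"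

definition double_layer_operator ::
  "(real^'n) set \<Rightarrow> ((real^'n \<Rightarrow> real) \<Rightarrow> real^'n \<Rightarrow> real) \<Rightarrow> bool" where
  "double_layer_operator \<Omega> K \<longleftrightarrow>
     (\<forall>g\<in>Hhalf \<Omega>. K g \<in> Hhalf \<Omega>) \<and>
     (\<forall>g\<in>Hhalf \<Omega>. \<forall>h\<in>Hhalf \<Omega>. \<forall>a. AE x in surface_measure (frontier \<Omega>).
        K (\<lambda>y. a * g y + h y) x = a * K g x + K h x) \<and>
     (\<exists>C. \<forall>g\<in>Hhalf \<Omega>. Hhalf_norm \<Omega> (K g) \<le> C * Hhalf_norm \<Omega> g) \<and>
     (\<forall>\<theta>. smooth \<theta> \<longrightarrow> (AE x in surface_measure (frontier \<Omega>).
        K \<theta> x = double_layer_integral \<Omega> \<theta> x))"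

definition symmetric_elliptic ::
  "(real^'n) set \<Rightarrow> (((real^'n \<Rightarrow> real) \<Rightarrow> real) \<Rightarrow> real^'n \<Rightarrow> real) \<Rightarrow> bool" where
  "symmetric_elliptic \<Omega> V \<longleftrightarrow>
     (\<forall>\<phi>\<in>Hmhalf \<Omega>. \<forall>\<psi>\<in>Hmhalf \<Omega>. \<phi> (V \<psi>) = \<psi> (V \<phi>)) \<and>
     (\<exists>\<alpha>>0. \<forall>\<psi>\<in>Hmhalf \<Omega>. \<psi> (V \<psi>) \<ge> \<alpha> * (Hmhalf_norm \<Omega> \<psi>)\<^sup>2)"

definition V_norm ::
  "(((real^'n \<Rightarrow> real) \<Rightarrow> real) \<Rightarrow> real^'n \<Rightarrow> real) \<Rightarrow> ((real^'n \<Rightarrow> real) \<Rightarrow> real) \<Rightarrow> real" where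
  "V_norm V \<psi> = sqrt (\<psi> (V \<psi>))"

definition V_inverse ::
  "(real^'n) set \<Rightarrow> (((real^'n \<Rightarrow> real) \<Rightarrow> real) \<Rightarrow> real^'n \<Rightarrow> real) \<Rightarrow>
   (real^'n \<Rightarrow> real) \<Rightarrow> (real^'n \<Rightarrow> real) \<Rightarrow> real" where
  "V_inverse \<Omega> V g =
     (SOME \<psi>. \<psi> \<in> Hmhalf \<Omega> \<and> (AE x in surface_measure (frontier \<Omega>). V \<psi> x = g x))"

definition V_inverse_norm ::
  "(real^'n) set \<Rightarrow> (((real^'n \<Rightarrow> real) \<Rightarrow> real) \<Rightarrow> real^'n \<Rightarrow> real) \<Rightarrow> (real^'n \<Rightarrow> real) \<Rightarrow> real" where
  "V_inverse_norm \<Omega> V g = sqrt (V_inverse \<Omega> V g g)"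

definition contraction_constant ::
  "(real^'n) set \<Rightarrow> (((real^'n \<Rightarrow> real) \<Rightarrow> real) \<Rightarrow> real^'n \<Rightarrow> real) \<Rightarrow>
   ((real^'n \<Rightarrow> real) \<Rightarrow> real^'n \<Rightarrow> real) \<Rightarrow> real \<Rightarrow> bool" where
  "contraction_constant \<Omega> V K C\<^sub>K \<longleftrightarrow>
     C\<^sub>K \<in> {1/2..<1} \<and>
     (\<forall>g\<in>Hhalf \<Omega>. V_inverse_norm \<Omega> V (\<lambda>x. 1/2 * g x + K g x) \<le> C\<^sub>K * V_inverse_norm \<Omega> V g)"


section \<open>Coefficients, forms and the energy norm\<close>

definition min_eigenvalue :: "real^'n^'n \<Rightarrow> real" where
  "min_eigenvalue M = (LEAST e. \<exists>\<xi>. \<xi> \<noteq> 0 \<and> M *v \<xi> = e *\<^sub>R \<xi>)"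

definition lambda_min :: "(real^'n) set \<Rightarrow> (real^'n \<Rightarrow> real^'n^'n) \<Rightarrow> real" where
  "lambda_min \<Omega> A = (INF x\<in>\<Omega>. min_eigenvalue (A x))"

definition diffusion_coefficient ::
  "(real^'n) set \<Rightarrow> (real^'n) set set \<Rightarrow> (real^'n \<Rightarrow> real^'n^'n) \<Rightarrow> bool" where
  "diffusion_coefficient \<Omega> \<T> A \<longleftrightarrow>
     (\<forall>x\<in>\<Omega>. transpose (A x) = A x) \<and>
     (\<exists>C. \<forall>x\<in>\<Omega>. \<forall>i j. \<bar>A x $ i $ j\<bar> \<le> C) \<and>
     (\<exists>\<alpha>>0. \<forall>x\<in>\<Omega>. \<forall>\<xi>. \<xi> \<bullet> (A x *v \<xi>) \<ge> \<alpha> * (norm \<xi>)\<^sup>2) \<and>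
     (\<forall>T\<in>\<T>. \<forall>i j. (\<lambda>x. A x $ i $ j) \<in> W1inf (interior T))"

definition lower_order_coefficients ::
  "(real^'n) set \<Rightarrow> (real^'n \<Rightarrow> real^'n) \<Rightarrow> (real^'n \<Rightarrow> real) \<Rightarrow> bool" where
  "lower_order_coefficients \<Omega> b c \<longleftrightarrow>
     (\<forall>i. (\<lambda>x. b x $ i) \<in> W1inf \<Omega>) \<and> c \<in> Linf (lebesgue_on \<Omega>) \<and>
     (AE x in lebesgue_on \<Omega>. 1/2 * weak_div \<Omega> b x + c x \<ge> 0)"

definition normal_flux :: "(real^'n) set \<Rightarrow> (real^'n \<Rightarrow> real^'n) \<Rightarrow> real^'n \<Rightarrow> real" where
  "normal_flux \<Omega> b x = (\<chi> i. bd_trace \<Omega> (\<lambda>y. b y $ i) x) \<bullet> outward_normal \<Omega> x"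

definition outflow_boundary :: "(real^'n) set \<Rightarrow> (real^'n \<Rightarrow> real^'n) \<Rightarrow> (real^'n) set" where
  "outflow_boundary \<Omega> b = {x \<in> frontier \<Omega>. normal_flux \<Omega> b x \<ge> 0}"

definition form_A ::
  "(real^'n) set \<Rightarrow> (real^'n \<Rightarrow> real^'n^'n) \<Rightarrow> (real^'n \<Rightarrow> real^'n) \<Rightarrow> (real^'n \<Rightarrow> real) \<Rightarrow>
   (real^'n \<Rightarrow> real) \<Rightarrow> (real^'n \<Rightarrow> real) \<Rightarrow> real" where
  "form_A \<Omega> A b c u v =
     (\<integral>x. (A x *v weak_grad \<Omega> u x - u x *\<^sub>R b x) \<bullet> weak_grad \<Omega> v x \<partial>lebesgue_on \<Omega>) +
     (\<integral>x. c x * u x * v x \<partial>lebesgue_on \<Omega>) +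
     (\<integral>x\<in>outflow_boundary \<Omega> b. normal_flux \<Omega> b x * bd_trace \<Omega> u x * bd_trace \<Omega> v x
        \<partial>surface_measure (frontier \<Omega>))"

fun form_B ::
  "(real^'n) set \<Rightarrow> (real^'n \<Rightarrow> real^'n^'n) \<Rightarrow> (real^'n \<Rightarrow> real^'n) \<Rightarrow> (real^'n \<Rightarrow> real) \<Rightarrow>
   (((real^'n \<Rightarrow> real) \<Rightarrow> real) \<Rightarrow> real^'n \<Rightarrow> real) \<Rightarrow> ((real^'n \<Rightarrow> real) \<Rightarrow> real^'n \<Rightarrow> real) \<Rightarrow>
   (real^'n \<Rightarrow> real) \<times> ((real^'n \<Rightarrow> real) \<Rightarrow> real) \<Rightarrow>
   (real^'n \<Rightarrow> real) \<times> ((real^'n \<Rightarrow> real) \<Rightarrow> real) \<Rightarrow> real" where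
  "form_B \<Omega> A b c V K (u, \<phi>) (v, \<psi>) =
     form_A \<Omega> A b c u v - \<phi> (bd_trace \<Omega> v) +
     \<psi> (\<lambda>x. 1/2 * bd_trace \<Omega> u x - K (bd_trace \<Omega> u) x) + \<psi> (V \<phi>)"

definition matrix_sqrt :: "real^'n^'n \<Rightarrow> real^'n^'n" where
  "matrix_sqrt M = (THE S. transpose S = S \<and> (\<forall>\<xi>. \<xi> \<bullet> (S *v \<xi>) \<ge> 0) \<and> S ** S = M)"

definition energy_norm ::
  "(real^'n) set \<Rightarrow> (real^'n \<Rightarrow> real^'n^'n) \<Rightarrow> (real^'n \<Rightarrow> real^'n) \<Rightarrow> (real^'n \<Rightarrow> real) \<Rightarrow>
   (real^'n \<Rightarrow> real) \<Rightarrow> real" where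
  "energy_norm \<Omega> A b c v = sqrt (
     (\<integral>x. (norm (matrix_sqrt (A x) *v weak_grad \<Omega> v x))\<^sup>2 \<partial>lebesgue_on \<Omega>) +
     (\<integral>x. (sqrt (1/2 * weak_div \<Omega> b x + c x) * v x)\<^sup>2 \<partial>lebesgue_on \<Omega>))"

definition C_harm :: "real \<Rightarrow> real \<Rightarrow> real \<Rightarrow> real" where
  "C_harm \<epsilon> \<mu> C\<^sub>K = 1/2 * ((1 - \<epsilon>) * \<mu> + 1 - sqrt (((1 - \<epsilon>) * \<mu> - 1)\<^sup>2 + C\<^sub>K))"

end

(* Green's formula and div b/2 + c >= 0 give A(v,v) >= |||v|||^2, so only the sign of
<psi,(1/2+K)v> is in doubt. For densities f supported away from the edges the single layer
potential u is a limit of mollified ones, for which the divergence theorem yields that u has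
trace V f and (grad u, grad v) = <f,(1/2+K)v> for v in H^1. Hence |grad u|^2 = <f,(1/2+K)Vf> <= C_K <f,Vf>
by the contraction property, and <f,(1/2+K)v>^2 <= C_K <f,Vf> |grad v|^2. Such f are dense in
H^{-1/2}, so the bound holds for all psi; what remains is a quadratic form in (|grad v|, |psi|_V)
whose least eigenvalue is C_harm. *)

theory Submission
 imports Defs
begin

abbreviation LIMSEQ_ascii (infixr "---->" 60) where "X ----> L == X \<longlonglongrightarrow> L"

section \<open>Smooth functions\<close>

lemma smooth_coinduct:
 assumes "f \<in> S"
  and step: "!!g. g \<in> S ==> \<exists>D. (\<forall>i. D i \<in> S) \<and>
   (\<forall>x. (g has_derivative (%h. \<Sum>i\<in>UNIV. D i x * h $ i)) (at x))"
 shows "smooth (f :: real^'n => real)"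
proof -
 from step have "\<forall>g\<in>S. \<exists>D. (\<forall>i. D i \<in> S) \<and>
   (\<forall>x. (g has_derivative (%h. \<Sum>i\<in>UNIV. D i x * h $ i)) (at x))" by blast
 then obtain d where d: "\<forall>g\<in>S. (\<forall>i. d g i \<in> S) \<and>
   (\<forall>x. (g has_derivative (%h. \<Sum>i\<in>UNIV. d g i x * h $ i)) (at x))"
  by metis
 define D where "D is = foldr (%i g. d g i) is f" for "is"
 have "D is \<in> S" for "is"
  by (induction "is") (use assms(1) d in \<open>auto simp: D_def\<close>)
 with d have "\<forall>is x. (D is has_derivative (%h. \<Sum>i\<in>UNIV. D (i # is) x * h $ i)) (at x)"
  by (auto simp: D_def)
 moreover have "D [] = f" by (simp add: D_def)
 ultimately show ?thesis unfolding smooth_def by blast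
qed

lemma smooth_deriv:
 assumes "smooth (f :: real^'n => real)"
 obtains D where "!!i. smooth (D i)"
  "!!x. (f has_derivative (%h. \<Sum>i\<in>UNIV. D i x * h $ i)) (at x)"
proof -
 obtain D where D: "D [] = f"
   "!!is x. (D is has_derivative (%h. \<Sum>i\<in>UNIV. D (i # is) x * h $ i)) (at x)"
  using assms unfolding smooth_def by blast
 have "smooth (D [i])" for i
  unfolding smooth_def
  by (rule exI[of _ "%is. D (is @ [i])"]) (use D in auto)
 have "(f has_derivative (%h. \<Sum>i\<in>UNIV. D [i] x * h $ i)) (at x)" for x
  using D(2)[of "[]" x] D(1) by simp
 with that[of "%i. D [i]"] \<open>!!i. smooth (D [i])\<close> show thesis by blast
qed

inductive_set fun_algebra :: "('a => real) set => ('a => real) set" for B where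
 base: "f \<in> B ==> f \<in> fun_algebra B"
| const: "(%_. c) \<in> fun_algebra B"
| add: "f \<in> fun_algebra B ==> g \<in> fun_algebra B ==> (%x. f x + g x) \<in> fun_algebra B"
| mult: "f \<in> fun_algebra B ==> g \<in> fun_algebra B ==> (%x. f x * g x) \<in> fun_algebra B"

lemma smooth_fun_algebra:
 fixes f :: "real^'n => real"
 assumes f: "f \<in> fun_algebra B"
  and B: "!!g. g \<in> B ==> \<exists>D. (\<forall>i. D i \<in> fun_algebra B) \<and>
   (\<forall>x. (g has_derivative (%h. \<Sum>i\<in>UNIV. D i x * h $ i)) (at x))"
 shows "smooth f"
proof (rule smooth_coinduct[OF f])
 fix g assume "g \<in> fun_algebra B"
 then show "\<exists>D. (\<forall>i. D i \<in> fun_algebra B) \<and>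
   (\<forall>x. (g has_derivative (%h. \<Sum>i\<in>UNIV. D i x * h $ i)) (at x))"
 proof induction
  case (base f) then show ?case by (rule B)
 next
  case (const c)
  have "((%_. c) has_derivative (%h. \<Sum>i\<in>UNIV. (%i x. 0) i x * h $ i)) (at x)" for x :: "real^'n"
   by (auto intro!: derivative_eq_intros)
  then show ?case by (intro exI[of _ "%_ _. 0"] conjI allI) (auto intro: fun_algebra.const)
 next
  case (add f g)
  then obtain D E where D: "\<forall>i. D i \<in> fun_algebra B"
    "\<forall>x. (f has_derivative (%h. \<Sum>i\<in>UNIV. D i x * h $ i)) (at x)"
   and E: "\<forall>i. E i \<in> fun_algebra B"
    "\<forall>x. (g has_derivative (%h. \<Sum>i\<in>UNIV. E i x * h $ i)) (at x)" by blast
  show ?case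
   by (rule exI[of _ "%i x. D i x + E i x"])
    (use D E in \<open>auto intro!: fun_algebra.add derivative_eq_intros simp: algebra_simps sum.distrib\<close>)
 next
  case (mult f g)
  then obtain D E where D: "\<forall>i. D i \<in> fun_algebra B"
    "\<forall>x. (f has_derivative (%h. \<Sum>i\<in>UNIV. D i x * h $ i)) (at x)"
   and E: "\<forall>i. E i \<in> fun_algebra B"
    "\<forall>x. (g has_derivative (%h. \<Sum>i\<in>UNIV. E i x * h $ i)) (at x)" by blast
  have "((%x. f x * g x) has_derivative
   (%h. \<Sum>i\<in>UNIV. (f x * E i x + D i x * g x) * h $ i)) (at x)" for x
   using has_derivative_mult[OF D(2)[rule_format, of x] E(2)[rule_format, of x]]
   by (simp add: algebra_simps sum.distrib sum_distrib_left sum_distrib_right)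
  then show ?case
   using D(1) E(1) mult.hyps
   by (intro exI[of _ "%i x. f x * E i x + D i x * g x"])
     (auto intro!: fun_algebra.add fun_algebra.mult)
 qed
qed

lemma smooth_ring_aux:
 assumes f: "f \<in> fun_algebra {f. smooth f}"
 shows "smooth (f :: real^'n => real)"
proof (rule smooth_fun_algebra[OF f])
 fix g :: "real^'n => real" assume "g \<in> {f. smooth f}"
 then show "\<exists>D. (\<forall>i. D i \<in> fun_algebra {f. smooth f}) \<and>
   (\<forall>x. (g has_derivative (%h. \<Sum>i\<in>UNIV. D i x * h $ i)) (at x))"
  using smooth_deriv[of g "\<exists>D. (\<forall>i. D i \<in> fun_algebra {f. smooth f}) \<and>
   (\<forall>x. (g has_derivative (%h. \<Sum>i\<in>UNIV. D i x * h $ i)) (at x))"]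
  by (blast intro: fun_algebra.base)
qed

named_theorems smooth_intros

lemma smooth_const [smooth_intros, simp]: "smooth (%_. c)"
 by (intro smooth_ring_aux fun_algebra.const)

lemma smooth_add [smooth_intros]: "smooth f ==> smooth g ==> smooth (%x. f x + g x)"
 by (intro smooth_ring_aux fun_algebra.add fun_algebra.base) auto

lemma smooth_mult [smooth_intros]: "smooth f ==> smooth g ==> smooth (%x. f x * g x)"
 by (intro smooth_ring_aux fun_algebra.mult fun_algebra.base) auto

lemma smooth_diff [smooth_intros]: "smooth f ==> smooth g ==> smooth (%x. f x - g x)"
 using smooth_add[OF _ smooth_mult[OF smooth_const[of "-1"]], of f g] by simp

lemma smooth_sum [smooth_intros]: "(!!i. i \<in> I ==> smooth (f i)) ==> smooth (%x. \<Sum>i\<in>I. f i x)"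
 by (induction I rule: infinite_finite_induct) (auto intro: smooth_add)

lemma smooth_power2 [smooth_intros]: "smooth f ==> smooth (%x. (f x)^2)"
 unfolding power2_eq_square by (rule smooth_mult)

lemma smooth_coord [smooth_intros]: "smooth (%x :: real^'n. x $ i)"
proof (rule smooth_coinduct[of _ "insert (%x. x $ i) (range (%c _. c))"])
 fix g :: "real^'n => real" assume "g \<in> insert (%x. x $ i) (range (%c _. c))"
 then consider "g = (%x. x $ i)" | c where "g = (%_. c)" by auto
 then show "\<exists>D. (\<forall>i'. D i' \<in> insert (%x. x $ i) (range (%c _. c))) \<and>
   (\<forall>x. (g has_derivative (%h. \<Sum>i\<in>UNIV. D i x * h $ i)) (at x))"
 proof cases
  case 1
  have "(%h :: real^'n. \<Sum>j\<in>UNIV. (if j = i then 1 else 0) * h $ j) = (%h. h $ i)"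
   by (auto simp: sum.remove[of UNIV i])
  then show ?thesis
   using 1 by (intro exI[of _ "%j _. if j = i then 1 else 0"])
    (auto intro!: bounded_linear_imp_has_derivative)
 next
  case 2
  then show ?thesis
   by (intro exI[of _ "%j _. 0"]) auto
 qed
qed auto

lemma smooth_norm2 [smooth_intros]: "smooth (%x :: real^'n. (norm x)^2)"
proof -
 have "(%x :: real^'n. (norm x)^2) = (%x. \<Sum>i\<in>UNIV. x $ i * x $ i)"
  by (simp add: power2_norm_eq_inner inner_vec_def)
 then show ?thesis by (auto intro!: smooth_intros)
qed

lemma smooth_compose_family:
 fixes h :: "'k => real => real" and f :: "real^'n => real"
 assumes f: "smooth f" and "!!k x. (h k has_real_derivative h (s k) (f x)) (at (f x))"
 shows "smooth (%x. h k (f x))"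
proof -
 let ?B = "{f. smooth f} \<union> range (%k x. h k (f x))"
 have sm: "smooth g ==> g \<in> fun_algebra ?B" for g by (rule fun_algebra.base) auto
 show ?thesis
 proof (rule smooth_fun_algebra[of _ ?B])
  fix g assume "g \<in> ?B"
  then consider "smooth g" | k where "g = (%x. h k (f x))" by auto
  then show "\<exists>D. (\<forall>i. D i \<in> fun_algebra ?B) \<and>
   (\<forall>x. (g has_derivative (%h. \<Sum>i\<in>UNIV. D i x * h $ i)) (at x))"
  proof cases
   case 1
   obtain D where "!!i. smooth (D i)"
    "!!x. (g has_derivative (%h. \<Sum>i\<in>UNIV. D i x * h $ i)) (at x)"
    using smooth_deriv[OF 1] by blast
   then show ?thesis by (intro exI[of _ D]) (auto intro: sm)
  next
   case (2 k)
   obtain D where D: "!!i. smooth (D i)"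
    "!!x. (f has_derivative (%h. \<Sum>i\<in>UNIV. D i x * h $ i)) (at x)"
    using smooth_deriv[OF f] by blast
   have "((%x. h k (f x)) has_derivative
     (%v. \<Sum>i\<in>UNIV. (h (s k) (f x) * D i x) * v $ i)) (at x)" for x
    using has_derivative_compose[OF D(2) assms(2)[of k x, unfolded has_field_derivative_def]]
    by (simp add: sum_distrib_left mult.assoc)
   then show ?thesis unfolding 2
    by (intro exI[of _ "%i x. h (s k) (f x) * D i x"] conjI)
      (rule allI fun_algebra.mult sm D(1) fun_algebra.base UnI2 rangeI | assumption)+
  qed
 qed (auto intro: fun_algebra.base)
qed

lemma smooth_affine:
 fixes f :: "real^'n => real"
 assumes "smooth f"
 shows "smooth (%x. f (a + s *\<^sub>R x))"
proof -
 let ?S = "{%x. c * g (a + s *\<^sub>R x) | c g. smooth g}"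
 show ?thesis
 proof (rule smooth_coinduct[of _ ?S])
  show "(%x. f (a + s *\<^sub>R x)) \<in> ?S"
   using assms by (intro CollectI exI[of _ 1] exI[of _ f]) simp
  fix g' assume "g' \<in> ?S"
  then obtain c g where g: "g' = (%x. c * g (a + s *\<^sub>R x))" "smooth g" by blast
  obtain D where D: "!!i. smooth (D i)"
   "!!x. (g has_derivative (%h. \<Sum>i\<in>UNIV. D i x * h $ i)) (at x)"
   using smooth_deriv[OF g(2)] by blast
  have *: "((%x. a + s *\<^sub>R x) has_derivative (%h. s *\<^sub>R h)) (at x)" for x :: "real^'n"
   by (auto intro!: derivative_eq_intros)
  have "((%x. c * g (a + s *\<^sub>R x)) has_derivative
    (%h. \<Sum>i\<in>UNIV. ((c * s) * D i (a + s *\<^sub>R x)) * h $ i)) (at x)" for x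
   using has_derivative_mult_right[OF has_derivative_compose[OF *[of x] D(2)], of c]
   by (simp add: sum_distrib_left mult_ac)
  then show "\<exists>D. (\<forall>i. D i \<in> ?S) \<and> (\<forall>x. (g' has_derivative (%h. \<Sum>i\<in>UNIV. D i x * h $ i)) (at x))"
   unfolding g(1)
   by (intro exI[of _ "%i x. (c * s) * D i (a + s *\<^sub>R x)"] conjI) (use D(1) in blast)+
 qed
qed

lemma smooth_shift: "smooth f ==> smooth (%x :: real^'n. f (x - a))"
 using smooth_affine[of f "-a" 1, unfolded scaleR_one] by (simp add: algebra_simps)

lemma smooth_reflect: "smooth f ==> smooth (%x :: real^'n. f (a - x))"
 using smooth_affine[of f a "-1"] by (simp add: algebra_simps)

lemma smooth_partial:
 assumes "smooth f"
 shows smooth_has_derivative: "(f has_derivative (%h. \<Sum>i\<in>UNIV. partial i f x * h $ i)) (at x)"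
  and smooth_partialI: "smooth (partial i f)"
proof -
 obtain D where D: "!!i. smooth (D i)"
  "!!x. (f has_derivative (%h. \<Sum>i\<in>UNIV. D i x * h $ i)) (at x)"
  using smooth_deriv[OF assms] by blast
 have "frechet_derivative f (at x) = (%h. \<Sum>i\<in>UNIV. D i x * h $ i)" for x
  using frechet_derivative_at[OF D(2)] by metis
 then have "partial i f = D i" for i
  by (auto simp: partial_def fun_eq_iff axis_def if_distrib if_distribR sum.If_cases cong: if_cong)
 with D show "(f has_derivative (%h. \<Sum>i\<in>UNIV. partial i f x * h $ i)) (at x)"
  and "smooth (partial i f)" by auto
qed

lemma smooth_continuous_on: "smooth f ==> continuous_on S f"
 by (rule continuous_at_imp_continuous_on) (auto intro: has_derivative_continuous[OF smooth_has_derivative])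

lemma smooth_measurable: "smooth f ==> f \<in> borel_measurable borel"
 by (intro borel_measurable_continuous_onI smooth_continuous_on)

lemma partial_eqI:
 assumes "(f has_derivative f') (at x)"
 shows "partial i f x = f' (axis i 1)"
 using frechet_derivative_at[OF assms] by (simp add: partial_def)

definition grad :: "(real^'n => real) => real^'n => real^'n" where
 "grad f x = (\<chi> i. partial i f x)"

lemma grad_nth [simp]: "grad f x $ i = partial i f x"
 by (simp add: grad_def)

lemma smooth_has_derivative_grad:
 "smooth f ==> (f has_derivative (%h. grad f x \<bullet> h)) (at x)"
 using smooth_has_derivative[of f x] by (simp add: inner_vec_def)

lemma continuous_on_grad: "smooth f ==> continuous_on S (grad f)"
 unfolding grad_def
 by (intro continuous_on_vec_lambda smooth_continuous_on smooth_partialI)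

lemma partial_mult:
 assumes "smooth f" "smooth g"
 shows "partial i (%x. f x * g x) x = f x * partial i g x + partial i f x * g x"
 by (subst partial_eqI[OF has_derivative_mult[OF smooth_has_derivative_grad smooth_has_derivative_grad]])
  (use assms in \<open>auto simp: inner_axis\<close>)

lemma partial_diff:
 assumes "smooth f" "smooth g"
 shows "partial i (%x. f x - g x) x = partial i f x - partial i g x"
 by (subst partial_eqI[OF has_derivative_diff[OF smooth_has_derivative_grad smooth_has_derivative_grad]])
  (use assms in \<open>auto simp: inner_axis\<close>)

lemma partial_sum:
 assumes "!!j. j \<in> I ==> smooth (f j)"
 shows "partial i (%x. \<Sum>j\<in>I. f j x) x = (\<Sum>j\<in>I. partial i (f j) x)"
 by (subst partial_eqI[OF has_derivative_sum[OF smooth_has_derivative_grad]])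
  (use assms in \<open>auto simp: inner_axis\<close>)

lemma partial_reflect:
 assumes "smooth (f :: real^'n => real)"
 shows "partial i (%x. f (a - x)) x = - partial i f (a - x)"
proof -
 have "((%x. a - x) has_derivative (%h. - h)) (at x)"
  by (auto intro!: derivative_eq_intros)
 from partial_eqI[OF has_derivative_compose[OF this smooth_has_derivative_grad[OF assms]]]
 show ?thesis by (simp add: inner_axis inner_minus_right)
qed

lemma partial_shift:
 assumes "smooth (f :: real^'n => real)"
 shows "partial i (%x. f (x - a)) x = partial i f (x - a)"
proof -
 have "((%x. x - a) has_derivative (%h. h)) (at x)"
  by (auto intro!: derivative_eq_intros)
 from partial_eqI[OF has_derivative_compose[OF this smooth_has_derivative_grad[OF assms]]]
 show ?thesis by (simp add: inner_axis)
qed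

definition cutoff :: "real poly => real => real" where
 "cutoff p t = (if t > 0 then poly p (1 / t) * exp (- (1 / t)) else 0)"

lemma cutoff_limit_0: "((%t. poly p (1 / t) * exp (- (1 / t))) \<longlongrightarrow> 0) (at_right (0::real))"
proof -
 have "((%x. poly p x * exp (- x)) \<longlongrightarrow> 0) (at_top :: real filter)"
 proof -
  have "((%x :: real. \<Sum>i\<le>degree p. coeff p i * (x ^ i / exp x)) \<longlongrightarrow> (\<Sum>i\<le>degree p. coeff p i * 0)) at_top"
   by (intro tendsto_intros tendsto_power_div_exp_0)
  then show ?thesis
   by (simp add: poly_altdef sum_distrib_right exp_minus divide_inverse mult.assoc)
 qed
 then have "((%t. poly p (inverse t) * exp (- inverse t)) \<longlongrightarrow> 0) (at_right (0::real))"
  by (rule filterlim_compose) (rule filterlim_inverse_at_top_right)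
 then show ?thesis by (simp add: inverse_eq_divide)
qed

lemma cutoff_deriv:
 "(cutoff p has_real_derivative cutoff ([:0, 0, 1:] * (p - pderiv p)) t) (at t)"
proof -
 consider "t > 0" | "t < 0" | "t = 0" by linarith
 then show ?thesis
 proof cases
  case 1
  have "((%t. poly p (1 / t) * exp (- (1 / t))) has_real_derivative
   cutoff ([:0, 0, 1:] * (p - pderiv p)) t) (at t)"
   using 1 by (auto intro!: derivative_eq_intros poly_DERIV[THEN DERIV_chain2]
     simp: cutoff_def field_simps power2_eq_square)
  then show ?thesis
   by (rule DERIV_cong_ev[THEN iffD1, OF refl _ refl, rotated])
    (use 1 in \<open>auto simp: cutoff_def eventually_at intro!: eventually_nhds_in_open[of "{0<..}", THEN eventually_mono]\<close>)
 next
  case 2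
  have "((%t. 0) has_real_derivative cutoff ([:0, 0, 1:] * (p - pderiv p)) t) (at t)"
   using 2 by (auto simp: cutoff_def)
  then show ?thesis
   by (rule DERIV_cong_ev[THEN iffD1, OF refl _ refl, rotated])
    (use 2 in \<open>auto simp: cutoff_def intro!: eventually_nhds_in_open[of "{..<0}", THEN eventually_mono]\<close>)
 next
  case 3
  have "((%h. cutoff p h / h) \<longlongrightarrow> 0) (at_right 0)"
   by (rule Lim_transform_eventually[OF cutoff_limit_0[of "pCons 0 p"]])
    (auto simp: eventually_at_filter cutoff_def)
  moreover have "((%h. cutoff p h / h) \<longlongrightarrow> 0) (at_left 0)"
   by (rule Lim_transform_eventually[OF tendsto_const])
    (auto simp: eventually_at_filter cutoff_def)
  ultimately have "((%h. cutoff p h / h) \<longlongrightarrow> 0) (at 0)"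
   using filterlim_split_at by blast
  then show ?thesis unfolding 3 has_field_derivative_iff by (simp add: cutoff_def)
 qed
qed

lemma smooth_cutoff: "smooth f ==> smooth (%x. cutoff p (f x))"
 by (rule smooth_compose_family[of f cutoff "%p. [:0, 0, 1:] * (p - pderiv p)"])
  (rule cutoff_deriv | assumption)+

definition bump :: "real^'n => real => real^'n => real" where
 "bump a r x = cutoff 1 (r^2 - (norm (x - a))^2)"

lemma smooth_bump: "smooth (bump a r)"
 unfolding bump_def
 by (intro smooth_cutoff smooth_diff smooth_const smooth_shift[of "%x. (norm x)^2"] smooth_norm2)

lemma bump_nonneg: "bump a r x \<ge> 0"
 by (simp add: bump_def cutoff_def)

lemma bump_pos_iff: "r > 0 ==> bump a r x > 0 \<longleftrightarrow> x \<in> ball a r"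
 by (auto simp: bump_def cutoff_def dist_norm norm_minus_commute power_strict_mono abs_le_square_iff
   power2_le_iff_abs_le intro: power2_less_imp_less)

lemma bump_eq_0: "r > 0 ==> x \<notin> ball a r ==> bump a r x = 0"
 using bump_pos_iff[of r a x] bump_nonneg[of a r x] by linarith

lemma bump_le_1: "bump a r x <= 1"
 by (simp add: bump_def cutoff_def)

lemma smooth_powr:
 assumes "smooth f" "!!x. f x > 0"
 shows "smooth (%x. f x powr a)"
proof -
 have "smooth (%x. (%(c, a). %t. c * t powr a) (1, a) (f x))"
  by (rule smooth_compose_family[of f "%(c, a). %t. c * t powr a"
     "%(c, a). (c * a, a - 1)"])
   (use assms in \<open>auto intro!: derivative_eq_intros split: prod.splits\<close>)
 then show ?thesis by simp
qed

lemma smooth_inverse: "smooth f ==> (!!x. f x > 0) ==> smooth (%x. inverse (f x))"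
 using smooth_powr[of f "-1"] by (simp add: powr_minus less_imp_le)

lemma smooth_ln:
 assumes "smooth f" "!!x. f x > 0"
 shows "smooth (%x. ln (f x))"
proof -
 have "smooth (%x. (%p. case p of None => ln | Some (c, a) => %t. c * t powr a) None (f x))"
  by (rule smooth_compose_family[of f _
     "%p. case p of None => Some (1, -1) | Some (c, a) => Some (c * a, a - 1)"])
   (use assms in \<open>auto intro!: derivative_eq_intros simp: powr_minus_divide less_imp_le abs_of_pos split: prod.splits option.splits\<close>)
 then show ?thesis by simp
qed

section \<open>Surface measures of polyhedra\<close>

definition plane :: "real^'n => real => (real^'n) set" where
 "plane n be = {x. n \<bullet> x = be}"

definition plane_proj :: "real^'n => real => real^'n => real^'n" where
 "plane_proj n be z = z - (n \<bullet> z - be) *\<^sub>R n"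

lemma norm_1_inner: "norm n = 1 ==> n \<bullet> n = 1"
 by (simp add: norm_eq_1)

lemma plane_proj_in: "norm n = 1 ==> plane_proj n be z \<in> plane n be"
 by (simp add: plane_def plane_proj_def inner_diff_right norm_1_inner)

lemma plane_proj_dist_le:
 assumes "norm n = 1" "y \<in> plane n be"
 shows "dist z (plane_proj n be z) <= dist z y"
proof -
 have "dist z (plane_proj n be z) = \<bar>n \<bullet> (z - y)\<bar>"
  using assms by (simp add: plane_def plane_proj_def dist_norm inner_diff_right)
 also have "... <= norm (z - y)"
  using Cauchy_Schwarz_ineq2[of n "z - y"] assms by simp
 finally show ?thesis by (simp add: dist_norm)
qed

lemma closest_point_plane:
 assumes "norm n = 1"
 shows "closest_point (plane n be) z = plane_proj n be z"
 by (rule closest_point_unique[symmetric])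
  (use assms in \<open>auto simp: plane_proj_in plane_proj_dist_le\<close>,
   auto simp: plane_def convex_hyperplane closed_hyperplane)

lemma infdist_plane:
 assumes "norm n = 1"
 shows "infdist z (plane n be) = \<bar>n \<bullet> z - be\<bar>"
proof -
 have "infdist z (plane n be) = dist z (plane_proj n be z)"
 proof (rule antisym)
  show "infdist z (plane n be) <= dist z (plane_proj n be z)"
   by (rule infdist_le[OF plane_proj_in[OF assms]])
  show "dist z (plane_proj n be z) <= infdist z (plane n be)"
   using plane_proj_in[OF assms, of be z] plane_proj_dist_le[OF assms]
   by (auto simp: infdist_def intro!: cINF_greatest)
 qed
 then show ?thesis using assms by (simp add: plane_proj_def dist_norm)
qed

lemma plane_hyperplanes: "norm n = 1 ==> plane n be \<in> hyperplanes"
 unfolding hyperplanes_def plane_def by (intro CollectI exI[of _ n] exI[of _ be]) auto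

lemma hyperplanes_plane:
 assumes "h \<in> hyperplanes"
 obtains n be where "norm n = 1" "h = plane n be"
proof -
 from assms obtain a b where ab: "a ~= 0" "h = {x. a \<bullet> x = b}"
  by (auto simp: hyperplanes_def)
 then have "h = plane (a /\<^sub>R norm a) (b / norm a)"
  by (auto simp: plane_def field_simps)
 with ab that[of "a /\<^sub>R norm a" "b / norm a"] show thesis by simp
qed

lemma plane_proj_measurable [measurable]: "plane_proj n be \<in> borel_measurable borel"
 unfolding plane_proj_def by measurable

lemma nn_integral_hyperplane:
 assumes n: "norm n = 1" and [measurable]: "F \<in> borel_measurable borel"
 shows "(\<integral>\<^sup>+x. F x \<partial>hyperplane_measure (plane n be)) =
  (\<integral>\<^sup>+z. F (plane_proj n be z) * indicator {-1/2..1/2} (n \<bullet> z - be) \<partial>lborel)"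
proof -
 let ?S = "{z. infdist z (plane n be) <= 1/2}"
 have S: "?S \<in> sets lborel" by (simp add: infdist_plane[OF n])
 then have S': "?S \<in> sets lebesgue" by simp
 have cp: "closest_point (plane n be) = plane_proj n be"
  by (rule ext) (rule closest_point_plane[OF n])
 have "plane_proj n be \<in> borel_measurable (lebesgue_on ?S)"
  by (intro measurable_restrict_space1 measurable_completion) simp
 then have "(\<integral>\<^sup>+x. F x \<partial>hyperplane_measure (plane n be)) =
   (\<integral>\<^sup>+z. F (plane_proj n be z) \<partial>lebesgue_on ?S)"
  unfolding hyperplane_measure_def cp
  by (subst nn_integral_distr) auto
 also have "... = (\<integral>\<^sup>+z. F (plane_proj n be z) * indicator ?S z \<partial>lborel)"
  using S' by (subst nn_integral_restrict_space) (auto simp: nn_integral_completion)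
 moreover have "indicator ?S z = (indicator {-1/2..1/2} (n \<bullet> z - be) :: ennreal)" for z
  unfolding indicator_def infdist_plane[OF n]
  by (rule arg_cong[where f=of_bool]) (unfold mem_Collect_eq atLeastAtMost_iff, linarith)
 ultimately show ?thesis by simp
qed

lemma sets_hyperplane_measure [simp, measurable_cong]: "sets (hyperplane_measure h) = sets borel"
 by (simp add: hyperplane_measure_def)

lemma space_hyperplane_measure [simp]: "space (hyperplane_measure h) = UNIV"
 by (simp add: hyperplane_measure_def)

lemma nn_integral_lborel_shift:
 assumes [measurable]: "f \<in> borel_measurable borel"
 shows "(\<integral>\<^sup>+x. f (x + a) \<partial>lborel) = (\<integral>\<^sup>+x. f x \<partial>(lborel :: 'a::euclidean_space measure))"
 by (subst (2) lborel_distr_plus[of a, symmetric]) (simp add: nn_integral_distr add.commute)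

lemma nn_integral_lborel_scale:
 assumes [measurable]: "f \<in> borel_measurable borel"
 shows "ennreal \<bar>c\<bar> * (\<integral>\<^sup>+s. f (c * s) \<partial>lborel) = (if c = 0 then 0 else \<integral>\<^sup>+s. f s \<partial>(lborel :: real measure))"
 using nn_integral_real_affine[of f c 0] by (simp add: mult.commute)

lemma lborel_swap:
 fixes f :: "'a::euclidean_space => 'b::euclidean_space => ennreal"
 assumes "case_prod f \<in> borel_measurable (borel \<Otimes>\<^sub>M borel)"
 shows "(\<integral>\<^sup>+x. \<integral>\<^sup>+y. f x y \<partial>lborel \<partial>lborel) = (\<integral>\<^sup>+y. \<integral>\<^sup>+x. f x y \<partial>lborel \<partial>lborel)"
 using lborel_pair.Fubini'[of "%y x. f x y"] measurable_pair_swap[OF assms] by (simp add: split_beta')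

text \<open>
 Integrating over the translates \<open>h + s e\<close> recovers the volume up to the factor \<open>\<bar>n \<bullet> e\<bar>\<close>. The
 right prism in the definition of the surface measure is moved to the oblique one by translations
 only, along the tangential part of \<open>e\<close> and then along \<open>n\<close>.
\<close>

lemma nn_integral_plane_coarea:
 fixes n e :: "real^'n" and g :: "real^'n => ennreal"
 assumes n: "norm n = 1" and ne: "n \<bullet> e ~= 0" and g [measurable]: "g \<in> borel_measurable borel"
 shows "ennreal \<bar>n \<bullet> e\<bar> * (\<integral>\<^sup>+s. \<integral>\<^sup>+y. g (y + s *\<^sub>R e) \<partial>hyperplane_measure (plane n be) \<partial>lborel) =
  (\<integral>\<^sup>+x. g x \<partial>lborel)"
proof -
 let ?kp = "n \<bullet> e" let ?P = "plane_proj n be"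
 let ?I = "%z. indicator {-1/2..1/2 :: real} (n \<bullet> z - be) :: ennreal"
 define ta where "ta = e - ?kp *\<^sub>R n"
 have nta: "n \<bullet> ta = 0" by (simp add: ta_def inner_diff_right norm_1_inner[OF n])
 have A: "(\<integral>\<^sup>+y. g (y + s *\<^sub>R e) \<partial>hyperplane_measure (plane n be)) =
   (\<integral>\<^sup>+z. g (?P z + (s * ?kp) *\<^sub>R n) * ?I z \<partial>lborel)" for s
 proof -
  have "(\<integral>\<^sup>+y. g (y + s *\<^sub>R e) \<partial>hyperplane_measure (plane n be)) =
   (\<integral>\<^sup>+z. g (?P z + s *\<^sub>R e) * ?I z \<partial>lborel)"
   by (rule nn_integral_hyperplane[OF n]) simp
  also have "... = (\<integral>\<^sup>+z. g (?P (z + - (s *\<^sub>R ta)) + s *\<^sub>R e) * ?I (z + - (s *\<^sub>R ta)) \<partial>lborel)"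
   by (rule nn_integral_lborel_shift[symmetric]) measurable
  also have "... = (\<integral>\<^sup>+z. g (?P z + (s * ?kp) *\<^sub>R n) * ?I z \<partial>lborel)"
   by (intro nn_integral_cong arg_cong2[where f="(*)"] arg_cong[where f=g] arg_cong[where f="indicator _"])
    (simp_all add: plane_proj_def inner_diff_right nta, simp add: ta_def algebra_simps)
  finally show ?thesis .
 qed
 have B: "ennreal \<bar>?kp\<bar> * (\<integral>\<^sup>+s. g (?P z + (s * ?kp) *\<^sub>R n) * ?I z \<partial>lborel) =
   (\<integral>\<^sup>+r. g (z + r *\<^sub>R n) * ?I z \<partial>lborel)" for z
 proof -
  have "ennreal \<bar>?kp\<bar> * (\<integral>\<^sup>+s. g (?P z + (s * ?kp) *\<^sub>R n) * ?I z \<partial>lborel) =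
    (\<integral>\<^sup>+s. g (?P z + s *\<^sub>R n) * ?I z \<partial>lborel)"
   using nn_integral_lborel_scale[of "%s. g (?P z + s *\<^sub>R n) * ?I z" ?kp] ne
   by (simp add: mult.commute)
  also have "... = (\<integral>\<^sup>+r. g (?P z + (r + (n \<bullet> z - be)) *\<^sub>R n) * ?I z \<partial>lborel)"
   by (rule nn_integral_lborel_shift[symmetric]) measurable
  finally show ?thesis by (simp add: plane_proj_def algebra_simps)
 qed
 have "ennreal \<bar>?kp\<bar> * (\<integral>\<^sup>+s. \<integral>\<^sup>+y. g (y + s *\<^sub>R e) \<partial>hyperplane_measure (plane n be) \<partial>lborel) =
   ennreal \<bar>?kp\<bar> * (\<integral>\<^sup>+z. \<integral>\<^sup>+s. g (?P z + (s * ?kp) *\<^sub>R n) * ?I z \<partial>lborel \<partial>lborel)"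
  unfolding A by (subst lborel_swap) (auto simp: plane_proj_def)
 also have "... = (\<integral>\<^sup>+z. \<integral>\<^sup>+r. g (z + r *\<^sub>R n) * ?I z \<partial>lborel \<partial>lborel)"
  by (subst nn_integral_cmult[symmetric], simp) (simp only: B)
 also have "... = (\<integral>\<^sup>+r. \<integral>\<^sup>+z. g (z + r *\<^sub>R n) * ?I z \<partial>lborel \<partial>lborel)"
  by (rule lborel_swap) measurable
 also have "... = (\<integral>\<^sup>+r. \<integral>\<^sup>+z. g z * ?I (z - r *\<^sub>R n) \<partial>lborel \<partial>lborel)"
 proof (rule nn_integral_cong)
  fix r
  show "(\<integral>\<^sup>+z. g (z + r *\<^sub>R n) * ?I z \<partial>lborel) = (\<integral>\<^sup>+z. g z * ?I (z - r *\<^sub>R n) \<partial>lborel)"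
   using nn_integral_lborel_shift[of "%z. g z * ?I (z - r *\<^sub>R n)" "r *\<^sub>R n"] by simp
 qed
 also have "... = (\<integral>\<^sup>+z. \<integral>\<^sup>+r. g z * ?I (z - r *\<^sub>R n) \<partial>lborel \<partial>lborel)"
  by (rule lborel_swap) measurable
 also have "... = (\<integral>\<^sup>+z. g z \<partial>lborel)"
 proof (rule nn_integral_cong)
  fix z
  have "(\<integral>\<^sup>+r. g z * ?I (z - r *\<^sub>R n) \<partial>lborel) =
    g z * (\<integral>\<^sup>+r. indicator {n \<bullet> z - be - 1/2..n \<bullet> z - be + 1/2} r \<partial>lborel)"
   by (subst nn_integral_cmult[symmetric])
    (auto intro!: nn_integral_cong simp: inner_diff_right norm_1_inner[OF n] indicator_def)
  then show "(\<integral>\<^sup>+r. g z * ?I (z - r *\<^sub>R n) \<partial>lborel) = g z"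
   by simp
 qed
 finally show ?thesis .
qed

lemma emeasure_hyperplane_null:
 assumes n: "norm n = 1" and S: "S \<in> sets borel" "S \<inter> plane n be \<subseteq> {x. a \<bullet> x = b}"
  and a: "a ~= (a \<bullet> n) *\<^sub>R n"
 shows "emeasure (hyperplane_measure (plane n be)) S = 0"
proof -
 let ?N = "{z. (a - (a \<bullet> n) *\<^sub>R n) \<bullet> z = b - be * (a \<bullet> n)}"
 have "{z. infdist z (plane n be) <= 1/2 \<and> closest_point (plane n be) z \<in> S} \<subseteq> ?N"
 proof safe
  fix z assume "closest_point (plane n be) z \<in> S"
  then have "plane_proj n be z \<in> {x. a \<bullet> x = b}"
   using S(2) plane_proj_in[OF n, of be z] by (auto simp: closest_point_plane[OF n])
  then show "(a - (a \<bullet> n) *\<^sub>R n) \<bullet> z = b - be * (a \<bullet> n)"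
   by (simp add: plane_proj_def algebra_simps inner_diff_right inner_diff_left)
 qed
 moreover have "negligible ?N"
  using a by (intro negligible_hyperplane) auto
 ultimately have "negligible {z. infdist z (plane n be) <= 1/2 \<and> closest_point (plane n be) z \<in> S}"
  using negligible_subset by blast
 then show ?thesis
  unfolding emeasure_hyperplane_measure[OF plane_hyperplanes[OF n] S(1)]
  using negligible_iff_emeasure0[OF negligible_imp_sets] by blast
qed

lemma plane_subset_imp_eq:
 assumes "norm n = 1" "norm n' = 1" "n' = (n' \<bullet> n) *\<^sub>R n" "x \<in> plane n be" "x \<in> plane n' be'"
 shows "plane n be = plane n' be'"
proof -
 define k where "k = n' \<bullet> n"
 have "n' = k *\<^sub>R n" using assms(3) by (simp add: k_def)
 moreover have "k ~= 0" using assms(2) calculation by auto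
 ultimately show ?thesis using assms(4,5) by (auto simp: plane_def)
qed

lemma emeasure_hyperplane_other:
 assumes "h \<in> hyperplanes" "h' \<in> hyperplanes" "h ~= h'" "S \<in> sets borel" "S \<inter> h \<subseteq> h'"
 shows "emeasure (hyperplane_measure h) S = 0"
proof -
 obtain n be where n: "norm n = 1" "h = plane n be" using hyperplanes_plane assms(1) by metis
 obtain n' be' where n': "norm n' = 1" "h' = plane n' be'" using hyperplanes_plane assms(2) by metis
 show ?thesis
 proof (cases "n' = (n' \<bullet> n) *\<^sub>R n")
  case False
  then show ?thesis
   using emeasure_hyperplane_null[OF n(1) assms(4), of be n' be'] assms(5) n n' by (auto simp: plane_def)
 next
  case True
  have "S \<inter> h = {}"
   using plane_subset_imp_eq[OF n(1) n'(1) True] assms(3,5) n(2) n'(2) by blast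
  then have "{z. infdist z h <= 1/2 \<and> closest_point h z \<in> S} = {}"
   using plane_proj_in[OF n(1)] by (auto simp: n closest_point_plane)
  then show ?thesis
   by (subst emeasure_hyperplane_measure[OF assms(1,4)]) (simp only: emeasure_empty)
 qed
qed

lemma emeasure_hyperplane_bounded:
 fixes S :: "(real^'n) set"
 assumes "h \<in> hyperplanes" "S \<in> sets borel" "bounded S"
 shows "emeasure (hyperplane_measure h) S < \<infinity>"
proof -
 obtain n be where n: "norm n = 1" "h = plane n be" using hyperplanes_plane assms(1) by metis
 obtain B where B: "!!x. x \<in> S ==> norm x <= B" using assms(3) by (auto simp: bounded_iff)
 let ?Z = "{z. infdist z h <= 1/2 \<and> closest_point h z \<in> S}"
 have "?Z \<subseteq> cball 0 (B + 1/2)"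
 proof
  fix z assume z: "z \<in> ?Z"
  then have *: "\<bar>n \<bullet> z - be\<bar> <= 1/2" "norm (plane_proj n be z) <= B"
   using B by (auto simp: n infdist_plane closest_point_plane)
  have "norm z <= norm (plane_proj n be z) + norm ((n \<bullet> z - be) *\<^sub>R n)"
   using norm_triangle_ineq[of "plane_proj n be z" "(n \<bullet> z - be) *\<^sub>R n"] by (simp add: plane_proj_def)
  then show "z \<in> cball 0 (B + 1/2)" using * n by simp
 qed
 then have "emeasure lebesgue ?Z <= emeasure lebesgue (cball (0 :: real^'n) (B + 1/2))"
  by (rule emeasure_mono) simp
 moreover have "emeasure lebesgue (cball (0 :: real^'n) (B + 1/2)) < top"
  using emeasure_bounded_finite[of "cball (0 :: real^'n) (B + 1/2)"] by simp
 ultimately have "emeasure lebesgue ?Z < top"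
  by (rule le_less_trans)
 then show ?thesis
  by (simp add: emeasure_hyperplane_measure[OF assms(1,2)])
qed

locale polyhedral_surface =
 fixes Bd :: "(real^'n) set" and H :: "(real^'n) set set"
 assumes compact_Bd: "compact Bd" and finite_H: "finite H" and H: "H \<subseteq> hyperplanes" and Bd_H: "Bd \<subseteq> \<Union>H"
begin

lemma Bd_borel [measurable]: "Bd \<in> sets borel"
 by (intro borel_closed compact_imp_closed compact_Bd)

lemma H_borel: "h \<in> H ==> h \<in> sets borel"
 using H by (auto simp: hyperplanes_def intro!: borel_closed closed_hyperplane)

lemma emeasure_surface_sum:
 assumes S: "S \<in> sets borel"
 shows "emeasure (surface_measure Bd) S = (\<Sum>h\<in>H. emeasure (hyperplane_measure h) (S \<inter> Bd))"
 unfolding emeasure_surface_measure[OF Bd_borel S]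
proof (rule nn_integral_count_space'[OF finite_H _ H])
 fix h assume h: "h \<in> hyperplanes" "h \<notin> H"
 have "emeasure (hyperplane_measure h) (S \<inter> Bd) <= emeasure (hyperplane_measure h) (\<Union>h'\<in>H. S \<inter> Bd \<inter> h')"
  by (rule emeasure_mono) (use Bd_H S H_borel finite_H in \<open>auto intro!: sets.finite_UN simp del: UN_simps\<close>)
 also have "... <= (\<Sum>h'\<in>H. emeasure (hyperplane_measure h) (S \<inter> Bd \<inter> h'))"
  by (rule emeasure_subadditive_finite) (use S H_borel finite_H in auto)
 also have "... = 0"
 proof (intro sum.neutral ballI)
  fix h' assume h': "h' \<in> H"
  show "emeasure (hyperplane_measure h) (S \<inter> Bd \<inter> h') = 0"
   by (rule emeasure_hyperplane_other[OF h(1), of h']) (use S H H_borel h h' in auto)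
 qed
 finally show "emeasure (hyperplane_measure h) (S \<inter> Bd) = 0" by simp
qed

lemma nn_integral_surface:
 assumes "F \<in> borel_measurable borel"
 shows "(\<integral>\<^sup>+y. F y \<partial>surface_measure Bd) = (\<Sum>h\<in>H. \<integral>\<^sup>+y. F y * indicator Bd y \<partial>hyperplane_measure h)"
 using assms
proof (induction rule: borel_measurable_induct)
 case (cong f g) then show ?case by (simp cong: nn_integral_cong)
next
 case (set A)
 then show ?case
  by (simp add: emeasure_surface_sum indicator_inter_arith[symmetric])
next
 case (mult u c) then show ?case
  by (simp add: nn_integral_cmult sum_distrib_left mult.assoc)
next
 case (add u v) then show ?case
  by (simp add: nn_integral_add distrib_right sum.distrib)
next
 case (seq U)
 have "(\<integral>\<^sup>+y. (SUP i. U i) y \<partial>surface_measure Bd) = (SUP i. \<integral>\<^sup>+y. U i y \<partial>surface_measure Bd)"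
  using seq by (simp add: image_comp nn_integral_monotone_convergence_SUP)
 also have "... = (SUP i. \<Sum>h\<in>H. \<integral>\<^sup>+y. U i y * indicator Bd y \<partial>hyperplane_measure h)"
  using seq by simp
 also have "... = (\<Sum>h\<in>H. SUP i. \<integral>\<^sup>+y. U i y * indicator Bd y \<partial>hyperplane_measure h)"
  using seq by (intro ennreal_SUP_sum) (auto simp: incseq_def le_fun_def intro!: nn_integral_mono mult_right_mono)
 also have "... = (\<Sum>h\<in>H. \<integral>\<^sup>+y. (SUP i. U i y * indicator Bd y) \<partial>hyperplane_measure h)"
  using seq by (intro sum.cong nn_integral_monotone_convergence_SUP[symmetric])
   (auto simp: incseq_def le_fun_def intro!: mult_right_mono)
 finally show ?case
  by (simp add: SUP_mult_right_ennreal image_comp)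
qed

lemma finite_surface: "finite_measure (surface_measure Bd)"
proof
 have "emeasure (surface_measure Bd) UNIV < \<infinity>"
  unfolding emeasure_surface_sum[OF borel_open[OF open_UNIV]]
  using finite_H H compact_imp_bounded[OF compact_Bd]
   emeasure_hyperplane_bounded[OF _ Bd_borel] by (auto simp: less_top)
 then show "emeasure (surface_measure Bd) (space (surface_measure Bd)) ~= \<infinity>"
  by simp
qed

lemma AE_surface: "AE y in surface_measure Bd. y \<in> Bd"
 by (rule AE_I[of _ _ "- Bd"]) (auto simp: emeasure_surface_sum)

lemma surface_nullI:
 assumes "S \<in> sets borel" "!!h. h \<in> H ==> emeasure (hyperplane_measure h) (S \<inter> Bd) = 0"
 shows "emeasure (surface_measure Bd) S = 0"
 using assms by (simp add: emeasure_surface_sum)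

lemma AE_surface_unique:
 "AE y in surface_measure Bd. \<exists>!h. h \<in> H \<and> y \<in> h"
proof -
 let ?S = "\<Union>h\<in>H. \<Union>h'\<in>H - {h}. h \<inter> h'"
 have meas: "?S \<in> sets borel" using finite_H H_borel by (auto intro!: sets.finite_UN)
 have null: "emeasure (surface_measure Bd) (h \<inter> h') = 0" if "h \<in> H" "h' \<in> H - {h}" for h h'
 proof (rule surface_nullI)
  fix k assume "k \<in> H"
  have "k ~= h \<or> k ~= h'" using that by auto
  then consider "k ~= h" | "k ~= h'" by blast
  then show "emeasure (hyperplane_measure k) (h \<inter> h' \<inter> Bd) = 0"
  proof cases
   case 1
   then show ?thesis
    by (intro emeasure_hyperplane_other[of k h]) (use that \<open>k \<in> H\<close> H H_borel in auto)
  next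
   case 2
   then show ?thesis
    by (intro emeasure_hyperplane_other[of k h']) (use that \<open>k \<in> H\<close> H H_borel in auto)
  qed
 qed (use that H_borel in auto)
 have "?S \<in> null_sets (surface_measure Bd)"
  using finite_H null H_borel by (intro null_sets.finite_UN finite_H finite_Diff) (auto simp: null_sets_def)
 then have "AE y in surface_measure Bd. y \<notin> ?S" by (rule AE_not_in)
 with AE_surface show ?thesis
 proof eventually_elim
  case (elim y)
  from elim(1) obtain h where h: "h \<in> H" "y \<in> h" using Bd_H by blast
  show ?case
  proof (rule ex1I)
   fix h' assume "h' \<in> H \<and> y \<in> h'"
   show "h' = h"
   proof (rule ccontr)
    assume "h' ~= h"
    with h \<open>h' \<in> H \<and> y \<in> h'\<close> have "y \<in> ?S"
     by (intro UN_I[of h] UN_I[of h']) auto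
    with elim(2) show False by (rule notE)
   qed
  qed (use h in simp)
 qed
qed

lemma AE_surface_singleton:
 assumes "CARD('n) \<ge> 2"
 shows "AE y in surface_measure Bd. y ~= x"
proof (rule AE_I[of _ _ "{x}"])
 show "emeasure (surface_measure Bd) {x} = 0"
 proof (rule surface_nullI)
  fix h assume "h \<in> H"
  then obtain n be where n: "norm n = 1" "h = plane n be" using hyperplanes_plane H by (metis subsetD)
  have "\<exists>a. a ~= (a \<bullet> n) *\<^sub>R n"
  proof (rule ccontr)
   assume "\<nexists>a. a ~= (a \<bullet> n) *\<^sub>R n"
   then have "(UNIV :: (real^'n) set) \<subseteq> span {n}"
    by (metis span_base span_scale singletonI subsetI)
   then have "dim (UNIV :: (real^'n) set) <= dim {n}"
    by (metis dim_span dim_subset)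
   also have "... <= 1" using dim_le_card[of "{n}" "{n}"] by (simp add: span_superset)
   finally show False using assms by simp
  qed
  then obtain a where "a ~= (a \<bullet> n) *\<^sub>R n" by blast
  then show "emeasure (hyperplane_measure h) ({x} \<inter> Bd) = 0"
   unfolding n(2) by (intro emeasure_hyperplane_null[OF n(1), of _ _ a "a \<bullet> x"]) auto
 qed simp
qed auto

end

lemma is_outward_normal_unique:
 assumes "is_outward_normal Om x nu" "is_outward_normal Om x nu'"
 shows "nu = nu'"
proof (rule ccontr)
 assume ne: "nu ~= nu'"
 obtain r r' where r: "norm nu = 1" "r > 0" "!!y. y \<in> ball x r ==> y \<in> Om \<longleftrightarrow> nu \<bullet> (y - x) < 0"
  and r': "norm nu' = 1" "r' > 0" "!!y. y \<in> ball x r' ==> y \<in> Om \<longleftrightarrow> nu' \<bullet> (y - x) < 0"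
  using assms unfolding is_outward_normal_def by metis
 have lt: "nu \<bullet> nu' < 1"
 proof -
  have "0 < (norm (nu - nu'))^2" using ne by simp
  also have "... = 2 - 2 * (nu \<bullet> nu')"
   using r(1) r'(1) by (simp add: power2_norm_eq_inner inner_diff inner_commute norm_eq_1)
  finally show ?thesis by simp
 qed
 define s where "s = min r r' / 4"
 have s: "s > 0" "s * 2 < r" "s * 2 < r'" using r r' by (auto simp: s_def min_def)
 let ?y = "x + s *\<^sub>R (nu' - nu)"
 have "norm (nu' - nu) <= 2" using norm_triangle_ineq4[of nu' nu] r r' by simp
 then have "norm (s *\<^sub>R (nu' - nu)) <= s * 2" using s by simp
 then have "norm (s *\<^sub>R (nu' - nu)) < r" "norm (s *\<^sub>R (nu' - nu)) < r'" using s by linarith+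
 then have "?y \<in> ball x r" "?y \<in> ball x r'" by (simp_all add: dist_norm)
 then have "nu \<bullet> (?y - x) < 0 \<longleftrightarrow> nu' \<bullet> (?y - x) < 0" using r(3) r'(3) by blast
 then show False
  using s lt r r' by (simp add: inner_diff_right mult_less_0_iff norm_eq_1 inner_commute)
qed

lemma outward_normal_eqI: "is_outward_normal Om x nu ==> outward_normal Om x = nu"
 unfolding outward_normal_def using is_outward_normal_unique by (auto intro!: the_equality)

lemma norm_outward_normal_le: "norm (outward_normal Om x) <= 1"
proof (cases "\<exists>nu. is_outward_normal Om x nu")
 case True
 then obtain nu where nu: "is_outward_normal Om x nu" by blast
 from outward_normal_eqI[OF nu] nu show ?thesis by (simp add: is_outward_normal_def)
qed (simp add: outward_normal_def)

definition flat_at :: "(real^'n) set => real => real^'n => bool" where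
 "flat_at Om dl y \<longleftrightarrow> y \<in> frontier Om \<and>
   (\<exists>nu. norm nu = 1 \<and> (\<forall>z\<in>ball y dl. z \<in> Om \<longleftrightarrow> nu \<bullet> (z - y) < 0))"

lemma flat_atD:
 assumes "flat_at Om dl y" "dl > 0"
 shows "norm (outward_normal Om y) = 1" "is_outward_normal Om y (outward_normal Om y)"
  "!!z. z \<in> ball y dl ==> z \<in> Om \<longleftrightarrow> outward_normal Om y \<bullet> (z - y) < 0"
proof -
 obtain nu where nu: "norm nu = 1" "\<forall>z\<in>ball y dl. z \<in> Om \<longleftrightarrow> nu \<bullet> (z - y) < 0"
  using assms by (auto simp: flat_at_def)
 then have "is_outward_normal Om y nu"
  using assms(2) by (auto simp: is_outward_normal_def)
 then show "norm (outward_normal Om y) = 1" "is_outward_normal Om y (outward_normal Om y)"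
  "!!z. z \<in> ball y dl ==> z \<in> Om \<longleftrightarrow> outward_normal Om y \<bullet> (z - y) < 0"
  using outward_normal_eqI nu by metis+
qed

lemma flat_at_mono: "flat_at Om dl y ==> dl' <= dl ==> flat_at Om dl' y"
 unfolding flat_at_def by (meson in_mono subset_ball)

lemma flat_at_frontier:
 assumes fl: "flat_at Om dl y" and "dl > 0" and x: "x \<in> frontier Om" "x \<in> ball y dl" and "open Om"
 shows "outward_normal Om y \<bullet> (x - y) = 0" "outward_normal Om x = outward_normal Om y"
proof -
 let ?nu = "outward_normal Om y"
 note n = flat_atD[OF fl \<open>dl > 0\<close>]
 have "x \<notin> Om" using x \<open>open Om\<close> by (simp add: frontier_def interior_open)
 then have ge: "?nu \<bullet> (x - y) \<ge> 0" using n(3)[OF x(2)] by simp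
 show 0: "?nu \<bullet> (x - y) = 0"
 proof (rule ccontr)
  assume "?nu \<bullet> (x - y) ~= 0"
  with ge have "x \<in> {z. ?nu \<bullet> (z - y) > 0} \<inter> ball y dl" using x by simp
  moreover have "open ({z. ?nu \<bullet> (z - y) > 0} \<inter> ball y dl)"
   by (intro open_Int open_ball open_Collect_less continuous_intros)
  ultimately obtain ep where "ep > 0" and ep: "ball x ep \<subseteq> {z. ?nu \<bullet> (z - y) > 0} \<inter> ball y dl"
   using openE by blast
  then obtain w where w: "w \<in> Om" "dist x w < ep"
   using x(1) by (auto simp: frontier_straddle)
  with ep have "?nu \<bullet> (w - y) > 0" "w \<in> ball y dl" by (auto simp: subset_eq)
  with n(3)[of w] w show False by simp
 qed
 have "is_outward_normal Om x ?nu"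
  unfolding is_outward_normal_def
 proof (intro conjI exI[of _ "dl - dist y x"] ballI)
  show "dl - dist y x > 0" using x by simp
  fix z assume "z \<in> ball x (dl - dist y x)"
  then have "z \<in> ball y dl" using dist_triangle[of y z x] by simp
  from n(3)[OF this] show "z \<in> Om \<longleftrightarrow> ?nu \<bullet> (z - x) < 0"
   using 0 by (simp add: inner_diff_right)
 qed (rule n(1))
 then show "outward_normal Om x = ?nu" by (rule outward_normal_eqI)
qed

lemma is_outward_normal_flat:
 assumes "is_outward_normal Om y nu" "open Om"
 obtains dl where "dl > 0" "flat_at Om dl y"
proof -
 obtain r where r: "norm nu = 1" "r > 0" "!!z. z \<in> ball y r ==> z \<in> Om \<longleftrightarrow> nu \<bullet> (z - y) < 0"
  using assms unfolding is_outward_normal_def by metis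
 have "y \<in> frontier Om"
  unfolding frontier_straddle
 proof safe
  fix ep :: real assume "ep > 0"
  define s where "s = min r ep / 2"
  have s: "s > 0" "s < r" "s < ep" using r \<open>ep > 0\<close> by (auto simp: s_def)
  have "y - s *\<^sub>R nu \<in> Om" "dist y (y - s *\<^sub>R nu) < ep"
  proof -
   have *: "dist y (y - s *\<^sub>R nu) = s" using r(1) s(1) by (simp add: dist_norm)
   with s(3) show "dist y (y - s *\<^sub>R nu) < ep" by simp
   have "nu \<bullet> (y - s *\<^sub>R nu - y) < 0" using r(1) s(1) by (simp add: norm_1_inner)
   with r(3)[of "y - s *\<^sub>R nu"] * s(2) show "y - s *\<^sub>R nu \<in> Om" by simp
  qed
  then show "\<exists>x\<in>Om. dist y x < ep" by blast
  have "y \<notin> Om" using r(2) r(3)[of y] by simp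
  then show "\<exists>x. x \<notin> Om \<and> dist y x < ep" using \<open>ep > 0\<close> by (intro exI[of _ y]) simp
 qed
 with r that[of r] show thesis by (auto simp: flat_at_def)
qed

lemma closed_flat_at:
 assumes "dl > 0" "open Om"
 shows "closed {y. flat_at Om dl y}"
 unfolding closed_sequential_limits
proof safe
 fix Y y assume Y: "\<forall>k. Y k \<in> {y. flat_at Om dl y}" "Y ----> y"
 define N where "N k = outward_normal Om (Y k)" for k
 have N: "norm (N k) = 1" "!!z. z \<in> ball (Y k) dl ==> z \<in> Om \<longleftrightarrow> N k \<bullet> (z - Y k) < 0" for k
  using flat_atD[of Om dl "Y k"] Y(1) assms(1) by (auto simp: N_def)
 have "compact (sphere (0 :: real^'a) 1)" by simp
 then obtain nu sg where nu: "strict_mono sg" "nu \<in> sphere 0 1" "(N \<circ> sg) ----> nu"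
  unfolding compact_def using N(1) by (metis mem_sphere_0)
 have Ysg: "(%k. Y (sg k)) ----> y"
  using LIMSEQ_subseq_LIMSEQ[OF Y(2) nu(1)] by (simp add: o_def)
 have lim: "(%k. N (sg k) \<bullet> (z - Y (sg k))) ----> nu \<bullet> (z - y)" for z
  using nu(3) Ysg by (intro tendsto_intros) (auto simp: o_def)
 have ev: "\<forall>\<^sub>F k in sequentially. z \<in> ball (Y (sg k)) dl" if "z \<in> ball y dl" for z
 proof -
  have "(%k. dist (Y (sg k)) z) ----> dist y z" using Ysg by (intro tendsto_intros)
  then show ?thesis using that order_tendstoD(2)[of _ "dist y z" sequentially dl] by (simp add: dist_commute)
 qed
 have neg: "z \<in> Om" if "z \<in> ball y dl" "nu \<bullet> (z - y) < 0" for z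
 proof -
  have "\<forall>\<^sub>F k in sequentially. N (sg k) \<bullet> (z - Y (sg k)) < 0"
   using order_tendstoD(2)[OF lim] that by blast
  then have "\<forall>\<^sub>F k in sequentially. z \<in> Om"
   using ev[OF that(1)] by eventually_elim (use N(2) in blast)
  then show ?thesis by simp
 qed
 have pos: "z \<notin> Om" if "z \<in> ball y dl" "nu \<bullet> (z - y) > 0" for z
 proof -
  have "\<forall>\<^sub>F k in sequentially. N (sg k) \<bullet> (z - Y (sg k)) > 0"
   using order_tendstoD(1)[OF lim] that by blast
  then have "\<forall>\<^sub>F k in sequentially. z \<notin> Om"
   using ev[OF that(1)] by eventually_elim (use N(2) in \<open>metis less_asym\<close>)
  then show ?thesis by simp
 qed
 have zero: "z \<notin> Om" if "z \<in> ball y dl" "nu \<bullet> (z - y) = 0" for z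
 proof
  assume "z \<in> Om"
  then have "z \<in> Om \<inter> ball y dl" using that by simp
  then obtain ep where ep: "ep > 0" "ball z ep \<subseteq> Om \<inter> ball y dl"
   using openE[of "Om \<inter> ball y dl" z] \<open>open Om\<close> by blast
  have "z + (ep/2) *\<^sub>R nu \<in> ball z ep" using ep(1) nu(2) by (simp add: dist_norm)
  moreover have "nu \<bullet> (z + (ep/2) *\<^sub>R nu - y) > 0"
   using that ep(1) nu(2) by (simp add: inner_diff_right inner_add_right norm_eq_1)
  ultimately show False using pos ep(2) by blast
 qed
 have "y \<in> frontier Om"
  using closed_sequentially[OF frontier_closed _ Y(2)] Y(1) by (auto simp: flat_at_def)
 moreover have "\<forall>z\<in>ball y dl. z \<in> Om \<longleftrightarrow> nu \<bullet> (z - y) < 0"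
  using neg pos zero by (meson linorder_cases)
 ultimately show "flat_at Om dl y"
  using nu(2) by (auto simp: flat_at_def)
qed

definition boundary_faces :: "(real^'n) set => (real^'n) set set" where
 "boundary_faces Om = (SOME F. finite F \<and> (\<forall>f\<in>F. polytope f \<and> aff_dim f = int CARD('n) - 1) \<and> frontier Om = \<Union>F)"

definition boundary_planes :: "(real^'n) set => (real^'n) set set" where
 "boundary_planes Om = (%f. affine hull f) ` boundary_faces Om"

locale lipschitz_polyhedron =
 fixes Om :: "(real^'n) set"
 assumes dom: "polyhedral_lipschitz_domain Om" and dim_ge_2: "CARD('n) \<ge> 2"
begin

abbreviation "Bd \<equiv> frontier Om"
abbreviation "sg \<equiv> surface_measure (frontier Om)"
abbreviation "normal \<equiv> outward_normal Om"

lemma open_Om: "open Om" and bounded_Om: "bounded Om" and nonempty_Om: "Om ~= {}"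
 and lipschitz_Om: "lipschitz_boundary Om" and polyhedral_Om: "polyhedral_boundary Om"
 using dom by (auto simp: polyhedral_lipschitz_domain_def)

lemma Bd_disjoint: "x \<in> Bd ==> x \<notin> Om"
 using open_Om by (simp add: frontier_def interior_open)

lemma faces:
 "finite (boundary_faces Om)" "!!f. f \<in> boundary_faces Om ==> polytope f \<and> aff_dim f = int CARD('n) - 1"
 "Bd = \<Union>(boundary_faces Om)"
 using someI_ex[OF polyhedral_Om[unfolded polyhedral_boundary_def]]
 unfolding boundary_faces_def[symmetric] by auto

lemma face_hull:
 assumes "f \<in> boundary_faces Om"
 shows "affine hull f \<in> hyperplanes"
proof -
 have "aff_dim f = int DIM(real^'n) - 1" using faces(2)[OF assms] by simp
 then obtain a b where "a ~= 0" "affine hull f = {x. a \<bullet> x = b}"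
  using aff_dim_eq_hyperplane[of f] by auto
 then show ?thesis by (auto simp: hyperplanes_def)
qed

sublocale polyhedral_surface Bd "boundary_planes Om"
proof
 show "compact Bd" using bounded_Om by (rule compact_frontier_bounded)
 show "finite (boundary_planes Om)" using faces(1) by (simp add: boundary_planes_def)
 show "boundary_planes Om \<subseteq> hyperplanes" using face_hull by (auto simp: boundary_planes_def)
 show "Bd \<subseteq> \<Union>(boundary_planes Om)"
  using faces(3) hull_subset by (fastforce simp: boundary_planes_def)
qed

lemma rel_boundary_face_null:
 assumes f: "f \<in> boundary_faces Om"
 shows "emeasure sg (f - rel_interior f) = 0"
proof (rule surface_nullI)
 have cf: "convex f" "closed f" using faces(2)[OF f]
  by (auto simp: polytope_imp_convex polytope_imp_closed)
 obtain n be where n: "norm n = 1" "affine hull f = plane n be"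
  using hyperplanes_plane face_hull[OF f] by metis
 let ?S = "f - rel_interior f"
 have "?S = rel_frontier f" using cf by (simp add: rel_frontier_def)
 then show meas: "?S \<in> sets borel" by (simp add: closed_rel_frontier borel_closed)
 fix h assume h: "h \<in> boundary_planes Om"
 have meas': "?S \<inter> Bd \<in> sets borel" using meas Bd_borel by blast
 show "emeasure (hyperplane_measure h) (?S \<inter> Bd) = 0"
 proof (cases "h = affine hull f")
  case False
  show ?thesis
   by (rule emeasure_hyperplane_other[of h "affine hull f"])
    (use False h H face_hull[OF f] meas' hull_subset[of f affine] in auto)
 next
  case True
  let ?C = "{z. plane_proj n be z \<in> f}"
  have "convex ?C"
  proof (rule convexI)
   fix x y and u v :: real assume *: "x \<in> ?C" "y \<in> ?C" "0 <= u" "0 <= v" "u + v = 1"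
   have "plane_proj n be (u *\<^sub>R x + v *\<^sub>R y) = u *\<^sub>R plane_proj n be x + v *\<^sub>R plane_proj n be y"
   proof -
    have v: "v = 1 - u" using *(5) by simp
    show ?thesis unfolding v by (simp add: plane_proj_def inner_add_right algebra_simps)
   qed
   then show "u *\<^sub>R x + v *\<^sub>R y \<in> ?C" using * cf(1) by (simp add: convexD)
  qed
  then have "negligible (frontier ?C)" by (rule negligible_convex_frontier)
  moreover have "{z. infdist z h <= 1/2 \<and> closest_point h z \<in> ?S \<inter> Bd} \<subseteq> frontier ?C"
  proof safe
   fix z assume "closest_point h z \<in> f" "closest_point h z \<notin> rel_interior f"
   then have z: "plane_proj n be z \<in> f" "plane_proj n be z \<notin> rel_interior f"
    using n True by (simp_all add: closest_point_plane)
   have "z \<notin> interior ?C"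
   proof
    assume "z \<in> interior ?C"
    then obtain r where r: "r > 0" "ball z r \<subseteq> ?C" by (auto simp: mem_interior)
    have "ball (plane_proj n be z) r \<inter> affine hull f \<subseteq> f"
    proof
     fix w assume w: "w \<in> ball (plane_proj n be z) r \<inter> affine hull f"
     then have "n \<bullet> w = be" using n(2) by (simp add: plane_def)
     moreover have "n \<bullet> plane_proj n be z = be" using plane_proj_in[OF n(1), of be z] by (simp add: plane_def)
     ultimately have "plane_proj n be (z + (w - plane_proj n be z)) = w"
      by (simp add: plane_proj_def inner_add_right inner_diff_right algebra_simps norm_1_inner[OF n(1)])
     moreover have "z + (w - plane_proj n be z) \<in> ball z r" using w by (simp add: dist_norm norm_minus_commute)
     ultimately show "w \<in> f" using r(2) by (metis (mono_tags) mem_Collect_eq subsetD)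
    qed
    then have "plane_proj n be z \<in> rel_interior f" using r(1) z(1) by (auto simp: mem_rel_interior_ball)
    then show False using z(2) by simp
   qed
   moreover have "z \<in> closure ?C" using subsetD[OF closure_subset, of z ?C] z(1) by simp
   ultimately show "z \<in> frontier ?C" by (simp add: frontier_def)
  qed
  ultimately have "negligible {z. infdist z h <= 1/2 \<and> closest_point h z \<in> ?S \<inter> Bd}"
   using negligible_subset by blast
  then have "emeasure lebesgue {z. infdist z h <= 1/2 \<and> closest_point h z \<in> ?S \<inter> Bd} = 0"
   using negligible_iff_emeasure0[OF negligible_imp_sets] by blast
  then show ?thesis
   using emeasure_hyperplane_measure[of h "?S \<inter> Bd"] h H meas' by auto
 qed
qed

text \<open>
 A boundary point in the relative interior of a face and on no other boundary plane is flat: near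
 it, the plane cuts a ball into two halves not meeting \<open>Bd\<close>, and the graph property excludes that
 both lie in \<open>Om\<close>.
\<close>

lemma normal_at_interior_of_face:
 assumes f: "f \<in> boundary_faces Om" and y: "y \<in> rel_interior f"
  and uniq: "!!h. h \<in> boundary_planes Om ==> y \<in> h ==> h = affine hull f"
  and n: "norm n = 1" "affine hull f = plane n be"
 shows "\<exists>nu\<in>{n, -n}. is_outward_normal Om y nu"
proof -
 have yf: "y \<in> f" using y rel_interior_subset by blast
 then have yBd: "y \<in> Bd" using f faces(3) by blast
 have yn: "n \<bullet> y = be" using yf hull_subset[of f affine] n(2) by (auto simp: plane_def)
 obtain r1 where r1: "r1 > 0" "ball y r1 \<inter> affine hull f \<subseteq> f"
  using y by (auto simp: mem_rel_interior_ball)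
 have "closed (\<Union>(boundary_planes Om - {affine hull f}))"
  using finite_H H by (intro closed_Union) (auto simp: hyperplanes_def closed_hyperplane)
 moreover have "y \<notin> \<Union>(boundary_planes Om - {affine hull f})" using uniq by blast
 ultimately obtain r2 where r2: "r2 > 0" "ball y r2 \<subseteq> - \<Union>(boundary_planes Om - {affine hull f})"
  using openE[of "- \<Union>(boundary_planes Om - {affine hull f})" y] by (auto simp: open_Compl)
 obtain e r3 g L where e: "norm e = 1" "r3 > 0" "L-lipschitz_on UNIV g"
  "!!z. z \<in> ball y r3 ==> z \<in> Om \<longleftrightarrow> z \<bullet> e < (g (z - (z \<bullet> e) *\<^sub>R e) :: real)"
  using lipschitz_Om yBd unfolding lipschitz_boundary_def by metis
 define r where "r = Min {r1, r2, r3}"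
 have r: "r > 0" "r <= r1" "r <= r2" "r <= r3" using r1 r2 e by (auto simp: r_def)
 have Bdr: "z \<in> Bd \<longleftrightarrow> n \<bullet> z = be" if "z \<in> ball y r" for z
 proof
  assume "z \<in> Bd"
  then obtain h where h: "h \<in> boundary_planes Om" "z \<in> h" using Bd_H by blast
  moreover have "z \<in> ball y r2" using that r by auto
  ultimately have "h = affine hull f" using r2(2) by blast
  then show "n \<bullet> z = be" using h n(2) by (simp add: plane_def)
 next
  assume "n \<bullet> z = be"
  then have "z \<in> ball y r1 \<inter> affine hull f" using that r n(2) by (auto simp: plane_def)
  then show "z \<in> Bd" using r1(2) f faces(3) by blast
 qed
 let ?side = "%nu. ball y r \<inter> {z. nu \<bullet> z > nu \<bullet> y}"
 have side: "?side nu \<subseteq> Om \<or> ?side nu \<inter> Om = {}" if "nu \<in> {n, -n}" for nu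
 proof (rule ccontr)
  assume "\<not> ?thesis"
  then have "?side nu \<inter> Bd ~= {}"
   by (intro connected_Int_frontier) (auto intro!: convex_connected convex_Int convex_halfspace_gt)
  then show False using that Bdr yn by auto
 qed
 have notboth: "\<not> (?side n \<subseteq> Om \<and> ?side (-n) \<subseteq> Om)"
 proof
  assume both: "?side n \<subseteq> Om \<and> ?side (-n) \<subseteq> Om"
  have off: "n \<bullet> z = be" if "z \<in> ball y r" "z \<notin> Om" for z
  proof (rule ccontr)
   assume "n \<bullet> z ~= be"
   then have "z \<in> ?side n \<or> z \<in> ?side (-n)" using that yn by (auto simp: linorder_neq_iff)
   with both that(2) show False by blast
  qed
  have proj: "(y + t *\<^sub>R e) - ((y + t *\<^sub>R e) \<bullet> e) *\<^sub>R e = y - (y \<bullet> e) *\<^sub>R e" for t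
   using e(1) by (simp add: inner_add_left algebra_simps norm_eq_1)
  have ball: "y + t *\<^sub>R e \<in> ball y r" if "\<bar>t\<bar> < r" for t
   using that e(1) by (simp add: dist_norm)
  have inOm: "y + t *\<^sub>R e \<in> Om \<longleftrightarrow> y \<bullet> e + t < g (y - (y \<bullet> e) *\<^sub>R e)" if "\<bar>t\<bar> < r" for t
  proof -
   have "y + t *\<^sub>R e \<in> ball y r3" using ball[OF that] r(4) by auto
   from e(4)[OF this] show ?thesis
    unfolding proj using e(1) by (simp add: inner_add_left norm_1_inner)
  qed
  have "y \<notin> Om" using yBd by (rule Bd_disjoint)
  then have ge: "y \<bullet> e \<ge> g (y - (y \<bullet> e) *\<^sub>R e)" using inOm[of 0] r(1) by simp
  then have "y + (r/2) *\<^sub>R e \<notin> Om" using inOm[of "r/2"] r(1) by simp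
  then have "n \<bullet> (y + (r/2) *\<^sub>R e) = be" using off ball[of "r/2"] r(1) by simp
  then have "n \<bullet> e = 0" using yn r(1) by (simp add: inner_add_right)
  then have "y + (- (r/2)) *\<^sub>R e \<in> Bd"
   using Bdr[OF ball[of "- (r/2)"]] yn r(1) by (simp add: inner_diff_right)
  then have "y + (- (r/2)) *\<^sub>R e \<notin> Om" by (rule Bd_disjoint)
  then have gt: "y \<bullet> e > g (y - (y \<bullet> e) *\<^sub>R e)" using inOm[of "- (r/2)"] r(1) by simp
  have "continuous_on UNIV g" using e(3) by (rule lipschitz_on_continuous_on)
  then have "open {z. z \<bullet> e > g (z - (z \<bullet> e) *\<^sub>R e)}"
   by (intro open_Collect_less continuous_intros) (auto elim: continuous_on_compose2 intro!: continuous_intros)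
  then obtain ep where ep: "ep > 0" "ball y ep \<subseteq> {z. z \<bullet> e > g (z - (z \<bullet> e) *\<^sub>R e)}"
   using gt openE by blast
  obtain w where "w \<in> Om" "dist y w < min ep r"
   using yBd ep(1) r(1) unfolding frontier_straddle by (metis min_less_iff_conj)
  then show False using ep(2) e(4)[of w] r(4) by (force simp: subset_eq)
 qed
 have notnone: "\<not> (?side n \<inter> Om = {} \<and> ?side (-n) \<inter> Om = {})"
 proof
  assume none: "?side n \<inter> Om = {} \<and> ?side (-n) \<inter> Om = {}"
  obtain w where w: "w \<in> Om" "dist y w < r"
   using yBd r(1) unfolding frontier_straddle by metis
  then have "n \<bullet> w = be" using none yn by (force simp: linorder_neq_iff)
  then have "w \<in> Bd" using Bdr[of w] w by simp
  then show False using w Bd_disjoint by blast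
 qed
 obtain nu where nu: "nu \<in> {n, -n}" "?side nu \<inter> Om = {}" "?side (-nu) \<subseteq> Om"
 proof (cases "?side n \<subseteq> Om")
  case True
  then have "?side (-n) \<inter> Om = {}" using notboth side[of "-n"] by blast
  with True that[of "-n"] show thesis by simp
 next
  case False
  then have 1: "?side n \<inter> Om = {}" using side[of n] by blast
  then have "?side (-n) \<subseteq> Om" using notnone side[of "-n"] by blast
  with 1 that[of n] show thesis by simp
 qed
 have "is_outward_normal Om y nu"
  unfolding is_outward_normal_def
 proof (intro conjI exI[of _ r] ballI)
  fix z assume z: "z \<in> ball y r"
  consider "z \<in> ?side nu" | "z \<in> ?side (-nu)" | "nu \<bullet> z = nu \<bullet> y"
   using z by (auto simp: not_less) linarith
  then show "z \<in> Om \<longleftrightarrow> nu \<bullet> (z - y) < 0"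
  proof cases
   case 3
   then have "z \<in> Bd" using Bdr[OF z] nu(1) yn by auto
   then show ?thesis using 3 Bd_disjoint by (simp add: inner_diff_right)
  qed (use nu in \<open>auto simp: inner_diff_right\<close>)
 qed (use nu(1) n(1) r(1) in auto)
 then show ?thesis using nu(1) by blast
qed

lemma AE_normal:
 "AE y in sg. is_outward_normal Om y (normal y) \<and>
   (\<forall>n be. norm n = 1 --> plane n be \<in> boundary_planes Om --> y \<in> plane n be --> normal y \<in> {n, -n})"
proof -
 have "AE y in sg. \<forall>f\<in>boundary_faces Om. y \<notin> f - rel_interior f"
 proof (rule AE_finite_allI[OF faces(1)])
  fix f assume f: "f \<in> boundary_faces Om"
  have "f - rel_interior f \<in> sets borel"
  proof -
   have "closed f" using faces(2)[OF f] by (auto simp: polytope_imp_closed)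
   then have "f - rel_interior f = rel_frontier f" by (simp add: rel_frontier_def)
   then show ?thesis by (simp add: closed_rel_frontier borel_closed)
  qed
  then show "AE y in sg. y \<notin> f - rel_interior f"
   using rel_boundary_face_null[OF f] by (intro AE_not_in) (auto simp: null_sets_def)
 qed
 with AE_surface AE_surface_unique show ?thesis
 proof eventually_elim
  case (elim y)
  then obtain f where f: "f \<in> boundary_faces Om" "y \<in> rel_interior f"
   using faces(3) by blast
  then have "y \<in> affine hull f" using rel_interior_subset hull_subset by (metis subsetD)
  moreover have "affine hull f \<in> boundary_planes Om" using f by (simp add: boundary_planes_def)
  ultimately have uniq: "h = affine hull f" if "h \<in> boundary_planes Om" "y \<in> h" for h
   using elim(2) that by blast
  have *: "\<exists>nu\<in>{n, -n}. is_outward_normal Om y nu" if "norm n = 1" "affine hull f = plane n be" for n be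
   using normal_at_interior_of_face[OF f uniq that] by blast
  obtain n be where "norm n = 1" "affine hull f = plane n be"
   using hyperplanes_plane face_hull[OF f(1)] by metis
  with * obtain nu where "is_outward_normal Om y nu" by blast
  then have 1: "is_outward_normal Om y (normal y)" using outward_normal_eqI by metis
  have "normal y \<in> {n, -n}" if "norm n = 1" "plane n be \<in> boundary_planes Om" "y \<in> plane n be" for n be
   using *[of n be] uniq[OF that(2,3)] that(1) outward_normal_eqI by metis
  with 1 show ?case by blast
 qed
qed

lemma normal_measurable [measurable]: "normal \<in> borel_measurable borel"
proof -
 let ?R = "{y. \<exists>dl>0. flat_at Om dl y}"
 have "?R = (\<Union>k. {y. flat_at Om (1 / real (Suc k)) y})"
 proof safe
  fix y and dl :: real assume "dl > 0" "flat_at Om dl y"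
  moreover obtain k where "1 / real (Suc k) < dl" using nat_approx_posE[OF \<open>dl > 0\<close>] by auto
  ultimately show "y \<in> (\<Union>k. {y. flat_at Om (1 / real (Suc k)) y})"
   using flat_at_mono[of Om dl y "1 / real (Suc k)"] by force
 qed (auto intro!: exI[of _ "1 / real (Suc _)"])
 then have meas: "?R \<in> sets borel"
  using closed_flat_at[OF _ open_Om] by (auto intro!: sets.countable_UN borel_closed)
 have cont: "continuous_on ?R normal"
  unfolding continuous_on_iff
 proof clarsimp
  fix y dl and e :: real assume *: "dl > 0" "flat_at Om dl y" "e > 0"
  show "\<exists>d>0. \<forall>x. (\<exists>dl>0. flat_at Om dl x) --> dist x y < d --> dist (normal x) (normal y) < e"
  proof (intro exI[of _ dl] conjI allI impI)
   fix x assume "\<exists>dl>0. flat_at Om dl x" "dist x y < dl"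
   then have "normal x = normal y"
    using flat_at_frontier(2)[OF *(2,1) _ _ open_Om, of x] by (auto simp: flat_at_def dist_commute)
   then show "dist (normal x) (normal y) < e" using *(3) by simp
  qed (rule *)
 qed
 have "normal = (%y. if y \<in> ?R then normal y else 0)"
 proof (rule ext)
  fix y
  have "normal y = 0" if "y \<notin> ?R"
  proof -
   have "\<nexists>nu. is_outward_normal Om y nu"
    using is_outward_normal_flat[OF _ open_Om, of y] that by blast
   then show ?thesis by (simp add: outward_normal_def)
  qed
  then show "normal y = (if y \<in> ?R then normal y else 0)" by simp
 qed
 also have "... \<in> borel_measurable borel"
  by (rule borel_measurable_continuous_on_if[OF meas cont]) simp
 finally show ?thesis .
qed

lemma normal_transversal:
 assumes e: "norm e = 1" and g: "L-lipschitz_on UNIV g"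
  and graph: "!!z. z \<in> ball p r ==> z \<in> Om \<longleftrightarrow> z \<bullet> e < (g (z - (z \<bullet> e) *\<^sub>R e) :: real)"
  and y: "y \<in> ball p r" and n: "is_outward_normal Om y nu"
 shows "nu \<bullet> e \<ge> 1 / (2 * (1 + L))"
proof -
 have L: "L \<ge> 0" using g by (rule lipschitz_on_nonneg)
 define dl where "dl = 1 / (1 + L)"
 have dl: "dl > 0" "dl <= 1" "L * dl < 1" using L by (auto simp: dl_def field_simps)
 define w where "w = dl *\<^sub>R (nu - (nu \<bullet> e) *\<^sub>R e)"
 obtain q where q: "norm nu = 1" "q > 0" "!!z. z \<in> ball y q ==> z \<in> Om \<longleftrightarrow> nu \<bullet> (z - y) < 0"
  using n unfolding is_outward_normal_def by metis
 have ee: "e \<bullet> e = 1" "nu \<bullet> nu = 1" using e q(1) by (simp_all add: norm_eq_1)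
 have we: "w \<bullet> e = 0" by (simp add: w_def inner_diff_left ee)
 have "(norm (nu - (nu \<bullet> e) *\<^sub>R e))^2 = 1 - (nu \<bullet> e)^2"
  unfolding power2_norm_eq_inner
  by (simp add: inner_diff inner_commute ee) (simp add: power2_eq_square)
 then have "(norm (nu - (nu \<bullet> e) *\<^sub>R e))^2 <= 1\<^sup>2" by simp
 then have "norm (nu - (nu \<bullet> e) *\<^sub>R e) <= 1" by (rule power2_le_imp_le) simp
 then have nw: "norm w <= dl" using dl by (simp add: w_def mult_left_le)
 obtain m where m: "is_outward_normal Om y nu" using n by blast
 obtain et where et: "et > 0" "flat_at Om et y" using is_outward_normal_flat[OF n open_Om] by blast
 then have "y \<in> Bd" by (simp add: flat_at_def)
 have cont: "continuous_on UNIV g" using g by (rule lipschitz_on_continuous_on)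
 have yg: "y \<bullet> e = g (y - (y \<bullet> e) *\<^sub>R e)"
 proof (rule antisym)
  show "g (y - (y \<bullet> e) *\<^sub>R e) <= y \<bullet> e"
   using graph[OF y] Bd_disjoint[OF \<open>y \<in> Bd\<close>] by simp
  show "y \<bullet> e <= g (y - (y \<bullet> e) *\<^sub>R e)"
  proof (rule ccontr)
   assume "\<not> ?thesis"
   moreover have "open {z. z \<bullet> e > g (z - (z \<bullet> e) *\<^sub>R e)}"
    by (intro open_Collect_less continuous_intros continuous_on_compose2[OF cont]) auto
   ultimately obtain ep where ep: "ep > 0" "ball y ep \<subseteq> {z. z \<bullet> e > g (z - (z \<bullet> e) *\<^sub>R e)} \<inter> ball p r"
    using openE[of "{z. z \<bullet> e > g (z - (z \<bullet> e) *\<^sub>R e)} \<inter> ball p r" y] y by (auto simp: not_le)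
   obtain w where "w \<in> Om" "dist y w < ep"
    using \<open>y \<in> Bd\<close> ep(1) unfolding frontier_straddle by metis
   then show False using ep(2) graph[of w] by (force simp: subset_eq)
  qed
 qed
 obtain ep where ep: "ep > 0" "ball y ep \<subseteq> ball p r \<inter> ball y q"
  using openE[of "ball p r \<inter> ball y q" y] y q(2) by auto
 define t where "t = ep / 4"
 let ?z = "y + t *\<^sub>R (w - e)"
 have t: "t > 0" using ep by (simp add: t_def)
 have "norm (w - e) <= 2" using norm_triangle_ineq4[of w e] nw dl e by simp
 then have "norm (t *\<^sub>R (w - e)) <= t * 2" using t by simp
 moreover have "t * 2 < ep" using ep by (simp add: t_def)
 ultimately have "?z \<in> ball y ep" by (simp add: dist_norm)
 then have z: "?z \<in> ball p r \<inter> ball y q" using ep by blast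
 have "?z - (?z \<bullet> e) *\<^sub>R e - (y - (y \<bullet> e) *\<^sub>R e) = t *\<^sub>R w"
  by (simp add: inner_add_left inner_diff_left we ee algebra_simps)
 then have "dist (g (?z - (?z \<bullet> e) *\<^sub>R e)) (g (y - (y \<bullet> e) *\<^sub>R e)) <= L * (t * norm w)"
  using lipschitz_onD[OF g, of "?z - (?z \<bullet> e) *\<^sub>R e" "y - (y \<bullet> e) *\<^sub>R e"] t by (simp add: dist_norm)
 moreover have "L * (t * norm w) < t"
 proof -
  have "L * (t * norm w) <= (L * dl) * t" using mult_left_mono[OF nw, of "L * t"] L t by (simp add: mult_ac)
  also have "... < 1 * t" using dl(3) t by (rule mult_strict_right_mono)
  finally show ?thesis by simp
 qed
 moreover have "?z \<bullet> e = y \<bullet> e - t" by (simp add: inner_add_left inner_diff_left we ee)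
 ultimately have "?z \<in> Om" using graph[of ?z] z yg by (simp add: dist_real_def)
 then have "nu \<bullet> (?z - y) < 0" using q(3)[of ?z] z by simp
 then have "nu \<bullet> (w - e) < 0" using t by (simp add: mult_less_0_iff)
 then have gt: "nu \<bullet> e > dl * (1 - (nu \<bullet> e)^2)"
  by (simp add: w_def inner_diff_right ee power2_eq_square inner_commute algebra_simps)
 then have "nu \<bullet> e \<ge> dl / 2"
 proof (cases "nu \<bullet> e \<ge> 1/2")
  case False
  have "\<bar>nu \<bullet> e\<bar> <= 1" using Cauchy_Schwarz_ineq2[of nu e] q(1) e by simp
  then have "(nu \<bullet> e)^2 <= 1" by (simp add: abs_square_le_1)
  then have "dl * (1 - (nu \<bullet> e)^2) \<ge> 0" using dl by simp
  then have "nu \<bullet> e > 0" using gt by linarith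
  then have "(nu \<bullet> e)^2 <= (1/2)^2" using False by (intro power_mono) auto
  then have "dl * (1/2) <= dl * (1 - (nu \<bullet> e)^2)" using dl by (intro mult_left_mono) (auto simp: power2_eq_square)
  then show ?thesis using gt by linarith
 qed (use dl in auto)
 moreover have "dl / 2 = 1 / (2 * (1 + L))" by (simp add: dl_def)
 ultimately show ?thesis by simp
qed

end

lemma integral_lebesgue_on_borel:
 fixes f :: "'a::euclidean_space => real"
 assumes "f \<in> borel_measurable borel" "Om \<in> sets borel"
 shows "(LINT x|lebesgue_on Om. f x) = (LINT x|lborel. indicator Om x * f x)"
 using assms by (subst integral_restrict_space) (auto simp: integral_completion)

lemma integrable_lebesgue_on_borel:
 fixes f :: "'a::euclidean_space => real"
 assumes "f \<in> borel_measurable borel" "Om \<in> sets borel"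
 shows "integrable (lebesgue_on Om) f \<longleftrightarrow> integrable lborel (%x. indicator Om x * f x)"
 using assms by (subst integrable_restrict_space) (auto simp: integrable_completion)

lemma nn_integral_hyperplane_swap:
 assumes n: "norm n = 1" and F: "case_prod F \<in> borel_measurable (borel \<Otimes>\<^sub>M borel)"
 shows "(\<integral>\<^sup>+y. \<integral>\<^sup>+s. F y s \<partial>(lborel :: real measure) \<partial>hyperplane_measure (plane n be)) =
  (\<integral>\<^sup>+s. \<integral>\<^sup>+y. F y s \<partial>hyperplane_measure (plane n be) \<partial>lborel)"
proof -
 note [measurable] = F
 let ?I = "%z. indicator {-1/2..1/2} (n \<bullet> z - be) :: ennreal"
 have "(\<integral>\<^sup>+y. \<integral>\<^sup>+s. F y s \<partial>lborel \<partial>hyperplane_measure (plane n be)) =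
   (\<integral>\<^sup>+z. (\<integral>\<^sup>+s. F (plane_proj n be z) s \<partial>lborel) * ?I z \<partial>lborel)"
  by (rule nn_integral_hyperplane[OF n]) measurable
 also have "... = (\<integral>\<^sup>+z. \<integral>\<^sup>+s. F (plane_proj n be z) s * ?I z \<partial>lborel \<partial>lborel)"
  by (intro nn_integral_cong nn_integral_multc[symmetric]) measurable
 also have "... = (\<integral>\<^sup>+s. \<integral>\<^sup>+z. F (plane_proj n be z) s * ?I z \<partial>lborel \<partial>lborel)"
  by (rule lborel_swap) measurable
 also have "... = (\<integral>\<^sup>+s. \<integral>\<^sup>+y. F y s \<partial>hyperplane_measure (plane n be) \<partial>lborel)"
  by (intro nn_integral_cong nn_integral_hyperplane[OF n, symmetric]) measurable
 finally show ?thesis .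
qed

lemma AE_hyperplane_in:
 assumes n: "norm n = 1"
 shows "AE y in hyperplane_measure (plane n be). y \<in> plane n be"
proof (rule AE_I[of _ _ "- plane n be"])
 have cl: "closed (plane n be)" by (simp add: plane_def closed_hyperplane)
 then show "- plane n be \<in> sets (hyperplane_measure (plane n be))" by auto
 have "{z. infdist z (plane n be) <= 1/2 \<and> closest_point (plane n be) z \<in> - plane n be} = {}"
  using plane_proj_in[OF n] by (auto simp: closest_point_plane[OF n])
 then show "emeasure (hyperplane_measure (plane n be)) (- plane n be) = 0"
  using cl by (subst emeasure_hyperplane_measure[OF plane_hyperplanes[OF n]])
   (auto simp: borel_closed simp del: Collect_empty_eq)
qed auto

section \<open>The divergence theorem\<close>

context lipschitz_polyhedron
begin

definition swept :: "real^'n => real => (real^'n) set => (real^'n) set" where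
 "swept e t h = (%(y, s). y + s *\<^sub>R e) ` ((h \<inter> Bd) \<times> {0..t})"

definition crossings :: "real^'n => real => real^'n => real" where
 "crossings e t x = (\<Sum>h\<in>boundary_planes Om. indicator (swept e t h) x)"

lemma swept_borel:
 assumes "h \<in> boundary_planes Om"
 shows "swept e t h \<in> sets borel"
proof -
 have "closed h" using assms H by (auto simp: hyperplanes_def closed_hyperplane)
 then have "compact ((h \<inter> Bd) \<times> {0..t})"
  by (intro compact_Times closed_Int_compact compact_Bd) auto
 then have "compact (swept e t h)" unfolding swept_def
  by (intro compact_continuous_image) (auto simp: split_beta intro!: continuous_intros)
 then show ?thesis by (intro borel_closed compact_imp_closed)
qed

lemma crossings_measurable [measurable]: "crossings e t \<in> borel_measurable borel"
 unfolding crossings_def using swept_borel by (intro borel_measurable_sum borel_measurable_indicator)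

lemma crossings_nonneg: "crossings e t x \<ge> 0"
 unfolding crossings_def by (intro sum_nonneg) auto

lemma nn_integral_swept:
 assumes h: "h \<in> boundary_planes Om" and [measurable]: "g \<in> borel_measurable borel"
 shows "(\<integral>\<^sup>+x. g x * indicator (swept e t h) x \<partial>lborel) =
  (\<integral>\<^sup>+y. ennreal \<bar>normal y \<bullet> e\<bar> * (\<integral>\<^sup>+s. g (y + s *\<^sub>R e) * indicator {0..t} s \<partial>lborel) * indicator Bd y
   \<partial>hyperplane_measure h)"
proof -
 obtain n be where n: "norm n = 1" "h = plane n be" using hyperplanes_plane H h by (metis subsetD)
 note [measurable] = swept_borel[OF h, of e t]
 have "AE y in sg. y \<in> h --> \<bar>normal y \<bullet> e\<bar> = \<bar>n \<bullet> e\<bar>"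
  using AE_normal by eventually_elim (use n h in fastforce)
 then obtain Z where Z: "Z \<in> null_sets sg" "{y. \<not> (y \<in> h --> \<bar>normal y \<bullet> e\<bar> = \<bar>n \<bullet> e\<bar>)} \<subseteq> Z"
  by (auto elim!: AE_E simp: null_sets_def)
 have "emeasure sg Z = 0" "Z \<in> sets borel" using Z by (auto simp: null_sets_def)
 then have "emeasure (hyperplane_measure h) (Z \<inter> Bd) = 0"
  using emeasure_surface_sum[of Z] h finite_H by simp
 then have "Z \<inter> Bd \<in> null_sets (hyperplane_measure h)"
  using \<open>Z \<in> sets borel\<close> by (simp add: null_sets_def)
 then have "AE y in hyperplane_measure h. y \<notin> Z \<inter> Bd" by (rule AE_not_in)
 with AE_hyperplane_in[OF n(1), of be]
 have ae: "AE y in hyperplane_measure h. y \<in> h \<and> (y \<in> Bd --> \<bar>normal y \<bullet> e\<bar> = \<bar>n \<bullet> e\<bar>)"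
  unfolding n(2)[symmetric] by eventually_elim (use Z(2) in blast)
 let ?R = "%y s. g (y + s *\<^sub>R e) * indicator {0..t} s * indicator Bd y"
 have "(\<integral>\<^sup>+y. ennreal \<bar>normal y \<bullet> e\<bar> * (\<integral>\<^sup>+s. g (y + s *\<^sub>R e) * indicator {0..t} s \<partial>lborel) * indicator Bd y
   \<partial>hyperplane_measure h) =
  (\<integral>\<^sup>+y. ennreal \<bar>n \<bullet> e\<bar> * (\<integral>\<^sup>+s. ?R y s \<partial>lborel) \<partial>hyperplane_measure h)"
  using ae by (intro nn_integral_cong_AE, eventually_elim) (auto simp: indicator_def)
 also have "... = ennreal \<bar>n \<bullet> e\<bar> * (\<integral>\<^sup>+y. \<integral>\<^sup>+s. ?R y s \<partial>lborel \<partial>hyperplane_measure h)"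
  by (rule nn_integral_cmult) measurable
 also have "... = (\<integral>\<^sup>+x. g x * indicator (swept e t h) x \<partial>lborel)"
 proof (cases "n \<bullet> e = 0")
  case True
  have "swept e t h \<subseteq> h" using True n by (auto simp: swept_def plane_def inner_add_right)
  moreover have "negligible h" unfolding n plane_def using n(1) by (intro negligible_hyperplane) auto
  ultimately have "negligible (swept e t h)" by (metis negligible_subset)
  then have "swept e t h \<in> null_sets lborel"
   by (simp add: negligible_iff_null_sets null_sets_completion_iff)
  then have "AE x in lborel. x \<notin> swept e t h" by (rule AE_not_in)
  then have "(\<integral>\<^sup>+x. g x * indicator (swept e t h) x \<partial>lborel) = (\<integral>\<^sup>+x. 0 \<partial>(lborel :: (real^'n) measure))"
   by (intro nn_integral_cong_AE, eventually_elim) simp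
  then show ?thesis using True by simp
 next
  case False
  have "(\<integral>\<^sup>+y. \<integral>\<^sup>+s. ?R y s \<partial>lborel \<partial>hyperplane_measure h) = (\<integral>\<^sup>+s. \<integral>\<^sup>+y. ?R y s \<partial>hyperplane_measure h \<partial>lborel)"
   unfolding n(2) by (rule nn_integral_hyperplane_swap[OF n(1)]) measurable
  also have "... = (\<integral>\<^sup>+s. \<integral>\<^sup>+y. (g (y + s *\<^sub>R e) * indicator (swept e t h) (y + s *\<^sub>R e)) \<partial>hyperplane_measure h \<partial>lborel)"
  proof (rule nn_integral_cong, rule nn_integral_cong_AE)
   fix s
   show "AE y in hyperplane_measure h. ?R y s = g (y + s *\<^sub>R e) * indicator (swept e t h) (y + s *\<^sub>R e)"
    using ae
   proof eventually_elim
    case (elim y)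
    have "y + s *\<^sub>R e \<in> swept e t h \<longleftrightarrow> y \<in> Bd \<and> s \<in> {0..t}"
    proof
     assume "y + s *\<^sub>R e \<in> swept e t h"
     then obtain y' s' where y': "y' \<in> h" "y' \<in> Bd" "s' \<in> {0..t}" "y + s *\<^sub>R e = y' + s' *\<^sub>R e"
      by (auto simp: swept_def)
     then have "n \<bullet> (y + s *\<^sub>R e) = n \<bullet> (y' + s' *\<^sub>R e)" by simp
     moreover have "n \<bullet> y = be" "n \<bullet> y' = be" using elim y'(1) n(2) by (auto simp: plane_def)
     ultimately have "s = s'" using False by (simp add: inner_add_right)
     then show "y \<in> Bd \<and> s \<in> {0..t}" using y' by simp
    qed (use elim in \<open>auto simp: swept_def intro!: image_eqI[of _ _ "(y, s)"]\<close>)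
    then show ?case by (auto simp: indicator_def)
   qed
  qed
  finally show ?thesis
   unfolding n(2) using nn_integral_plane_coarea[OF n(1) False, of "%x. g x * indicator (swept e t (plane n be)) x" be]
    swept_borel[OF h, of e t] n(2) by simp
 qed
 finally show ?thesis by simp
qed

abbreviation "flow_weight e \<equiv> (%(y, r). \<bar>normal y \<bullet> e\<bar> * indicator {0..1 :: real} r)"

lemma pair_sigma_finite_surface: "pair_sigma_finite sg (lborel :: real measure)"
proof -
 interpret finite_measure sg by (rule finite_surface)
 show ?thesis ..
qed

lemma surface_flow:
 assumes t: "t > 0" and g: "g \<in> borel_measurable borel"
 shows "(LINT x|lborel. g x * crossings e t x) =
  t * (LINT p|(sg \<Otimes>\<^sub>M lborel). g (fst p + (t * snd p) *\<^sub>R e) * flow_weight e p)"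
proof -
 interpret pair_sigma_finite sg "lborel :: real measure" by (rule pair_sigma_finite_surface)
 let ?F = "%p. fst p + (t * snd p) *\<^sub>R e"
 have [measurable]: "?F \<in> measurable (sg \<Otimes>\<^sub>M lborel) borel" by measurable
 have nn: "(\<integral>\<^sup>+x. f x * ennreal (crossings e t x) \<partial>lborel) =
   ennreal t * (\<integral>\<^sup>+p. f (?F p) * ennreal (flow_weight e p) \<partial>(sg \<Otimes>\<^sub>M lborel))"
  if [measurable]: "f \<in> borel_measurable borel" for f
 proof -
  have "(\<integral>\<^sup>+x. f x * ennreal (crossings e t x) \<partial>lborel) =
    (\<integral>\<^sup>+x. (\<Sum>h\<in>boundary_planes Om. f x * indicator (swept e t h) x) \<partial>lborel)"
   unfolding crossings_def
   by (simp add: sum_distrib_left ennreal_indicator flip: sum_ennreal)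
  also have "... = (\<Sum>h\<in>boundary_planes Om. \<integral>\<^sup>+x. f x * indicator (swept e t h) x \<partial>lborel)"
   using swept_borel by (intro nn_integral_sum) simp
  also have "... = (\<integral>\<^sup>+y. ennreal \<bar>normal y \<bullet> e\<bar> * (\<integral>\<^sup>+s. f (y + s *\<^sub>R e) * indicator {0..t} s \<partial>lborel) \<partial>sg)"
   by (subst nn_integral_surface) (auto simp: nn_integral_swept intro!: sum.cong)
  also have "... = (\<integral>\<^sup>+y. ennreal t * (\<integral>\<^sup>+r. f (y + (t * r) *\<^sub>R e) * ennreal (flow_weight e (y, r)) \<partial>lborel) \<partial>sg)"
  proof (rule nn_integral_cong)
   fix y
   have "(\<integral>\<^sup>+s. f (y + s *\<^sub>R e) * indicator {0..t} s \<partial>lborel) =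
     ennreal t * (\<integral>\<^sup>+r. f (y + (t * r) *\<^sub>R e) * indicator {0..t} (t * r) \<partial>lborel)"
    using nn_integral_lborel_scale[of "%s. f (y + s *\<^sub>R e) * indicator {0..t} s" t] t by simp
   also have "(%r. indicator {0..t} (t * r)) = (indicator {0..1} :: real => ennreal)"
    using t by (auto simp: indicator_def fun_eq_iff zero_le_mult_iff)
   finally show "ennreal \<bar>normal y \<bullet> e\<bar> * (\<integral>\<^sup>+s. f (y + s *\<^sub>R e) * indicator {0..t} s \<partial>lborel) =
     ennreal t * (\<integral>\<^sup>+r. f (y + (t * r) *\<^sub>R e) * ennreal (flow_weight e (y, r)) \<partial>lborel)"
    by (simp add: ennreal_mult ennreal_indicator mult_ac nn_integral_cmult[symmetric])
  qed
  also have "... = ennreal t * (\<integral>\<^sup>+y. \<integral>\<^sup>+r. f (y + (t * r) *\<^sub>R e) * ennreal (flow_weight e (y, r)) \<partial>lborel \<partial>sg)"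
   by (rule nn_integral_cmult) measurable
  also have "(\<integral>\<^sup>+y. \<integral>\<^sup>+r. f (y + (t * r) *\<^sub>R e) * ennreal (flow_weight e (y, r)) \<partial>lborel \<partial>sg) =
    (\<integral>\<^sup>+p. f (?F p) * ennreal (flow_weight e p) \<partial>(sg \<Otimes>\<^sub>M lborel))"
   by (subst lborel.nn_integral_fst[symmetric]) (auto simp: split_beta)
  finally show ?thesis .
 qed
 let ?W = "%p. t * flow_weight e p"
 have eq: "density lborel (%x. ennreal (crossings e t x)) =
   distr (density (sg \<Otimes>\<^sub>M lborel) (%p. ennreal (?W p))) borel ?F" (is "?D = ?R")
 proof (rule measure_eqI)
  fix A assume "A \<in> sets ?D"
  then have [measurable]: "A \<in> sets borel" by simp
  have "?F -` A \<in> sets (sg \<Otimes>\<^sub>M (lborel :: real measure))"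
   using measurable_sets[of ?F "sg \<Otimes>\<^sub>M lborel" borel A] by (simp add: space_pair_measure)
  then have "emeasure ?R A = (\<integral>\<^sup>+p. ennreal (?W p) * indicator A (?F p) \<partial>(sg \<Otimes>\<^sub>M lborel))"
   by (subst emeasure_distr, simp, simp, subst emeasure_density)
    (auto simp: split_beta space_pair_measure indicator_def intro!: nn_integral_cong)
  also have "... = (\<integral>\<^sup>+p. ennreal t * (indicator A (?F p) * ennreal (flow_weight e p)) \<partial>(sg \<Otimes>\<^sub>M lborel))"
   using t by (intro nn_integral_cong) (auto simp: ennreal_mult mult_ac split_beta)
  also have "... = ennreal t * (\<integral>\<^sup>+p. indicator A (?F p) * ennreal (flow_weight e p) \<partial>(sg \<Otimes>\<^sub>M lborel))"
   by (rule nn_integral_cmult) (simp add: split_beta)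
  also have "... = emeasure ?D A"
   by (subst nn[symmetric]) (auto simp: emeasure_density mult.commute)
  finally show "emeasure ?D A = emeasure ?R A" by simp
 qed simp
 have "(LINT x|lborel. g x * crossings e t x) = (LINT x|?D. g x)"
  using g crossings_nonneg by (subst integral_density) (auto simp: mult.commute)
 also have "... = (\<integral>p. g (?F p) \<partial>density (sg \<Otimes>\<^sub>M lborel) (%p. ennreal (?W p)))"
  unfolding eq using g by (subst integral_distr) auto
 also have "... = (LINT p|(sg \<Otimes>\<^sub>M lborel). ?W p *\<^sub>R g (?F p))"
  using g t by (subst integral_density) (auto simp: split_beta)
 also have "... = t * (LINT p|(sg \<Otimes>\<^sub>M lborel). g (?F p) * flow_weight e p)"
  by (subst integral_mult_right_zero[symmetric]) (simp add: mult_ac)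
 finally show ?thesis .
qed

lemma AE_pair_fst:
 assumes "AE y in sg. P y"
 shows "AE p in (sg \<Otimes>\<^sub>M (lborel :: real measure)). P (fst p)"
proof -
 from assms obtain Z where Z: "Z \<in> null_sets sg" "{y. \<not> P y} \<subseteq> Z"
  by (auto elim!: AE_E simp: null_sets_def)
 have "Z \<times> UNIV \<in> null_sets (sg \<Otimes>\<^sub>M (lborel :: real measure))"
  by (rule lborel.times_in_null_sets1[OF Z(1)]) simp
 then show ?thesis by (rule AE_I') (use Z(2) in auto)
qed

lemma AE_pair_snd:
 assumes "AE r in lborel. P (r :: real)"
 shows "AE p in (sg \<Otimes>\<^sub>M lborel). P (snd p)"
proof -
 from assms obtain Z where Z: "Z \<in> null_sets lborel" "{y. \<not> P y} \<subseteq> Z"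
  by (auto elim!: AE_E simp: null_sets_def)
 have "UNIV \<times> Z \<in> null_sets (sg \<Otimes>\<^sub>M (lborel :: real measure))"
  by (rule lborel.times_in_null_sets2[OF _ Z(1)]) simp
 then show ?thesis by (rule AE_I') (use Z(2) in auto)
qed

text \<open>
 The difference of the indicator functions of \<open>Om + t e\<close> and \<open>Om\<close>, split evenly among the boundary
 planes that the segment from \<open>x - t e\<close> to \<open>x\<close> crosses within \<open>Bd\<close>.
\<close>

definition shift_jump :: "real^'n => real => real^'n => real" where
 "shift_jump e t x = (indicator Om (x - t *\<^sub>R e) - indicator Om x) / crossings e t x"

lemma shift_jump_crossings:
 assumes "t \<ge> 0"
 shows "shift_jump e t x * crossings e t x = indicator Om (x - t *\<^sub>R e) - indicator Om x"
  and crossings_ge_1: "indicator Om (x - t *\<^sub>R e) ~= (indicator Om x :: real) ==> crossings e t x \<ge> 1"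
proof -
 show ge: "crossings e t x \<ge> 1" if "indicator Om (x - t *\<^sub>R e) ~= (indicator Om x :: real)"
 proof -
  let ?S = "closed_segment (x - t *\<^sub>R e) x"
  have "x - t *\<^sub>R e \<in> ?S" "x \<in> ?S" by auto
  then have "?S \<inter> Om ~= {}" "?S - Om ~= {}"
   using that by (cases "x \<in> Om"; cases "x - t *\<^sub>R e \<in> Om"; force)+
  then have "?S \<inter> Bd ~= {}" by (intro connected_Int_frontier) auto
  then obtain y where y: "y \<in> ?S" "y \<in> Bd" by blast
  then obtain u where u: "0 <= u" "u <= 1" "y = (1 - u) *\<^sub>R (x - t *\<^sub>R e) + u *\<^sub>R x"
   by (auto simp: closed_segment_def)
  obtain h where h: "h \<in> boundary_planes Om" "y \<in> h" using y Bd_H by blast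
  have "x = y + ((1 - u) * t) *\<^sub>R e" using u by (simp add: algebra_simps)
  moreover have "(1 - u) * t \<in> {0..t}" using u assms by (auto simp: mult_left_le_one_le)
  ultimately have "x \<in> swept e t h"
   using y h unfolding swept_def by (intro image_eqI[of _ _ "(y, (1 - u) * t)"]) auto
  then have "1 = (indicator (swept e t h) x :: real)" by simp
  also have "... <= crossings e t x"
   unfolding crossings_def using h finite_H by (intro member_le_sum) auto
  finally show ?thesis .
 qed
 show "shift_jump e t x * crossings e t x = indicator Om (x - t *\<^sub>R e) - indicator Om x"
  using ge by (cases "indicator Om (x - t *\<^sub>R e) = (indicator Om x :: real)") (auto simp: shift_jump_def)
qed

lemma shift_jump_bound: "t \<ge> 0 ==> \<bar>shift_jump e t x\<bar> <= 1"
 using crossings_ge_1[of t x e] 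
 by (cases "indicator Om (x - t *\<^sub>R e) = (indicator Om x :: real)")
  (auto simp: shift_jump_def indicator_def field_simps split: if_splits)

lemma Om_borel [measurable]: "Om \<in> sets borel"
 using open_Om by simp

lemma shift_jump_measurable [measurable]: "shift_jump e t \<in> borel_measurable borel"
 unfolding shift_jump_def by measurable

lemma shift_jump_eventually:
 assumes y: "is_outward_normal Om y (normal y)" and uniq: "\<exists>!h. h \<in> boundary_planes Om \<and> y \<in> h"
  and r: "0 < r" "r < 1" and ne: "normal y \<bullet> e ~= 0" and t: "T ----> 0" "!!k. T k > 0"
 shows "\<forall>\<^sub>F k in sequentially. shift_jump e (T k) (y + (T k * r) *\<^sub>R e) = sgn (normal y \<bullet> e)"
proof -
 obtain dl where dl: "dl > 0" "flat_at Om dl y" using is_outward_normal_flat[OF y open_Om] by blast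
 note fl = flat_atD[OF dl(2,1)] flat_at_frontier[OF dl(2,1) _ _ open_Om]
 have "(%k. T k * norm e) ----> 0 * norm e" using t by (intro tendsto_intros)
 then have "\<forall>\<^sub>F k in sequentially. T k * norm e < dl" using dl(1) by (intro order_tendstoD(2)) auto
 then show ?thesis
 proof eventually_elim
  case (elim k)
  let ?t = "T k" let ?x = "y + (?t * r) *\<^sub>R e"
  have small: "y + s *\<^sub>R e \<in> ball y dl" if "\<bar>s\<bar> <= ?t" for s
  proof -
   have "\<bar>s\<bar> * norm e <= ?t * norm e" using that by (intro mult_right_mono) auto
   then show ?thesis using elim by (simp add: dist_norm)
  qed
  have tr: "\<bar>?t * r\<bar> <= ?t" "\<bar>?t * r - s\<bar> <= ?t" if "s \<in> {0..?t}" for s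
  proof -
   have "0 <= ?t * r" "?t * r <= ?t" using t(2)[of k] r mult_left_le[of r ?t] by auto
   with that show "\<bar>?t * r\<bar> <= ?t" "\<bar>?t * r - s\<bar> <= ?t" by auto
  qed
  obtain h where h: "h \<in> boundary_planes Om" "y \<in> h" "!!h'. h' \<in> boundary_planes Om ==> y \<in> h' ==> h' = h"
   using uniq by blast
  have yBd: "y \<in> Bd" using dl(2) by (simp add: flat_at_def)
  have swept: "?x \<in> swept e ?t h' \<longleftrightarrow> h' = h" if h': "h' \<in> boundary_planes Om" for h'
  proof
   assume "?x \<in> swept e ?t h'"
   then obtain y' s where s: "y' \<in> h'" "y' \<in> Bd" "s \<in> {0..?t}" "?x = y' + s *\<^sub>R e"
    by (auto simp: swept_def)
   then have y': "y' = y + (?t * r - s) *\<^sub>R e" by (simp add: algebra_simps)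
   then have "normal y \<bullet> (y' - y) = 0" using fl(4)[OF s(2)] small[OF tr(2)[OF s(3)]] by simp
   then have "?t * r = s" using y' ne by simp
   then show "h' = h" using y' h(3)[OF h'] s(1) by simp
  next
   assume "h' = h"
   then show "?x \<in> swept e ?t h'"
    using h(2) yBd r t(2)[of k] mult_left_le[of r ?t]
    unfolding swept_def by (intro image_eqI[of _ _ "(y, ?t * r)"]) (simp_all add: less_imp_le)
  qed
  have cr: "crossings e ?t ?x = 1"
   unfolding crossings_def using h(1) finite_H
   by (subst sum.remove[of _ h]) (auto simp: swept indicator_def sum.neutral)
  have x1: "?x \<in> Om \<longleftrightarrow> normal y \<bullet> e < 0"
   using fl(3)[OF small[OF tr(1)[of 0]]] t(2)[of k] r by (auto simp: mult_less_0_iff less_imp_le)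
  have eq: "?x - ?t *\<^sub>R e = y + (?t * r - ?t) *\<^sub>R e" by (simp add: algebra_simps)
  have "y + (?t * r - ?t) *\<^sub>R e \<in> Om \<longleftrightarrow> normal y \<bullet> e > 0"
  proof -
   have "?t * r - ?t < 0" using t(2)[of k] r by (simp add: mult_less_cancel_left2)
   then show ?thesis
    using fl(3)[OF small[OF tr(2)[of ?t]]] t(2)[of k] by (auto simp: mult_less_0_iff less_imp_le)
  qed
  then show ?case
   unfolding shift_jump_def eq cr using x1 ne by (simp add: indicator_def sgn_if)
 qed
qed

lemma bounded_on_cball:
 fixes f :: "real^'n => real"
 assumes "continuous_on UNIV f"
 obtains M where "M > 0" "!!x. x \<in> cball 0 R ==> \<bar>f x\<bar> <= M"
proof -
 have "bounded (f ` cball 0 R)"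
  by (intro compact_imp_bounded compact_continuous_image continuous_on_subset[OF assms]) auto
 then obtain M where "M > 0" "\<forall>x\<in>f ` cball 0 R. norm x <= M" by (auto simp: bounded_pos)
 with that show thesis by auto
qed

lemma Om_in_cball: obtains R where "R > 0" "closure Om \<subseteq> cball 0 R"
 using bounded_closure[OF bounded_Om] by (auto simp: bounded_pos subset_eq)

theorem divergence_theorem:
 fixes ph :: "real^'n => real"
 assumes d: "!!x. (ph has_derivative ph' x) (at x)" and cont: "continuous_on UNIV (%x. ph' x e)"
 shows "(LINT x|lebesgue_on Om. ph' x e) = (LINT y|sg. ph y * (normal y \<bullet> e))"
proof -
 interpret pair_sigma_finite sg "lborel :: real measure" by (rule pair_sigma_finite_surface)
 interpret S: finite_measure sg by (rule finite_surface)
 define T where "T k = 1 / real (Suc k)" for k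
 let ?z = "%k p. fst p + (T k * snd p) *\<^sub>R e" and ?S = "LINT y|sg. ph y * (normal y \<bullet> e)"
 let ?F = "%k p. ph (?z k p) * shift_jump e (T k) (?z k p) * flow_weight e p" and ?P = "sg \<Otimes>\<^sub>M (lborel :: real measure)"
 let ?G = "%p. ph (fst p) * (normal (fst p) \<bullet> e) * indicator {0..1 :: real} (snd p)"
 have T: "T k > 0" "T k <= 1" for k by (auto simp: T_def)
 have T0: "T ----> 0" unfolding T_def by (rule LIMSEQ_Suc[OF lim_1_over_n])
 have cph: "continuous_on UNIV ph"
  by (intro continuous_at_imp_continuous_on ballI) (rule has_derivative_continuous[OF d])
 then have [measurable]: "ph \<in> borel_measurable borel" by (rule borel_measurable_continuous_onI)
 have [measurable]: "(%x. ph' x e) \<in> borel_measurable borel" using cont by (rule borel_measurable_continuous_onI)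
 obtain R where R: "R > 0" "closure Om \<subseteq> cball 0 R" by (rule Om_in_cball)
 have ROm: "norm x <= R" if "x \<in> Om \<or> x \<in> Bd" for x
  using that R(2) closure_subset[of Om] by (auto simp: frontier_def)
 have Rt: "x + s *\<^sub>R e \<in> cball 0 (R + norm e)" if "x \<in> Om \<or> x \<in> Bd" "0 <= s" "s <= 1" for x s
 proof -
  have "norm (x + s *\<^sub>R e) <= norm x + s * norm e" using norm_triangle_ineq[of x "s *\<^sub>R e"] that by simp
  also have "s * norm e <= norm e" using that by (simp add: mult_left_le_one_le)
  finally show ?thesis using ROm[OF that(1)] by simp
 qed
 obtain M where M: "M > 0" "!!x. x \<in> cball 0 (R + norm e) ==> \<bar>ph x\<bar> <= M"
  using bounded_on_cball[OF cph] by blast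
 let ?W = "%p. M * (norm e * indicator (UNIV \<times> {0..1 :: real}) p)"
 obtain M' where M': "M' > 0" "!!x. x \<in> cball 0 (R + norm e) ==> \<bar>ph' x e\<bar> <= M'"
  using bounded_on_cball[OF cont] by blast
 have finOm: "emeasure lborel Om < \<infinity>" by (rule emeasure_bounded_finite[OF bounded_Om])
 define q where "q k x = (ph (x + T k *\<^sub>R e) - ph x) / T k" for k x
 have line: "((%s. ph (x + s *\<^sub>R e)) has_real_derivative ph' (x + s *\<^sub>R e) e) (at s)" for x s
 proof -
  have "((%s. x + s *\<^sub>R e) has_derivative (%s. s *\<^sub>R e)) (at s)"
   by (auto intro!: derivative_eq_intros)
  from has_derivative_compose[OF this d[of "x + s *\<^sub>R e"]]
  have "((%s. ph (x + s *\<^sub>R e)) has_derivative (%h. ph' (x + s *\<^sub>R e) (h *\<^sub>R e))) (at s)" .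
  moreover have "ph' (x + s *\<^sub>R e) (h *\<^sub>R e) = ph' (x + s *\<^sub>R e) e * h" for h
   using linear_scale[OF has_derivative_linear[OF d], of "x + s *\<^sub>R e" h e] by (simp add: mult.commute)
  ultimately show ?thesis by (simp add: has_field_derivative_def)
 qed
 have q_bound: "\<bar>q k x\<bar> <= M'" if x: "x \<in> Om" for k x
 proof -
  obtain s where s: "0 < s" "s < T k" "ph (x + T k *\<^sub>R e) - ph (x + 0 *\<^sub>R e) = (T k - 0) * ph' (x + s *\<^sub>R e) e"
   using MVT2[of 0 "T k" "%s. ph (x + s *\<^sub>R e)" "%s. ph' (x + s *\<^sub>R e) e"] T(1)[of k] line by blast
  then have "q k x = ph' (x + s *\<^sub>R e) e" using T(1)[of k] by (simp add: q_def)
  then show ?thesis using M'(2)[OF Rt, of x s] x s T(2)[of k] by simp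
 qed
 have q_lim: "(%k. q k x) ----> ph' x e" for x
 proof -
  have "((%h. (ph (x + h *\<^sub>R e) - ph x) / h) \<longlongrightarrow> ph' x e) (at 0)"
   using line[of x 0] by (simp add: has_field_derivative_iff)
  then show ?thesis
   unfolding q_def by (rule filterlim_compose[of _ _ _ T])
    (use T(1) T0 in \<open>auto simp: filterlim_at less_imp_neq[symmetric] less_imp_le\<close>)
 qed
 have [measurable]: "q k \<in> borel_measurable borel" for k unfolding q_def by measurable
 have L: "(%k. LINT x|lborel. indicator Om x * q k x) ----> (LINT x|lborel. indicator Om x * ph' x e)"
 proof (rule integral_dominated_convergence[where w="%x. M' * indicator Om x"])
  show "integrable lborel (%x. M' * indicator Om x :: real)"
   using finOm by (intro integrable_mult_right integrable_real_indicator) auto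
 qed (use q_lim q_bound in \<open>auto simp: indicator_def\<close>)
 have jump: "(LINT x|lborel. indicator Om x * q k x) =
   (LINT p|(sg \<Otimes>\<^sub>M lborel). ph (?z k p) * shift_jump e (T k) (?z k p)
     * flow_weight e p)" for k
 proof -
  have i: "integrable lborel (%x. indicator Om x * ph (x + s *\<^sub>R e))" if "0 <= s" "s <= 1" for s
  proof (rule Bochner_Integration.integrable_bound[of _ "%x. M * indicator Om x"])
   show "integrable lborel (%x. M * indicator Om x :: real)"
    using finOm by (intro integrable_mult_right integrable_real_indicator) auto
   show "AE x in lborel. norm (indicator Om x * ph (x + s *\<^sub>R e)) <= norm (M * indicator Om x)"
    using M(1) M(2)[OF Rt] that by (intro AE_I2) (simp add: indicator_def)
  qed simp
  have "(LINT x|lborel. indicator Om x * q k x) =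
    (LINT x|lborel. (indicator Om x * ph (x + T k *\<^sub>R e) - indicator Om x * ph (x + 0 *\<^sub>R e)) / T k)"
   by (simp add: q_def field_simps)
  also have "... = ((LINT x|lborel. indicator Om x * ph (x + T k *\<^sub>R e)) -
    (LINT x|lborel. indicator Om x * ph (x + 0 *\<^sub>R e))) / T k"
   using i[of "T k"] i[of 0] T[of k] by (subst integral_divide_zero) (auto simp: less_imp_le)
  also have "(LINT x|lborel. indicator Om x * ph (x + T k *\<^sub>R e)) =
    (LINT x|lborel. indicator Om (x - T k *\<^sub>R e) * ph x)"
   by (subst (2) lborel_distr_plus[of "T k *\<^sub>R e", symmetric], subst integral_distr) (simp_all add: add.commute)
  also have "(LINT x|lborel. indicator Om (x - T k *\<^sub>R e) * ph x) - (LINT x|lborel. indicator Om x * ph (x + 0 *\<^sub>R e)) =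
    (LINT x|lborel. indicator Om (x - T k *\<^sub>R e) * ph x - indicator Om x * ph x)"
  proof -
   have "integrable lborel (%x. indicator Om (x - T k *\<^sub>R e) * ph x)"
    by (subst lborel_distr_plus[of "T k *\<^sub>R e", symmetric], subst integrable_distr_eq)
     (use i[of "T k"] T[of k] in \<open>auto simp: add.commute less_imp_le\<close>)
   then show ?thesis using i[of 0] by simp
  qed
  also have "... = (LINT x|lborel. (ph x * shift_jump e (T k) x) * crossings e (T k) x)"
   by (simp only: mult.assoc shift_jump_crossings[OF less_imp_le[OF T(1)]] right_diff_distrib)
    (simp add: mult.commute)
  also have "... = T k * (LINT p|(sg \<Otimes>\<^sub>M lborel). ph (?z k p) * shift_jump e (T k) (?z k p)
     * flow_weight e p)"
   by (rule surface_flow[OF T(1)]) measurable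
  finally show ?thesis using T(1)[of k] by simp
 qed
 have w: "integrable ?P ?W"
   using lborel.emeasure_pair_measure_Times[of UNIV sg "{0..1 :: real}"] S.emeasure_finite[of UNIV, unfolded infinity_ennreal_def less_top]
   by (intro integrable_mult_right integrable_real_indicator) (auto simp: ennreal_mult_less_top less_top)
 have bd: "AE p in ?P. norm (?F k p) <= ?W p" for k
   using AE_pair_fst[OF AE_surface]
  proof eventually_elim
   case (elim p)
   obtain y r where p: "p = (y, r)" by force
   show ?case
   proof (cases "r \<in> {0..1}")
    case True
    have "T k * r <= 1" using True T[of k] mult_le_one[of "T k" r] by auto
    then have "\<bar>ph (y + (T k * r) *\<^sub>R e)\<bar> <= M"
     using elim True T(1)[of k] by (intro M(2) Rt) (auto simp: p)
    moreover have "\<bar>shift_jump e (T k) (y + (T k * r) *\<^sub>R e)\<bar> <= 1"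
     using shift_jump_bound T(1)[of k] by (simp add: less_imp_le)
    moreover have "\<bar>normal y \<bullet> e\<bar> <= norm e"
     using Cauchy_Schwarz_ineq2[of "normal y" e] norm_outward_normal_le[of Om y]
      mult_right_mono[of "norm (normal y)" 1 "norm e"] by simp
    ultimately have "\<bar>ph (y + (T k * r) *\<^sub>R e)\<bar> * \<bar>shift_jump e (T k) (y + (T k * r) *\<^sub>R e)\<bar> * \<bar>normal y \<bullet> e\<bar>
      <= M * 1 * norm e"
     using M(1) by (intro mult_mono) auto
    then show ?thesis using True by (simp add: p abs_mult)
   qed (simp add: p)
  qed
  have "AE r in lborel. (r :: real) ~= 0" "AE r in lborel. (r :: real) ~= 1"
   by (rule AE_lborel_singleton)+
  from this[THEN AE_pair_snd] AE_pair_fst[OF AE_normal] AE_pair_fst[OF AE_surface_unique]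
 have pt: "AE p in ?P. (%k. ?F k p) ----> ?G p"
  proof eventually_elim
   case (elim p)
   obtain y r where p: "p = (y, r)" by force
   show ?case
   proof (cases "r \<in> {0..1} \<and> normal y \<bullet> e ~= 0")
    case True
    then have r: "0 < r" "r < 1" using elim(1,2) p by auto
    have "\<forall>\<^sub>F k in sequentially. shift_jump e (T k) (y + (T k * r) *\<^sub>R e) = sgn (normal y \<bullet> e)"
     using elim p True by (intro shift_jump_eventually r T0 T(1)) auto
    then have ev: "(%k. shift_jump e (T k) (y + (T k * r) *\<^sub>R e)) ----> sgn (normal y \<bullet> e)"
     by (rule tendsto_eventually)
    have "(%k. y + (T k * r) *\<^sub>R e) ----> y + (0 * r) *\<^sub>R e" using T0 by (intro tendsto_intros)
    then have "(%k. ph (y + (T k * r) *\<^sub>R e)) ----> ph y"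
     using continuous_on_tendsto_compose[OF cph, of "%k. y + (T k * r) *\<^sub>R e" y] by simp
    from tendsto_mult[OF tendsto_mult[OF this ev] tendsto_const[of "\<bar>normal y \<bullet> e\<bar>"]]
    show ?thesis using True by (simp add: p mult.assoc sgn_mult_abs)
   qed (auto simp: p)
  qed
 have m: "?G \<in> borel_measurable ?P" "?F k \<in> borel_measurable ?P" for k by (auto simp: split_beta)
 note lim = integral_dominated_convergence[OF m w pt bd] and int = integrable_dominated_convergence[OF m w pt bd]
 from integral_fst'[OF int]
 have "(LINT p|?P. ?G p) =
   (LINT y|sg. LINT r|lborel. ph y * (normal y \<bullet> e) * indicator {0..1 :: real} r)"
  by simp
 also have "... = ?S"
  by (simp add: integral_indicator)
 finally have eq: "(LINT p|?P. ?G p) = ?S" .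
 have "(%k. LINT x|lborel. indicator Om x * q k x) ----> ?S"
  using lim unfolding jump eq .
 with L have "(LINT x|lborel. indicator Om x * ph' x e) = ?S"
  by (rule LIMSEQ_unique)
 then show ?thesis by (subst integral_lebesgue_on_borel) auto
qed

end

section \<open>Square integrable functions and mollification\<close>

lemma L2_measurable [measurable_dest]: "f \<in> L2 M ==> f \<in> borel_measurable M"
 and L2_square: "f \<in> L2 M ==> integrable M (%x. (f x)^2)"
 by (auto simp: L2_def)

lemma L2_mult_integrable:
 assumes "f \<in> L2 M" "g \<in> L2 M"
 shows "integrable M (%x. f x * g x)"
proof (rule Bochner_Integration.integrable_bound)
 show "integrable M (%x. (f x)^2 + (g x)^2)"
  using assms by (intro Bochner_Integration.integrable_add) (auto simp: L2_def)
 have "\<bar>a * b\<bar> <= a^2 + b^2" for a b :: real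
 proof -
  have "0 <= \<bar>a\<bar> * \<bar>b\<bar>" by simp
  moreover have "2 * (\<bar>a\<bar> * \<bar>b\<bar>) <= a^2 + b^2" using sum_squares_bound[of "\<bar>a\<bar>" "\<bar>b\<bar>"] by simp
  ultimately show ?thesis unfolding abs_mult by linarith
 qed
 then show "AE x in M. norm (f x * g x) <= norm ((f x)^2 + (g x)^2)" by simp
qed (use assms in \<open>auto simp: L2_def\<close>)

lemma L2_lincomb:
 assumes "f \<in> L2 M" "g \<in> L2 M"
 shows "(%x. a * f x + b * g x) \<in> L2 M"
proof -
 have "integrable M (%x. a^2 * (f x)^2 + b^2 * (g x)^2 + 2 * a * b * (f x * g x))"
  using assms by (intro Bochner_Integration.integrable_add integrable_mult_right L2_mult_integrable) (auto simp: L2_def)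
 moreover have "(%x. a * f x + b * g x) \<in> borel_measurable M" using assms by measurable
 ultimately show ?thesis by (simp add: L2_def power2_sum power_mult_distrib mult_ac)
qed

lemma L2_add: "f \<in> L2 M ==> g \<in> L2 M ==> (%x. f x + g x) \<in> L2 M"
 and L2_diff: "f \<in> L2 M ==> g \<in> L2 M ==> (%x. f x - g x) \<in> L2 M"
 and L2_scale: "f \<in> L2 M ==> (%x. a * f x) \<in> L2 M"
 using L2_lincomb[of f M g 1 1] L2_lincomb[of f M g 1 "-1"] L2_lincomb[of f M f a 0] by simp_all

lemma L2_cong_AE:
 assumes "f \<in> L2 M" "g \<in> borel_measurable M" "AE x in M. f x = g x"
 shows "g \<in> L2 M"
proof -
 have "integrable M (%x. (g x)^2) \<longleftrightarrow> integrable M (%x. (f x)^2)"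
  using assms by (intro integrable_cong_AE) (auto simp: L2_def)
 then show ?thesis using assms by (simp add: L2_def)
qed

lemma (in finite_measure) L2_bounded:
 assumes "f \<in> borel_measurable M" "AE x in M. \<bar>f x\<bar> <= C"
 shows "f \<in> L2 M"
proof -
 have "AE x in M. norm ((f x)^2) <= C^2"
  using assms(2) by eventually_elim (simp add: abs_le_square_iff[symmetric])
 then show ?thesis using assms(1) by (auto simp: L2_def intro!: integrable_const_bound[where B="C^2"])
qed

lemma (in finite_measure) L2_integrable: "f \<in> L2 M ==> integrable M f"
proof -
 assume "f \<in> L2 M"
 moreover have "(%_. 1) \<in> L2 M" by (rule L2_bounded[where C=1]) auto
 ultimately show ?thesis using L2_mult_integrable by fastforce
qed

lemma L2_bounded_mult:
 assumes "f \<in> L2 M" "g \<in> borel_measurable M" "AE x in M. \<bar>g x\<bar> <= C"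
 shows "(%x. g x * f x) \<in> L2 M"
proof -
 have "integrable M (%x. (g x * f x)^2)"
 proof (rule Bochner_Integration.integrable_bound[where f="%x. C^2 * (f x)^2"])
  show "AE x in M. norm ((g x * f x)^2) <= norm (C^2 * (f x)^2)"
   using assms(3) by eventually_elim
    (auto simp: power_mult_distrib abs_le_square_iff[symmetric] intro!: mult_right_mono)
 qed (use assms in \<open>auto simp: L2_def\<close>)
 moreover have "(%x. g x * f x) \<in> borel_measurable M" using assms by measurable
 ultimately show ?thesis by (simp add: L2_def)
qed

lemma L2_Cauchy_Schwarz:
 assumes f: "f \<in> L2 M" and g: "g \<in> L2 M"
 shows "\<bar>LINT x|M. f x * g x\<bar> <= sqrt (LINT x|M. (f x)^2) * sqrt (LINT x|M. (g x)^2)"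
proof -
 let ?A = "LINT x|M. (f x)^2" let ?B = "LINT x|M. f x * g x" let ?C = "LINT x|M. (g x)^2"
 have A: "?A \<ge> 0" "?C \<ge> 0" by simp_all
 have quad: "a^2 * ?A + 2 * a * b * ?B + b^2 * ?C \<ge> 0" for a b
 proof -
  have "0 <= (LINT x|M. (a * f x + b * g x)^2)" by simp
  also have "(LINT x|M. (a * f x + b * g x)^2) =
    (LINT x|M. a^2 * (f x)^2 + 2 * a * b * (f x * g x) + b^2 * (g x)^2)"
   by (intro Bochner_Integration.integral_cong) (auto simp: power2_sum power_mult_distrib mult_ac)
  also have "... = a^2 * ?A + 2 * a * b * ?B + b^2 * ?C"
   using f g by (simp add: L2_mult_integrable L2_square)
  finally show ?thesis .
 qed
 have "?B^2 <= ?A * ?C"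
 proof (cases "?C = 0")
  case True
  have "?B = 0"
  proof (rule ccontr)
   assume B: "?B ~= 0"
   have "2 * (- (?A + 1) / (2 * ?B)) * ?B + ?A \<ge> 0"
    using quad[of 1 "- (?A + 1) / (2 * ?B)"] True by simp
   then show False using B by (simp add: field_simps)
  qed
  then show ?thesis using A by simp
 next
  case False
  then have "?C > 0" using A by linarith
  have "?C * (?C * ?A - ?B^2) \<ge> 0"
   using quad[of ?C "- ?B"] by (simp add: power2_eq_square algebra_simps)
  then show ?thesis using \<open>?C > 0\<close> by (simp add: zero_le_mult_iff mult.commute)
 qed
 then have "\<bar>?B\<bar> <= sqrt (?A * ?C)" by (rule real_le_rsqrt[of "\<bar>?B\<bar>", simplified])
 then show ?thesis by (simp add: real_sqrt_mult)
qed

definition L2_lim :: "'a measure => (nat => 'a => real) => ('a => real) => bool" where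
 "L2_lim M f g \<longleftrightarrow> (\<forall>k. f k \<in> L2 M) \<and> g \<in> L2 M \<and> (%k. LINT x|M. (f k x - g x)^2) ----> 0"

lemma L2_limD: "L2_lim M f g ==> f k \<in> L2 M" "L2_lim M f g ==> g \<in> L2 M"
 by (auto simp: L2_lim_def)

lemma L2_lim_const: "f \<in> L2 M ==> L2_lim M (%_. f) f"
 by (simp add: L2_lim_def)

lemma square_sum_le: "(a + b)^2 <= 2 * a^2 + 2 * (b :: real)^2"
 using zero_le_power2[of "a - b"] by (simp add: power2_sum power2_diff)

lemma LIMSEQ_squeeze_0:
 fixes f g :: "nat => real"
 assumes "g ----> 0" "!!k. 0 <= f k" "!!k. f k <= g k"
 shows "f ----> 0"
 using tendsto_sandwich[OF _ _ tendsto_const assms(1), of f] assms(2,3) by auto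

lemma L2_add_bound:
 assumes "f \<in> L2 M" "g \<in> L2 M"
 shows "(LINT x|M. (f x + g x)^2) <= 2 * (LINT x|M. (f x)^2) + 2 * (LINT x|M. (g x)^2)"
proof -
 have "(LINT x|M. (f x + g x)^2) <= (LINT x|M. 2 * (f x)^2 + 2 * (g x)^2)"
  using assms L2_add[OF assms] by (intro integral_mono square_sum_le) (auto simp: L2_square)
 then show ?thesis using assms by (simp add: L2_square)
qed

lemma L2_lim_add:
 assumes "L2_lim M f f'" "L2_lim M g g'"
 shows "L2_lim M (%k x. f k x + g k x) (%x. f' x + g' x)"
 unfolding L2_lim_def
proof (intro conjI allI)
 have bd: "(LINT x|M. ((f k x + g k x) - (f' x + g' x))^2) <=
   2 * (LINT x|M. (f k x - f' x)^2) + 2 * (LINT x|M. (g k x - g' x)^2)" for k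
  using L2_add_bound[of "%x. f k x - f' x" M "%x. g k x - g' x"] assms
  by (simp add: L2_lim_def L2_diff add_diff_add)
 have "(%k. 2 * (LINT x|M. (f k x - f' x)^2) + 2 * (LINT x|M. (g k x - g' x)^2)) ----> 2 * 0 + 2 * 0"
  using assms by (intro tendsto_add tendsto_mult_left) (auto simp: L2_lim_def)
 then show "(%k. LINT x|M. ((f k x + g k x) - (f' x + g' x))^2) ----> 0"
  by (intro LIMSEQ_squeeze_0[OF _ _ bd]) simp_all
 show "(%x. f k x + g k x) \<in> L2 M" for k
  using assms by (intro L2_add) (auto simp: L2_lim_def)
 show "(%x. f' x + g' x) \<in> L2 M"
  using assms by (intro L2_add) (auto simp: L2_lim_def)
qed

lemma L2_lim_bounded_mult:
 assumes "L2_lim M f f'" "g \<in> borel_measurable M" "AE x in M. \<bar>g x\<bar> <= C"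
 shows "L2_lim M (%k x. g x * f k x) (%x. g x * f' x)"
 unfolding L2_lim_def
proof (intro conjI allI)
 have d: "(%x. f k x - f' x) \<in> L2 M" for k using assms(1) by (simp add: L2_lim_def L2_diff)
 have bd: "(LINT x|M. (g x * f k x - g x * f' x)^2) <= C^2 * (LINT x|M. (f k x - f' x)^2)" for k
 proof -
  have "(LINT x|M. (g x * (f k x - f' x))^2) <= (LINT x|M. C^2 * (f k x - f' x)^2)"
  proof (rule integral_mono_AE)
   show "integrable M (%x. (g x * (f k x - f' x))^2)"
    using L2_bounded_mult[OF d assms(2,3)] by (rule L2_square)
   show "AE x in M. (g x * (f k x - f' x))^2 <= C^2 * (f k x - f' x)^2"
    using assms(3) by eventually_elim
     (auto simp: power_mult_distrib abs_le_square_iff[symmetric] intro!: mult_right_mono)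
  qed (use d in \<open>auto simp: L2_square\<close>)
  then show ?thesis by (simp add: right_diff_distrib)
 qed
 have "(%k. C^2 * (LINT x|M. (f k x - f' x)^2)) ----> C\<^sup>2 * 0"
  using assms by (intro tendsto_mult_left) (auto simp: L2_lim_def)
 then show "(%k. LINT x|M. (g x * f k x - g x * f' x)^2) ----> 0"
  by (intro LIMSEQ_squeeze_0[OF _ _ bd]) simp_all
 show "(%x. g x * f k x) \<in> L2 M" for k
  using assms by (intro L2_bounded_mult[where C=C]) (auto simp: L2_lim_def)
 show "(%x. g x * f' x) \<in> L2 M"
  using assms by (intro L2_bounded_mult[where C=C]) (auto simp: L2_lim_def)
qed

lemma L2_lim_scale: "L2_lim M f f' ==> L2_lim M (%k x. a * f k x) (%x. a * f' x)"
 using L2_lim_bounded_mult[of M f f' "%_. a" "\<bar>a\<bar>"] by simp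

lemma L2_lim_diff:
 "L2_lim M f f' ==> L2_lim M g g' ==> L2_lim M (%k x. f k x - g k x) (%x. f' x - g' x)"
 using L2_lim_add[of M f f' "%k x. -1 * g k x" "%x. -1 * g' x"] L2_lim_scale[of M g g' "-1"] by simp

lemma L2_lim_integral_mult1:
 assumes "L2_lim M f f'" "g \<in> L2 M"
 shows "(%k. LINT x|M. f k x * g x) ----> (LINT x|M. f' x * g x)"
proof -
 have eq: "\<bar>(LINT x|M. f k x * g x) - (LINT x|M. f' x * g x)\<bar> <=
   sqrt (LINT x|M. (f k x - f' x)^2) * sqrt (LINT x|M. (g x)^2)" for k
  using L2_Cauchy_Schwarz[OF L2_diff, of "f k" M f' g] assms
  by (simp add: L2_lim_def left_diff_distrib L2_mult_integrable)
 have "(%k. sqrt (LINT x|M. (f k x - f' x)^2) * sqrt (LINT x|M. (g x)^2)) ----> sqrt 0 * sqrt (LINT x|M. (g x)^2)"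
  using assms by (intro tendsto_mult_right tendsto_real_sqrt) (simp add: L2_lim_def)
 then have "(%k. \<bar>(LINT x|M. f k x * g x) - (LINT x|M. f' x * g x)\<bar>) ----> 0"
  by (intro LIMSEQ_squeeze_0[OF _ _ eq]) simp_all
 then have "(%k. (LINT x|M. f k x * g x) - (LINT x|M. f' x * g x)) ----> 0"
  by (rule tendsto_rabs_zero_cancel)
 then show ?thesis by (simp add: LIM_zero_iff)
qed

lemma L2_lim_square:
 assumes "L2_lim M f f'"
 shows "(%k. LINT x|M. (f k x)^2) ----> (LINT x|M. (f' x)^2)"
proof -
 have f: "f k \<in> L2 M" "f' \<in> L2 M" for k using assms by (auto simp: L2_lim_def)
 have "(LINT x|M. (f k x)^2) = (LINT x|M. (f k x - f' x)^2) + 2 * (LINT x|M. f k x * f' x) - (LINT x|M. f' x * f' x)" for k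
 proof -
  have "(LINT x|M. (f k x)^2) = (LINT x|M. (f k x - f' x)^2 + 2 * (f k x * f' x) - f' x * f' x)"
   by (intro Bochner_Integration.integral_cong) (auto simp: power2_eq_square algebra_simps)
  also have "... = (LINT x|M. (f k x - f' x)^2) + 2 * (LINT x|M. f k x * f' x) - (LINT x|M. f' x * f' x)"
   using f by (simp add: L2_mult_integrable L2_square[OF L2_diff])
  finally show ?thesis .
 qed
 moreover have "(%k. (LINT x|M. (f k x - f' x)^2) + 2 * (LINT x|M. f k x * f' x) - (LINT x|M. f' x * f' x))
   ----> 0 + 2 * (LINT x|M. f' x * f' x) - (LINT x|M. f' x * f' x)"
  using assms by (intro tendsto_add tendsto_diff tendsto_mult_left tendsto_const L2_lim_integral_mult1[OF assms f(2)])
   (simp add: L2_lim_def)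
 ultimately show ?thesis by (simp add: power2_eq_square)
qed

lemma L2_lim_mult:
 assumes f: "L2_lim M f f'" and g: "L2_lim M g g'"
 shows "(%k. LINT x|M. f k x * g k x) ----> (LINT x|M. f' x * g' x)"
proof -
 have polar: "(LINT x|M. a x * b x) =
   ((LINT x|M. (a x + b x)^2) - (LINT x|M. (a x)^2) - (LINT x|M. (b x)^2)) / 2"
  if "a \<in> L2 M" "b \<in> L2 M" for a b
 proof -
  have "(LINT x|M. (a x + b x)^2) = (LINT x|M. (a x)^2 + (b x)^2 + 2 * (a x * b x))"
   by (simp add: power2_sum mult.assoc)
  also have "... = (LINT x|M. (a x)^2) + (LINT x|M. (b x)^2) + 2 * (LINT x|M. a x * b x)"
   using that by (simp add: L2_mult_integrable L2_square)
  finally show ?thesis by simp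
 qed
 show ?thesis
  unfolding polar[OF L2_limD(1)[OF f] L2_limD(1)[OF g]] polar[OF L2_limD(2)[OF f] L2_limD(2)[OF g]]
  by (intro tendsto_divide tendsto_diff tendsto_const L2_lim_square L2_lim_add f g) simp
qed

lemma integral_lborel_shift:
 fixes w :: "'a::euclidean_space => real"
 assumes "w \<in> borel_measurable borel"
 shows "(LINT x|lborel. w (x + a)) = (LINT x|lborel. w x)"
  and "integrable lborel (%x. w (x + a)) \<longleftrightarrow> integrable lborel w"
 by (subst (2) lborel_distr_plus[of a, symmetric], use assms in \<open>simp add: integral_distr integrable_distr_eq add.commute\<close>)+

lemma translation_L1_approx:
 fixes w :: "'a::euclidean_space => real"
 assumes w: "integrable lborel w"
  and ap: "!!ep. ep > 0 ==> \<exists>u. integrable lborel u \<and> (LINT x|lborel. \<bar>w x - u x\<bar>) < ep \<and>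
   (%k. LINT x|lborel. \<bar>u (x + h k) - u x\<bar>) ----> 0"
 shows "(%k. LINT x|lborel. \<bar>w (x + h k) - w x\<bar>) ----> 0"
proof (rule LIMSEQ_I, goal_cases)
 case (1 r)
 then obtain u where u: "integrable lborel u" "(LINT x|lborel. \<bar>w x - u x\<bar>) < r / 3"
   "(%k. LINT x|lborel. \<bar>u (x + h k) - u x\<bar>) ----> 0"
  using ap[of "r / 3"] by auto
 then obtain N where N: "!!k. k \<ge> N ==> (LINT x|lborel. \<bar>u (x + h k) - u x\<bar>) < r / 3"
  using LIMSEQ_D[OF u(3), of "r / 3"] 1 by auto
 have meas [measurable]: "w \<in> borel_measurable borel" "u \<in> borel_measurable borel" using w u by auto
 have sh: "integrable lborel (%x. w (x + h k))" "integrable lborel (%x. u (x + h k))" for k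
  using w u by (simp_all add: integral_lborel_shift)
 have "(LINT x|lborel. \<bar>w (x + h k) - w x\<bar>) < r" if "k \<ge> N" for k
 proof -
  have "(LINT x|lborel. \<bar>w (x + h k) - w x\<bar>) <=
    (LINT x|lborel. \<bar>w (x + h k) - u (x + h k)\<bar> + (\<bar>u (x + h k) - u x\<bar> + \<bar>w x - u x\<bar>))"
   using w u sh by (intro integral_mono integrable_abs Bochner_Integration.integrable_add Bochner_Integration.integrable_diff) auto
  also have "... = (LINT x|lborel. \<bar>w (x + h k) - u (x + h k)\<bar>) + ((LINT x|lborel. \<bar>u (x + h k) - u x\<bar>) + (LINT x|lborel. \<bar>w x - u x\<bar>))"
   using w u sh by simp
  also have "(LINT x|lborel. \<bar>w (x + h k) - u (x + h k)\<bar>) = (LINT x|lborel. \<bar>w x - u x\<bar>)"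
   by (rule integral_lborel_shift(1)) simp
  finally show ?thesis using u(2) N[OF that] by linarith
 qed
 then show ?case by auto
qed

lemma translation_L1_open:
 assumes U: "open U" "emeasure lborel U < \<infinity>" and h: "h ----> (0 :: 'a::euclidean_space)"
 shows "(%k. LINT x|lborel. \<bar>indicator U (x + h k) - indicator U x\<bar>) ----> (0 :: real)"
proof -
 let ?i = "indicator U :: 'a => real"
 have [measurable]: "U \<in> sets borel" using U by simp
 have int: "integrable lborel (?i)" using U by simp
 have sh: "integrable lborel (%x. ?i (x + h k) :: real)" for k
  by (subst integral_lborel_shift(2)) (use int in auto)
 have "(LINT x|lborel. \<bar>?i (x + h k) - ?i x\<bar>) =
   (2 :: real) * (LINT x|lborel. max 0 (?i x - ?i (x + h k)))" for k
 proof -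
  have "(LINT x|lborel. \<bar>?i (x + h k) - ?i x\<bar>) =
    (LINT x|lborel. 2 * max 0 (?i x - ?i (x + h k)) + (?i (x + h k) - ?i x))"
   by (intro Bochner_Integration.integral_cong) (auto simp: indicator_def)
  also have "... = 2 * (LINT x|lborel. max 0 (?i x - ?i (x + h k))) +
    ((LINT x|lborel. ?i (x + h k)) - (LINT x|lborel. ?i x))"
   using int sh by (subst Bochner_Integration.integral_add) (auto intro!: integrable_max)
  also have "(LINT x|lborel. ?i (x + h k)) = ((LINT x|lborel. ?i x) :: real)"
   by (rule integral_lborel_shift(1)) simp
  finally show ?thesis by simp
 qed
 moreover have "(%k. LINT x|lborel. max 0 (?i x - ?i (x + h k))) ----> (LINT x|(lborel :: 'a measure). 0)"
 proof (rule integral_dominated_convergence[where w="?i"])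
  show "AE x in lborel. (%k. max 0 (?i x - ?i (x + h k)) :: real) ----> 0"
  proof (rule AE_I2)
   fix x
   have "\<forall>\<^sub>F k in sequentially. max 0 (?i x - ?i (x + h k)) = (0 :: real)"
   proof (cases "x \<in> U")
    case True
    have "(%k. x + h k) ----> x + 0" using h by (intro tendsto_intros)
    then have "\<forall>\<^sub>F k in sequentially. x + h k \<in> U" using U True topological_tendstoD by fastforce
    then show ?thesis by eventually_elim (auto simp: indicator_def)
   qed (auto simp: indicator_def)
   then show "(%k. max 0 (?i x - ?i (x + h k)) :: real) ----> 0" by (rule tendsto_eventually)
  qed
 qed (use int in \<open>auto simp: indicator_def\<close>)
 ultimately show ?thesis
  using tendsto_mult_left[of "%k. LINT x|lborel. max 0 (?i x - ?i (x + h k))" 0 sequentially "2 :: real"]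
  by (simp only: integral_zero mult_zero_right)
qed

lemma translation_L1:
 fixes w :: "'a::euclidean_space => real"
 assumes "integrable lborel w" and h: "h ----> 0"
 shows "(%k. LINT x|lborel. \<bar>w (x + h k) - w x\<bar>) ----> 0"
 using assms(1)
proof induction
 case (base A c)
 have A: "A \<in> sets borel" "emeasure lborel A < \<infinity>" using base by auto
 show ?case
 proof (rule translation_L1_approx)
  show "integrable lborel (%x. indicator A x *\<^sub>R c)" using A by (intro integrable_scaleR_left integrable_real_indicator) auto
  fix ep :: real assume ep: "ep > 0"
  obtain U where U: "open U" "A \<subseteq> U" "emeasure lebesgue (U - A) < ennreal (ep / (\<bar>c\<bar> + 1))"
  proof (rule sets_lebesgue_outer_open)
   show "A \<in> sets lebesgue" using A by simp
   show "ep / (\<bar>c\<bar> + 1) > 0" using ep by (intro divide_pos_pos) auto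
  qed
  then have UA: "emeasure lborel (U - A) < ennreal (ep / (\<bar>c\<bar> + 1))" using A by simp
  have "A \<union> (U - A) = U" using U(2) by (rule Diff_partition)
  moreover have "emeasure lborel (A \<union> (U - A)) <= emeasure lborel A + emeasure lborel (U - A)"
   by (rule emeasure_subadditive) (use U A in auto)
  ultimately have "emeasure lborel U <= emeasure lborel A + emeasure lborel (U - A)" by simp
  also have "... < \<infinity>" using A order_less_trans[OF UA ennreal_less_top] by simp
  finally have fin: "emeasure lborel U < \<infinity>" .
  have "(%k. \<bar>c\<bar> * (LINT x|lborel. \<bar>indicator U (x + h k) - indicator U x\<bar>)) ----> \<bar>c\<bar> * 0"
   by (intro tendsto_mult_left translation_L1_open U fin h)
  moreover have "(LINT x|lborel. \<bar>indicator U (x + h k) *\<^sub>R c - indicator U x *\<^sub>R c\<bar>) =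
    \<bar>c\<bar> * (LINT x|lborel. \<bar>indicator U (x + h k) - indicator U x\<bar>)" for k
  proof -
   have "\<bar>indicator U (x + h k) *\<^sub>R c - indicator U x *\<^sub>R c\<bar> = \<bar>c\<bar> * \<bar>indicator U (x + h k) - indicator U x\<bar>" for x
    by (simp add: abs_mult[symmetric] algebra_simps)
   then show ?thesis by simp
  qed
  ultimately have lim: "(%k. LINT x|lborel. \<bar>indicator U (x + h k) *\<^sub>R c - indicator U x *\<^sub>R c\<bar>) ----> 0"
   by simp
  have "(LINT x|lborel. \<bar>indicator A x *\<^sub>R c - indicator U x *\<^sub>R c\<bar>) = (LINT x|lborel. \<bar>c\<bar> * indicator (U - A) x)"
   using U(2) by (intro Bochner_Integration.integral_cong) (auto simp: indicator_def)
  also have "... = \<bar>c\<bar> * measure lborel (U - A)" by simp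
  also have "... < ep"
  proof -
   have "ennreal (measure lborel (U - A)) < ennreal (ep / (\<bar>c\<bar> + 1))"
    using UA order_less_trans[OF UA ennreal_less_top] by (subst emeasure_eq_ennreal_measure[symmetric]) auto
   then have "measure lborel (U - A) < ep / (\<bar>c\<bar> + 1)" by (simp add: ennreal_less_iff)
   then have "(\<bar>c\<bar> + 1) * measure lborel (U - A) < ep" by (simp add: field_simps)
   then show ?thesis using measure_nonneg[of lborel "U - A"] by (simp only: distrib_right mult_1)
  qed
  finally show "\<exists>u. integrable lborel u \<and> (LINT x|lborel. \<bar>indicator A x *\<^sub>R c - u x\<bar>) < ep \<and>
   (%k. LINT x|lborel. \<bar>u (x + h k) - u x\<bar>) ----> 0"
   using lim fin U by (intro exI[of _ "%x. indicator U x *\<^sub>R c"] conjI integrable_scaleR_left integrable_real_indicator) auto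
 qed
next
 case (add f g)
 have sh: "integrable lborel (%x. f (x + h k))" "integrable lborel (%x. g (x + h k))" for k
  using add by (simp_all add: integral_lborel_shift)
 have "(LINT x|lborel. \<bar>(f (x + h k) + g (x + h k)) - (f x + g x)\<bar>) <=
   (LINT x|lborel. \<bar>f (x + h k) - f x\<bar>) + (LINT x|lborel. \<bar>g (x + h k) - g x\<bar>)" for k
 proof -
  have "(LINT x|lborel. \<bar>(f (x + h k) + g (x + h k)) - (f x + g x)\<bar>) <=
    (LINT x|lborel. \<bar>f (x + h k) - f x\<bar> + \<bar>g (x + h k) - g x\<bar>)"
   using add.hyps sh by (intro integral_mono) auto
  then show ?thesis using add.hyps sh by simp
 qed
 then show ?case
  by (intro LIMSEQ_squeeze_0[OF tendsto_add_zero[OF add.IH]]) auto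
next
 case (lim f s)
 show ?case
 proof (rule translation_L1_approx[OF lim(4)])
  fix ep :: real assume "ep > 0"
  have "(%i. LINT x|lborel. \<bar>f x - s i x\<bar>) ----> (LINT x|(lborel :: 'a measure). 0)"
  proof (rule integral_dominated_convergence[where w="%x. 3 * \<bar>f x\<bar>"])
   show "AE x in lborel. (%i. \<bar>f x - s i x\<bar>) ----> 0"
   proof (rule AE_I2)
    fix x show "(%i. \<bar>f x - s i x\<bar>) ----> 0"
     using tendsto_rabs[OF tendsto_diff[OF tendsto_const[of "f x"] lim(2)[of x]]] by simp
   qed
   show "AE x in lborel. norm \<bar>f x - s i x\<bar> <= 3 * \<bar>f x\<bar>" for i
   proof (rule AE_I2)
    fix x show "norm \<bar>f x - s i x\<bar> <= 3 * \<bar>f x\<bar>" using lim(3)[of x i] by simp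
   qed
  qed (use lim(1,4) in auto)
  then obtain N where "!!i. i \<ge> N ==> (LINT x|lborel. \<bar>f x - s i x\<bar>) < ep"
   using LIMSEQ_D[of _ "0 :: real" ep] \<open>ep > 0\<close> by fastforce
  then show "\<exists>u. integrable lborel u \<and> (LINT x|lborel. \<bar>f x - u x\<bar>) < ep \<and>
   (%k. LINT x|lborel. \<bar>u (x + h k) - u x\<bar>) ----> 0"
   using lim(1,5) by (intro exI[of _ "s N"]) auto
 qed
qed

lemma square_diff_le_abs: "a \<ge> 0 ==> b \<ge> 0 ==> (a - b)^2 <= \<bar>a^2 - b\<^sup>2\<bar>" for a b :: real
proof -
 assume ab: "a \<ge> 0" "b \<ge> 0"
 have "(a - b)^2 = \<bar>a - b\<bar> * \<bar>a - b\<bar>" by (simp add: power2_eq_square)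
 also have "... <= \<bar>a - b\<bar> * (a + b)" using ab by (intro mult_left_mono) auto
 also have "... = \<bar>a^2 - b\<^sup>2\<bar>" using ab by (simp add: power2_eq_square square_diff_square_factored abs_mult mult.commute)
 finally show ?thesis .
qed

lemma translation_L2:
 fixes w :: "'a::euclidean_space => real"
 assumes "w \<in> L2 lborel" and h: "h ----> 0"
 shows "(%k. LINT x|lborel. (w (x + h k) - w x)^2) ----> 0"
proof -
 have [measurable]: "w \<in> borel_measurable borel" using assms by (simp add: L2_def)
 let ?p = "%x. max 0 (w x)" let ?n = "%x. max 0 (- w x)"
 have int: "integrable lborel (%x. (?p x)^2)" "integrable lborel (%x. (?n x)^2)"
  by (rule Bochner_Integration.integrable_bound[OF L2_square[OF assms(1)]]; simp add: max_def)+
 have sh: "integrable lborel (%x. (?p (x + h k))^2)" "integrable lborel (%x. (?n (x + h k))^2)" for k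
  using int integral_lborel_shift(2)[of "%x. (?p x)^2" "h k"] integral_lborel_shift(2)[of "%x. (?n x)^2" "h k"] by auto
 let ?R = "%k. 2 * (LINT x|lborel. \<bar>(?p (x + h k))\<^sup>2 - (?p x)\<^sup>2\<bar>) + 2 * (LINT x|lborel. \<bar>(?n (x + h k))\<^sup>2 - (?n x)\<^sup>2\<bar>)"
 have bd: "(LINT x|lborel. (w (x + h k) - w x)^2) <= ?R k" for k
 proof -
  have "(LINT x|lborel. (w (x + h k) - w x)^2) <=
   (LINT x|lborel. 2 * \<bar>(?p (x + h k))\<^sup>2 - (?p x)\<^sup>2\<bar> + 2 * \<bar>(?n (x + h k))\<^sup>2 - (?n x)\<^sup>2\<bar>)"
  proof (rule integral_mono')
   show "integrable lborel (%x. 2 * \<bar>(?p (x + h k))\<^sup>2 - (?p x)\<^sup>2\<bar> + 2 * \<bar>(?n (x + h k))\<^sup>2 - (?n x)\<^sup>2\<bar>)"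
    using int sh by auto
   fix x
   have "w (x + h k) - w x = (?p (x + h k) - ?p x) + (?n x - ?n (x + h k))" by (auto simp: max_def)
   then have "(w (x + h k) - w x)^2 <= 2 * (?p (x + h k) - ?p x)^2 + 2 * (?n x - ?n (x + h k))^2"
    using square_sum_le by metis
   also have "... <= 2 * \<bar>(?p (x + h k))\<^sup>2 - (?p x)\<^sup>2\<bar> + 2 * \<bar>(?n (x + h k))\<^sup>2 - (?n x)\<^sup>2\<bar>"
    using square_diff_le_abs[of "?p (x + h k)" "?p x"] square_diff_le_abs[of "?n (x + h k)" "?n x"]
    by (simp add: power2_commute[of "?n x"])
   finally show "(w (x + h k) - w x)^2 <= 2 * \<bar>(?p (x + h k))\<^sup>2 - (?p x)\<^sup>2\<bar> + 2 * \<bar>(?n (x + h k))\<^sup>2 - (?n x)\<^sup>2\<bar>" .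
  qed simp
  then show ?thesis using int sh by simp
 qed
 have "?R ----> 2 * 0 + 2 * 0"
  using translation_L1[OF int(1) h] translation_L1[OF int(2) h] by (intro tendsto_add tendsto_mult_left)
 then show ?thesis
  by (intro LIMSEQ_squeeze_0[OF _ _ bd]) simp_all
qed

lemma smooth_lipschitz_on_cball:
 fixes k :: "real^'n => real"
 assumes "smooth k"
 obtains C where "C > 0" "!!x. norm x <= R ==> norm (grad k x) <= C"
  "!!x y. norm x <= R ==> norm y <= R ==> \<bar>k x - k y\<bar> <= C * norm (x - y)"
proof -
 have "bounded (grad k ` cball 0 R)"
  by (intro compact_imp_bounded compact_continuous_image continuous_on_grad assms compact_cball)
 then obtain C where C: "C > 0" "!!x. norm x <= R ==> norm (grad k x) <= C"
  by (auto simp: bounded_pos)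
 have "norm (k x - k y) <= C * norm (x - y)" if "norm x <= R" "norm y <= R" for x y
 proof (rule differentiable_bound[OF convex_cball[of 0 R]])
  fix z :: "real^'n" assume "z \<in> cball 0 R"
  then show "onorm ((\<bullet>) (grad k z)) <= C"
   using C by (intro onorm_le) (metis Cauchy_Schwarz_ineq2 mem_cball_0 mult_right_mono norm_ge_zero order_trans real_norm_def)
  show "(k has_derivative (\<bullet>) (grad k z)) (at z within cball 0 R)"
   by (rule has_derivative_at_withinI[OF smooth_has_derivative_grad[OF assms]])
 qed (use that in auto)
 with C that show thesis by auto
qed

context
 fixes M :: "(real^'n) measure" and w :: "real^'n => real" and B :: real
 assumes M [measurable_cong]: "sets M = sets borel" and w: "integrable M w"
  and B: "AE y in M. w y ~= 0 --> norm y <= B"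
begin

lemma convolution_integrable:
 assumes k: "continuous_on UNIV k"
 shows "integrable M (%y. w y * k (x - y))"
proof -
 have "bounded (k ` cball 0 (norm x + B))"
  by (intro compact_imp_bounded compact_continuous_image continuous_on_subset[OF k] compact_cball) auto
 then obtain C where C: "C > 0" "!!z. norm z <= norm x + B ==> \<bar>k z\<bar> <= C"
  by (auto simp: bounded_pos)
 have [measurable]: "k \<in> borel_measurable borel" using k by (rule borel_measurable_continuous_onI)
 show ?thesis
 proof (rule Bochner_Integration.integrable_bound[where f="%y. C * w y"])
  show "AE y in M. norm (w y * k (x - y)) <= norm (C * w y)"
   using B
  proof eventually_elim
   case (elim y)
   show ?case
   proof (cases "w y = 0")
    case False
    then have "\<bar>k (x - y)\<bar> <= C" using elim norm_triangle_ineq4[of x y] by (intro C(2)) simp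
    then show ?thesis using C(1) using mult_left_mono[of "\<bar>k (x - y)\<bar>" C "\<bar>w y\<bar>"] by (simp add: abs_mult mult.commute)
   qed simp
  qed
 qed (use w in auto)
qed

lemma convolution_has_derivative:
 assumes k: "smooth k"
 shows "((%x. LINT y|M. w y * k (x - y)) has_derivative
  (%h. \<Sum>i\<in>UNIV. (LINT y|M. w y * partial i k (x - y)) * h $ i)) (at x)"
 unfolding has_derivative_iff_norm tendsto_at_iff_sequentially
proof (intro conjI allI impI)
 let ?F = "%x. LINT y|M. w y * k (x - y)" and ?D = "%i. LINT y|M. w y * partial i k (x - y)"
 show "bounded_linear (%h. \<Sum>i\<in>UNIV. ?D i * h $ i)"
  by (intro bounded_linear_sum bounded_linear_const_mult bounded_linear_vec_nth)
 fix X assume X: "\<forall>n. X n \<in> UNIV - {x}" "X ----> x"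
 define q where "q n y = (k (X n - y) - k (x - y) - grad k (x - y) \<bullet> (X n - x)) / norm (X n - x)" for n y
 have Xne: "norm (X n - x) > 0" for n using X(1) by auto
 obtain R where R: "R > 0" "!!n. norm (X n) <= R" using convergent_imp_bounded[OF X(2)] by (auto simp: bounded_pos)
 obtain C where C: "C > 0" "!!z. norm z <= R + norm x + B ==> norm (grad k z) <= C"
  "!!z z'. norm z <= R + norm x + B ==> norm z' <= R + norm x + B ==> \<bar>k z - k z'\<bar> <= C * norm (z - z')"
  using smooth_lipschitz_on_cball[OF k] by metis
 have ck: "continuous_on UNIV k" "continuous_on UNIV (partial i k)" for i
  using k by (auto intro: smooth_continuous_on smooth_partialI)
 have [measurable]: "k \<in> borel_measurable borel" "partial i k \<in> borel_measurable borel" for i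
  using ck by (auto intro: borel_measurable_continuous_onI)
 have [measurable]: "grad k \<in> borel_measurable borel"
  using continuous_on_grad[OF k] by (rule borel_measurable_continuous_onI)
 have eq: "(?F (X n) - ?F x - (\<Sum>i\<in>UNIV. ?D i * (X n - x) $ i)) / norm (X n - x) = (LINT y|M. w y * q n y)" for n
 proof -
  have "(LINT y|M. w y * q n y) = (LINT y|M. (w y * k (X n - y) - w y * k (x - y) -
    (\<Sum>i\<in>UNIV. w y * partial i k (x - y) * (X n - x) $ i)) / norm (X n - x))"
   by (simp add: q_def inner_vec_def sum_distrib_left right_diff_distrib mult.assoc)
  then show ?thesis
   using convolution_integrable[OF ck(1)] convolution_integrable[OF ck(2)] by simp
 qed
 then have "norm (?F (X n) - ?F x - (\<Sum>i\<in>UNIV. ?D i * (X n - x) $ i)) / norm (X n - x) = \<bar>LINT y|M. w y * q n y\<bar>" for n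
  by (simp add: eq[symmetric] abs_divide)
 moreover have "(%n. LINT y|M. w y * q n y) ----> (LINT y|M. 0)"
 proof (rule integral_dominated_convergence[where w="%y. \<bar>w y\<bar> * (2 * C)"])
  show "AE y in M. (%n. w y * q n y) ----> 0"
  proof (rule AE_I2)
   fix y
   have "((%z. norm ((k z - k (x - y)) - grad k (x - y) \<bullet> (z - (x - y))) / norm (z - (x - y))) \<longlongrightarrow> 0) (at (x - y))"
    using smooth_has_derivative_grad[OF k, of "x - y"] by (simp add: has_derivative_iff_norm)
   moreover have "filterlim (%n. X n - y) (at (x - y)) sequentially"
    using X by (auto simp: filterlim_at intro!: tendsto_intros)
   ultimately have "(%n. norm ((k (X n - y) - k (x - y)) - grad k (x - y) \<bullet> ((X n - y) - (x - y))) / norm ((X n - y) - (x - y))) ----> 0"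
    by (rule filterlim_compose)
   then have "(%n. \<bar>q n y\<bar>) ----> 0" by (simp add: q_def abs_divide)
   then show "(%n. w y * q n y) ----> 0" by (intro tendsto_mult_right_zero) (rule tendsto_rabs_zero_cancel)
  qed
  show "AE y in M. norm (w y * q n y) <= \<bar>w y\<bar> * (2 * C)" for n
   using B
  proof eventually_elim
   case (elim y)
   show ?case
   proof (cases "w y = 0")
    case False
    have *: "norm (X n - y) <= R + norm x + B" "norm (x - y) <= R + norm x + B"
     using norm_triangle_ineq4[of "X n" y] norm_triangle_ineq4[of x y] R(1) R(2)[of n] elim False norm_ge_zero[of x] by linarith+
    have "\<bar>k (X n - y) - k (x - y) - grad k (x - y) \<bullet> (X n - x)\<bar> <=
      \<bar>k (X n - y) - k (x - y)\<bar> + \<bar>grad k (x - y) \<bullet> (X n - x)\<bar>" by linarith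
    also have "... <= C * norm (X n - x) + C * norm (X n - x)"
     using C(3)[OF *] Cauchy_Schwarz_ineq2[of "grad k (x - y)" "X n - x"]
      mult_right_mono[OF C(2)[OF *(2)], of "norm (X n - x)"] by (intro add_mono) auto
    finally have "\<bar>q n y\<bar> <= 2 * C" using Xne[of n] by (simp add: q_def abs_divide divide_simps)
    then show ?thesis by (simp add: abs_mult mult_left_mono)
   qed simp
  qed
  show "(%y. w y * q n y) \<in> borel_measurable M" for n unfolding q_def using w by measurable
 qed (use w in auto)
 ultimately show "((%y. norm (?F y - ?F x - (\<Sum>i\<in>UNIV. ?D i * (y - x) $ i)) / norm (y - x)) \<circ> X) ----> 0"
  using tendsto_rabs_zero by (simp add: o_def)
qed

lemma smooth_convolution: "smooth k ==> smooth (%x. LINT y|M. w y * k (x - y))"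
proof (rule smooth_coinduct[of _ "{%x. (LINT y|M. w y * k (x - y)) | k. smooth k}"])
 fix g assume "g \<in> {%x. (LINT y|M. w y * k (x - y)) | k. smooth k}"
 then obtain k where k: "g = (%x. LINT y|M. w y * k (x - y))" "smooth k" by blast
 show "\<exists>D. (\<forall>i. D i \<in> {%x. (LINT y|M. w y * k (x - y)) | k. smooth k}) \<and>
   (\<forall>x. (g has_derivative (%h. \<Sum>i\<in>UNIV. D i x * h $ i)) (at x))"
  unfolding k(1) using convolution_has_derivative[OF k(2)] smooth_partialI[OF k(2)]
  by (intro exI[of _ "%i x. LINT y|M. w y * partial i k (x - y)"]) blast
qed blast

lemma partial_convolution:
 "smooth k ==> partial i (%x. LINT y|M. w y * k (x - y)) x = (LINT y|M. w y * partial i k (x - y))"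
 by (subst partial_eqI[OF convolution_has_derivative])
  (auto simp: axis_def if_distrib if_distribR sum.If_cases cong: if_cong)

end

definition mollifier :: "real^'n => real^'n => real" where
 "mollifier e z = bump e 1 z / (LINT x|lborel. bump e 1 x)"

lemma bump_measurable [measurable]: "bump a r \<in> borel_measurable borel"
 by (rule smooth_measurable[OF smooth_bump])

lemma bump_integrable: "r > 0 ==> integrable lborel (bump a r)"
 by (rule Bochner_Integration.integrable_bound[of lborel "indicator (ball a r) :: _ => real"])
  (auto simp: indicator_def bump_le_1 bump_nonneg bump_eq_0 emeasure_lborel_ball_finite[unfolded infinity_ennreal_def])

lemma bump_integral_pos: "(LINT x|lborel. bump e 1 x) > 0"
proof (rule ccontr)
 assume "\<not> ?thesis"
 then have "(LINT x|lborel. bump e 1 x) = 0"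
  using Bochner_Integration.integral_nonneg[of lborel "bump e 1"] bump_nonneg by fastforce
 then have "AE x in lborel. bump e 1 x = 0"
  using integral_nonneg_eq_0_iff_AE[OF bump_integrable[of 1 e]] by (simp add: bump_nonneg)
 then have "AE x in lborel. x \<notin> ball e 1"
  by eventually_elim (use bump_pos_iff[of 1 e] in \<open>auto simp: less_le\<close>)
 then have "emeasure lborel (ball e 1) = 0" by (subst (asm) AE_iff_measurable[of "ball e 1"]) auto
 then have "negligible (ball e 1)" by (simp add: negligible_iff_emeasure0)
 then show False using open_not_negligible[of "ball e 1"] by simp
qed

lemma mollifier_props:
 shows mollifier_nonneg: "mollifier e z \<ge> 0"
  and mollifier_eq_0: "norm (z - e) \<ge> 1 ==> mollifier e z = 0"
  and smooth_mollifier: "smooth (mollifier e)"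
  and mollifier_integrable: "integrable lborel (mollifier e)"
  and mollifier_integral: "(LINT z|lborel. mollifier e z) = 1"
  and mollifier_bounded: "mollifier e z <= 1 / (LINT x|lborel. bump e 1 x)"
 unfolding mollifier_def
 using bump_integral_pos[of e] bump_nonneg[of e 1 z] bump_le_1[of e 1 z] bump_integrable[of 1 e]
  smooth_mult[OF smooth_bump smooth_const[of "inverse (LINT x|lborel. bump e 1 x)"], of e 1]
 by (auto simp: divide_inverse bump_eq_0 dist_norm norm_minus_commute intro!: mult_right_mono)

lemma mollifier_measurable [measurable]: "mollifier e \<in> borel_measurable borel"
 by (rule smooth_measurable[OF smooth_mollifier])

definition scaled_mollifier :: "real^'n => real => real^'n => real" where
 "scaled_mollifier e ep z = mollifier e (z /\<^sub>R ep) / ep ^ CARD('n)"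

definition mollify :: "real^'n => real => (real^'n => real) => real^'n => real" where
 "mollify e ep w x = (LINT y|lborel. w y * scaled_mollifier e ep (x - y))"

lemma smooth_scaled_mollifier: "smooth (scaled_mollifier e ep)"
proof -
 have "smooth (%z. mollifier e (0 + inverse ep *\<^sub>R z) * inverse (ep ^ CARD('a)))"
  by (rule smooth_mult[OF smooth_affine[OF smooth_mollifier] smooth_const])
 then show ?thesis by (simp add: scaled_mollifier_def[abs_def] divide_inverse)
qed

lemma scaled_mollifier_eq_0: "ep > 0 ==> norm (z - ep *\<^sub>R e) \<ge> ep ==> scaled_mollifier e ep z = 0"
proof -
 assume ep: "ep > 0" "norm (z - ep *\<^sub>R e) \<ge> ep"
 have "z /\<^sub>R ep - e = (z - ep *\<^sub>R e) /\<^sub>R ep" using ep(1) by (simp add: scaleR_diff_right)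
 then have "norm (z /\<^sub>R ep - e) = norm (z - ep *\<^sub>R e) / ep"
  using ep(1) by (simp only: norm_scaleR abs_inverse abs_of_pos divide_inverse mult.commute)
 also have "... \<ge> 1" using ep by (subst le_divide_eq_1_pos) auto
 finally show ?thesis by (simp add: scaled_mollifier_def mollifier_eq_0)
qed

lemma lborel_integral_affine:
 fixes h :: "real^'n => real"
 assumes "c ~= 0" "h \<in> borel_measurable borel"
 shows "(LINT y|lborel. h y) = \<bar>c\<bar> ^ CARD('n) * (LINT z|lborel. h (a + c *\<^sub>R z))"
proof -
 let ?T = "%z :: real^'n. a + c *\<^sub>R z" let ?c = "\<bar>c\<bar> ^ DIM(real^'n)"
 have "(LINT y|lborel. h y) = (LINT y|density (distr lborel borel ?T) (%_. ennreal ?c). h y)"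
  using arg_cong[OF lborel_affine[OF assms(1), of a], of "%M. integral\<^sup>L M h"] by (simp only:)
 also have "... = (LINT y|distr lborel borel ?T. ?c *\<^sub>R h y)" by (rule integral_density) (use assms in simp_all)
 also have "... = (LINT z|lborel. ?c *\<^sub>R h (?T z))" by (rule integral_distr) (use assms in simp_all)
 finally show ?thesis by simp
qed

lemma mollify_eq:
 fixes w :: "real^'n => real"
 assumes [measurable]: "w \<in> borel_measurable borel" and ep: "ep > 0"
 shows "mollify e ep w x = (LINT z|density lborel (%z. ennreal (mollifier e z)). w (x - ep *\<^sub>R z))"
proof -
 have "(%y. w y * scaled_mollifier e ep (x - y)) \<in> borel_measurable borel"
  by (rule borel_measurable_times[OF assms(1) smooth_measurable[OF smooth_reflect[OF smooth_scaled_mollifier]]])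
 from lborel_integral_affine[OF _ this, of "- ep" x] ep
 have "mollify e ep w x = (LINT z|lborel. mollifier e z *\<^sub>R w (x - ep *\<^sub>R z))"
  unfolding mollify_def integral_mult_right_zero[symmetric] by (simp add: scaled_mollifier_def mult.commute)
 also have "... = (LINT z|density lborel (%z. ennreal (mollifier e z)). w (x - ep *\<^sub>R z))"
  by (rule integral_density[symmetric]) (simp_all add: mollifier_nonneg)
 finally show ?thesis .
qed

lemma smooth_mollify:
 assumes "integrable lborel w" "!!y. w y ~= 0 ==> norm y <= B"
 shows "smooth (mollify e ep w)"
  and "partial i (mollify e ep w) x = (LINT y|lborel. w y * partial i (scaled_mollifier e ep) (x - y))"
 unfolding mollify_def
 by (rule smooth_convolution[where B=B] partial_convolution[where B=B];
  use assms smooth_scaled_mollifier in auto)+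

lemma LIMSEQ_squeeze_0_ennreal:
 fixes f g :: "nat => ennreal"
 assumes "g ----> 0" "!!k. f k <= g k"
 shows "f ----> 0"
 using tendsto_sandwich[of "%_. 0" f sequentially g 0] assms by simp

text \<open>\<open>th\<close> is the absolute value or the square; both satisfy Jensen's inequality.\<close>

lemma mollify_convergence:
 fixes w :: "real^'n => real"
 assumes w: "integrable lborel w" and ep: "!!k. ep k > 0"
  and th [measurable]: "th \<in> borel_measurable borel"
  and jensen: "!!P f. emeasure P (space P) = 1 ==> integrable P f ==>
    ennreal (th (LINT z|P. f z)) <= (\<integral>\<^sup>+z. ennreal (th (f z)) \<partial>(P :: (real^'n) measure))"
  and lim: "!!z. (%k. \<integral>\<^sup>+x. ennreal (th (w (x - ep k *\<^sub>R z) - w x)) \<partial>lborel) ----> 0"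
  and bd: "!!k z. (\<integral>\<^sup>+x. ennreal (th (w (x - ep k *\<^sub>R z) - w x)) \<partial>lborel) <= ennreal C"
 shows "(%k. \<integral>\<^sup>+x. ennreal (th (mollify e (ep k) w x - w x)) \<partial>lborel) ----> 0"
proof -
 let ?P = "density lborel (%z. ennreal (mollifier e z))"
 have wm [measurable]: "w \<in> borel_measurable borel" using w by auto
 have P: "emeasure ?P (space ?P) = 1"
 proof -
  have "emeasure ?P (space ?P) = (\<integral>\<^sup>+z. ennreal (mollifier e z) \<partial>lborel)"
   by (simp add: emeasure_density)
  also have "... = ennreal (LINT z|lborel. mollifier e z)"
   by (intro nn_integral_eq_integral mollifier_integrable) (simp add: mollifier_nonneg)
  finally show "emeasure ?P (space ?P) = 1" by (simp add: mollifier_integral)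
 qed
 then interpret P: finite_measure ?P by (intro finite_measureI) simp
 have P1: "measure ?P (space ?P) = 1" using P by (simp add: measure_def)
 interpret pair_sigma_finite ?P "lborel :: (real^'n) measure" ..
 have int: "integrable ?P (%z. w (x - ep k *\<^sub>R z))" for x k
 proof (subst integrable_density)
  have "integrable lborel (%z. w (x + (- ep k) *\<^sub>R z))"
  proof -
   have "integrable (density (distr lborel borel (%z. x + (- ep k) *\<^sub>R z)) (%_. ennreal (\<bar>- ep k\<bar> ^ DIM(real^'n)))) w"
    using ep[of k] w by (subst lborel_affine[of "- ep k" x, symmetric]) simp_all
   then show ?thesis
    using ep[of k] by (subst (asm) integrable_density) (auto simp: integrable_distr_eq)
  qed
  then have "integrable lborel (%z. (1 / (LINT x|lborel. bump e 1 x)) * w (x + (- ep k) *\<^sub>R z))"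
   by (rule integrable_mult_right)
  then show "integrable lborel (%z. mollifier e z *\<^sub>R w (x - ep k *\<^sub>R z))"
  proof (rule Bochner_Integration.integrable_bound)
   show "AE z in lborel. norm (mollifier e z *\<^sub>R w (x - ep k *\<^sub>R z)) <=
     norm ((1 / (LINT x|lborel. bump e 1 x)) * w (x + (- ep k) *\<^sub>R z))"
    using mult_right_mono[OF mollifier_bounded abs_ge_zero] bump_integral_pos[of e]
    by (intro AE_I2) (simp add: abs_mult mollifier_nonneg)
  qed measurable
 qed (auto simp: mollifier_nonneg)
 let ?c = "%k z. \<integral>\<^sup>+x. ennreal (th (w (x - ep k *\<^sub>R z) - w x)) \<partial>lborel"
 have le: "(\<integral>\<^sup>+x. ennreal (th (mollify e (ep k) w x - w x)) \<partial>lborel) <= (\<integral>\<^sup>+z. ?c k z \<partial>?P)" for k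
 proof -
  have "mollify e (ep k) w x - w x = (LINT z|?P. w (x - ep k *\<^sub>R z) - w x)" for x
   using int P1 by (simp add: mollify_eq[OF wm ep])
  then have "(\<integral>\<^sup>+x. ennreal (th (mollify e (ep k) w x - w x)) \<partial>lborel) <=
    (\<integral>\<^sup>+x. \<integral>\<^sup>+z. ennreal (th (w (x - ep k *\<^sub>R z) - w x)) \<partial>?P \<partial>lborel)"
   using jensen[OF P Bochner_Integration.integrable_diff[OF int P.integrable_const]]
   by (intro nn_integral_mono) (simp only:)
  also have "... = (\<integral>\<^sup>+z. ?c k z \<partial>?P)"
   by (rule Fubini') measurable
  finally show ?thesis .
 qed
 have "(%k. \<integral>\<^sup>+z. ?c k z \<partial>?P) ----> (\<integral>\<^sup>+z. 0 \<partial>?P)"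
 proof (rule nn_integral_dominated_convergence[where w="%_. ennreal C"])
  show "?c k \<in> borel_measurable ?P" for k by measurable
  show "(\<integral>\<^sup>+z. ennreal C \<partial>?P) < \<infinity>"
   by (simp only: nn_integral_const P mult_1_right ennreal_less_top infinity_ennreal_def)
  show "AE z in ?P. ?c k z <= ennreal C" for k by (rule AE_I2) (rule bd)
  show "AE z in ?P. (%k. ?c k z) ----> 0" by (rule AE_I2) (rule lim)
 qed simp_all
 then have "(%k. \<integral>\<^sup>+z. ?c k z \<partial>?P) ----> 0" by (simp only: nn_integral_const mult_zero_left)
 then show ?thesis by (rule LIMSEQ_squeeze_0_ennreal) (rule le)
qed

lemma mollify_L1:
 assumes w: "integrable lborel w" and ep: "!!k. ep k > 0" "ep ----> 0"
 shows "(%k. \<integral>\<^sup>+x. ennreal \<bar>mollify e (ep k) w x - w x\<bar> \<partial>lborel) ----> 0"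
proof (rule mollify_convergence[OF w ep(1), of abs])
 have [measurable]: "w \<in> borel_measurable borel" using w by auto
 have sh: "integrable lborel (%x. w (x - a))" for a using w integral_lborel_shift(2)[of w "- a"] by simp
 have nn: "(\<integral>\<^sup>+x. ennreal \<bar>w (x - a) - w x\<bar> \<partial>lborel) = ennreal (LINT x|lborel. \<bar>w (x - a) - w x\<bar>)" for a
  using w sh by (intro nn_integral_eq_integral) auto
 show "(%k. \<integral>\<^sup>+x. ennreal \<bar>w (x - ep k *\<^sub>R z) - w x\<bar> \<partial>lborel) ----> 0" for z
 proof -
  have "(%k. - (ep k *\<^sub>R z)) ----> - (0 *\<^sub>R z)" by (intro tendsto_minus tendsto_scaleR ep tendsto_const)
  then have "(%k. LINT x|lborel. \<bar>w (x + - (ep k *\<^sub>R z)) - w x\<bar>) ----> 0" by (intro translation_L1 w) simp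
  then show ?thesis unfolding nn using tendsto_ennrealI[of _ 0] by simp
 qed
 show "(\<integral>\<^sup>+x. ennreal \<bar>w (x - ep k *\<^sub>R z) - w x\<bar> \<partial>lborel) <= ennreal (2 * (LINT x|lborel. \<bar>w x\<bar>))" for k z
 proof -
  have "(LINT x|lborel. \<bar>w (x - ep k *\<^sub>R z) - w x\<bar>) <= (LINT x|lborel. \<bar>w (x - ep k *\<^sub>R z)\<bar> + \<bar>w x\<bar>)"
   using w sh by (intro integral_mono) auto
  also have "... = 2 * (LINT x|lborel. \<bar>w x\<bar>)"
   using w sh integral_lborel_shift(1)[of "%x. \<bar>w x\<bar>" "- (ep k *\<^sub>R z)"] by simp
  finally show ?thesis unfolding nn by (rule ennreal_leI)
 qed
 show "ennreal \<bar>LINT z|P. f z\<bar> <= (\<integral>\<^sup>+z. ennreal \<bar>f z\<bar> \<partial>P)" if "integrable P f" for P :: "(real^'a) measure" and f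
  using integral_norm_bound_ennreal[OF that] by simp
qed simp

lemma bounded_support_L2_integrable:
 fixes w :: "real^'n => real"
 assumes "w \<in> L2 lborel" "!!y. w y ~= 0 ==> norm y <= B"
 shows "integrable lborel w"
proof -
 have "(indicator (cball 0 B) :: real^'n => real) \<in> L2 lborel"
  using emeasure_lborel_cball_finite[of "0 :: real^'n" B]
  by (auto simp: L2_def power2_eq_square indicator_inter_arith[symmetric] intro!: integrable_real_indicator borel_measurable_indicator)
 from L2_mult_integrable[OF assms(1) this] show ?thesis
  by (rule Bochner_Integration.integrable_cong[THEN iffD1, OF refl, rotated])
   (use assms(2) in \<open>auto simp: indicator_def\<close>)
qed

lemma jensen_square:
 assumes "emeasure P (space P) = 1" "integrable P f"
 shows "ennreal ((LINT z|P. f z)^2) <= (\<integral>\<^sup>+z. ennreal ((f z)^2) \<partial>P)"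
proof (cases "integrable P (%z. (f z)^2)")
 case True
 have P: "measure P (space P) = 1" using assms(1) by (simp add: measure_def)
 interpret finite_measure P by (rule finite_measureI) (simp add: assms(1))
 have "f \<in> L2 P" "(%_. 1) \<in> L2 P" using True assms by (auto simp: L2_def)
 then have "\<bar>LINT z|P. f z\<bar> <= sqrt (LINT z|P. (f z)^2)" using L2_Cauchy_Schwarz[of f P "%_. 1"] by (simp add: P)
 then have "(LINT z|P. f z)^2 <= (LINT z|P. (f z)^2)"
  using power_mono[of "\<bar>LINT z|P. f z\<bar>" "sqrt (LINT z|P. (f z)^2)" 2] by simp
 then show ?thesis using True by (subst nn_integral_eq_integral) (auto intro: ennreal_leI)
next
 case False
 then have "(\<integral>\<^sup>+z. ennreal ((f z)^2) \<partial>P) = \<infinity>"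
  using assms(2) by (auto simp: integrable_iff_bounded less_top[symmetric])
 then show ?thesis by simp
qed

lemma mollify_L2:
 assumes w: "w \<in> L2 lborel" and B: "!!y. w y ~= 0 ==> norm y <= B" and ep: "!!k. ep k > 0" "ep ----> 0"
 shows "(%k. \<integral>\<^sup>+x. ennreal ((mollify e (ep k) w x - w x)^2) \<partial>lborel) ----> 0"
proof (rule mollify_convergence[OF bounded_support_L2_integrable[OF w B] ep(1), of "%s. s^2"])
 have [measurable]: "w \<in> borel_measurable borel" using w by (simp add: L2_def)
 have sh: "(%x. w (x - a)) \<in> L2 lborel" for a
  using w integral_lborel_shift(2)[of "%x. (w x)^2" "- a"] by (simp add: L2_def)
 have nn: "(\<integral>\<^sup>+x. ennreal ((w (x - a) - w x)^2) \<partial>lborel) = ennreal (LINT x|lborel. (w (x - a) - w x)^2)" for a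
  using L2_diff[OF sh w] by (intro nn_integral_eq_integral) (auto simp: L2_def)
 show "(%k. \<integral>\<^sup>+x. ennreal ((w (x - ep k *\<^sub>R z) - w x)^2) \<partial>lborel) ----> 0" for z
 proof -
  have "(%k. - (ep k *\<^sub>R z)) ----> - (0 *\<^sub>R z)" by (intro tendsto_minus tendsto_scaleR ep tendsto_const)
  then have "(%k. LINT x|lborel. (w (x + - (ep k *\<^sub>R z)) - w x)^2) ----> 0" by (intro translation_L2 w) simp
  then show ?thesis unfolding nn using tendsto_ennrealI[of _ 0] by simp
 qed
 show "(\<integral>\<^sup>+x. ennreal ((w (x - ep k *\<^sub>R z) - w x)^2) \<partial>lborel) <= ennreal (4 * (LINT x|lborel. (w x)^2))" for k z
 proof -
  have "(LINT x|lborel. (w (x - ep k *\<^sub>R z) + (- 1) * w x)^2) <=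
    2 * (LINT x|lborel. (w (x - ep k *\<^sub>R z))^2) + 2 * (LINT x|lborel. ((- 1) * w x)^2)"
   by (intro L2_add_bound sh L2_scale w)
  also have "... = 4 * (LINT x|lborel. (w x)^2)"
   using integral_lborel_shift(1)[of "%x. (w x)^2" "- (ep k *\<^sub>R z)"] by simp
  finally show ?thesis unfolding nn by (simp add: ennreal_leI)
 qed
qed (auto intro: jensen_square)

lemma AE_lebesgue_on_iff:
 "U \<in> sets lebesgue ==> (AE x in lebesgue_on U. P x) \<longleftrightarrow> (AE x in lebesgue. x \<in> U --> P x)"
 by (subst AE_restrict_space_iff) auto

lemma borel_representative:
 fixes f :: "real^'n => real"
 assumes f: "f \<in> borel_measurable (lebesgue_on U)" and U: "U \<in> sets borel"
 obtains f' where "f' \<in> borel_measurable borel" "AE x in lebesgue_on U. f x = f' x" "!!x. x \<notin> U ==> f' x = 0"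
proof -
 have U': "U \<in> sets lebesgue" using U by simp
 have "(%x. if x \<in> U then f x else 0) \<in> borel_measurable lebesgue"
  by (rule borel_measurable_if_I[OF f U'])
 then obtain g where g: "g \<in> borel_measurable lborel" "AE x in lborel. (if x \<in> U then f x else 0) = g x"
  using completion_ex_borel_measurable_real by blast
 show thesis
 proof (rule that[of "%x. indicator U x * g x"])
  show "(%x. indicator U x * g x) \<in> borel_measurable borel" using g(1) U by simp
  show "AE x in lebesgue_on U. f x = indicator U x * g x"
   unfolding AE_lebesgue_on_iff[OF U'] using AE_completion[OF g(2)] by eventually_elim auto
 qed simp
qed

lemma lebesgue_on_zero_outside:
 fixes f :: "real^'n => real"
 assumes "f \<in> borel_measurable borel" "U \<in> sets borel" "!!x. x \<notin> U ==> f x = 0"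
 shows "integrable (lebesgue_on U) f \<longleftrightarrow> integrable lborel f" "(LINT x|lebesgue_on U. f x) = (LINT x|lborel. f x)"
proof -
 have "(%x. indicator U x * f x) = f"
  using assms(3) by (intro ext) (case_tac "x \<in> U", auto simp: indicator_def)
 then show "integrable (lebesgue_on U) f \<longleftrightarrow> integrable lborel f" "(LINT x|lebesgue_on U. f x) = (LINT x|lborel. f x)"
  using integrable_lebesgue_on_borel[OF assms(1,2)] integral_lebesgue_on_borel[OF assms(1,2)] by auto
qed

lemma lebesgue_on_subset_zero:
 fixes f :: "real^'n => real"
 assumes "K \<in> sets lebesgue" "U \<in> sets lebesgue" "K \<subseteq> U" "!!x. x \<in> U - K ==> f x = 0"
 shows "integrable (lebesgue_on U) f \<longleftrightarrow> integrable (lebesgue_on K) f"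
  and "(LINT x|lebesgue_on U. f x) = (LINT x|lebesgue_on K. f x)"
proof -
 have eq: "(%x. if x \<in> U then f x else 0) = (%x. if x \<in> K then f x else 0)"
  using assms(3,4) by (intro ext) (case_tac "x \<in> K", auto)
 show "integrable (lebesgue_on U) f \<longleftrightarrow> integrable (lebesgue_on K) f"
  unfolding Lebesgue_Measure.integrable_restrict_UNIV[OF assms(1), symmetric] Lebesgue_Measure.integrable_restrict_UNIV[OF assms(2), symmetric] eq ..
 show "(LINT x|lebesgue_on U. f x) = (LINT x|lebesgue_on K. f x)"
  unfolding Lebesgue_Measure.integral_restrict_UNIV[OF assms(1), symmetric] Lebesgue_Measure.integral_restrict_UNIV[OF assms(2), symmetric] eq ..
qed

lemma test_function_smooth: "test_function U ph ==> smooth ph"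
 by (simp add: test_function_def)

lemma test_function_mult: "smooth rh ==> test_function U ph ==> test_function U (%x. rh x * ph x)"
 by (auto simp: test_function_def intro!: smooth_mult)

lemma locally_integrable_mult_compact:
 fixes f ps :: "real^'n => real"
 assumes f: "locally_integrable U f" and U: "open U" and K: "compact K" "K \<subseteq> U"
  and ps: "continuous_on UNIV ps" "!!x. x \<notin> K ==> ps x = 0"
 shows "integrable (lebesgue_on U) (%x. f x * ps x)"
proof -
 have Kb: "K \<in> sets lebesgue" "U \<in> sets lebesgue" using K(1) U by (auto simp: lmeasurable_compact fmeasurableD)
 have int: "integrable (lebesgue_on K) f" using f K by (auto simp: locally_integrable_def)
 have "bounded (ps ` K)" using K ps(1) by (meson compact_imp_bounded compact_continuous_image continuous_on_subset subset_UNIV)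
 then obtain C where C: "!!x. x \<in> K ==> \<bar>ps x\<bar> <= C" by (auto simp: bounded_iff)
 have "ps \<in> borel_measurable lebesgue" using borel_measurable_continuous_onI[OF ps(1)] by (simp add: measurable_completion)
 then have [measurable]: "ps \<in> borel_measurable (lebesgue_on K)" by (rule measurable_restrict_space1)
 have "integrable (lebesgue_on K) (%x. f x * ps x)"
 proof (rule Bochner_Integration.integrable_bound[where f="%x. C * f x"])
  have "\<bar>f x\<bar> * \<bar>ps x\<bar> <= \<bar>f x\<bar> * \<bar>C\<bar>" if "x \<in> K" for x
   using C[OF that] by (intro mult_left_mono) auto
  then show "AE x in lebesgue_on K. norm (f x * ps x) <= norm (C * f x)"
   by (auto simp: abs_mult mult.commute intro!: AE_I2)
 qed (use int in auto)
 then show ?thesis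
  using lebesgue_on_subset_zero(1)[OF Kb K(2), of "%x. f x * ps x"] ps(2) by auto
qed

lemma partial_eq_0_outside:
 assumes K: "compact K" and ph: "smooth ph" "!!x. x \<notin> K ==> ph x = 0" and x: "x \<notin> K"
 shows "partial i ph x = (0 :: real)"
proof -
 have "open (- K)" using K by (simp add: compact_imp_closed open_Compl)
 then have "(ph has_derivative (%_. 0)) (at x)"
  using ph(2) x by (intro has_derivative_transform_within_open[OF has_derivative_const[of 0], of "- K"]) auto
 from partial_eqI[OF this] show ?thesis .
qed

lemma test_function_integrable:
 fixes f :: "real^'n => real"
 assumes "locally_integrable U f" "open U" "test_function U ph"
 shows "integrable (lebesgue_on U) (%x. f x * ph x)" "integrable (lebesgue_on U) (%x. f x * partial i ph x)"
proof -
 obtain K where K: "compact K" "K \<subseteq> U" "!!x. x \<notin> K ==> ph x = 0" and sm: "smooth ph"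
  using assms(3) by (auto simp: test_function_def)
 show "integrable (lebesgue_on U) (%x. f x * ph x)"
  by (rule locally_integrable_mult_compact[OF assms(1,2) K(1,2) smooth_continuous_on[OF sm] K(3)])
 show "integrable (lebesgue_on U) (%x. f x * partial i ph x)"
  by (rule locally_integrable_mult_compact[OF assms(1,2) K(1,2) smooth_continuous_on[OF smooth_partialI[OF sm]]
    partial_eq_0_outside[OF K(1) sm K(3)]])
qed

lemma test_function_scaled_mollifier:
 assumes "ep > 0" "cball (x - ep *\<^sub>R e) ep \<subseteq> U"
 shows "test_function U (%y. scaled_mollifier e ep (x - y))"
 unfolding test_function_def
proof (intro conjI exI[of _ "cball (x - ep *\<^sub>R e) ep"] allI impI)
 fix y assume "y \<notin> cball (x - ep *\<^sub>R e) ep"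
 then have "norm ((x - y) - ep *\<^sub>R e) \<ge> ep" by (simp add: dist_norm algebra_simps)
 then show "scaled_mollifier e ep (x - y) = 0" by (rule scaled_mollifier_eq_0[OF assms(1)])
qed (use assms(2) smooth_reflect[OF smooth_scaled_mollifier] in auto)

lemma fundamental_lemma:
 fixes g :: "real^'n => real"
 assumes U: "open U" and g: "locally_integrable U g"
  and zero: "!!ph. test_function U ph ==> (LINT x|lebesgue_on U. g x * ph x) = 0"
 shows "AE x in lebesgue_on U. g x = 0"
proof -
 have ball: "AE x in lebesgue. x \<in> ball p r --> g x = 0" if r: "r > 0" "cball p (2 * r) \<subseteq> U" for p r
 proof -
  let ?K = "cball p (2 * r)"
  have K: "?K \<in> sets lebesgue" "U \<in> sets lebesgue" "?K \<in> sets borel" using U by auto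
  have int: "integrable (lebesgue_on ?K) g" using g r by (auto simp: locally_integrable_def)
  obtain w where w: "w \<in> borel_measurable borel" "AE x in lebesgue_on ?K. g x = w x" "!!x. x \<notin> ?K ==> w x = 0"
   using borel_representative[OF borel_measurable_integrable[OF int] K(3)] by blast
  have "integrable (lebesgue_on ?K) w"
   using int w(1,2) by (subst integrable_cong_AE[of _ _ g]) (auto intro!: measurable_restrict_space1 measurable_completion)
  then have wi: "integrable lborel w" using lebesgue_on_zero_outside(1)[OF w(1) K(3) w(3)] by simp
  have m0: "mollify 0 ep w x = 0" if ep: "ep > 0" "ep <= r" and x: "x \<in> cball p r" for ep x
  proof -
   let ?ph = "%y. scaled_mollifier 0 ep (x - y)"
   have "cball x ep \<subseteq> ?K"
   proof
    fix y assume "y \<in> cball x ep"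
    then show "y \<in> ?K" using ep x dist_triangle[of p y x] by simp
   qed
   then have t: "test_function ?K ?ph" using test_function_scaled_mollifier[OF ep(1), of x 0 ?K] by simp
   then obtain L where L: "L \<subseteq> ?K" "!!y. y \<notin> L ==> ?ph y = 0" by (auto simp: test_function_def)
   have tU: "test_function U ?ph" using t r(2) unfolding test_function_def by (meson order_trans)
   have "mollify 0 ep w x = (LINT y|lebesgue_on ?K. w y * ?ph y)"
    unfolding mollify_def using w(3) smooth_measurable[OF test_function_smooth[OF t]]
    by (intro lebesgue_on_zero_outside(2)[symmetric] borel_measurable_times[OF w(1)] K(3)) auto
   also have "... = (LINT y|lebesgue_on ?K. g y * ?ph y)"
   proof (rule integral_cong_AE)
    have m: "?ph \<in> borel_measurable (lebesgue_on ?K)" "w \<in> borel_measurable (lebesgue_on ?K)"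
     using smooth_measurable[OF test_function_smooth[OF t]] w(1)
     by (auto intro!: measurable_restrict_space1 measurable_completion)
    then show "(%y. w y * ?ph y) \<in> borel_measurable (lebesgue_on ?K)" by (intro borel_measurable_times)
    show "(%y. g y * ?ph y) \<in> borel_measurable (lebesgue_on ?K)" using int m by (intro borel_measurable_times) auto
    show "AE y in lebesgue_on ?K. w y * ?ph y = g y * ?ph y" using w(2) by eventually_elim simp
   qed
   also have "... = (LINT y|lebesgue_on U. g y * ?ph y)"
   proof (rule lebesgue_on_subset_zero(2)[OF K(1,2) r(2), symmetric])
    fix y assume "y \<in> U - ?K"
    then have "y \<notin> L" using L(1) by blast
    then show "g y * ?ph y = 0" using L(2)[of y] by simp
   qed
   also have "... = 0" by (rule zero[OF tU])
   finally show ?thesis .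
  qed
  define ep where "ep k = r / real (Suc k)" for k
  have "(%k. r * (1 / real (Suc k))) ----> r * 0"
   by (intro tendsto_mult_left LIMSEQ_Suc[OF lim_1_over_n])
  then have ep: "ep k > 0" "ep k <= r" "ep ----> 0" for k
   using r by (auto simp: ep_def[abs_def] divide_simps)
  let ?I = "\<integral>\<^sup>+x. ennreal \<bar>w x\<bar> * indicator (cball p r) x \<partial>lborel"
  have "?I <= (\<integral>\<^sup>+x. ennreal \<bar>mollify 0 (ep k) w x - w x\<bar> \<partial>lborel)" for k
   using m0[OF ep(1,2)] by (intro nn_integral_mono) (auto simp: indicator_def)
  then have "?I <= 0" using LIMSEQ_le_const[OF mollify_L1[OF wi ep(1,3), of 0]] by blast
  then have "AE x in lborel. ennreal \<bar>w x\<bar> * indicator (cball p r) x = 0"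
   using w(1) by (subst (asm) le_zero_eq, subst (asm) nn_integral_0_iff_AE) (auto intro!: borel_measurable_times_ennreal borel_measurable_indicator)
  then have "AE x in lebesgue. x \<in> cball p r --> w x = 0"
   by (rule AE_completion[THEN AE_mp]) (auto simp: indicator_def intro!: AE_I2)
  moreover have "AE x in lebesgue. x \<in> ?K --> g x = w x" using w(2) K(1) by (simp add: AE_lebesgue_on_iff)
  ultimately show ?thesis
   by eventually_elim (use r(1) in \<open>auto\<close>)
 qed
 let ?F = "{ball p r | p r. r > 0 \<and> cball p (2 * r) \<subseteq> U}"
 obtain F where F: "F \<subseteq> ?F" "countable F" "\<Union>F = \<Union>?F"
  by (rule Lindelof[of ?F]) (auto simp: that)
 have "U \<subseteq> \<Union>?F"
 proof
  fix x assume "x \<in> U"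
  then obtain s where "s > 0" "cball x s \<subseteq> U" using U open_contains_cball by blast
  then show "x \<in> \<Union>?F" by (intro UnionI[of "ball x (s / 2)"]) (auto intro!: exI[of _ x] exI[of _ "s / 2"])
 qed
 then have "U \<subseteq> \<Union>F" using F(3) by simp
 moreover have "AE x in lebesgue. \<forall>B\<in>F. x \<in> B --> g x = 0"
  unfolding AE_ball_countable[OF F(2)] using F(1) ball by blast
 ultimately have "AE x in lebesgue. x \<in> U --> g x = 0"
  by (auto elim!: eventually_mono)
 then show ?thesis using U by (simp add: AE_lebesgue_on_iff)
qed

lemma locally_integrable_lincomb:
 assumes "locally_integrable U f" "locally_integrable U g"
 shows "locally_integrable U (%x. a * f x + b * g x)"
 using assms by (auto simp: locally_integrable_def)

lemma has_weak_grad_lincomb: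
 fixes u v :: "real^'n => real"
 assumes U: "open U" and u: "has_weak_grad U u g" and v: "has_weak_grad U v h"
 shows "has_weak_grad U (%x. a * u x + b * v x) (%x. a *\<^sub>R g x + b *\<^sub>R h x)"
 unfolding has_weak_grad_def
proof (intro conjI allI impI)
 show "locally_integrable U (%x. a * u x + b * v x)" "locally_integrable U (%x. (a *\<^sub>R g x + b *\<^sub>R h x) $ i)" for i
  using u v by (auto simp: has_weak_grad_def intro!: locally_integrable_lincomb)
 fix ph i assume ph: "test_function U ph"
 have int: "integrable (lebesgue_on U) (%x. u x * partial i ph x)" "integrable (lebesgue_on U) (%x. v x * partial i ph x)"
  "integrable (lebesgue_on U) (%x. g x $ i * ph x)" "integrable (lebesgue_on U) (%x. h x $ i * ph x)"
  using u v test_function_integrable[OF _ U ph] by (auto simp: has_weak_grad_def)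
 have "(LINT x|lebesgue_on U. (a * u x + b * v x) * partial i ph x) =
   a * (LINT x|lebesgue_on U. u x * partial i ph x) + b * (LINT x|lebesgue_on U. v x * partial i ph x)"
  using int by (simp add: distrib_right mult.assoc)
 also have "... = - (a * (LINT x|lebesgue_on U. g x $ i * ph x) + b * (LINT x|lebesgue_on U. h x $ i * ph x))"
  using u v ph by (simp add: has_weak_grad_def)
 also have "... = - (LINT x|lebesgue_on U. (a *\<^sub>R g x + b *\<^sub>R h x) $ i * ph x)"
  using int by (simp add: distrib_right mult.assoc)
 finally show "(LINT x|lebesgue_on U. (a * u x + b * v x) * partial i ph x) =
   - (LINT x|lebesgue_on U. (a *\<^sub>R g x + b *\<^sub>R h x) $ i * ph x)" .
qed

lemma has_weak_grad_unique:
 fixes v :: "real^'n => real"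
 assumes U: "open U" and g: "has_weak_grad U v g" and h: "has_weak_grad U v h"
 shows "AE x in lebesgue_on U. g x = h x"
proof -
 have d: "has_weak_grad U (%x. 1 * v x + (-1) * v x) (%x. 1 *\<^sub>R g x + (-1) *\<^sub>R h x)"
  by (rule has_weak_grad_lincomb[OF U g h])
 have "AE x in lebesgue_on U. g x $ i - h x $ i = 0" for i
 proof (rule fundamental_lemma[OF U])
  show "locally_integrable U (%x. g x $ i - h x $ i)" using d by (simp add: has_weak_grad_def)
  show "(LINT x|lebesgue_on U. (g x $ i - h x $ i) * ph x) = 0" if "test_function U ph" for ph
   using d that by (simp add: has_weak_grad_def)
 qed
 then have "AE x in lebesgue_on U. \<forall>i. g x $ i - h x $ i = 0" using AE_finite_allI[where S="UNIV :: 'n set" and M="lebesgue_on U" and Q="%i x. g x $ i - h x $ i = 0"] by simp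
 then show ?thesis by eventually_elim (simp add: vec_eq_iff)
qed

lemma weak_grad_eq_AE:
 assumes "open U" "has_weak_grad U v g"
 shows "AE x in lebesgue_on U. weak_grad U v x = g x"
 by (rule has_weak_grad_unique[OF assms(1) _ assms(2)])
  (auto simp: weak_grad_def intro: someI[of "has_weak_grad U v", OF assms(2)])

lemma has_weak_grad_mult:
 fixes v rh :: "real^'n => real"
 assumes U: "open U" and v: "has_weak_grad U v g" and rh: "smooth rh"
  and loc: "!!i. locally_integrable U (%x. rh x * g x $ i + v x * partial i rh x)" "locally_integrable U (%x. rh x * v x)"
 shows "has_weak_grad U (%x. rh x * v x) (%x. rh x *\<^sub>R g x + v x *\<^sub>R grad rh x)"
 unfolding has_weak_grad_def
proof (intro conjI allI impI)
 show "locally_integrable U (%x. (rh x *\<^sub>R g x + v x *\<^sub>R grad rh x) $ i)" for i using loc(1) by simp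
 fix ph i assume ph: "test_function U ph"
 have sm: "smooth ph" using ph by (rule test_function_smooth)
 have t: "test_function U (%x. rh x * ph x)" "test_function U (%x. partial i rh x * ph x)"
  using ph rh by (auto intro: test_function_mult smooth_partialI)
 have vl: "locally_integrable U v" "locally_integrable U (%x. g x $ i)" using v by (auto simp: has_weak_grad_def)
 note ints = test_function_integrable(2)[OF vl(1) U t(1), of i] test_function_integrable(1)[OF vl(1) U t(2)]
  test_function_integrable(1)[OF vl(2) U t(1)]
 have "(LINT x|lebesgue_on U. (rh x * v x) * partial i ph x) =
   (LINT x|lebesgue_on U. v x * partial i (%x. rh x * ph x) x - v x * (partial i rh x * ph x))"
  by (intro Bochner_Integration.integral_cong refl) (simp only: partial_mult[OF rh sm], simp add: algebra_simps)
 also have "... = - (LINT x|lebesgue_on U. g x $ i * (rh x * ph x)) - (LINT x|lebesgue_on U. v x * (partial i rh x * ph x))"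
  using ints v t(1) by (simp add: has_weak_grad_def)
 also have "... = - (LINT x|lebesgue_on U. g x $ i * (rh x * ph x) + v x * (partial i rh x * ph x))"
  using ints by simp
 finally show "(LINT x|lebesgue_on U. (rh x * v x) * partial i ph x) =
   - (LINT x|lebesgue_on U. (rh x *\<^sub>R g x + v x *\<^sub>R grad rh x) $ i * ph x)"
  by (simp add: algebra_simps)
qed (rule loc(2))

section \<open>Sobolev functions on the domain\<close>

context lipschitz_polyhedron
begin

abbreviation "vol \<equiv> lebesgue_on Om"

lemma Om_sets: "Om \<in> sets lebesgue" "Om \<in> lmeasurable"
 using open_Om bounded_Om by (auto simp: lmeasurable_open)

lemma finite_vol: "finite_measure vol"
 by (rule finite_measure_lebesgue_on[OF Om_sets(2)])

lemma measurable_vol: "f \<in> borel_measurable borel ==> f \<in> borel_measurable vol"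
 by (intro measurable_restrict_space1 measurable_completion) simp

lemma measurable_vol_cong_AE:
 fixes f g :: "real^'n => real"
 assumes "f \<in> borel_measurable vol" "AE x in vol. f x = g x"
 shows "g \<in> borel_measurable vol"
proof -
 have "(%x. if x \<in> Om then g x else 0) \<in> borel_measurable lebesgue"
  by (rule borel_measurable_AE[OF borel_measurable_if_I[OF assms(1) Om_sets(1)]])
   (use assms(2) in \<open>auto simp: AE_lebesgue_on_iff[OF Om_sets(1)] elim!: eventually_mono\<close>)
 then show ?thesis by (rule borel_measurable_if_D)
qed

lemma AE_vol_in: "AE x in vol. x \<in> Om"
 by (rule AE_I2) simp

lemma continuous_bounded_closure:
 fixes f :: "real^'n => real"
 assumes "continuous_on UNIV f"
 obtains C where "C > 0" "!!x. x \<in> closure Om ==> \<bar>f x\<bar> <= C"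
proof -
 obtain R where R: "closure Om \<subseteq> cball 0 R" by (rule Om_in_cball)
 obtain C where "C > 0" "!!x. x \<in> cball 0 R ==> \<bar>f x\<bar> <= C"
  using bounded_on_cball[OF assms] by blast
 with R that show thesis by blast
qed

lemma in_closure: "x \<in> Om ==> x \<in> closure Om" "x \<in> Bd ==> x \<in> closure Om"
 using closure_subset[of Om] by (auto simp: frontier_def)

lemma continuous_L2:
 fixes f :: "real^'n => real"
 assumes f: "continuous_on UNIV f"
 shows "f \<in> L2 vol" "f \<in> L2 sg"
  and continuous_integrable: "integrable vol f" "integrable sg f"
proof -
 interpret V: finite_measure vol by (rule finite_vol)
 interpret S: finite_measure sg by (rule finite_surface)
 obtain C where C: "!!x. x \<in> closure Om ==> \<bar>f x\<bar> <= C" using continuous_bounded_closure[OF f] by blast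
 have m: "f \<in> borel_measurable borel" using f by (rule borel_measurable_continuous_onI)
 show v: "f \<in> L2 vol"
  by (rule V.L2_bounded[OF measurable_vol[OF m], of C]) (use C in_closure in \<open>auto intro!: AE_I2\<close>)
 show s: "f \<in> L2 sg"
 proof (rule S.L2_bounded[of _ C])
  show "AE x in sg. \<bar>f x\<bar> <= C" using AE_surface by eventually_elim (use C in_closure in auto)
 qed (use m in simp)
 show "integrable vol f" "integrable sg f" using V.L2_integrable[OF v] S.L2_integrable[OF s] .
qed

lemma L2_bounded_closure_mult:
 assumes f: "continuous_on UNIV f" and g: "g \<in> L2 vol"
 shows "(%x. f x * g x) \<in> L2 vol"
proof -
 obtain C where C: "!!x. x \<in> closure Om ==> \<bar>f x\<bar> <= C" using continuous_bounded_closure[OF f] by blast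
 show ?thesis
  by (rule L2_bounded_mult[OF g measurable_vol[OF borel_measurable_continuous_onI[OF f]], of C])
   (use C in_closure in \<open>auto intro!: AE_I2\<close>)
qed

lemma L2_lim_closure_mult:
 assumes f: "continuous_on UNIV f" and g: "L2_lim vol g g'"
 shows "L2_lim vol (%k x. f x * g k x) (%x. f x * g' x)"
proof -
 obtain C where C: "!!x. x \<in> closure Om ==> \<bar>f x\<bar> <= C" using continuous_bounded_closure[OF f] by blast
 show ?thesis
  by (rule L2_lim_bounded_mult[OF g measurable_vol[OF borel_measurable_continuous_onI[OF f]], of C])
   (use C in_closure in \<open>auto intro!: AE_I2\<close>)
qed

lemma L2_locally_integrable:
 assumes "f \<in> L2 vol"
 shows "locally_integrable Om f"
 unfolding locally_integrable_def
proof (intro allI impI)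
 fix K assume K: "compact K \<and> K \<subseteq> Om"
 interpret finite_measure vol by (rule finite_vol)
 have Ks: "K \<in> sets lebesgue" using K by (simp add: lmeasurable_compact fmeasurableD)
 have "integrable lebesgue (%x. indicator K x *\<^sub>R (if x \<in> Om then f x else 0))"
  using L2_integrable[OF assms] Ks
  by (intro integrable_mult_indicator) (simp_all add: Lebesgue_Measure.integrable_restrict_UNIV[OF Om_sets(1)])
 moreover have "(%x. indicator K x *\<^sub>R (if x \<in> Om then f x else 0)) = (%x. if x \<in> K then f x else 0)"
  using K by (auto simp: indicator_def fun_eq_iff)
 ultimately show "integrable (lebesgue_on K) f"
  by (simp add: Lebesgue_Measure.integrable_restrict_UNIV[OF Ks])
qed

abbreviation "wgrad \<equiv> weak_grad Om"

lemma H1D: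
 assumes "v \<in> H1 Om"
 shows H1_L2: "v \<in> L2 vol" and H1_weak_grad: "has_weak_grad Om v (wgrad v)"
  and H1_grad_L2: "(%x. wgrad v x $ i) \<in> L2 vol"
proof -
 obtain g where g: "v \<in> L2 vol" "has_weak_grad Om v g" "!!i. (%x. g x $ i) \<in> L2 vol"
  using assms by (auto simp: H1_def)
 show "v \<in> L2 vol" by (rule g)
 show "has_weak_grad Om v (wgrad v)" unfolding weak_grad_def by (rule someI[of "has_weak_grad Om v", OF g(2)])
 have "AE x in vol. g x $ i = wgrad v x $ i"
  using weak_grad_eq_AE[OF open_Om g(2)] by eventually_elim simp
 then show "(%x. wgrad v x $ i) \<in> L2 vol"
  by (intro L2_cong_AE[OF g(3)] measurable_vol_cong_AE[OF L2_measurable[OF g(3)]])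
qed

lemma H1I:
 assumes "v \<in> L2 vol" "has_weak_grad Om v g" "!!i. (%x. g x $ i) \<in> L2 vol"
 shows "v \<in> H1 Om" "AE x in vol. wgrad v x = g x"
 using assms weak_grad_eq_AE[OF open_Om assms(2)] by (auto simp: H1_def)

lemma has_weak_grad_smooth:
 assumes ph: "smooth ph"
 shows "has_weak_grad Om ph (grad ph)"
 unfolding has_weak_grad_def
proof (intro conjI allI impI)
 show "locally_integrable Om ph" "locally_integrable Om (%x. grad ph x $ i)" for i
  using ph by (auto intro!: L2_locally_integrable continuous_L2 smooth_continuous_on smooth_partialI)
 fix ps i assume ps: "test_function Om ps"
 then have sm: "smooth ps" by (rule test_function_smooth)
 have c: "continuous_on UNIV ph" "continuous_on UNIV ps" "continuous_on UNIV (partial i ph)" "continuous_on UNIV (partial i ps)"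
  using ph sm by (auto intro: smooth_continuous_on smooth_partialI)
 have "(LINT x|vol. (ph x * (grad ps x \<bullet> axis i 1) + (grad ph x \<bullet> axis i 1) * ps x)) =
   (LINT y|sg. ph y * ps y * (normal y \<bullet> axis i 1))"
  by (rule divergence_theorem[OF has_derivative_mult[OF smooth_has_derivative_grad[OF ph] smooth_has_derivative_grad[OF sm]]])
   (use c in \<open>auto simp: inner_axis intro!: continuous_intros\<close>)
 also have "... = (LINT y|sg. 0)"
 proof (rule integral_cong_AE)
  show "AE y in sg. ph y * ps y * (normal y \<bullet> axis i 1) = 0"
   using AE_surface
  proof eventually_elim
   case (elim y)
   then show ?case using ps Bd_disjoint[OF elim] by (auto simp: test_function_def)
  qed
 qed (use c[THEN borel_measurable_continuous_onI] in simp_all)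
 finally have "(LINT x|vol. ph x * partial i ps x) + (LINT x|vol. partial i ph x * ps x) = 0"
  using c by (subst (asm) Bochner_Integration.integral_add)
   (auto simp: inner_axis intro!: continuous_integrable continuous_intros)
 then show "(LINT x|vol. ph x * partial i ps x) = - (LINT x|vol. grad ph x $ i * ps x)" by simp
qed

lemma smooth_H1:
 assumes "smooth ph"
 shows "ph \<in> H1 Om" "AE x in vol. wgrad ph x = grad ph x"
 using H1I[OF continuous_L2(1)[OF smooth_continuous_on] has_weak_grad_smooth, of ph] assms
 by (auto intro: continuous_L2 smooth_continuous_on smooth_partialI)

lemma H1_lincomb:
 assumes u: "u \<in> H1 Om" and v: "v \<in> H1 Om"
 shows "(%x. a * u x + b * v x) \<in> H1 Om"
  and "AE x in vol. wgrad (%x. a * u x + b * v x) x = a *\<^sub>R wgrad u x + b *\<^sub>R wgrad v x"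
proof -
 have *: "has_weak_grad Om (%x. a * u x + b * v x) (%x. a *\<^sub>R wgrad u x + b *\<^sub>R wgrad v x)"
  by (intro has_weak_grad_lincomb open_Om H1_weak_grad u v)
 show "(%x. a * u x + b * v x) \<in> H1 Om"
  "AE x in vol. wgrad (%x. a * u x + b * v x) x = a *\<^sub>R wgrad u x + b *\<^sub>R wgrad v x"
  using H1I[OF L2_lincomb[OF H1_L2[OF u] H1_L2[OF v]] *] L2_lincomb[OF H1_grad_L2[OF u] H1_grad_L2[OF v]] by auto
qed

lemma H1_diff:
 assumes "u \<in> H1 Om" "v \<in> H1 Om"
 shows "(%x. u x - v x) \<in> H1 Om" "AE x in vol. wgrad (%x. u x - v x) x = wgrad u x - wgrad v x"
 using H1_lincomb[OF assms, of 1 "-1"] by simp_all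

lemma H1_norm_sq:
 assumes "v \<in> H1 Om" "AE x in vol. wgrad v x = g x" "!!i. (%x. g x $ i) \<in> L2 vol"
 shows "(H1_norm Om v)^2 = (LINT x|vol. (v x)^2) + (\<Sum>i\<in>UNIV. LINT x|vol. (g x $ i)^2)"
proof -
 have nsq: "(norm (z :: real^'n))^2 = (\<Sum>i\<in>UNIV. (z $ i)^2)" for z
  unfolding power2_norm_eq_inner inner_vec_def by (simp add: power2_eq_square)
 have "(LINT x|vol. (norm (wgrad v x))^2) = (LINT x|vol. (\<Sum>i\<in>UNIV. (g x $ i)^2))"
  unfolding nsq using assms(2)
  by (intro integral_cong_AE borel_measurable_sum borel_measurable_power L2_measurable H1_grad_L2 assms(1,3))
   (auto elim!: eventually_mono)
 also have "... = (\<Sum>i\<in>UNIV. LINT x|vol. (g x $ i)^2)"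
  by (rule Bochner_Integration.integral_sum) (rule L2_square[OF assms(3)])
 finally show ?thesis by (simp add: H1_norm_def sum_nonneg)
qed

lemma H1_norm_nonneg: "H1_norm Om v \<ge> 0"
 by (simp add: H1_norm_def)

definition H1_lim :: "(nat => real^'n => real) => (real^'n => real) => bool" where
 "H1_lim u v \<longleftrightarrow> (\<forall>k. u k \<in> H1 Om) \<and> v \<in> H1 Om \<and> (%k. H1_norm Om (%x. u k x - v x)) ----> 0"

lemma H1_norm_diff_sq:
 assumes "u \<in> H1 Om" "v \<in> H1 Om"
 shows "(H1_norm Om (%x. u x - v x))^2 =
  (LINT x|vol. (u x - v x)^2) + (\<Sum>i\<in>UNIV. LINT x|vol. (wgrad u x $ i - wgrad v x $ i)^2)"
 using H1_norm_sq[OF H1_diff[OF assms]] L2_diff[OF H1_grad_L2[OF assms(1)] H1_grad_L2[OF assms(2)]] by simp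

lemma H1_limD:
 assumes "H1_lim u v"
 shows "u k \<in> H1 Om" "v \<in> H1 Om" "L2_lim vol u v" "L2_lim vol (%k x. wgrad (u k) x $ i) (%x. wgrad v x $ i)"
proof -
 show u: "u k \<in> H1 Om" and v: "v \<in> H1 Om" for k using assms by (auto simp: H1_lim_def)
 have lim: "(%k. (H1_norm Om (%x. u k x - v x))^2) ----> 0"
  using tendsto_power[of _ 0 sequentially 2] assms by (simp add: H1_lim_def)
 have le: "(LINT x|vol. (u k x - v x)^2) <= (H1_norm Om (%x. u k x - v x))^2"
  "(LINT x|vol. (wgrad (u k) x $ i - wgrad v x $ i)^2) <= (H1_norm Om (%x. u k x - v x))^2" for k
 proof -
  have "0 <= (LINT x|vol. (u k x - v x)^2)" by simp
  moreover have "(LINT x|vol. (wgrad (u k) x $ i - wgrad v x $ i)^2) <=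
    (\<Sum>i\<in>UNIV. LINT x|vol. (wgrad (u k) x $ i - wgrad v x $ i)^2)"
   by (rule member_le_sum) auto
  moreover have "0 <= (\<Sum>i\<in>UNIV. LINT x|vol. (wgrad (u k) x $ i - wgrad v x $ i)^2)" by (rule sum_nonneg) simp
  ultimately show "(LINT x|vol. (u k x - v x)^2) <= (H1_norm Om (%x. u k x - v x))^2"
   "(LINT x|vol. (wgrad (u k) x $ i - wgrad v x $ i)^2) <= (H1_norm Om (%x. u k x - v x))^2"
   unfolding H1_norm_diff_sq[OF u v] by linarith+
 qed
 show "L2_lim vol u v" "L2_lim vol (%k x. wgrad (u k) x $ i) (%x. wgrad v x $ i)"
  unfolding L2_lim_def using LIMSEQ_squeeze_0[OF lim _ le(1)] LIMSEQ_squeeze_0[OF lim _ le(2)] u v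
  by (auto intro: H1_L2 H1_grad_L2)
qed

lemma H1_limI:
 assumes "!!k. u k \<in> H1 Om" "v \<in> H1 Om" "L2_lim vol u v"
  and "!!i. L2_lim vol (%k x. wgrad (u k) x $ i) (%x. wgrad v x $ i)"
 shows "H1_lim u v"
proof -
 have "(%k. (H1_norm Om (%x. u k x - v x))^2) ----> 0 + (\<Sum>i\<in>(UNIV :: 'n set). 0)"
  unfolding H1_norm_diff_sq[OF assms(1,2)]
  using assms(3,4) by (intro tendsto_add tendsto_sum) (auto simp: L2_lim_def)
 then have "(%k. sqrt ((H1_norm Om (%x. u k x - v x))^2)) ----> sqrt 0"
  by (intro tendsto_real_sqrt) simp
 then show ?thesis using assms(1,2) by (simp add: H1_lim_def H1_norm_nonneg)
qed

lemma L2_lim_cong_AE: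
 assumes "L2_lim M f f'" "!!k. AE x in M. f k x = g k x" "AE x in M. f' x = g' x"
  and "!!k. g k \<in> borel_measurable M" "g' \<in> borel_measurable M"
 shows "L2_lim M g g'"
proof -
 have "(LINT x|M. (f k x - f' x)^2) = (LINT x|M. (g k x - g' x)^2)" for k
 proof (rule integral_cong_AE)
  show "AE x in M. (f k x - f' x)^2 = (g k x - g' x)^2" using assms(2)[of k] assms(3) by eventually_elim simp
 qed (use assms(4,5) L2_measurable[OF L2_limD(1)[OF assms(1)]] L2_measurable[OF L2_limD(2)[OF assms(1)]]
   in \<open>auto intro!: borel_measurable_power borel_measurable_diff\<close>)
 moreover have "g k \<in> L2 M" for k using L2_limD(1)[OF assms(1)] assms(4,2) by (rule L2_cong_AE)
 moreover have "g' \<in> L2 M" using L2_limD(2)[OF assms(1)] assms(5,3) by (rule L2_cong_AE)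
 ultimately show ?thesis using assms(1) by (simp add: L2_lim_def)
qed

lemma H1_lim_smoothI:
 assumes u: "!!k. smooth (u k)" and v: "v \<in> H1 Om" and "L2_lim vol u v"
  and g: "!!i. L2_lim vol (%k x. partial i (u k) x) (%x. wgrad v x $ i)"
 shows "H1_lim u v"
proof (rule H1_limI)
 fix i
 show "L2_lim vol (%k x. wgrad (u k) x $ i) (%x. wgrad v x $ i)"
 proof (rule L2_lim_cong_AE[OF g])
  show "AE x in vol. partial i (u k) x = wgrad (u k) x $ i" for k
   using smooth_H1(2)[OF u[of k]] by eventually_elim simp
 qed (use H1_grad_L2[OF smooth_H1(1)[OF u]] H1_grad_L2[OF v] in \<open>auto simp: L2_def\<close>)
qed (use assms smooth_H1 in auto)

lemma H1_lim_smoothD: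
 assumes u: "!!k. smooth (u k)" and l: "H1_lim u v"
 shows "L2_lim vol (%k x. partial i (u k) x) (%x. wgrad v x $ i)"
proof (rule L2_lim_cong_AE[OF H1_limD(4)[OF l, of i]])
 show "AE x in vol. wgrad (u k) x $ i = partial i (u k) x" for k
  using smooth_H1(2)[OF u[of k]] by eventually_elim simp
 show "partial i (u k) \<in> borel_measurable vol" for k
  by (rule measurable_vol[OF smooth_measurable[OF smooth_partialI[OF u]]])
qed (use H1_grad_L2[OF H1_limD(2)[OF l]] in \<open>auto simp: L2_def\<close>)

lemma H1_lim_lincomb:
 assumes "H1_lim u u'" "H1_lim v v'"
 shows "H1_lim (%k x. a * u k x + b * v k x) (%x. a * u' x + b * v' x)"
proof (rule H1_limI)
 note D = H1_limD[OF assms(1)] H1_limD[OF assms(2)]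
 show "L2_lim vol (%k x. a * u k x + b * v k x) (%x. a * u' x + b * v' x)"
  by (intro L2_lim_add L2_lim_scale D)
 show "(%x. a * u k x + b * v k x) \<in> H1 Om" "(%x. a * u' x + b * v' x) \<in> H1 Om" for k
  by (intro H1_lincomb D)+
 fix i
 show "L2_lim vol (%k x. wgrad (%x. a * u k x + b * v k x) x $ i) (%x. wgrad (%x. a * u' x + b * v' x) x $ i)"
 proof (rule L2_lim_cong_AE)
  show "L2_lim vol (%k x. a * (wgrad (u k) x $ i) + b * (wgrad (v k) x $ i)) (%x. a * (wgrad u' x $ i) + b * (wgrad v' x $ i))"
   by (intro L2_lim_add L2_lim_scale D)
  show "AE x in vol. a * (wgrad (u k) x $ i) + b * (wgrad (v k) x $ i) = wgrad (%x. a * u k x + b * v k x) x $ i" for k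
   using H1_lincomb(2)[OF D(1) D(5), of a k b k] by eventually_elim simp
  show "AE x in vol. a * (wgrad u' x $ i) + b * (wgrad v' x $ i) = wgrad (%x. a * u' x + b * v' x) x $ i"
   using H1_lincomb(2)[OF D(2) D(6), of a b] by eventually_elim simp
 qed (use H1_grad_L2[OF H1_lincomb(1)[OF D(1) D(5)]] H1_grad_L2[OF H1_lincomb(1)[OF D(2) D(6)]] in \<open>auto simp: L2_def\<close>)
qed

end

context lipschitz_polyhedron
begin

lemma boundary_direction:
 assumes "p \<in> Bd"
 obtains e r c where "r > 0" "c > 0" "!!y. y \<in> ball p r ==> is_outward_normal Om y (normal y) ==> normal y \<bullet> e \<ge> c"
proof -
 obtain e r g L where e: "norm e = 1" "r > 0" "L-lipschitz_on UNIV g"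
  "!!z. z \<in> ball p r ==> z \<in> Om \<longleftrightarrow> z \<bullet> e < (g (z - (z \<bullet> e) *\<^sub>R e) :: real)"
  using lipschitz_Om assms unfolding lipschitz_boundary_def by metis
 have "L \<ge> 0" using e(3) by (rule lipschitz_on_nonneg)
 then have "1 / (2 * (1 + L)) > 0" by simp
 with that[of r "1 / (2 * (1 + L))" e] normal_transversal[OF e(1,3,4)] e(2) show thesis by blast
qed

lemma transversal_field:
 obtains X :: "'n => real^'n => real" and c where "!!j. smooth (X j)" "c > 0"
  "AE y in sg. (\<Sum>j\<in>UNIV. X j y * normal y $ j) \<ge> c"
proof -
 have "\<forall>p\<in>Bd. \<exists>e r c. r > 0 \<and> c > 0 \<and> (\<forall>y\<in>ball p r. is_outward_normal Om y (normal y) --> normal y \<bullet> e \<ge> c)"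
  using boundary_direction by metis
 then obtain E r c where P: "!!p. p \<in> Bd ==> r p > 0" "!!p. p \<in> Bd ==> (c p :: real) > 0"
  "!!p y. p \<in> Bd ==> y \<in> ball p (r p) ==> is_outward_normal Om y (normal y) ==> normal y \<bullet> E p \<ge> c p"
  by metis
 have "Bd \<subseteq> (\<Union>p\<in>Bd. ball p (r p))" using P(1) by force
 then obtain D where D: "D \<subseteq> Bd" "finite D" "Bd \<subseteq> (\<Union>p\<in>D. ball p (r p))"
  using compactE_image[OF compact_Bd, of Bd "%p. ball p (r p)"] by (metis open_ball)
 let ?f = "%y. \<Sum>p\<in>D. c p * bump p (r p) y"
 have cf: "continuous_on UNIV ?f"
  by (intro smooth_continuous_on smooth_sum smooth_mult smooth_const smooth_bump)
 have pos: "?f y > 0" if "y \<in> Bd" for y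
 proof -
  from subsetD[OF D(3) that] obtain p where p: "p \<in> D" "y \<in> ball p (r p)" by blast
  then have "p \<in> Bd" using D(1) by blast
  then have "c p * bump p (r p) y > 0" using P(1,2) p(2) bump_pos_iff[of "r p" p y] by simp
  moreover have "c p * bump p (r p) y <= ?f y"
   using p(1) D(1,2) P(2) bump_nonneg by (intro member_le_sum mult_nonneg_nonneg) (auto simp: subset_iff intro: less_imp_le)
  ultimately show ?thesis by linarith
 qed
 obtain m where m: "m > 0" "!!y. y \<in> Bd ==> ?f y \<ge> m"
 proof (cases "Bd = {}")
  case True then show thesis using that[of 1] by simp
 next
  case False
  obtain y0 where "y0 \<in> Bd" "\<forall>y\<in>Bd. ?f y0 <= ?f y"
   using continuous_attains_inf[OF compact_Bd False continuous_on_subset[OF cf]] by auto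
  then show thesis using that[of "?f y0"] pos by blast
 qed
 show thesis
 proof (rule that[of "%j y. \<Sum>p\<in>D. E p $ j * bump p (r p) y" m])
  show "smooth (%y. \<Sum>p\<in>D. E p $ j * bump p (r p) y)" for j
   by (intro smooth_sum smooth_mult smooth_const smooth_bump)
  show "AE y in sg. (\<Sum>j\<in>UNIV. (\<Sum>p\<in>D. E p $ j * bump p (r p) y) * normal y $ j) \<ge> m"
   using AE_surface AE_normal
  proof eventually_elim
   case (elim y)
   have "m <= ?f y" using m(2) elim(1) by blast
   also have "... <= (\<Sum>p\<in>D. (normal y \<bullet> E p) * bump p (r p) y)"
   proof (rule sum_mono)
    fix p assume "p \<in> D"
    then have "p \<in> Bd" using D(1) by blast
    show "c p * bump p (r p) y <= (normal y \<bullet> E p) * bump p (r p) y"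
    proof (cases "y \<in> ball p (r p)")
     case True
     then show ?thesis using P(3)[OF \<open>p \<in> Bd\<close> True] elim(2) bump_nonneg by (intro mult_right_mono) auto
    qed (simp add: bump_eq_0[OF P(1)[OF \<open>p \<in> Bd\<close>]])
   qed
   also have "... = (\<Sum>p\<in>D. \<Sum>j\<in>UNIV. E p $ j * bump p (r p) y * normal y $ j)"
    by (simp add: inner_vec_def sum_distrib_right sum_distrib_left mult_ac)
   also have "... = (\<Sum>j\<in>UNIV. (\<Sum>p\<in>D. E p $ j * bump p (r p) y) * normal y $ j)"
    by (subst sum.swap) (simp add: sum_distrib_right)
   finally show ?case .
  qed
 qed (rule m(1))
qed

lemma normal_bound: "\<bar>normal y $ j\<bar> <= 1"
 using component_le_norm_cart[of "normal y" j] norm_outward_normal_le[of Om y] by linarith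

lemma normal_nth_measurable [measurable]: "(%y. normal y $ j) \<in> borel_measurable borel"
 using borel_measurable_inner[OF normal_measurable borel_measurable_const[of "axis j 1"]] by (simp add: inner_axis)

lemma surface_integrable_normal:
 assumes "integrable sg f"
 shows "integrable sg (%y. f y * normal y $ j)"
proof (rule Bochner_Integration.integrable_bound[OF assms])
 show "AE y in sg. norm (f y * normal y $ j) <= norm (f y)"
  using normal_bound by (intro AE_I2) (simp add: abs_mult mult_left_le)
qed (use assms in measurable)

lemma divergence_product:
 assumes "smooth ph" "smooth ps"
 shows "(LINT x|vol. partial i ph x * ps x + ph x * partial i ps x) = (LINT y|sg. ph y * ps y * normal y $ i)"
proof -
 have c: "continuous_on UNIV ph" "continuous_on UNIV ps" "continuous_on UNIV (partial i ph)" "continuous_on UNIV (partial i ps)"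
  using assms by (auto intro: smooth_continuous_on smooth_partialI)
 have "(LINT x|vol. (ph x * (grad ps x \<bullet> axis i 1) + (grad ph x \<bullet> axis i 1) * ps x)) =
   (LINT y|sg. ph y * ps y * (normal y \<bullet> axis i 1))"
  by (rule divergence_theorem[OF has_derivative_mult[OF smooth_has_derivative_grad[OF assms(1)] smooth_has_derivative_grad[OF assms(2)]]])
   (use c in \<open>auto simp: inner_axis intro!: continuous_intros\<close>)
 then show ?thesis by (simp add: inner_axis add.commute)
qed

lemma trace_inequality_L1:
 obtains C where "C > 0" "!!ph. smooth ph ==> (!!x. ph x \<ge> 0) ==>
  (LINT y|sg. ph y) <= C * (LINT x|vol. ph x + norm (grad ph x))"
proof -
 let ?N = "%ph. LINT x|vol. ph x + norm (grad ph x)"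
 obtain X :: "'n => real^'n => real" and c :: real where X: "!!j. smooth (X j)" "c > 0"
  "AE y in sg. (\<Sum>j\<in>UNIV. X j y * normal y $ j) \<ge> c"
  by (rule transversal_field) (rule that)
 have cX: "continuous_on UNIV (X j)" "continuous_on UNIV (partial j (X j))" for j
  using X(1) by (auto intro: smooth_continuous_on smooth_partialI)
 have "\<exists>B. \<forall>j. \<forall>x\<in>closure Om. \<bar>X j x\<bar> <= B \<and> \<bar>partial j (X j) x\<bar> <= B"
 proof -
  have "\<forall>j. \<exists>B>0. \<forall>x\<in>closure Om. \<bar>X j x\<bar> <= B \<and> \<bar>partial j (X j) x\<bar> <= B"
  proof
   fix j
   obtain B1 B2 where "B1 > 0" "!!x. x \<in> closure Om ==> \<bar>X j x\<bar> <= B1" "B2 > 0" "!!x. x \<in> closure Om ==> \<bar>partial j (X j) x\<bar> <= B2"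
    using continuous_bounded_closure[OF cX(1)] continuous_bounded_closure[OF cX(2)] by metis
   then show "\<exists>B>0. \<forall>x\<in>closure Om. \<bar>X j x\<bar> <= B \<and> \<bar>partial j (X j) x\<bar> <= B"
    by (intro exI[of _ "max B1 B2"]) (auto simp: le_max_iff_disj)
  qed
  then obtain B where B: "!!j. B j > 0" "!!j x. x \<in> closure Om ==> \<bar>X j x\<bar> <= B j \<and> \<bar>partial j (X j) x\<bar> <= B j" by metis
  have "B j <= (\<Sum>j\<in>UNIV. B j)" for j using B(1) by (intro member_le_sum) (auto intro: less_imp_le)
  with B(2) show ?thesis by (meson order_trans)
 qed
 then obtain B where B: "!!j x. x \<in> closure Om ==> \<bar>X j x\<bar> <= B" "!!j x. x \<in> closure Om ==> \<bar>partial j (X j) x\<bar> <= B"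
  by blast
 define C where "C = CARD('n) * \<bar>B\<bar> / c + 1"
 have "(LINT y|sg. ph y) <= C * ?N ph" if ph: "smooth ph" "!!x. ph x \<ge> 0" for ph
 proof -
  have c: "continuous_on UNIV ph" "continuous_on UNIV (partial j ph)" "continuous_on UNIV (%x. norm (grad ph x))" for j
   using ph by (auto intro: smooth_continuous_on smooth_partialI continuous_on_norm continuous_on_grad)
  have I: "?N ph \<ge> 0" using ph(2) by (intro Bochner_Integration.integral_nonneg) simp
  have ip: "integrable vol (%x. partial j ph x * X j x + ph x * partial j (X j) x)" for j
   by (intro continuous_integrable(1) continuous_intros c cX)
  have iS: "integrable sg (%y. ph y * X j y * normal y $ j)" for j
   by (intro surface_integrable_normal continuous_integrable(2) continuous_intros c cX)
  have "c * (LINT y|sg. ph y) = (LINT y|sg. c * ph y)" by simp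
  also have "... <= (LINT y|sg. (\<Sum>j\<in>UNIV. ph y * X j y * normal y $ j))"
  proof (rule integral_mono_AE)
   show "AE y in sg. c * ph y <= (\<Sum>j\<in>UNIV. ph y * X j y * normal y $ j)"
    using X(3)
   proof eventually_elim
    case (elim y)
    from mult_right_mono[OF this ph(2)[of y]] show ?case
     by (simp add: sum_distrib_left mult_ac)
   qed
  qed (use iS c in \<open>auto intro!: continuous_integrable(2)\<close>)
  also have "... = (\<Sum>j\<in>UNIV. LINT y|sg. ph y * X j y * normal y $ j)" using iS by (rule Bochner_Integration.integral_sum)
  also have "... = (\<Sum>j\<in>UNIV. LINT x|vol. partial j ph x * X j x + ph x * partial j (X j) x)"
   by (simp add: divergence_product[OF ph(1) X(1)])
  also have "... <= (\<Sum>j\<in>(UNIV :: 'n set). \<bar>B\<bar> * ?N ph)"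
  proof (rule sum_mono)
   fix j :: 'n
   have "(LINT x|vol. partial j ph x * X j x + ph x * partial j (X j) x) <= (LINT x|vol. \<bar>B\<bar> * (ph x + norm (grad ph x)))"
   proof (rule integral_mono_AE[OF ip])
    show "integrable vol (%x. \<bar>B\<bar> * (ph x + norm (grad ph x)))"
     by (intro continuous_integrable(1) continuous_intros c)
    show "AE x in vol. partial j ph x * X j x + ph x * partial j (X j) x <= \<bar>B\<bar> * (ph x + norm (grad ph x))"
    proof (rule AE_I2)
     fix x assume "x \<in> space vol"
     then have x: "x \<in> closure Om" using in_closure by simp
     have "\<bar>partial j ph x\<bar> <= norm (grad ph x)" using component_le_norm_cart[of "grad ph x" j] by simp
     then have "\<bar>partial j ph x * X j x\<bar> <= norm (grad ph x) * \<bar>B\<bar>"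
      unfolding abs_mult using B(1)[OF x, of j] by (intro mult_mono) auto
     moreover have "\<bar>ph x * partial j (X j) x\<bar> <= ph x * \<bar>B\<bar>"
      unfolding abs_mult using B(2)[OF x, of j] ph(2)[of x] by (intro mult_mono) auto
     ultimately show "partial j ph x * X j x + ph x * partial j (X j) x <= \<bar>B\<bar> * (ph x + norm (grad ph x))"
      by (simp add: algebra_simps abs_le_iff)
    qed
   qed
   then show "(LINT x|vol. partial j ph x * X j x + ph x * partial j (X j) x) <= \<bar>B\<bar> * ?N ph"
    by simp
  qed
  also have "... = CARD('n) * \<bar>B\<bar> * ?N ph" by simp
  finally have "(LINT y|sg. ph y) <= CARD('n) * \<bar>B\<bar> / c * ?N ph"
   using X(2) by (simp add: field_simps)
  also have "... <= C * ?N ph"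
   using I by (intro mult_right_mono) (auto simp: C_def)
  finally show ?thesis .
 qed
 moreover have "C > 0" using X(2) by (simp add: C_def add_nonneg_pos)
 ultimately show thesis using that by blast
qed

lemma trace_inequality:
 obtains C where "C > 0" "!!ph. smooth ph ==> (LINT y|sg. (ph y)^2) <= C * (H1_norm Om ph)^2"
proof -
 obtain C where C: "C > 0" "!!ph. smooth ph ==> (!!x. ph x \<ge> 0) ==>
  (LINT y|sg. ph y) <= C * (LINT x|vol. ph x + norm (grad ph x))" using trace_inequality_L1 by blast
 have "(LINT y|sg. (ph y)^2) <= (2 * C) * (H1_norm Om ph)^2" if ph: "smooth ph" for ph
 proof -
  have c: "continuous_on UNIV ph" "continuous_on UNIV (%x. norm (grad ph x))"
   using ph by (auto intro: smooth_continuous_on continuous_on_norm continuous_on_grad)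
  have g2: "grad (%x. (ph x)^2) x = (2 * ph x) *\<^sub>R grad ph x" for x
   using partial_mult[OF ph ph] by (simp add: vec_eq_iff power2_eq_square)
  have "(LINT y|sg. (ph y)^2) <= C * (LINT x|vol. (ph x)^2 + norm (grad (%x. (ph x)^2) x))"
   by (rule C(2)) (auto intro: smooth_power2 ph)
  also have "... <= C * (LINT x|vol. 2 * (ph x)^2 + 2 * (norm (grad ph x))^2)"
  proof (intro mult_left_mono integral_mono)
   show "integrable vol (%x. (ph x)^2 + norm (grad (%x. (ph x)^2) x))"
    unfolding g2 by (intro continuous_integrable(1)) (auto intro!: continuous_intros c)
   show "integrable vol (%x. 2 * (ph x)^2 + 2 * (norm (grad ph x))^2)"
    by (intro continuous_integrable(1) continuous_intros c)
   fix x
   have "2 * (\<bar>ph x\<bar> * norm (grad ph x)) <= (ph x)^2 + (norm (grad ph x))^2"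
    using sum_squares_bound[of "\<bar>ph x\<bar>" "norm (grad ph x)"] by simp
   then have "2 * (\<bar>ph x\<bar> * norm (grad ph x)) <= (ph x)^2 + 2 * (norm (grad ph x))^2"
    using zero_le_power2[of "norm (grad ph x)"] by linarith
   then show "(ph x)^2 + norm (grad (%x. (ph x)^2) x) <= 2 * (ph x)^2 + 2 * (norm (grad ph x))^2"
    unfolding g2 using zero_le_power2[of "norm (grad ph x)"]
     by (simp add: abs_mult mult.assoc)
  qed (use C in auto)
  also have "(LINT x|vol. 2 * (ph x)^2 + 2 * (norm (grad ph x))^2) = 2 * (H1_norm Om ph)^2"
  proof -
   have "(LINT x|vol. (norm (wgrad ph x))^2) = (LINT x|vol. (norm (grad ph x))^2)"
   proof (rule integral_cong_AE)
    show "AE x in vol. (norm (wgrad ph x))^2 = (norm (grad ph x))^2"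
     using smooth_H1(2)[OF ph] by eventually_elim simp
    show "(%x. (norm (grad ph x))^2) \<in> borel_measurable vol"
     by (intro measurable_vol borel_measurable_continuous_onI continuous_intros c)
    have "(norm (z :: real^'n))^2 = (\<Sum>i\<in>UNIV. (z $ i)^2)" for z
     unfolding power2_norm_eq_inner inner_vec_def by (simp add: power2_eq_square)
    then show "(%x. (norm (wgrad ph x))^2) \<in> borel_measurable vol"
     by (simp add: borel_measurable_sum borel_measurable_power L2_measurable[OF H1_grad_L2[OF smooth_H1(1)[OF ph]]])
   qed
   moreover have "integrable vol (%x. (ph x)^2)" "integrable vol (%x. (norm (grad ph x))^2)"
    by (intro continuous_integrable(1) continuous_intros c)+
   ultimately show ?thesis by (simp add: H1_norm_def)
  qed
  finally show ?thesis by (simp add: mult_ac)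
 qed
 moreover have "2 * C > 0" using C by simp
 ultimately show thesis using that by blast
qed

end

lemma scaled_mollifier_nonneg: "ep > 0 ==> scaled_mollifier e ep z \<ge> 0"
 by (simp add: scaled_mollifier_def mollifier_nonneg)

lemma mollify_const: "ep > 0 ==> mollify e ep (%_. 1) x = 1"
proof -
 assume ep: "ep > 0"
 have d: "(LINT z|density lborel (%x. ennreal (mollifier e x)). (1 :: real)) = (LINT z|lborel. mollifier e z *\<^sub>R (1 :: real))"
  by (rule integral_density) (auto simp: mollifier_nonneg)
 have "mollify e ep (%_. 1) x = (LINT z|density lborel (%x. ennreal (mollifier e x)). (1 :: real))"
  by (rule mollify_eq[OF borel_measurable_const ep])
 then show ?thesis unfolding d by (simp add: mollifier_integral)
qed

lemma mollify_bounded: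
 assumes w: "integrable lborel w" "!!y. w y ~= 0 ==> norm y <= B" and M: "AE y in lborel. \<bar>w y\<bar> <= M" and ep: "ep > 0"
 shows "\<bar>mollify e ep w x\<bar> <= M"
proof -
 let ?J = "%y. scaled_mollifier e ep (x - y)"
 have sm: "smooth ?J" by (rule smooth_reflect[OF smooth_scaled_mollifier])
 have J1: "(LINT y|lborel. ?J y) = 1" using mollify_const[OF ep, of e x] by (simp add: mollify_def)
 then have Ji: "integrable lborel ?J" using not_integrable_integral_eq by fastforce
 have iw: "integrable lborel (%y. w y * ?J y)"
  by (rule convolution_integrable[where B=B]) (use w smooth_continuous_on[OF smooth_scaled_mollifier] in auto)
 have "\<bar>mollify e ep w x\<bar> <= (LINT y|lborel. \<bar>w y * ?J y\<bar>)"
  unfolding mollify_def by (rule integral_abs_bound)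
 also have "... <= (LINT y|lborel. M * ?J y)"
 proof (rule integral_mono_AE)
  show "AE y in lborel. \<bar>w y * ?J y\<bar> <= M * ?J y"
   using M by eventually_elim (auto simp: abs_mult scaled_mollifier_nonneg[OF ep] intro!: mult_right_mono)
 qed (use iw Ji in auto)
 also have "... = M" using J1 by simp
 finally show ?thesis .
qed

context lipschitz_polyhedron
begin

lemma shift_into_domain:
 assumes "p \<in> closure Om"
 shows "\<exists>r e ep0. r > 0 \<and> ep0 > 0 \<and> (\<forall>ep x. 0 < ep --> ep < ep0 --> x \<in> Om -->
  cball (x - ep *\<^sub>R e) ep \<inter> cball p r ~= {} --> cball (x - ep *\<^sub>R e) ep \<subseteq> Om)"
proof (cases "p \<in> Om")
 case True
 then obtain R where R: "R > 0" "ball p R \<subseteq> Om" using open_Om openE by blast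
 have "cball x ep \<subseteq> Om" if ep: "0 < ep" "ep < R / 3" "cball x ep \<inter> cball p (R / 3) ~= {}" for ep x
 proof
  fix z assume z: "z \<in> cball x ep"
  obtain w where "w \<in> cball x ep" "w \<in> cball p (R / 3)" using ep(3) by blast
  then have "dist p z < R"
   using z ep(2) dist_triangle[of p z w] dist_triangle[of w z x] by (simp add: dist_commute)
  then show "z \<in> Om" using R by auto
 qed
 then show ?thesis using R(1) by (intro exI[of _ "R / 3"] exI[of _ 0]) auto
next
 case False
 then have p: "p \<in> Bd" using assms open_Om by (simp add: frontier_def interior_open)
 obtain e R g L where e: "norm e = 1" "R > 0" "L-lipschitz_on UNIV g"
  "!!z. z \<in> ball p R ==> z \<in> Om \<longleftrightarrow> z \<bullet> e < (g (z - (z \<bullet> e) *\<^sub>R e) :: real)"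
  using lipschitz_Om p unfolding lipschitz_boundary_def by metis
 have L: "L \<ge> 0" using e(3) by (rule lipschitz_on_nonneg)
 have ee: "e \<bullet> e = 1" using e(1) by (simp add: norm_1_inner)
 let ?e = "(L + 1) *\<^sub>R e" let ?ep0 = "R / (2 * (L + 3))"
 have "cball (x - ep *\<^sub>R ?e) ep \<subseteq> Om"
  if ep: "0 < ep" "ep < ?ep0" and x: "x \<in> Om" and ne: "cball (x - ep *\<^sub>R ?e) ep \<inter> cball p (R / 2) ~= {}" for ep x
 proof
  fix z assume z: "z \<in> cball (x - ep *\<^sub>R ?e) ep"
  have small: "(L + 3) * ep < R / 2" using ep(2) L by (simp add: field_simps)
  have small2: "2 * ep <= (L + 3) * ep" "(L + 1) * ep + ep <= (L + 3) * ep" using L ep(1) by (auto intro!: mult_right_mono simp: algebra_simps)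
  obtain w where w: "w \<in> cball (x - ep *\<^sub>R ?e) ep" "w \<in> cball p (R / 2)" using ne by blast
  have "dist p z <= R / 2 + 2 * ep"
   using z w dist_triangle[of p z w] dist_triangle[of w z "x - ep *\<^sub>R ?e"] by (simp add: dist_commute)
  then have zR: "z \<in> ball p R" using small small2 by simp
  have "dist (x - ep *\<^sub>R ?e) x = (L + 1) * ep" using L ep(1) e(1) by (simp add: dist_norm abs_mult)
  then have "dist p x <= R / 2 + ep + (L + 1) * ep"
   using w dist_triangle[of p x w] dist_triangle[of w x "x - ep *\<^sub>R ?e"] by (simp add: dist_commute)
  then have xR: "x \<in> ball p R" using small small2 by simp
  define d where "d = z - (x - ep *\<^sub>R ?e)"
  have nd: "norm d <= ep" using z by (simp add: d_def dist_norm norm_minus_commute)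
  have zx: "z = x - ep *\<^sub>R ?e + d" by (simp add: d_def)
  have "\<bar>d \<bullet> e\<bar> <= ep" using Cauchy_Schwarz_ineq2[of d e] e(1) nd by simp
  then have "z \<bullet> e <= x \<bullet> e - ep * (L + 1) + ep" by (simp add: zx inner_add_left inner_diff_left ee)
  moreover have "x \<bullet> e < g (x - (x \<bullet> e) *\<^sub>R e)" using e(4)[OF xR] x by simp
  moreover have "\<bar>g (z - (z \<bullet> e) *\<^sub>R e) - g (x - (x \<bullet> e) *\<^sub>R e)\<bar> <= L * ep"
  proof -
   have eq: "(z - (z \<bullet> e) *\<^sub>R e) - (x - (x \<bullet> e) *\<^sub>R e) = d - (d \<bullet> e) *\<^sub>R e"
    by (simp add: zx inner_add_left inner_diff_left ee algebra_simps)
   have "(norm (d - (d \<bullet> e) *\<^sub>R e))^2 = (norm d)^2 - (d \<bullet> e)^2"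
    unfolding power2_norm_eq_inner by (simp add: inner_diff inner_commute ee) (simp add: power2_eq_square)
   then have "(norm (d - (d \<bullet> e) *\<^sub>R e))^2 <= (norm d)^2" by simp
   then have "norm (d - (d \<bullet> e) *\<^sub>R e) <= ep" using nd power2_le_imp_le by fastforce
   then have "L * dist (z - (z \<bullet> e) *\<^sub>R e) (x - (x \<bullet> e) *\<^sub>R e) <= L * ep"
    unfolding dist_norm eq using L by (rule mult_left_mono)
   then show ?thesis
    using lipschitz_onD[OF e(3), of "z - (z \<bullet> e) *\<^sub>R e" "x - (x \<bullet> e) *\<^sub>R e"] by (simp add: dist_real_def)
  qed
  ultimately have "z \<bullet> e < g (z - (z \<bullet> e) *\<^sub>R e)" by (simp add: algebra_simps abs_le_iff)
  then show "z \<in> Om" using e(4)[OF zR] by simp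
 qed
 moreover have "?ep0 > 0" using e(2) L by simp
 ultimately show ?thesis using e(2) by (intro exI[of _ "R / 2"] exI[of _ ?e] exI[of _ ?ep0]) auto
qed

lemma L2_vol_representative:
 assumes "f \<in> L2 vol"
 obtains f' where "f' \<in> L2 lborel" "AE x in vol. f x = f' x" "!!x. x \<notin> Om ==> f' x = 0"
proof -
 obtain f' where f': "f' \<in> borel_measurable borel" "AE x in vol. f x = f' x" "!!x. x \<notin> Om ==> f' x = 0"
  using borel_representative[OF L2_measurable[OF assms] Om_borel] by blast
 have "f' \<in> L2 vol" by (rule L2_cong_AE[OF assms measurable_vol[OF f'(1)] f'(2)])
 then have "integrable lborel (%x. (f' x)^2)"
  using lebesgue_on_zero_outside(1)[of "%x. (f' x)^2" Om] f'(1,3) by (simp add: L2_def)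
 then have "f' \<in> L2 lborel" using f'(1) by (simp add: L2_def)
 with f' that show thesis by blast
qed

lemma L2_lborel_vol:
 assumes "f \<in> L2 lborel"
 shows "f \<in> L2 vol"
proof -
 have m: "f \<in> borel_measurable borel" using assms by (simp add: L2_def)
 have "integrable lborel (%x. indicator Om x *\<^sub>R (f x)\<^sup>2)"
  using assms by (intro integrable_mult_indicator) (auto simp: L2_def)
 then have "integrable vol (%x. (f x)^2)"
  by (subst integrable_lebesgue_on_borel) (use m in auto)
 then show ?thesis using measurable_vol[OF m] by (simp add: L2_def)
qed

lemma mollify_L2_vol:
 assumes w: "w \<in> L2 lborel" and B: "!!y. w y ~= 0 ==> norm y <= B" and ep: "!!k. ep k > 0" "ep ----> 0"
 shows "L2_lim vol (%k. mollify e (ep k) w) w"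
 unfolding L2_lim_def
proof (intro conjI allI)
 have wi: "integrable lborel w" by (rule bounded_support_L2_integrable[OF w B])
 have sm: "smooth (mollify e (ep k) w)" for k by (rule smooth_mollify(1)[OF wi B])
 show m: "mollify e (ep k) w \<in> L2 vol" for k by (rule continuous_L2(1)[OF smooth_continuous_on[OF sm]])
 show w': "w \<in> L2 vol" by (rule L2_lborel_vol[OF w])
 have wm: "w \<in> borel_measurable borel" using w by (simp add: L2_def)
 have "ennreal (LINT x|vol. (mollify e (ep k) w x - w x)^2) <= (\<integral>\<^sup>+x. ennreal ((mollify e (ep k) w x - w x)^2) \<partial>lborel)" for k
 proof -
  have "ennreal (LINT x|vol. (mollify e (ep k) w x - w x)^2) = (\<integral>\<^sup>+x. ennreal ((mollify e (ep k) w x - w x)^2) \<partial>vol)"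
   by (rule nn_integral_eq_integral[symmetric]) (use L2_diff[OF m w'] in \<open>auto simp: L2_def\<close>)
  also have "... = (\<integral>\<^sup>+x. ennreal ((mollify e (ep k) w x - w x)^2) * indicator Om x \<partial>lborel)"
   by (subst nn_integral_restrict_space) (use Om_sets in \<open>auto simp: nn_integral_completion\<close>)
  also have "... <= (\<integral>\<^sup>+x. ennreal ((mollify e (ep k) w x - w x)^2) \<partial>lborel)"
   by (intro nn_integral_mono) (auto simp: indicator_def)
  finally show ?thesis .
 qed
 note le = this
 have lim: "(%k. \<integral>\<^sup>+x. ennreal ((mollify e (ep k) w x - w x)^2) \<partial>lborel) ----> 0"
  by (rule mollify_L2[OF w B ep])
 have "(%k. ennreal (LINT x|vol. (mollify e (ep k) w x - w x)^2)) ----> 0"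
  by (rule LIMSEQ_squeeze_0_ennreal[OF lim le])
 then have "(%k. ennreal (LINT x|vol. (mollify e (ep k) w x - w x)^2)) ----> ennreal 0"
  by (simp only: ennreal_0)
 then show "(%k. LINT x|vol. (mollify e (ep k) w x - w x)^2) ----> 0"
  by (rule tendsto_ennrealD) (auto intro!: always_eventually)
qed

lemma local_smooth_approximation:
 assumes patch: "ep0 > 0" "!!ep x. 0 < ep ==> ep < ep0 ==> x \<in> Om ==>
   cball (x - ep *\<^sub>R e) ep \<inter> cball p r ~= {} ==> cball (x - ep *\<^sub>R e) ep \<subseteq> Om"
  and rh: "smooth rh" "!!x. x \<notin> cball p r ==> rh x = 0" and v: "v \<in> H1 Om"
 shows "\<exists>ph :: nat => real^'n => real. (\<forall>k. smooth (ph k)) \<and> L2_lim vol ph (%x. rh x * v x) \<and>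
  (\<forall>i. L2_lim vol (%k. partial i (ph k)) (%x. rh x * wgrad v x $ i + v x * partial i rh x)) \<and>
  (\<forall>M. (AE x in vol. \<bar>v x\<bar> <= M) --> (\<exists>C. \<forall>k x. \<bar>ph k x\<bar> <= C))"
proof -
 have crh: "continuous_on UNIV rh" "continuous_on UNIV (partial i rh)" for i
  using rh(1) by (auto intro: smooth_continuous_on smooth_partialI)
 obtain R where R: "closure Om \<subseteq> cball 0 R" by (rule Om_in_cball)
 have B: "norm y <= R" if "y \<in> Om" for y using R in_closure(1)[OF that] by auto
 let ?dg = "%i x. rh x * wgrad v x $ i + v x * partial i rh x"
 have wg: "(%x. rh x * v x) \<in> L2 vol" "?dg i \<in> L2 vol" for i
  using L2_bounded_closure_mult[OF crh(1) H1_L2[OF v]]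
   L2_add[OF L2_bounded_closure_mult[OF crh(1) H1_grad_L2[OF v]] L2_bounded_closure_mult[OF crh(2) H1_L2[OF v]]]
  by (simp_all add: mult.commute)
 have hw: "has_weak_grad Om (%x. rh x * v x) (%x. rh x *\<^sub>R wgrad v x + v x *\<^sub>R grad rh x)"
  by (intro has_weak_grad_mult open_Om H1_weak_grad v rh(1) L2_locally_integrable wg)
 obtain w0 where w0: "w0 \<in> L2 lborel" "AE x in vol. rh x * v x = w0 x" "!!x. x \<notin> Om ==> w0 x = 0"
  using L2_vol_representative[OF wg(1)] by blast
 have "\<exists>g. g \<in> L2 lborel \<and> (AE x in vol. ?dg i x = g x) \<and> (\<forall>x. x \<notin> Om --> g x = 0)" for i
  using L2_vol_representative[OF wg(2)[of i]] by blast
 then have "\<forall>i. \<exists>g. g \<in> L2 lborel \<and> (AE x in vol. ?dg i x = g x) \<and> (\<forall>x. x \<notin> Om --> g x = 0)" ..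
 from choice[OF this] obtain g0 where g0: "!!i. g0 i \<in> L2 lborel" "!!i. AE x in vol. ?dg i x = g0 i x" "!!i x. x \<notin> Om ==> g0 i x = 0"
  by blast
 have wB: "norm y <= R" if "w0 y ~= 0" for y using B w0(3) that by blast
 have gB: "norm y <= R" if "g0 i y ~= 0" for y i using B g0(3) that by blast
 have wi: "integrable lborel w0" "integrable lborel (g0 i)" for i
  using bounded_support_L2_integrable[OF w0(1) wB] bounded_support_L2_integrable[OF g0(1) gB] by auto
 have wm: "w0 \<in> borel_measurable borel" "g0 i \<in> borel_measurable borel" for i using w0(1) g0(1) by (auto simp: L2_def)
 have to_vol: "(LINT y|lborel. f0 y * ps y) = (LINT y|vol. f y * ps y)"
  if "f0 \<in> borel_measurable borel" "f \<in> borel_measurable vol" "AE x in vol. f x = f0 x" "!!x. x \<notin> Om ==> f0 x = 0" "smooth ps" for f0 f ps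
 proof -
  have "(LINT y|lborel. f0 y * ps y) = (LINT y|vol. f0 y * ps y)"
   using that smooth_measurable[of ps] by (intro lebesgue_on_zero_outside(2)[symmetric]) auto
  also have "... = (LINT y|vol. f y * ps y)"
   using that(3) by (intro integral_cong_AE borel_measurable_times measurable_vol[OF that(1)] that(2)
     measurable_vol[OF smooth_measurable[OF that(5)]]) (auto elim!: eventually_mono)
  finally show ?thesis .
 qed
 have wz: "AE y in vol. y \<notin> cball p r --> rh y * v y = 0" "AE y in vol. y \<notin> cball p r --> ?dg i y = 0" for i
  using rh(2) partial_eq_0_outside[OF compact_cball rh] by auto
 have part: "partial i (mollify e ep w0) x = mollify e ep (g0 i) x" if ep: "0 < ep" "ep < ep0" and x: "x \<in> Om" for ep x i
 proof -
  let ?K = "cball (x - ep *\<^sub>R e) ep" let ?J = "%y. scaled_mollifier e ep (x - y)"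
  have smJ: "smooth ?J" by (rule smooth_reflect[OF smooth_scaled_mollifier])
  have J0: "?J y = 0" if "y \<notin> ?K" for y
  proof -
   have "norm ((x - y) - ep *\<^sub>R e) \<ge> ep" using that by (simp add: dist_norm algebra_simps)
   then show ?thesis by (rule scaled_mollifier_eq_0[OF ep(1)])
  qed
  have pJ: "partial i ?J y = - partial i (scaled_mollifier e ep) (x - y)" for y
   by (rule partial_reflect[OF smooth_scaled_mollifier])
  have pJ0: "partial i ?J y = 0" if "y \<notin> ?K" for y
   by (rule partial_eq_0_outside[OF compact_cball smJ J0 that])
  have prh0: "partial i rh y = 0" if "y \<notin> cball p r" for y
   by (rule partial_eq_0_outside[OF compact_cball rh that])
  have "partial i (mollify e ep w0) x = (LINT y|lborel. w0 y * - partial i ?J y)"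
   using smooth_mollify(2)[OF wi(1) wB] by (simp add: pJ)
  also have "... = - (LINT y|lborel. w0 y * partial i ?J y)" by simp
  also have "(LINT y|lborel. w0 y * partial i ?J y) = (LINT y|vol. (rh y * v y) * partial i ?J y)"
   by (rule to_vol[OF wm(1) L2_measurable[OF wg(1)] w0(2,3) smooth_partialI[OF smJ]])
  also have "... = - (LINT y|vol. ?dg i y * ?J y)"
  proof (cases "?K \<inter> cball p r = {}")
   case False
   have "test_function Om ?J" by (rule test_function_scaled_mollifier[OF ep(1) patch(2)[OF ep x False]])
   then show ?thesis using hw by (simp add: has_weak_grad_def)
  next
   case True
   have "(LINT y|vol. (rh y * v y) * partial i ?J y) = (LINT y|vol. 0)"
   proof (rule Bochner_Integration.integral_cong[OF refl])
    fix y show "(rh y * v y) * partial i ?J y = 0"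
    proof (cases "y \<in> ?K")
     case yK: True
     have "y \<notin> cball p r" using True yK by (rule disjoint_iff[THEN iffD1, rule_format])
     then have "rh y = 0" by (rule rh(2))
     then show ?thesis by (simp only: mult_zero_left)
    qed (simp only: pJ0 mult_zero_right not_False_eq_True)
   qed
   moreover have "(LINT y|vol. ?dg i y * ?J y) = (LINT y|vol. 0)"
   proof (rule Bochner_Integration.integral_cong[OF refl])
    fix y show "?dg i y * ?J y = 0"
    proof (cases "y \<in> ?K")
     case yK: True
     have y: "y \<notin> cball p r" using True yK by (rule disjoint_iff[THEN iffD1, rule_format])
     show ?thesis by (simp only: rh(2)[OF y] prh0[OF y] mult_zero_left mult_zero_right add_0)
    qed (simp only: J0 mult_zero_right not_False_eq_True)
   qed
   ultimately show ?thesis by simp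
  qed
  also have "(LINT y|vol. ?dg i y * ?J y) = (LINT y|lborel. g0 i y * ?J y)"
   by (rule to_vol[OF wm(2) L2_measurable[OF wg(2)] g0(2,3) smJ, symmetric])
  finally show ?thesis by (simp add: mollify_def[of _ _ "g0 i"])
 qed
 define ep where "ep k = ep0 / real (Suc (Suc k))" for k
 have ep: "ep k > 0" "ep k < ep0" for k using patch(1) by (auto simp: ep_def field_simps add_pos_nonneg)
 have "(%k. ep0 * (1 / real (Suc (Suc k)))) ----> ep0 * 0"
  by (intro tendsto_mult_left LIMSEQ_Suc[OF LIMSEQ_Suc[OF lim_1_over_n]])
 then have ep0: "ep ----> 0" by (simp add: ep_def[abs_def])
 let ?ph = "%k. mollify e (ep k) w0"
 have sm: "smooth (?ph k)" for k by (rule smooth_mollify(1)[OF wi(1) wB])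
 show ?thesis
 proof (rule exI[of _ ?ph], intro conjI allI impI)
  show "smooth (?ph k)" for k by (rule sm)
  show "L2_lim vol ?ph (%x. rh x * v x)"
  proof (rule L2_lim_cong_AE[OF mollify_L2_vol[OF w0(1) wB ep(1) ep0]])
   show "AE x in vol. w0 x = rh x * v x" using w0(2) by eventually_elim simp
  qed (use L2_measurable[OF wg(1)] measurable_vol[OF smooth_measurable[OF sm]] in auto)
  show "L2_lim vol (%k. partial i (?ph k)) (?dg i)" for i
  proof (rule L2_lim_cong_AE[OF mollify_L2_vol[OF g0(1) gB ep(1) ep0]])
   show "AE x in vol. g0 i x = ?dg i x" using g0(2)[of i] by eventually_elim simp
   show "AE x in vol. mollify e (ep k) (g0 i) x = partial i (?ph k) x" for k
    using part[OF ep] by (intro AE_I2) simp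
  qed (use L2_measurable[OF wg(2)] measurable_vol[OF smooth_measurable[OF smooth_partialI[OF sm]]] in auto)
  fix M assume M: "AE x in vol. \<bar>v x\<bar> <= M"
  obtain C where C: "C > 0" "!!x. x \<in> closure Om ==> \<bar>rh x\<bar> <= C" using continuous_bounded_closure[OF crh(1)] by blast
  have "AE x in lebesgue. x \<in> Om --> \<bar>w0 x\<bar> <= C * \<bar>M\<bar>"
   unfolding AE_lebesgue_on_iff[OF Om_sets(1), symmetric] using M w0(2) AE_vol_in
  proof eventually_elim
   case (elim x)
   have "\<bar>rh x * v x\<bar> <= C * \<bar>M\<bar>"
    unfolding abs_mult using C(1) C(2)[OF in_closure(1)[OF elim(3)]] elim(1) by (intro mult_mono) auto
   then show ?case using elim(2) by simp
  qed
  then have "AE x in lborel. \<bar>w0 x\<bar> <= C * \<bar>M\<bar>"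
   unfolding AE_completion_iff
  proof eventually_elim
   case (elim x)
   then show ?case using w0(3)[of x] C(1) by (cases "x \<in> Om") auto
  qed
  then have "\<bar>?ph k x\<bar> <= C * \<bar>M\<bar>" for k x
   using mollify_bounded[OF wi(1), of R "C * \<bar>M\<bar>" "ep k" e x] wB ep(1) by blast
  then show "\<exists>C. \<forall>k x. \<bar>?ph k x\<bar> <= C" by blast
 qed
qed

lemma partition_of_unity:
 assumes "!!p. p \<in> closure Om ==> r p > 0"
 obtains D rh where "finite D" "D \<subseteq> closure Om" "!!p. smooth (rh p)"
  "!!p x. p \<in> D ==> x \<notin> cball p (r p) ==> rh p x = (0 :: real)" "!!x. x \<in> closure Om ==> (\<Sum>p\<in>D. rh p x) = 1"
proof -
 have cc: "compact (closure Om)" using bounded_Om by simp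
 have "closure Om \<subseteq> (\<Union>p\<in>closure Om. ball p (r p))" using assms by force
 then obtain D where D: "D \<subseteq> closure Om" "finite D" "closure Om \<subseteq> (\<Union>p\<in>D. ball p (r p))"
  using compactE_image[OF cc, of "closure Om" "%p. ball p (r p)"] by (metis open_ball)
 let ?f = "%x. \<Sum>p\<in>D. bump p (r p) x"
 have smf: "smooth ?f" by (intro smooth_sum smooth_bump)
 have pos: "?f x > 0" if "x \<in> closure Om" for x
 proof -
  from subsetD[OF D(3) that] obtain p where p: "p \<in> D" "x \<in> ball p (r p)" by blast
  then have "bump p (r p) x > 0" using assms D(1) bump_pos_iff[of "r p" p x] by blast
  moreover have "bump p (r p) x <= ?f x" using p(1) D(2) bump_nonneg by (intro member_le_sum) auto
  ultimately show ?thesis by linarith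
 qed
 obtain x0 where x0: "x0 \<in> closure Om" "\<forall>x\<in>closure Om. ?f x0 <= ?f x"
  using continuous_attains_inf[OF cc _ smooth_continuous_on[OF smf]] nonempty_Om by auto
 let ?F = "%x. ?f x + cutoff 1 (?f x0 - ?f x)"
 have Fpos: "?F x > 0" for x
 proof (cases "?f x > 0")
  case True then show ?thesis by (simp add: cutoff_def add_pos_nonneg)
 next
  case False
  have "?f x \<ge> 0" by (intro sum_nonneg bump_nonneg)
  moreover have "?f x0 - ?f x > 0" using pos[OF x0(1)] False by linarith
  ultimately show ?thesis by (simp add: cutoff_def add_nonneg_pos)
 qed
 have smF: "smooth (%x. inverse (?F x))"
  by (rule smooth_inverse[OF smooth_add[OF smf smooth_cutoff[OF smooth_diff[OF smooth_const smf]]] Fpos])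
 show thesis
 proof (rule that[of D "%p x. bump p (r p) x * inverse (?F x)"])
  show "smooth (%x. bump p (r p) x * inverse (?F x))" for p by (rule smooth_mult[OF smooth_bump smF])
  show "bump p (r p) x * inverse (?F x) = 0" if "p \<in> D" "x \<notin> cball p (r p)" for p x
   using bump_eq_0[of "r p" x p] that assms D(1) by fastforce
  show "(\<Sum>p\<in>D. bump p (r p) x * inverse (?F x)) = 1" if x: "x \<in> closure Om" for x
  proof -
   have "cutoff 1 (?f x0 - ?f x) = 0" using bspec[OF x0(2) x] by (simp add: cutoff_def not_less)
   then show ?thesis using pos[OF x] by (simp add: sum_distrib_right[symmetric])
  qed
 qed (use D in auto)
qed

lemma L2_lim_sum:
 assumes "finite I" "!!j. j \<in> I ==> L2_lim vol (f j) (g j)"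
 shows "L2_lim vol (%k x. \<Sum>j\<in>I. f j k x) (%x. \<Sum>j\<in>I. g j x)"
 using assms
proof (induction I rule: finite_induct)
 case empty
 show ?case using L2_lim_const[OF continuous_L2(1)[of "%_. 0"]] by simp
next
 case (insert j I)
 then show ?case using L2_lim_add[of vol "f j" "g j"] by simp
qed

theorem smooth_dense_H1:
 assumes v: "v \<in> H1 Om"
 obtains ph where "!!k. smooth (ph k)" "H1_lim ph v"
  "!!M. AE x in vol. \<bar>v x\<bar> <= M ==> \<exists>C. \<forall>k x. \<bar>ph k x\<bar> <= C"
proof -
 have "\<forall>p\<in>closure Om. \<exists>r e ep0. r > 0 \<and> ep0 > 0 \<and> (\<forall>ep x. 0 < ep --> ep < ep0 --> x \<in> Om -->
  cball (x - ep *\<^sub>R e) ep \<inter> cball p r ~= {} --> cball (x - ep *\<^sub>R e) ep \<subseteq> Om)"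
  using shift_into_domain by blast
 then obtain r e ep0 where patch: "!!p. p \<in> closure Om ==> r p > 0" "!!p. p \<in> closure Om ==> ep0 p > (0 :: real)"
  "!!p ep x. p \<in> closure Om ==> 0 < ep ==> ep < ep0 p ==> x \<in> Om ==>
   cball (x - ep *\<^sub>R e p) ep \<inter> cball p (r p) ~= {} ==> cball (x - ep *\<^sub>R e p) ep \<subseteq> Om"
  by metis
 obtain D rh where D: "finite D" "D \<subseteq> closure Om" "!!p. smooth (rh p)"
  "!!p x. p \<in> D ==> x \<notin> cball p (r p) ==> rh p x = (0 :: real)" "!!x. x \<in> closure Om ==> (\<Sum>p\<in>D. rh p x) = 1"
  using partition_of_unity[of r, OF patch(1)] by metis
 have "\<exists>ph :: nat => real^'n => real. (\<forall>k. smooth (ph k)) \<and> L2_lim vol ph (%x. rh p x * v x) \<and>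
  (\<forall>i. L2_lim vol (%k. partial i (ph k)) (%x. rh p x * wgrad v x $ i + v x * partial i (rh p) x)) \<and>
  (\<forall>M. (AE x in vol. \<bar>v x\<bar> <= M) --> (\<exists>C. \<forall>k x. \<bar>ph k x\<bar> <= C))" if p: "p \<in> D" for p
 proof -
  have "p \<in> closure Om" using p D(2) by blast
  show ?thesis
   by (rule local_smooth_approximation[OF patch(2)[OF \<open>p \<in> closure Om\<close>] patch(3)[OF \<open>p \<in> closure Om\<close>] D(3) D(4)[OF p] v])
 qed
 then have "\<forall>p\<in>D. \<exists>ph :: nat => real^'n => real. (\<forall>k. smooth (ph k)) \<and> L2_lim vol ph (%x. rh p x * v x) \<and>
  (\<forall>i. L2_lim vol (%k. partial i (ph k)) (%x. rh p x * wgrad v x $ i + v x * partial i (rh p) x)) \<and>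
  (\<forall>M. (AE x in vol. \<bar>v x\<bar> <= M) --> (\<exists>C. \<forall>k x. \<bar>ph k x\<bar> <= C))" by blast
 from bchoice[OF this] obtain ph where ph: "!!p k. p \<in> D ==> smooth (ph p k)" "!!p. p \<in> D ==> L2_lim vol (ph p) (%x. rh p x * v x)"
  "!!p i. p \<in> D ==> L2_lim vol (%k. partial i (ph p k)) (%x. rh p x * wgrad v x $ i + v x * partial i (rh p) x)"
  "!!p M. p \<in> D ==> AE x in vol. \<bar>v x\<bar> <= M ==> \<exists>C. \<forall>k x. \<bar>ph p k x\<bar> <= C" by blast
 let ?ph = "%k x. \<Sum>p\<in>D. ph p k x"
 have sm: "smooth (?ph k)" for k by (rule smooth_sum) (rule ph(1))
 have s0: "(\<Sum>p\<in>D. partial i (rh p) x) = 0" if x: "x \<in> Om" for x i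
 proof -
  have "((%x. \<Sum>p\<in>D. rh p x) has_derivative (%h. 0)) (at x)"
   using D(5)[OF in_closure(1)] x
   by (intro has_derivative_transform_within_open[OF has_derivative_const[of 1] open_Om]) auto
  from partial_eqI[OF this] show ?thesis by (subst (asm) partial_sum) (use D(3) in auto)
 qed
 have lim: "H1_lim ?ph v"
 proof (rule H1_lim_smoothI[OF sm v])
  show "L2_lim vol ?ph v"
  proof (rule L2_lim_cong_AE[OF L2_lim_sum[OF D(1) ph(2)]])
   show "AE x in vol. (\<Sum>p\<in>D. rh p x * v x) = v x"
    using D(5)[OF in_closure(1)] by (intro AE_I2) (simp add: sum_distrib_right[symmetric])
  qed (use L2_measurable[OF H1_L2[OF v]] measurable_vol[OF smooth_measurable[OF sm]] in auto)
  fix i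
  show "L2_lim vol (%k x. partial i (?ph k) x) (%x. wgrad v x $ i)"
  proof (rule L2_lim_cong_AE[OF L2_lim_sum[OF D(1) ph(3)]])
   show "AE x in vol. (\<Sum>p\<in>D. partial i (ph p k) x) = partial i (?ph k) x" for k
    by (intro AE_I2 partial_sum[symmetric] ph(1))
   show "AE x in vol. (\<Sum>p\<in>D. rh p x * wgrad v x $ i + v x * partial i (rh p) x) = wgrad v x $ i"
    using D(5)[OF in_closure(1)] s0 by (intro AE_I2) (simp add: sum.distrib sum_distrib_right[symmetric] sum_distrib_left[symmetric])
  qed (use L2_measurable[OF H1_grad_L2[OF v]] measurable_vol[OF smooth_measurable[OF smooth_partialI[OF sm]]] in auto)
 qed
 have "\<exists>C. \<forall>k x. \<bar>?ph k x\<bar> <= C" if M: "AE x in vol. \<bar>v x\<bar> <= M" for M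
 proof -
  have "\<forall>p\<in>D. \<exists>C. \<forall>k x. \<bar>ph p k x\<bar> <= C" using ph(4)[OF _ M] by blast
  from bchoice[OF this] obtain C where C: "!!p k x. p \<in> D ==> \<bar>ph p k x\<bar> <= C p" by blast
  have "\<bar>?ph k x\<bar> <= (\<Sum>p\<in>D. C p)" for k x
   using sum_abs[of "%p. ph p k x" D] sum_mono[of D "%p. \<bar>ph p k x\<bar>" C] C by (meson order_trans)
  then show ?thesis by blast
 qed
 then show thesis by (rule that[OF sm lim])
qed

end

lemma (in finite_measure) L2_norm_L1:
 assumes h: "h \<in> L2 M"
 shows "(LINT x|M. \<bar>h x\<bar>) <= sqrt (LINT x|M. (h x)^2) * sqrt (measure M (space M))"
proof -
 have "(%x. \<bar>h x\<bar>) \<in> L2 M" using h by (auto simp: L2_def intro!: borel_measurable_abs)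
 moreover have "(%_. 1) \<in> L2 M" by (rule L2_bounded[where C=1]) auto
 ultimately have "\<bar>LINT x|M. \<bar>h x\<bar> * 1\<bar> <= sqrt (LINT x|M. \<bar>h x\<bar>\<^sup>2) * sqrt (LINT x|M. 1\<^sup>2)"
  by (rule L2_Cauchy_Schwarz)
 then show ?thesis by simp
qed

lemma (in finite_measure) L2_complete:
 assumes f: "!!k. f k \<in> L2 M"
  and Cauchy: "!!e. e > 0 ==> \<exists>N. \<forall>m\<ge>N. \<forall>n\<ge>N. (LINT x|M. (f m x - f n x)^2) < e"
 obtains g where "L2_lim M f g"
proof -
 let ?m = "measure M (space M)"
 let ?d = "%m n. LINT x|M. (f m x - f n x)^2"
 have fm[measurable]: "f k \<in> borel_measurable M" for k using f by (rule L2_measurable)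
 have "\<exists>N. \<forall>m\<ge>N. \<forall>n\<ge>N. (LINT x|M. norm (f m x - f n x)) < e" if e: "e > 0" for e
 proof -
  have m: "sqrt ?m + 1 > 0" by (simp add: add_nonneg_pos)
  obtain N where N: "\<forall>m\<ge>N. \<forall>n\<ge>N. ?d m n < (e / (sqrt ?m + 1))^2"
   using Cauchy[of "(e / (sqrt ?m + 1))^2"] e m by auto
  have "(LINT x|M. norm (f m x - f n x)) < e" if mn: "m \<ge> N" "n \<ge> N" for m n
  proof -
   have "sqrt (?d m n) < sqrt ((e / (sqrt ?m + 1))^2)"
    using N mn by (intro real_sqrt_less_mono) auto
   then have s: "sqrt (?d m n) < e / (sqrt ?m + 1)" using e m by simp
   have "(LINT x|M. norm (f m x - f n x)) <= sqrt (?d m n) * sqrt ?m"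
    using L2_norm_L1[OF L2_diff[OF f f, of m n]] by simp
   also have "... <= e / (sqrt ?m + 1) * sqrt ?m" using s by (intro mult_right_mono) auto
   also have "... < e" using m e by (simp add: pos_divide_less_eq algebra_simps)
   finally show ?thesis .
  qed
  then show ?thesis by blast
 qed
 then obtain r where r: "strict_mono r" "AE x in M. Cauchy (%i. f (r i) x)"
  using cauchy_L1_AE_cauchy_subseq[of M f, OF L2_integrable[OF f]] by blast
 define g where "g x = lim (%i. f (r i) x)" for x
 have gm[measurable]: "g \<in> borel_measurable M" unfolding g_def[abs_def] by measurable
 have gl: "AE x in M. (%i. f (r i) x) ----> g x"
  using r(2) by eventually_elim (simp add: g_def real_Cauchy_convergent convergent_LIMSEQ_iff[symmetric])
 have bound: "(\<integral>\<^sup>+x. ennreal ((f k x - g x)^2) \<partial>M) <= ennreal e"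
  if N: "\<forall>m\<ge>N. \<forall>n\<ge>N. ?d m n < e" and k: "k \<ge> N" for k N e
 proof -
  have "(\<integral>\<^sup>+x. ennreal ((f k x - g x)^2) \<partial>M) = (\<integral>\<^sup>+x. liminf (%i. ennreal ((f k x - f (r i) x)^2)) \<partial>M)"
  proof (rule nn_integral_cong_AE)
   show "AE x in M. ennreal ((f k x - g x)^2) = liminf (%i. ennreal ((f k x - f (r i) x)^2))"
    using gl
   proof eventually_elim
    fix x assume "(%i. f (r i) x) ----> g x"
    then have "(%i. ennreal ((f k x - f (r i) x)^2)) ----> ennreal ((f k x - g x)^2)"
     by (intro tendsto_ennrealI tendsto_power tendsto_diff tendsto_const)
    then show "ennreal ((f k x - g x)^2) = liminf (%i. ennreal ((f k x - f (r i) x)^2))"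
     by (rule lim_imp_Liminf[OF sequentially_bot, symmetric])
   qed
  qed
  also have "... <= liminf (%i. \<integral>\<^sup>+x. ennreal ((f k x - f (r i) x)^2) \<partial>M)"
   by (rule nn_integral_liminf) measurable
  also have "... <= limsup (%i. \<integral>\<^sup>+x. ennreal ((f k x - f (r i) x)^2) \<partial>M)"
   by (rule Liminf_le_Limsup) simp
  also have "... <= ennreal e"
  proof (rule Limsup_bounded)
   have "(\<integral>\<^sup>+x. ennreal ((f k x - f (r i) x)^2) \<partial>M) <= ennreal e" if "i \<ge> N" for i
   proof -
    have ri: "r i \<ge> N" using that seq_suble[OF r(1), of i] by simp
    have "(\<integral>\<^sup>+x. ennreal ((f k x - f (r i) x)^2) \<partial>M) = ennreal (LINT x|M. (f k x - f (r i) x)^2)"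
     by (intro nn_integral_eq_integral L2_square L2_diff f) auto
    also have "... <= ennreal e" using N k ri by (intro ennreal_leI less_imp_le) blast
    finally show ?thesis .
   qed
   then show "\<forall>\<^sub>F i in sequentially. (\<integral>\<^sup>+x. ennreal ((f k x - f (r i) x)^2) \<partial>M) <= ennreal e"
    unfolding eventually_sequentially by blast
  qed
  finally show ?thesis .
 qed
 have dL2: "(%x. f k x - g x) \<in> L2 M" if N: "\<forall>m\<ge>N. \<forall>n\<ge>N. ?d m n < e" and k: "k \<ge> N" for k N e
 proof -
  have "integrable M (%x. (f k x - g x)^2)"
  proof (rule integrableI_bounded)
   show "(\<integral>\<^sup>+x. ennreal (norm ((f k x - g x)^2)) \<partial>M) < \<infinity>"
    using bound[OF N k] by (simp add: le_less_trans)
  qed measurable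
  then show ?thesis by (simp add: L2_def)
 qed
 obtain N1 where N1: "\<forall>m\<ge>N1. \<forall>n\<ge>N1. ?d m n < 1" using Cauchy[of 1] by auto
 have g: "g \<in> L2 M" using L2_diff[OF f[of N1] dL2[OF N1 order_refl]] by simp
 have "(%k. LINT x|M. (f k x - g x)^2) ----> 0"
 proof (rule LIMSEQ_I)
  fix e :: real assume e: "e > 0"
  obtain N where N: "\<forall>m\<ge>N. \<forall>n\<ge>N. ?d m n < e / 2" using Cauchy[of "e / 2"] e by auto
  have "norm ((LINT x|M. (f k x - g x)^2) - 0) < e" if k: "k \<ge> N" for k
  proof -
   have "ennreal (LINT x|M. (f k x - g x)^2) = (\<integral>\<^sup>+x. ennreal ((f k x - g x)^2) \<partial>M)"
    by (rule nn_integral_eq_integral[symmetric]) (use L2_square[OF dL2[OF N k]] in auto)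
   also have "... <= ennreal (e / 2)" by (rule bound[OF N k])
   finally have "(LINT x|M. (f k x - g x)^2) <= e / 2" using e by (simp add: ennreal_le_iff)
   then show ?thesis using e by simp
  qed
  then show "\<exists>N. \<forall>k\<ge>N. norm ((LINT x|M. (f k x - g x)^2) - 0) < e" by blast
 qed
 with f g have "L2_lim M f g" by (simp add: L2_lim_def)
 then show thesis by (rule that)
qed

lemma L2_lim_unique:
 assumes "L2_lim M f g" "L2_lim M f h"
 shows "AE x in M. g x = h x"
proof -
 have gh: "(%x. g x - h x) \<in> L2 M" using assms by (intro L2_diff) (auto dest: L2_limD)
 have "L2_lim M (%k x. f k x - f k x) (%x. g x - h x)" using assms by (rule L2_lim_diff)
 then have "(%k. LINT x|M. (f k x - f k x)^2) ----> (LINT x|M. (g x - h x)^2)" by (rule L2_lim_square)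
 then have "(LINT x|M. (g x - h x)^2) = 0" by (simp add: LIMSEQ_const_iff)
 then have "AE x in M. (g x - h x)^2 = 0"
  using integral_nonneg_eq_0_iff_AE[OF L2_square[OF gh]] by simp
 then show ?thesis by eventually_elim simp
qed

lemma L2_lim_bounded:
 assumes "L2_lim M f g" "!!k. AE x in M. \<bar>f k x\<bar> <= C"
 shows "AE x in M. \<bar>g x\<bar> <= C"
proof -
 let ?h = "%x. (max 0 (\<bar>g x\<bar> - C))^2"
 have g: "g \<in> L2 M" and f: "f k \<in> L2 M" for k using assms(1) by (auto dest: L2_limD)
 have [measurable]: "g \<in> borel_measurable M" using g by (rule L2_measurable)
 have d: "integrable M (%x. (f k x - g x)^2)" for k by (intro L2_square L2_diff f g)
 have le: "AE x in M. ?h x <= (f k x - g x)^2" for k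
  using assms(2)[of k]
 proof eventually_elim
  fix x assume "\<bar>f k x\<bar> <= C"
  then have "max 0 (\<bar>g x\<bar> - C) <= \<bar>f k x - g x\<bar>" by linarith
  then have "?h x <= \<bar>f k x - g x\<bar>\<^sup>2" by (intro power_mono) auto
  then show "?h x <= (f k x - g x)^2" by simp
 qed
 have hi: "integrable M ?h"
  by (rule Bochner_Integration.integrable_bound[OF d[of 0]]) (use le[of 0] in auto)
 have "(LINT x|M. ?h x) <= (LINT x|M. (f k x - g x)^2)" for k by (rule integral_mono_AE[OF hi d le])
 then have "(LINT x|M. ?h x) <= 0"
  using assms(1) by (intro LIMSEQ_le_const[of "%k. LINT x|M. (f k x - g x)^2"]) (auto simp: L2_lim_def)
 then have "(LINT x|M. ?h x) = 0" by (simp add: order_antisym)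
 then have "AE x in M. ?h x = 0" using integral_nonneg_eq_0_iff_AE[OF hi] by simp
 then show ?thesis by eventually_elim (auto simp: max_def split: if_splits)
qed

context lipschitz_polyhedron
begin

abbreviation tr :: "(real^'n => real) => real^'n => real" where "tr \<equiv> bd_trace Om"

lemma L2_surface_borel: "g \<in> L2 sg ==> g \<in> borel_measurable borel"
 using L2_measurable[of g sg] by (simp only: measurable_cong_sets[OF sets_surface_measure refl])

lemma H1_norm_triangle_sq:
 assumes "u \<in> H1 Om" "v \<in> H1 Om" "w \<in> H1 Om"
 shows "(H1_norm Om (%x. u x - w x))^2 <= 2 * (H1_norm Om (%x. u x - v x))^2 + 2 * (H1_norm Om (%x. v x - w x))^2"
proof -
 have "(LINT x|vol. (u x - w x)^2) <= 2 * (LINT x|vol. (u x - v x)^2) + 2 * (LINT x|vol. (v x - w x)^2)"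
  using L2_add_bound[OF L2_diff[OF H1_L2 H1_L2] L2_diff[OF H1_L2 H1_L2], OF assms(1,2,2,3)] by simp
 moreover have "(LINT x|vol. (wgrad u x $ i - wgrad w x $ i)^2) <=
   2 * (LINT x|vol. (wgrad u x $ i - wgrad v x $ i)^2) + 2 * (LINT x|vol. (wgrad v x $ i - wgrad w x $ i)^2)" for i
  using L2_add_bound[OF L2_diff[OF H1_grad_L2 H1_grad_L2] L2_diff[OF H1_grad_L2 H1_grad_L2], OF assms(1,2,2,3), of i i i i] by simp
 then have "(\<Sum>i\<in>UNIV. LINT x|vol. (wgrad u x $ i - wgrad w x $ i)^2) <=
   (\<Sum>i\<in>UNIV. 2 * (LINT x|vol. (wgrad u x $ i - wgrad v x $ i)^2) + 2 * (LINT x|vol. (wgrad v x $ i - wgrad w x $ i)^2))"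
  by (rule sum_mono)
 ultimately show ?thesis
  unfolding H1_norm_diff_sq[OF assms(1,2)] H1_norm_diff_sq[OF assms(2,3)] H1_norm_diff_sq[OF assms(1,3)]
  by (simp add: sum.distrib sum_distrib_left)
qed

lemma H1_norm_diff_commute:
 assumes "u \<in> H1 Om" "v \<in> H1 Om"
 shows "(H1_norm Om (%x. u x - v x))^2 = (H1_norm Om (%x. v x - u x))^2"
 unfolding H1_norm_diff_sq[OF assms] H1_norm_diff_sq[OF assms(2,1)] by (simp add: power2_commute)

lemma H1_lim_norm_sq: "H1_lim u v ==> (%k. (H1_norm Om (%x. u k x - v x))^2) ----> 0"
 using tendsto_power[of _ 0 sequentially 2] by (fastforce simp: H1_lim_def)

lemma H1_lim_norm:
 assumes "H1_lim u v"
 shows "(%k. (H1_norm Om (u k))^2) ----> (H1_norm Om v)\<^sup>2"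
proof -
 note D = H1_limD[OF assms]
 have s: "(H1_norm Om w)^2 = (LINT x|vol. (w x)^2) + (\<Sum>i\<in>UNIV. LINT x|vol. (wgrad w x $ i)^2)" if "w \<in> H1 Om" for w
  by (rule H1_norm_sq[OF that]) (use H1_grad_L2[OF that] in auto)
 show ?thesis unfolding s[OF D(1)] s[OF D(2)]
  by (rule tendsto_add[OF L2_lim_square[OF D(3)] tendsto_sum[OF L2_lim_square[OF D(4)]]])
qed

lemma smooth_trace_Cauchy:
 assumes ph: "!!k. smooth (ph k)" and lim: "H1_lim ph v"
 obtains g where "L2_lim sg ph g"
proof -
 interpret S: finite_measure sg by (rule finite_surface)
 obtain C where C: "C > 0" "!!ph. smooth ph ==> (LINT y|sg. (ph y)^2) <= C * (H1_norm Om ph)^2"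
  using trace_inequality by blast
 note D = H1_limD[OF lim]
 show thesis
 proof (rule S.L2_complete[of ph])
  show "ph k \<in> L2 sg" for k by (rule continuous_L2(2)[OF smooth_continuous_on[OF ph]])
  show "L2_lim sg ph g ==> thesis" for g by (rule that)
  fix e :: real assume e: "e > 0"
  have "e / (4 * C) > 0" using e C by simp
  then obtain N where "\<forall>k\<ge>N. norm ((H1_norm Om (%x. ph k x - v x))^2 - 0) < e / (4 * C)"
   using LIMSEQ_D[OF H1_lim_norm_sq[OF lim]] by blast
  then have N: "k \<ge> N ==> (H1_norm Om (%x. ph k x - v x))^2 < e / (4 * C)" for k by auto
  have "(LINT x|sg. (ph m x - ph n x)^2) < e" if mn: "m \<ge> N" "n \<ge> N" for m n
  proof -
   have "(LINT x|sg. (ph m x - ph n x)^2) <= C * (H1_norm Om (%x. ph m x - ph n x))^2"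
    by (rule C(2)[OF smooth_diff[OF ph ph]])
   also have "... <= C * (2 * (H1_norm Om (%x. ph m x - v x))^2 + 2 * (H1_norm Om (%x. ph n x - v x))^2)"
    using H1_norm_triangle_sq[OF D(1,2,1)] C(1) H1_norm_diff_commute[OF D(2,1)] by (intro mult_left_mono) (auto simp: less_imp_le)
   also have "... < C * (4 * (e / (4 * C)))"
    using N[OF mn(1)] N[OF mn(2)] C(1) by (intro mult_strict_left_mono) auto
   also have "... = e" using C(1) by simp
   finally show ?thesis .
  qed
  then show "\<exists>N. \<forall>m\<ge>N. \<forall>n\<ge>N. (LINT x|sg. (ph m x - ph n x)^2) < e" by blast
 qed
qed

lemma is_trace_iff:
 assumes "v \<in> H1 Om"
 shows "is_trace Om v g \<longleftrightarrow> (\<exists>ph. (\<forall>k. smooth (ph k)) \<and> H1_lim ph v \<and> L2_lim sg ph g)"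
 using assms continuous_L2(2)[OF smooth_continuous_on] smooth_H1(1)
 unfolding is_trace_def H1_lim_def L2_lim_def by blast

lemma is_trace_bd_trace:
 assumes v: "v \<in> H1 Om"
 shows "is_trace Om v (tr v)"
proof -
 obtain ph where ph: "!!k. smooth (ph k)" "H1_lim ph v" by (rule smooth_dense_H1[OF v]) (rule that)
 obtain g where g: "L2_lim sg ph g" using smooth_trace_Cauchy[OF ph] by blast
 have "is_trace Om v g" unfolding is_trace_iff[OF v] using ph g by blast
 then show ?thesis unfolding bd_trace_def by (rule someI[of "is_trace Om v"])
qed

lemma trace_limit:
 assumes ph: "!!k. smooth (ph k)" and lim: "H1_lim ph v"
 shows "L2_lim sg ph (tr v)"
proof -
 have v: "v \<in> H1 Om" by (rule H1_limD(2)[OF lim])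
 obtain ps where ps: "!!k. smooth (ps k)" "H1_lim ps v" "L2_lim sg ps (tr v)"
  using is_trace_bd_trace[OF v] unfolding is_trace_iff[OF v] by blast
 obtain C where C: "C > 0" "!!ph. smooth ph ==> (LINT y|sg. (ph y)^2) <= C * (H1_norm Om ph)^2"
  using trace_inequality by blast
 have "L2_lim sg (%k x. ph k x - ps k x) (%x. 0)"
  unfolding L2_lim_def
 proof (intro conjI allI)
  show "(%x. ph k x - ps k x) \<in> L2 sg" for k by (rule continuous_L2(2)[OF smooth_continuous_on[OF smooth_diff[OF ph ps(1)]]])
  show "(%x. 0) \<in> L2 sg" by (simp add: L2_def)
  let ?b = "%k. C * (2 * (H1_norm Om (%x. ph k x - v x))^2 + 2 * (H1_norm Om (%x. ps k x - v x))^2)"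
  have "?b ----> C * (2 * 0 + 2 * 0)"
   by (intro tendsto_mult tendsto_add tendsto_const H1_lim_norm_sq lim ps(2))
  then have b0: "?b ----> 0" by simp
  have "(LINT x|sg. (ph k x - ps k x - 0)^2) <= ?b k" for k
  proof -
   have "(LINT x|sg. (ph k x - ps k x)^2) <= C * (H1_norm Om (%x. ph k x - ps k x))^2"
    by (rule C(2)[OF smooth_diff[OF ph ps(1)]])
   also have "... <= ?b k"
    using H1_norm_triangle_sq[OF H1_limD(1)[OF lim] v H1_limD(1)[OF ps(2)]] C(1)
     H1_norm_diff_commute[OF v H1_limD(1)[OF ps(2)]] by (intro mult_left_mono) (auto simp: less_imp_le)
   finally show ?thesis by simp
  qed
  then show "(%k. LINT x|sg. (ph k x - ps k x - 0)^2) ----> 0"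
   by (intro LIMSEQ_squeeze_0[OF b0]) auto
 qed
 from L2_lim_add[OF this ps(3)] show ?thesis by simp
qed

lemma trace_L2: "v \<in> H1 Om ==> tr v \<in> L2 sg"
 using is_trace_bd_trace by (auto simp: is_trace_def)

lemma trace_eqI:
 assumes "!!k. smooth (ph k)" "H1_lim ph v" "L2_lim sg ph g"
 shows "AE x in sg. tr v x = g x"
 by (rule L2_lim_unique[OF trace_limit[OF assms(1,2)] assms(3)])

lemma trace_smooth:
 assumes ph: "smooth ph"
 shows "AE x in sg. tr ph x = ph x"
proof (rule trace_eqI)
 show "H1_lim (%_. ph) ph" using smooth_H1(1)[OF ph] by (intro H1_limI L2_lim_const H1_L2 H1_grad_L2)
 show "L2_lim sg (%_. ph) ph" by (intro L2_lim_const continuous_L2(2) smooth_continuous_on ph)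
qed (rule ph)

lemma trace_lincomb:
 assumes u: "u \<in> H1 Om" and v: "v \<in> H1 Om"
 shows "AE x in sg. tr (%x. a * u x + b * v x) x = a * tr u x + b * tr v x"
proof -
 obtain ph where ph: "!!k. smooth (ph k)" "H1_lim ph u" by (rule smooth_dense_H1[OF u]) (rule that)
 obtain ps where ps: "!!k. smooth (ps k)" "H1_lim ps v" by (rule smooth_dense_H1[OF v]) (rule that)
 show ?thesis
 proof (rule trace_eqI)
  show "smooth (%x. a * ph k x + b * ps k x)" for k
   by (intro smooth_add smooth_mult smooth_const ph(1) ps(1))
  show "H1_lim (%k x. a * ph k x + b * ps k x) (%x. a * u x + b * v x)" by (rule H1_lim_lincomb[OF ph(2) ps(2)])
  show "L2_lim sg (%k x. a * ph k x + b * ps k x) (%x. a * tr u x + b * tr v x)"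
   by (rule L2_lim_add[OF L2_lim_scale[OF trace_limit[OF ph]] L2_lim_scale[OF trace_limit[OF ps]]])
 qed
qed

lemma trace_bound:
 obtains C where "C > 0" "!!v. v \<in> H1 Om ==> (LINT y|sg. (tr v y)^2) <= C * (H1_norm Om v)^2"
proof -
 obtain C where C: "C > 0" "!!ph. smooth ph ==> (LINT y|sg. (ph y)^2) <= C * (H1_norm Om ph)^2"
  using trace_inequality by blast
 have "(LINT y|sg. (tr v y)^2) <= C * (H1_norm Om v)^2" if v: "v \<in> H1 Om" for v
 proof -
  obtain ph where ph: "!!k. smooth (ph k)" "H1_lim ph v" by (rule smooth_dense_H1[OF v]) (rule that)
  show ?thesis
   by (rule LIMSEQ_le[OF L2_lim_square[OF trace_limit[OF ph]] tendsto_mult_left[OF H1_lim_norm[OF ph(2)]]])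
    (use C(2)[OF ph(1)] in blast)
 qed
 with C(1) show thesis by (rule that)
qed

lemma trace_bounded:
 assumes v: "v \<in> H1 Om" and M: "AE x in vol. \<bar>v x\<bar> <= M"
 obtains C where "AE x in sg. \<bar>tr v x\<bar> <= C"
proof -
 obtain ph where ph: "!!k. smooth (ph k)" "H1_lim ph v" "!!M. AE x in vol. \<bar>v x\<bar> <= M ==> \<exists>C. \<forall>k x. \<bar>ph k x\<bar> <= C"
  by (rule smooth_dense_H1[OF v]) (rule that)
 from ph(3)[OF M] obtain C where C: "!!k x. \<bar>ph k x\<bar> <= C" by blast
 show thesis by (rule that, rule L2_lim_bounded[OF trace_limit[OF ph(1,2)], of C]) (simp add: C)
qed

end

context lipschitz_polyhedron
begin

lemma Hhalf_I: "v \<in> H1 Om ==> g \<in> borel_measurable borel ==> AE x in sg. tr v x = g x ==> g \<in> Hhalf Om"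
 by (auto simp: Hhalf_def)

lemma Hhalf_E:
 assumes "g \<in> Hhalf Om"
 obtains v where "v \<in> H1 Om" "AE x in sg. tr v x = g x"
 using assms by (auto simp: Hhalf_def)

lemma trace_Hhalf: "v \<in> H1 Om ==> tr v \<in> Hhalf Om"
 by (rule Hhalf_I) (auto intro: L2_surface_borel trace_L2)

lemma smooth_Hhalf: "smooth ph ==> ph \<in> Hhalf Om"
 by (rule Hhalf_I[OF smooth_H1(1) smooth_measurable trace_smooth])

lemma Hhalf_L2:
 assumes "g \<in> Hhalf Om"
 shows "g \<in> L2 sg"
proof -
 obtain v where v: "v \<in> H1 Om" "AE x in sg. tr v x = g x" by (rule Hhalf_E[OF assms])
 show ?thesis by (rule L2_cong_AE[OF trace_L2[OF v(1)] _ v(2)]) (use assms in \<open>simp add: Hhalf_def measurable_cong_sets[OF sets_surface_measure refl]\<close>)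
qed

lemma Hhalf_lincomb:
 assumes g: "g \<in> Hhalf Om" and h: "h \<in> Hhalf Om"
 shows "(%x. a * g x + b * h x) \<in> Hhalf Om"
proof -
 obtain u where u: "u \<in> H1 Om" "AE x in sg. tr u x = g x" by (rule Hhalf_E[OF g])
 obtain v where v: "v \<in> H1 Om" "AE x in sg. tr v x = h x" by (rule Hhalf_E[OF h])
 show ?thesis
 proof (rule Hhalf_I[OF H1_lincomb(1)[OF u(1) v(1), of a b]])
  show "(%x. a * g x + b * h x) \<in> borel_measurable borel"
   using g h by (auto simp: Hhalf_def intro!: borel_measurable_add borel_measurable_times)
  show "AE x in sg. tr (%x. a * u x + b * v x) x = a * g x + b * h x"
   using trace_lincomb[OF u(1) v(1), of a b] u(2) v(2) by eventually_elim simp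
 qed
qed

lemma Hhalf_add_scale: "g \<in> Hhalf Om ==> h \<in> Hhalf Om ==> (%x. a * g x + h x) \<in> Hhalf Om"
 and Hhalf_scale: "g \<in> Hhalf Om ==> (%x. a * g x) \<in> Hhalf Om"
 and Hhalf_diff: "g \<in> Hhalf Om ==> h \<in> Hhalf Om ==> (%x. g x - h x) \<in> Hhalf Om"
 using Hhalf_lincomb[of g h a 1] Hhalf_lincomb[of g g a 0] Hhalf_lincomb[of g h 1 "-1"] by simp_all

lemma Hhalf_norm_le:
 assumes "v \<in> H1 Om" "AE x in sg. tr v x = g x"
 shows "Hhalf_norm Om g <= H1_norm Om v"
 unfolding Hhalf_norm_def
 by (rule cInf_lower) (use assms in \<open>auto intro!: bdd_belowI[of _ 0] H1_norm_nonneg\<close>)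

lemma Hhalf_norm_trace_le: "v \<in> H1 Om ==> Hhalf_norm Om (tr v) <= H1_norm Om v"
 by (rule Hhalf_norm_le) auto

lemma Hhalf_norm_nonneg: "g \<in> Hhalf Om ==> Hhalf_norm Om g \<ge> 0"
 unfolding Hhalf_norm_def by (rule cInf_greatest) (auto intro: H1_norm_nonneg simp: Hhalf_def)

lemma Hhalf_norm_approx:
 assumes g: "g \<in> Hhalf Om" and e: "e > 0"
 obtains v where "v \<in> H1 Om" "AE x in sg. tr v x = g x" "H1_norm Om v < Hhalf_norm Om g + e"
proof -
 let ?S = "{H1_norm Om v | v. v \<in> H1 Om \<and> (AE x in sg. tr v x = g x)}"
 have "?S ~= {}" using g by (auto simp: Hhalf_def)
 moreover have "Inf ?S < Hhalf_norm Om g + e" using e by (simp add: Hhalf_norm_def)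
 ultimately obtain s where "s \<in> ?S" "s < Hhalf_norm Om g + e" by (rule cInf_lessD[THEN bexE])
 then show thesis using that by auto
qed

lemma H1_norm_scale:
 assumes v: "v \<in> H1 Om"
 shows "H1_norm Om (%x. a * v x) = \<bar>a\<bar> * H1_norm Om v"
proof -
 have l: "(%x. a * v x) \<in> H1 Om" "AE x in vol. wgrad (%x. a * v x) x = a *\<^sub>R wgrad v x"
  using H1_lincomb[OF v v, of a 0] by simp_all
 have "(H1_norm Om (%x. a * v x))^2 = (LINT x|vol. (a * v x)^2) + (\<Sum>i\<in>UNIV. LINT x|vol. ((a *\<^sub>R wgrad v x) $ i)^2)"
  by (rule H1_norm_sq[OF l]) (simp add: L2_scale[OF H1_grad_L2[OF v]])
 also have "... = a^2 * (H1_norm Om v)^2"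
  unfolding H1_norm_sq[OF v AE_I2[OF refl] H1_grad_L2[OF v]]
  by (simp add: power_mult_distrib sum_distrib_left algebra_simps)
 also have "... = (\<bar>a\<bar> * H1_norm Om v)^2" by (simp add: power_mult_distrib)
 finally show ?thesis by (rule power2_eq_imp_eq) (auto intro!: mult_nonneg_nonneg H1_norm_nonneg)
qed

lemma Hhalf_norm_scale_le:
 assumes g: "g \<in> Hhalf Om"
 shows "Hhalf_norm Om (%x. a * g x) <= \<bar>a\<bar> * Hhalf_norm Om g"
proof (rule field_le_epsilon)
 fix e :: real assume e: "e > 0"
 then have "e / (\<bar>a\<bar> + 1) > 0" by simp
 then obtain v where v: "v \<in> H1 Om" "AE x in sg. tr v x = g x" "H1_norm Om v < Hhalf_norm Om g + e / (\<bar>a\<bar> + 1)"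
  using Hhalf_norm_approx[OF g] by blast
 have av: "(%x. a * v x) \<in> H1 Om" using H1_lincomb(1)[OF v(1) v(1), of a 0] by simp
 have "AE x in sg. tr (%x. a * v x + 0 * v x) x = a * g x" using trace_lincomb[OF v(1) v(1), of a 0] v(2) by eventually_elim simp
 then have "Hhalf_norm Om (%x. a * g x) <= H1_norm Om (%x. a * v x)" by (intro Hhalf_norm_le av) simp
 also have "... <= \<bar>a\<bar> * (Hhalf_norm Om g + e / (\<bar>a\<bar> + 1))"
  unfolding H1_norm_scale[OF v(1)] using v(3) by (intro mult_left_mono) auto
 also have "... <= \<bar>a\<bar> * Hhalf_norm Om g + e" using e by (simp add: field_simps)
 finally show "Hhalf_norm Om (%x. a * g x) <= \<bar>a\<bar> * Hhalf_norm Om g + e" .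
qed

lemma Hhalf_norm_0:
 assumes "g \<in> Hhalf Om" "AE x in sg. g x = 0"
 shows "Hhalf_norm Om g = 0"
proof (rule antisym[OF _ Hhalf_norm_nonneg[OF assms(1)]])
 have v: "(%x. 0 :: real) \<in> H1 Om" by (rule smooth_H1(1)[OF smooth_const])
 have "H1_norm Om (%x. 0) = 0" using H1_norm_scale[OF v, of 0] by simp
 moreover have "AE x in sg. tr (%x. 0) x = g x" using trace_smooth[OF smooth_const, of 0] assms(2) by eventually_elim simp
 ultimately show "Hhalf_norm Om g <= 0" using Hhalf_norm_le[OF v] by force
qed

lemma Hhalf_L2_bound:
 obtains C where "C \<ge> 0" "!!g. g \<in> Hhalf Om ==> sqrt (LINT x|sg. (g x)^2) <= C * Hhalf_norm Om g"
proof -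
 obtain C where C: "C > 0" "!!v. v \<in> H1 Om ==> (LINT y|sg. (tr v y)^2) <= C * (H1_norm Om v)^2"
  by (rule trace_bound) (rule that)
 have "sqrt (LINT x|sg. (g x)^2) <= sqrt C * Hhalf_norm Om g" if g: "g \<in> Hhalf Om" for g
 proof (rule field_le_epsilon)
  fix e :: real assume e: "e > 0"
  then have "e / sqrt C > 0" using C by simp
  then obtain v where v: "v \<in> H1 Om" "AE x in sg. tr v x = g x" "H1_norm Om v < Hhalf_norm Om g + e / sqrt C"
   using Hhalf_norm_approx[OF g] by blast
  have "(LINT x|sg. (g x)^2) = (LINT x|sg. (tr v x)^2)"
  proof (rule integral_cong_AE)
   show "AE x in sg. (g x)^2 = (tr v x)^2" using v(2) by eventually_elim simp
  qed (use L2_measurable[OF Hhalf_L2[OF g]] L2_measurable[OF trace_L2[OF v(1)]] in \<open>auto intro!: borel_measurable_power\<close>)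
  also have "... <= C * (H1_norm Om v)^2" by (rule C(2)[OF v(1)])
  finally have "sqrt (LINT x|sg. (g x)^2) <= sqrt (C * (H1_norm Om v)^2)" by (rule real_sqrt_le_mono)
  also have "... = sqrt C * H1_norm Om v" by (simp add: real_sqrt_mult H1_norm_nonneg)
  also have "... <= sqrt C * (Hhalf_norm Om g + e / sqrt C)" using v(3) C(1) by (intro mult_left_mono) auto
  also have "... = sqrt C * Hhalf_norm Om g + e" using C(1) by (simp add: distrib_left)
  finally show "sqrt (LINT x|sg. (g x)^2) <= sqrt C * Hhalf_norm Om g + e" .
 qed
 then show thesis using that[of "sqrt C"] C(1) by simp
qed

lemma Hmhalf_linear:
 assumes "ps \<in> Hmhalf Om" "g \<in> Hhalf Om" "h \<in> Hhalf Om"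
 shows "ps (%x. a * g x + h x) = a * ps g + ps h"
 using assms by (auto simp: Hmhalf_def)

lemma Hmhalf_E:
 assumes "ps \<in> Hmhalf Om"
 obtains C where "C \<ge> 0" "!!g. g \<in> Hhalf Om ==> \<bar>ps g\<bar> <= C * Hhalf_norm Om g"
proof -
 obtain C where C: "!!g. g \<in> Hhalf Om ==> \<bar>ps g\<bar> <= C * Hhalf_norm Om g" using assms unfolding Hmhalf_def by blast
 have "\<bar>ps g\<bar> <= \<bar>C\<bar> * Hhalf_norm Om g" if "g \<in> Hhalf Om" for g
  using C[OF that] mult_right_mono[OF abs_ge_self Hhalf_norm_nonneg[OF that], of C] by linarith
 then show thesis using that[of "\<bar>C\<bar>"] by simp
qed

lemma Hmhalf_diff:
 assumes "ps \<in> Hmhalf Om" "g \<in> Hhalf Om" "h \<in> Hhalf Om"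
 shows "ps (%x. g x - h x) = ps g - ps h"
 using Hmhalf_linear[OF assms(1,3,2), of "-1"] by simp

lemma Hmhalf_cong:
 assumes ps: "ps \<in> Hmhalf Om" and g: "g \<in> Hhalf Om" "h \<in> Hhalf Om" and AE: "AE x in sg. g x = h x"
 shows "ps g = ps h"
proof -
 have "AE x in sg. g x - h x = 0" using AE by eventually_elim simp
 then have "Hhalf_norm Om (%x. g x - h x) = 0" by (rule Hhalf_norm_0[OF Hhalf_diff[OF g]])
 moreover obtain C where "!!g. g \<in> Hhalf Om ==> \<bar>ps g\<bar> <= C * Hhalf_norm Om g" by (rule Hmhalf_E[OF ps]) (rule that)
 ultimately have "\<bar>ps (%x. g x - h x)\<bar> <= 0" using Hhalf_diff[OF g] by fastforce
 then show ?thesis using Hmhalf_diff[OF ps g] by simp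
qed

lemma Hmhalf_bound:
 assumes ps: "ps \<in> Hmhalf Om" and g: "g \<in> Hhalf Om"
 shows "\<bar>ps g\<bar> <= Hmhalf_norm Om ps * Hhalf_norm Om g"
proof -
 obtain C where C: "C \<ge> 0" "!!g. g \<in> Hhalf Om ==> \<bar>ps g\<bar> <= C * Hhalf_norm Om g" by (rule Hmhalf_E[OF ps]) (rule that)
 let ?S = "(%g. \<bar>ps g\<bar>) ` {g \<in> Hhalf Om. Hhalf_norm Om g <= 1}"
 have "bdd_above ?S"
 proof (rule bdd_aboveI)
  fix s assume "s \<in> ?S"
  then obtain g where g: "g \<in> Hhalf Om" "Hhalf_norm Om g <= 1" "s = \<bar>ps g\<bar>" by blast
  then show "s <= C" using C(2)[OF g(1)] mult_left_mono[OF g(2) C(1)] by simp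
 qed
 then have up: "\<bar>ps g\<bar> <= Hmhalf_norm Om ps" if "g \<in> Hhalf Om" "Hhalf_norm Om g <= 1" for g
  unfolding Hmhalf_norm_def using that by (intro cSUP_upper) auto
 show ?thesis
 proof (cases "Hhalf_norm Om g = 0")
  case True
  then show ?thesis using C(2)[OF g] by simp
 next
  case False
  then have n: "Hhalf_norm Om g > 0" using Hhalf_norm_nonneg[OF g] by simp
  let ?a = "1 / Hhalf_norm Om g"
  have "\<bar>ps (%x. ?a * g x)\<bar> <= Hmhalf_norm Om ps"
   by (rule up[OF Hhalf_scale[OF g]]) (use Hhalf_norm_scale_le[OF g, of ?a] n in simp)
  moreover have "ps (%x. (?a - 1) * g x + g x) = (?a - 1) * ps g + ps g" by (rule Hmhalf_linear[OF ps g g])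
  then have "ps (%x. ?a * g x) = ?a * ps g" by (simp add: algebra_simps)
  ultimately have "\<bar>?a * ps g\<bar> <= Hmhalf_norm Om ps" by (simp only:)
  then show ?thesis using n by (simp add: abs_mult pos_divide_le_eq)
 qed
qed

lemma Hmhalf_lincomb:
 assumes ph: "ph \<in> Hmhalf Om" and ps: "ps \<in> Hmhalf Om"
 shows "(%g. a * ph g + ps g) \<in> Hmhalf Om"
proof -
 have "\<bar>a * ph g + ps g\<bar> <= (\<bar>a\<bar> * Hmhalf_norm Om ph + Hmhalf_norm Om ps) * Hhalf_norm Om g" if g: "g \<in> Hhalf Om" for g
 proof -
  have "\<bar>a * ph g + ps g\<bar> <= \<bar>a\<bar> * \<bar>ph g\<bar> + \<bar>ps g\<bar>" by (metis abs_mult abs_triangle_ineq)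
  also have "... <= \<bar>a\<bar> * (Hmhalf_norm Om ph * Hhalf_norm Om g) + Hmhalf_norm Om ps * Hhalf_norm Om g"
   by (intro add_mono mult_left_mono Hmhalf_bound ph ps g) auto
  finally show ?thesis by (simp add: algebra_simps)
 qed
 moreover have "a * ph (%x. s * g x + h x) + ps (%x. s * g x + h x) = s * (a * ph g + ps g) + (a * ph h + ps h)"
  if "g \<in> Hhalf Om" "h \<in> Hhalf Om" for g h s
  unfolding Hmhalf_linear[OF ph that] Hmhalf_linear[OF ps that] by (simp add: algebra_simps)
 ultimately show ?thesis unfolding Hmhalf_def by blast
qed

abbreviation density_functional :: "(real^'n => real) => (real^'n => real) => real" where
 "density_functional f \<equiv> %g. LINT y|sg. f y * g y"

lemma density_functional_Hmhalf:
 assumes f: "f \<in> L2 sg"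
 shows "density_functional f \<in> Hmhalf Om"
proof -
 obtain C where C: "C \<ge> 0" "!!g. g \<in> Hhalf Om ==> sqrt (LINT x|sg. (g x)^2) <= C * Hhalf_norm Om g"
  by (rule Hhalf_L2_bound) (rule that)
 have "\<bar>LINT y|sg. f y * g y\<bar> <= (sqrt (LINT y|sg. (f y)^2) * C) * Hhalf_norm Om g" if g: "g \<in> Hhalf Om" for g
 proof -
  have "\<bar>LINT y|sg. f y * g y\<bar> <= sqrt (LINT y|sg. (f y)^2) * sqrt (LINT y|sg. (g y)^2)"
   by (rule L2_Cauchy_Schwarz[OF f Hhalf_L2[OF g]])
  also have "... <= sqrt (LINT y|sg. (f y)^2) * (C * Hhalf_norm Om g)" by (intro mult_left_mono C(2) g) simp
  finally show ?thesis by (simp add: mult.assoc)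
 qed
 moreover have "(LINT y|sg. f y * (a * g y + h y)) = a * (LINT y|sg. f y * g y) + (LINT y|sg. f y * h y)"
  if "g \<in> Hhalf Om" "h \<in> Hhalf Om" for g h a
 proof -
  have "(LINT y|sg. f y * (a * g y + h y)) = (LINT y|sg. a * (f y * g y) + f y * h y)" by (simp add: algebra_simps)
  also have "... = a * (LINT y|sg. f y * g y) + (LINT y|sg. f y * h y)"
   using L2_mult_integrable[OF f Hhalf_L2[OF that(1)]] L2_mult_integrable[OF f Hhalf_L2[OF that(2)]]
   by (subst Bochner_Integration.integral_add) auto
  finally show ?thesis .
 qed
 ultimately show ?thesis unfolding Hmhalf_def by blast
qed

lemma Hmhalf_trace_limit:
 assumes ps: "ps \<in> Hmhalf Om" and lim: "H1_lim u v"
 shows "(%k. ps (tr (u k))) ----> ps (tr v)"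
proof -
 note D = H1_limD(1,2)[OF lim]
 have "\<bar>ps (tr (u k)) - ps (tr v)\<bar> <= \<bar>Hmhalf_norm Om ps\<bar> * H1_norm Om (%x. u k x - v x)" for k
 proof -
  let ?d = "%x. u k x - v x"
  have d: "?d \<in> H1 Om" by (rule H1_diff(1)[OF D])
  have "AE x in sg. tr ?d x = tr (u k) x - tr v x" using trace_lincomb[OF D(1)[of k] D(2), of 1 "-1"] by simp
  then have "ps (tr ?d) = ps (%x. tr (u k) x - tr v x)"
   by (intro Hmhalf_cong ps trace_Hhalf d Hhalf_diff D)
  also have "... = ps (tr (u k)) - ps (tr v)" by (intro Hmhalf_diff ps trace_Hhalf D)
  finally have "\<bar>ps (tr (u k)) - ps (tr v)\<bar> <= Hmhalf_norm Om ps * Hhalf_norm Om (tr ?d)"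
   using Hmhalf_bound[OF ps trace_Hhalf[OF d]] by simp
  also have "... <= \<bar>Hmhalf_norm Om ps\<bar> * Hhalf_norm Om (tr ?d)"
   by (intro mult_right_mono abs_ge_self Hhalf_norm_nonneg trace_Hhalf d)
  also have "... <= \<bar>Hmhalf_norm Om ps\<bar> * H1_norm Om ?d" by (intro mult_left_mono Hhalf_norm_trace_le d) simp
  finally show ?thesis .
 qed
 note le = this
 have "(%k. \<bar>Hmhalf_norm Om ps\<bar> * H1_norm Om (%x. u k x - v x)) ----> \<bar>Hmhalf_norm Om ps\<bar> * 0"
  using lim by (intro tendsto_mult_left) (simp add: H1_lim_def)
 then have "(%k. \<bar>ps (tr (u k)) - ps (tr v)\<bar>) ----> 0"
  by (intro LIMSEQ_squeeze_0[OF _ abs_ge_zero le]) simp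
 then show ?thesis by (simp add: tendsto_rabs_zero_iff LIM_zero_iff)
qed

end

lemma nonneg_quadratic_linear_part:
 fixes a b :: real
 assumes "a \<ge> 0" and q: "!!t. 0 <= 2 * t * a + t^2 * b"
 shows "a = 0"
proof (rule ccontr)
 assume "a ~= 0"
 then have a: "a > 0" using assms(1) by simp
 define c where "c = \<bar>b\<bar> + 1"
 have c: "c > 0" "b <= c" by (auto simp: c_def)
 have "(a / c)^2 * b <= (a / c)^2 * c" using c by (intro mult_left_mono) auto
 also have "... = a^2 / c" using c by (simp add: power2_eq_square)
 finally have "2 * (- (a / c)) * a + (- (a / c))^2 * b <= - (a^2 / c)" by (simp add: power2_eq_square)
 also have "... < 0" using a c by simp
 finally show False using q[of "- (a / c)"] by linarith
qed

lemma quadratic_form_minimizer: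
 fixes f :: "'a::euclidean_space => 'a"
 assumes W: "subspace W" "W ~= {0}" and f: "linear f" "!!x y. f x \<bullet> y = x \<bullet> f y" "f ` W \<subseteq> W"
 obtains e mu where "e \<in> W" "norm e = 1" "f e = mu *\<^sub>R e"
proof -
 let ?S = "W \<inter> sphere 0 1"
 have "compact ?S" using W(1) by (intro closed_Int_compact closed_subspace compact_sphere)
 moreover have "?S ~= {}"
 proof -
  obtain w where w: "w \<in> W" "w ~= 0" using W subspace_0 by blast
  then have "(1 / norm w) *\<^sub>R w \<in> ?S" using subspace_scale[OF W(1)] by simp
  then show ?thesis by blast
 qed
 moreover have "continuous_on ?S (%x. x \<bullet> f x)"
  using f(1) by (intro continuous_intros linear_continuous_on linear_conv_bounded_linear[THEN iffD1])
 ultimately have "\<exists>x\<in>?S. \<forall>y\<in>?S. x \<bullet> f x <= y \<bullet> f y" by (rule continuous_attains_inf)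
 then obtain e where e: "e \<in> W" "norm e = 1" and min: "!!y. y \<in> W ==> norm y = 1 ==> e \<bullet> f e <= y \<bullet> f y"
  by (simp add: Bex_def Ball_def) blast
 define m where "m = e \<bullet> f e"
 define w where "w = f e - m *\<^sub>R e"
 have ray: "m * (y \<bullet> y) <= y \<bullet> f y" if y: "y \<in> W" for y
 proof (cases "y = 0")
  case False
  have "m <= ((1 / norm y) *\<^sub>R y) \<bullet> f ((1 / norm y) *\<^sub>R y)"
   using False y unfolding m_def by (intro min subspace_scale[OF W(1)]) auto
  also have "... = (y \<bullet> f y) / (y \<bullet> y)"
   by (simp add: linear_scale[OF f(1)] power2_norm_eq_inner[symmetric] power2_eq_square)
  finally show ?thesis using False by (simp add: pos_le_divide_eq)
 qed (simp add: linear_0[OF f(1)])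
 have ee: "e \<bullet> e = 1" using e(2) by (simp add: norm_1_inner)
 have wW: "w \<in> W" unfolding w_def using e(1) f(3) W(1) by (auto intro!: subspace_diff subspace_scale)
 have we: "w \<bullet> e = 0" by (simp add: w_def m_def inner_diff_left ee inner_commute[of "f e"])
 have few: "f e = w + m *\<^sub>R e" by (simp add: w_def)
 have wfe: "w \<bullet> f e = w \<bullet> w" using we by (simp add: few inner_add_right)
 have efw: "e \<bullet> f w = w \<bullet> w" using f(2)[of e w] wfe by (simp add: inner_commute)
 have q: "0 <= 2 * t * (w \<bullet> w) + t^2 * (w \<bullet> f w - m * (w \<bullet> w))" for t
 proof -
  have "e + t *\<^sub>R w \<in> W" by (intro subspace_add subspace_scale W(1) e(1) wW)
  from ray[OF this] have h1: "m * ((e + t *\<^sub>R w) \<bullet> (e + t *\<^sub>R w)) <= (e + t *\<^sub>R w) \<bullet> (f e + t *\<^sub>R f w)"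
   by (simp only: linear_add[OF f(1)] linear_scale[OF f(1)])
  have h2: "(e + t *\<^sub>R w) \<bullet> (e + t *\<^sub>R w) = 1 + t^2 * (w \<bullet> w)"
   using we by (simp add: inner_add_left inner_add_right ee inner_commute[of e w] power2_eq_square)
  have h3: "(e + t *\<^sub>R w) \<bullet> (f e + t *\<^sub>R f w) = m + 2 * t * (w \<bullet> w) + t^2 * (w \<bullet> f w)"
   by (simp only: inner_add_left inner_add_right inner_scaleR_left inner_scaleR_right wfe efw m_def[symmetric])
    (simp add: power2_eq_square algebra_simps)
  have "m * 1 + m * (t^2 * (w \<bullet> w)) <= m + 2 * t * (w \<bullet> w) + t^2 * (w \<bullet> f w)"
   using h1 unfolding h2 h3 distrib_left .
  then show ?thesis unfolding right_diff_distrib by (simp add: mult.left_commute)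
 qed
 from nonneg_quadratic_linear_part[OF inner_ge_zero q] have "w \<bullet> w = 0" .
 then have "f e = m *\<^sub>R e" by (simp add: w_def)
 with e show thesis by (rule that)
qed

lemma symmetric_eigenbasis_subspace:
 fixes f :: "'a::euclidean_space => 'a"
 assumes f: "linear f" "!!x y. f x \<bullet> y = x \<bullet> f y"
 shows "subspace W ==> f ` W \<subseteq> W ==>
  \<exists>B. finite B \<and> B \<subseteq> W \<and> (\<forall>e\<in>B. norm e = 1 \<and> (\<exists>mu. f e = mu *\<^sub>R e)) \<and> pairwise orthogonal B \<and> W \<subseteq> span B"
proof (induction "dim W" arbitrary: W rule: less_induct)
 case (less W)
 show ?case
 proof (cases "W = {0}")
  case True
  then show ?thesis by (intro exI[of _ "{}"]) auto
 next
  case False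
  obtain e mu where e: "e \<in> W" "norm e = 1" "f e = mu *\<^sub>R e"
   by (rule quadratic_form_minimizer[OF less.prems(1) False f less.prems(2)])
  let ?W = "W \<inter> {x. e \<bullet> x = 0}"
  have ee: "e \<bullet> e = 1" using e(2) by (simp add: norm_1_inner)
  have sub: "subspace ?W" using less.prems(1) by (intro subspace_inter subspace_hyperplane)
  have "e \<bullet> f x = 0" if "e \<bullet> x = 0" for x using f(2)[of e x] e(3) that by simp
  then have inv: "f ` ?W \<subseteq> ?W" using less.prems(2) by blast
  have "e \<notin> ?W" using ee by simp
  then have "?W \<subset> W" using e(1) by blast
  then have "dim ?W < dim W" using sub less.prems(1)
   by (metis dim_psubset span_eq_iff)
  from less.hyps[OF this sub inv] obtain B where B: "finite B" "B \<subseteq> ?W" "\<forall>e\<in>B. norm e = 1 \<and> (\<exists>mu. f e = mu *\<^sub>R e)"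
   "pairwise orthogonal B" "?W \<subseteq> span B" by blast
  have "W \<subseteq> span (insert e B)"
  proof
   fix x assume x: "x \<in> W"
   have "x - (e \<bullet> x) *\<^sub>R e \<in> ?W"
    using x e(1) less.prems(1) by (auto intro!: subspace_diff subspace_scale simp: inner_diff_right ee)
   then have "x - (e \<bullet> x) *\<^sub>R e \<in> span (insert e B)" using B(5) span_mono[of B "insert e B"] by blast
   moreover have "(e \<bullet> x) *\<^sub>R e \<in> span (insert e B)" by (intro span_scale span_base) simp
   ultimately have "(x - (e \<bullet> x) *\<^sub>R e) + (e \<bullet> x) *\<^sub>R e \<in> span (insert e B)" by (rule span_add)
   then show "x \<in> span (insert e B)" by simp
  qed
  moreover have "pairwise orthogonal (insert e B)"
   using B(2,4) by (auto simp: pairwise_insert orthogonal_def inner_commute[of e])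
  ultimately show ?thesis using B(1,2,3) e by (intro exI[of _ "insert e B"]) auto
 qed
qed

lemma symmetric_eigenbasis:
 fixes M :: "real^'n^'n"
 assumes M: "transpose M = M"
 obtains B mu where "finite B" "!!e. e \<in> B ==> norm e = 1" "!!e. e \<in> B ==> M *v e = mu e *\<^sub>R e"
  "!!e e'. e \<in> B ==> e' \<in> B ==> e \<bullet> e' = (if e = e' then 1 else 0)" "!!x. x = (\<Sum>e\<in>B. (e \<bullet> x) *\<^sub>R e)"
proof -
 have "\<exists>B. finite B \<and> B \<subseteq> UNIV \<and> (\<forall>e\<in>B. norm e = 1 \<and> (\<exists>mu. M *v e = mu *\<^sub>R e)) \<and> pairwise orthogonal B \<and> UNIV \<subseteq> span B"
  by (rule symmetric_eigenbasis_subspace) (auto simp: dot_lmul_matrix[symmetric] M transpose_matrix_vector[symmetric])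
 then obtain B where B: "finite B" "!!e. e \<in> B ==> norm e = 1" "\<forall>e\<in>B. \<exists>mu. M *v e = mu *\<^sub>R e" "pairwise orthogonal B" "span B = UNIV"
  by blast
 from bchoice[OF B(3)] obtain mu where mu: "!!e. e \<in> B ==> M *v e = mu e *\<^sub>R e" by blast
 have on: "e \<bullet> e' = (if e = e' then 1 else 0)" if "e \<in> B" "e' \<in> B" for e e'
  using that B(2)[OF that(1)] B(4) by (auto simp: pairwise_def orthogonal_def norm_1_inner)
 have "x = (\<Sum>e\<in>B. (e \<bullet> x) *\<^sub>R e)" for x
 proof -
  have "x \<in> span B" using B(5) by simp
  then obtain u where u: "x = (\<Sum>e\<in>B. u e *\<^sub>R e)" using span_finite[OF B(1)] by auto
  have "e \<bullet> x = u e" if "e \<in> B" for e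
   unfolding u inner_sum_right inner_scaleR_right using that B(1) by (simp add: on if_distrib[of "(*) _"] cong: sum.cong if_cong)
  then have "(\<Sum>e\<in>B. (e \<bullet> x) *\<^sub>R e) = (\<Sum>e\<in>B. u e *\<^sub>R e)" by (intro sum.cong refl) simp
  then show ?thesis using u by simp
 qed
 from that[OF B(1,2) mu on this] show thesis .
qed

lemma min_eigenvalue:
 fixes M :: "real^'n^'n"
 assumes M: "transpose M = M"
 shows symmetric_quadratic_form_ge: "x \<bullet> (M *v x) \<ge> min_eigenvalue M * (norm x)^2"
  and min_eigenvalue_ge: "(!!\<xi>. \<xi> \<bullet> (M *v \<xi>) \<ge> al * (norm \<xi>)^2) ==> al <= min_eigenvalue M"
proof -
 obtain B mu where B: "finite B" "!!e. e \<in> B ==> norm e = 1" "!!e. e \<in> B ==> M *v e = mu e *\<^sub>R e"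
  "!!e e'. e \<in> B ==> e' \<in> B ==> e \<bullet> e' = (if e = e' then 1 else 0)" "!!x. x = (\<Sum>e\<in>B. (e \<bullet> x) *\<^sub>R e)"
  by (rule symmetric_eigenbasis[OF M]) (rule that)
 have Mx: "x \<bullet> (M *v x) = (\<Sum>e\<in>B. mu e * (e \<bullet> x)^2)" for x
 proof -
  have "M *v x = (\<Sum>e\<in>B. (e \<bullet> x) *\<^sub>R (M *v e))"
   using arg_cong[OF B(5)[of x], of "(*v) M"] by (simp add: linear_sum[OF matrix_vector_mul_linear] linear_scale[OF matrix_vector_mul_linear])
  then show ?thesis by (simp add: B(3) inner_sum_right inner_commute[of x] power2_eq_square mult_ac)
 qed
 have xx: "(norm x)^2 = (\<Sum>e\<in>B. (e \<bullet> x)^2)" for x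
 proof -
  have "x \<bullet> x = x \<bullet> (\<Sum>e\<in>B. (e \<bullet> x) *\<^sub>R e)" by (rule arg_cong[OF B(5)])
  also have "... = (\<Sum>e\<in>B. (e \<bullet> x)^2)"
   unfolding inner_sum_right inner_scaleR_right by (intro sum.cong refl) (simp add: inner_commute power2_eq_square)
  finally show ?thesis by (simp only: power2_norm_eq_inner)
 qed
 have "B ~= {}"
 proof
  assume "B = {}"
  then have "(1 :: real^'n) = 0" using B(5)[of 1] by simp
  then have "(1 :: real^'n) $ i = 0 $ i" for i by (simp only:)
  then show False by simp
 qed
 define m where "m = Min (mu ` B)"
 have mle: "m <= mu e" if "e \<in> B" for e using that B(1) by (auto simp: m_def)
 have ray: "m * (norm x)^2 <= x \<bullet> (M *v x)" for x
  unfolding Mx xx sum_distrib_left by (intro sum_mono mult_right_mono mle) auto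
 have "m \<in> mu ` B" unfolding m_def using B(1) \<open>B ~= {}\<close> by (intro Min_in) auto
 then obtain e where e: "e \<in> B" "mu e = m" by blast
 have min: "min_eigenvalue M = m"
  unfolding min_eigenvalue_def
 proof (rule Least_equality)
  show "\<exists>\<xi>. \<xi> ~= 0 \<and> M *v \<xi> = m *\<^sub>R \<xi>" using e B(2)[OF e(1)] B(3)[OF e(1)] by (intro exI[of _ e]) auto
  fix y assume "\<exists>\<xi>. \<xi> ~= 0 \<and> M *v \<xi> = y *\<^sub>R \<xi>"
  then obtain \<xi> where "\<xi> ~= 0" "M *v \<xi> = y *\<^sub>R \<xi>" by blast
  then show "m <= y" using ray[of \<xi>] by (simp add: power2_norm_eq_inner)
 qed
 then show "x \<bullet> (M *v x) \<ge> min_eigenvalue M * (norm x)^2" using ray by simp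
 show "al <= min_eigenvalue M" if al: "!!\<xi>. \<xi> \<bullet> (M *v \<xi>) \<ge> al * (norm \<xi>)^2"
  using al[of e] B(2)[OF e(1)] B(3)[OF e(1)] e(2) by (simp add: min norm_1_inner)
qed

lemma matrix_sqrt:
 fixes M :: "real^'n^'n"
 assumes M: "transpose M = M" and pos: "!!x. x ~= 0 ==> x \<bullet> (M *v x) > 0"
 shows "(norm (matrix_sqrt M *v x))^2 = x \<bullet> (M *v x)"
proof -
 let ?P = "%S :: real^'n^'n. transpose S = S \<and> (\<forall>\<xi>. \<xi> \<bullet> (S *v \<xi>) \<ge> 0) \<and> S ** S = M"
 obtain B mu where B: "finite B" "!!e. e \<in> B ==> norm e = 1" "!!e. e \<in> B ==> M *v e = mu e *\<^sub>R e"
  "!!e e'. e \<in> B ==> e' \<in> B ==> e \<bullet> e' = (if e = e' then 1 else 0)" "!!x. x = (\<Sum>e\<in>B. (e \<bullet> x) *\<^sub>R e)"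
  by (rule symmetric_eigenbasis[OF M]) (rule that)
 have mu: "mu e > 0" if "e \<in> B" for e
  using pos[of e] B(2)[OF that] B(3)[OF that] by (cases "e = 0") (auto simp: norm_1_inner)
 have ext: "S = T" if ST: "!!e. e \<in> B ==> S *v e = T *v e" for S T :: "real^'n^'n"
 proof (rule matrix_eq[THEN iffD2, rule_format])
  fix x
  have *: "S *v x = (\<Sum>e\<in>B. (e \<bullet> x) *\<^sub>R (S *v e))" for S :: "real^'n^'n"
   using arg_cong[OF B(5)[of x], of "(*v) S"] by (simp add: linear_sum[OF matrix_vector_mul_linear] linear_scale[OF matrix_vector_mul_linear])
  show "S *v x = T *v x" unfolding *[of S] *[of T] by (intro sum.cong refl) (simp add: ST)
 qed
 let ?f = "%x. \<Sum>e\<in>B. (sqrt (mu e) * (e \<bullet> x)) *\<^sub>R e"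
 have lf: "linear ?f"
  by (intro linearI) (simp_all add: inner_add_right distrib_left scaleR_left_distrib sum.distrib scaleR_sum_right mult_ac)
 have fe: "?f e = sqrt (mu e) *\<^sub>R e" if "e \<in> B" for e
 proof -
  have "?f e = (\<Sum>e'\<in>B. if e' = e then sqrt (mu e) *\<^sub>R e else 0)"
   by (intro sum.cong refl) (auto simp: B(4) that)
  then show ?thesis using that B(1) by simp
 qed
 let ?S = "matrix ?f"
 have S: "?S *v x = ?f x" for x using matrix_works[of ?f x] lf by (simp add: linear_def)
 have sym: "(?S *v x) \<bullet> y = x \<bullet> (?S *v y)" for x y
  unfolding S inner_sum_left inner_sum_right by (intro sum.cong refl) (simp add: inner_commute[of x] mult_ac)
 have PS: "?P ?S"
 proof (intro conjI allI)
  show "transpose ?S = ?S"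
  proof (rule matrix_eq[THEN iffD2, rule_format])
   fix x
   have "(transpose ?S *v x) \<bullet> y = (?S *v x) \<bullet> y" for y
    by (simp only: sym dot_lmul_matrix transpose_matrix_vector)
   then show "transpose ?S *v x = ?S *v x" using vector_eq_rdot by blast
  qed
  show "\<xi> \<bullet> (?S *v \<xi>) \<ge> 0" for \<xi>
   unfolding S inner_sum_right inner_scaleR_right
   by (intro sum_nonneg) (auto simp: inner_commute[of \<xi>] mult.assoc less_imp_le[OF mu] intro!: mult_nonneg_nonneg)
  show "?S ** ?S = M"
  proof (rule ext)
   fix e assume e: "e \<in> B"
   have "(?S ** ?S) *v e = sqrt (mu e) *\<^sub>R (?S *v e)"
    by (simp only: matrix_vector_mul_assoc[symmetric] S[of e] fe[OF e] linear_scale[OF matrix_vector_mul_linear])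
   then show "(?S ** ?S) *v e = M *v e" using mu[OF e] by (simp only: S[of e] fe[OF e] B(3)[OF e]) simp
  qed
 qed
 have uniq: "T = ?S" if T: "?P T" for T
 proof (rule ext)
  fix e assume e: "e \<in> B"
  let ?r = "sqrt (mu e)" let ?w = "T *v e - ?r *\<^sub>R e"
  have "T *v (T *v e) = (?r * ?r) *\<^sub>R e" using T B(3)[OF e] mu[OF e] by (simp add: matrix_vector_mul_assoc)
  then have "T *v ?w = - ?r *\<^sub>R ?w"
   by (simp add: matrix_vector_mult_diff_distrib linear_scale[OF matrix_vector_mul_linear] scaleR_diff_right)
  then have "?w \<bullet> (T *v ?w) = - ?r * (?w \<bullet> ?w)" by simp
  moreover have "?w \<bullet> (T *v ?w) \<ge> 0" using T by blast
  ultimately have "?r * (?w \<bullet> ?w) <= 0" by linarith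
  then have "?w \<bullet> ?w <= 0" using mu[OF e] by (simp add: mult_le_0_iff)
  then have "?w = 0" by (metis inner_eq_zero_iff inner_ge_zero order_antisym)
  then show "T *v e = ?S *v e" by (simp add: S fe[OF e])
 qed
 have "?P (matrix_sqrt M)" unfolding matrix_sqrt_def by (rule theI[of ?P, OF PS uniq])
 then have P: "transpose (matrix_sqrt M) = matrix_sqrt M" "matrix_sqrt M ** matrix_sqrt M = M" by blast+
 have "(norm (matrix_sqrt M *v x))^2 = x \<bullet> (transpose (matrix_sqrt M) *v (matrix_sqrt M *v x))"
  by (simp only: power2_norm_eq_inner transpose_matrix_vector dot_lmul_matrix[symmetric] inner_commute)
 then show ?thesis by (simp only: P(1) matrix_vector_mul_assoc P(2))
qed

context lipschitz_polyhedron
begin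

lemma green_smooth:
 assumes p: "p \<in> H1 Om" and q: "smooth q"
 shows "(LINT x|vol. wgrad p x $ i * q x + p x * partial i q x) = (LINT y|sg. tr p y * q y * normal y $ i)"
proof -
 obtain ph where ph: "!!k. smooth (ph k)" "H1_lim ph p" by (rule smooth_dense_H1[OF p]) (rule that)
 have c: "continuous_on UNIV q" "continuous_on UNIV (partial i q)"
  using q by (auto intro: smooth_continuous_on smooth_partialI)
 note D = H1_lim_smoothD[OF ph] H1_limD(3)[OF ph(2)]
 note int = L2_mult_integrable[OF L2_limD(1)[OF D(1)] continuous_L2(1)[OF c(1)]]
  L2_mult_integrable[OF L2_limD(1)[OF D(2)] continuous_L2(1)[OF c(2)]]
  L2_mult_integrable[OF L2_limD(2)[OF D(1)] continuous_L2(1)[OF c(1)]]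
  L2_mult_integrable[OF L2_limD(2)[OF D(2)] continuous_L2(1)[OF c(2)]]
 have "(%k. (LINT x|vol. partial i (ph k) x * q x) + (LINT x|vol. ph k x * partial i q x)) ---->
   (LINT x|vol. wgrad p x $ i * q x) + (LINT x|vol. p x * partial i q x)"
  by (rule tendsto_add[OF L2_lim_integral_mult1[OF D(1) continuous_L2(1)[OF c(1)]] L2_lim_integral_mult1[OF D(2) continuous_L2(1)[OF c(2)]]])
 then have l1: "(%k. LINT x|vol. partial i (ph k) x * q x + ph k x * partial i q x) ---->
   (LINT x|vol. wgrad p x $ i * q x + p x * partial i q x)"
  by (simp only: Bochner_Integration.integral_add[OF int(1,2)] Bochner_Integration.integral_add[OF int(3,4)])
 have "(%y. normal y $ i * q y) \<in> L2 sg"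
  by (rule L2_bounded_mult[OF continuous_L2(2)[OF c(1)], where C=1]) (auto simp: normal_bound)
 from L2_lim_integral_mult1[OF trace_limit[OF ph] this]
 have "(%k. LINT y|sg. ph k y * q y * normal y $ i) ----> (LINT y|sg. tr p y * q y * normal y $ i)"
  by (simp add: mult_ac)
 then have l2: "(%k. LINT x|vol. partial i (ph k) x * q x + ph k x * partial i q x) ----> (LINT y|sg. tr p y * q y * normal y $ i)"
  by (simp only: divergence_product[OF ph(1) q])
 show ?thesis by (rule LIMSEQ_unique[OF l1 l2])
qed

lemma W1inf_domain:
 assumes "p \<in> W1inf Om"
 obtains C where "p \<in> H1 Om" "AE x in vol. \<bar>p x\<bar> <= C" "AE x in vol. \<bar>wgrad p x $ i\<bar> <= C" "AE y in sg. \<bar>tr p y\<bar> <= C"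
proof -
 interpret V: finite_measure vol by (rule finite_vol)
 obtain g where p: "p \<in> Linf vol" and g: "has_weak_grad Om p g" "!!i. (%x. g x $ i) \<in> Linf vol"
  using assms by (auto simp: W1inf_def)
 have Linf_L2: "f \<in> L2 vol" if "f \<in> Linf vol" for f using that by (auto simp: Linf_def intro: V.L2_bounded)
 note H = H1I[OF Linf_L2[OF p] g(1) Linf_L2[OF g(2)]]
 obtain C1 where C1: "AE x in vol. \<bar>p x\<bar> <= C1" using p by (auto simp: Linf_def)
 obtain C2 where C2: "AE x in vol. \<bar>g x $ i\<bar> <= C2" using g(2)[of i] by (auto simp: Linf_def)
 obtain C3 where C3: "AE y in sg. \<bar>tr p y\<bar> <= C3" by (rule trace_bounded[OF H(1) C1])
 let ?C = "max C1 (max C2 C3)"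
 show thesis
 proof (rule that[OF H(1), of ?C])
  show "AE x in vol. \<bar>p x\<bar> <= ?C" using C1 by eventually_elim simp
  show "AE x in vol. \<bar>wgrad p x $ i\<bar> <= ?C" using C2 H(2) by eventually_elim simp
  show "AE y in sg. \<bar>tr p y\<bar> <= ?C" using C3 by eventually_elim simp
 qed
qed

lemma green_square:
 assumes p: "p \<in> W1inf Om" and v: "v \<in> H1 Om"
 shows "(LINT x|vol. wgrad p x $ i * (v x)^2 + 2 * p x * v x * wgrad v x $ i) = (LINT y|sg. tr p y * normal y $ i * (tr v y)^2)"
  and "integrable vol (%x. wgrad p x $ i * (v x)^2)" "integrable vol (%x. p x * v x * wgrad v x $ i)"
  and "integrable sg (%y. tr p y * normal y $ i * (tr v y)^2)"
proof -
 obtain C where pH: "p \<in> H1 Om" and C: "AE x in vol. \<bar>p x\<bar> <= C" "AE x in vol. \<bar>wgrad p x $ i\<bar> <= C" "AE y in sg. \<bar>tr p y\<bar> <= C"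
  by (rule W1inf_domain[OF p]) (rule that)
 obtain ph where ph: "!!k. smooth (ph k)" "H1_lim ph v" by (rule smooth_dense_H1[OF v]) (rule that)
 note D = H1_lim_smoothD[OF ph, of i] H1_limD(3)[OF ph(2)] trace_limit[OF ph]
 note m = L2_measurable[OF H1_grad_L2[OF pH, of i]] L2_measurable[OF H1_L2[OF pH]]
 have nm: "(%y. tr p y * normal y $ i) \<in> borel_measurable sg"
  using L2_measurable[OF trace_L2[OF pH]] by (intro borel_measurable_times) auto
 have nb: "AE y in sg. \<bar>tr p y * normal y $ i\<bar> <= C"
  using C(3)
 proof eventually_elim
  fix y assume "\<bar>tr p y\<bar> <= C"
  then show "\<bar>tr p y * normal y $ i\<bar> <= C"
   using mult_mono[of "\<bar>tr p y\<bar>" C "\<bar>normal y $ i\<bar>" 1] normal_bound[of y i] by (simp add: abs_mult)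
 qed
 note L = L2_lim_bounded_mult[OF D(2) m(1) C(2)] L2_lim_bounded_mult[OF D(2) m(2) C(1)] L2_lim_bounded_mult[OF D(3) nm nb]
 have i1: "integrable vol (%x. (wgrad p x $ i * ph k x) * ph k x)" "integrable vol (%x. (wgrad p x $ i * v x) * v x)"
  and i2: "integrable vol (%x. (p x * ph k x) * partial i (ph k) x)" "integrable vol (%x. (p x * v x) * wgrad v x $ i)"
  and i3: "integrable sg (%y. (tr p y * normal y $ i * tr v y) * tr v y)" for k
  using L2_mult_integrable[OF L2_limD(1)[OF L(1)] L2_limD(1)[OF D(2)]] L2_mult_integrable[OF L2_limD(2)[OF L(1)] L2_limD(2)[OF D(2)]]
   L2_mult_integrable[OF L2_limD(1)[OF L(2)] L2_limD(1)[OF D(1)]] L2_mult_integrable[OF L2_limD(2)[OF L(2)] L2_limD(2)[OF D(1)]]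
   L2_mult_integrable[OF L2_limD(2)[OF L(3)] L2_limD(2)[OF D(3)]] by blast+
 show int: "integrable vol (%x. wgrad p x $ i * (v x)^2)" "integrable vol (%x. p x * v x * wgrad v x $ i)"
  "integrable sg (%y. tr p y * normal y $ i * (tr v y)^2)"
  using i1(2) i2(2) i3 by (simp_all add: power2_eq_square mult.assoc)
 have "(%k. (LINT x|vol. (wgrad p x $ i * ph k x) * ph k x) + 2 * (LINT x|vol. (p x * ph k x) * partial i (ph k) x)) ---->
   (LINT x|vol. (wgrad p x $ i * v x) * v x) + 2 * (LINT x|vol. (p x * v x) * wgrad v x $ i)"
  by (rule tendsto_add[OF L2_lim_mult[OF L(1) D(2)] tendsto_mult_left[OF L2_lim_mult[OF L(2) D(1)]]])
 moreover have "(LINT x|vol. (wgrad p x $ i * ph k x) * ph k x) + 2 * (LINT x|vol. (p x * ph k x) * partial i (ph k) x)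
   = (LINT y|sg. (tr p y * normal y $ i * ph k y) * ph k y)" for k
 proof -
  have "(LINT x|vol. (wgrad p x $ i * ph k x) * ph k x) + 2 * (LINT x|vol. (p x * ph k x) * partial i (ph k) x)
    = (LINT x|vol. (wgrad p x $ i * ph k x) * ph k x + 2 * ((p x * ph k x) * partial i (ph k) x))"
   using i1(1) i2(1) by simp
  also have "... = (LINT x|vol. wgrad p x $ i * (ph k x * ph k x) + p x * partial i (%x. ph k x * ph k x) x)"
   by (simp add: partial_mult[OF ph(1) ph(1)] algebra_simps)
  also have "... = (LINT y|sg. tr p y * (ph k y * ph k y) * normal y $ i)"
   by (rule green_smooth[OF pH smooth_mult[OF ph(1) ph(1)]])
  finally show ?thesis by (simp add: mult_ac)
 qed
 ultimately have "(LINT x|vol. (wgrad p x $ i * v x) * v x) + 2 * (LINT x|vol. (p x * v x) * wgrad v x $ i) =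
   (LINT y|sg. (tr p y * normal y $ i * tr v y) * tr v y)"
  using L2_lim_mult[OF L(3) D(3)] LIMSEQ_unique by force
 moreover have "(LINT x|vol. wgrad p x $ i * (v x)^2 + 2 * p x * v x * wgrad v x $ i) =
   (LINT x|vol. wgrad p x $ i * (v x)^2) + 2 * (LINT x|vol. p x * v x * wgrad v x $ i)"
  using int(1,2) by (subst Bochner_Integration.integral_mult_right_zero[symmetric], subst Bochner_Integration.integral_add[symmetric])
   (simp_all add: mult.assoc)
 ultimately show "(LINT x|vol. wgrad p x $ i * (v x)^2 + 2 * p x * v x * wgrad v x $ i) = (LINT y|sg. tr p y * normal y $ i * (tr v y)^2)"
  by (simp add: power2_eq_square mult.assoc)
qed

lemma convection_identity:
 assumes b: "!!i. (%x. b x $ i) \<in> W1inf Om" and v: "v \<in> H1 Om"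
 shows "(LINT x|vol. weak_div Om b x * (v x)^2) + 2 * (LINT x|vol. v x * (b x \<bullet> wgrad v x)) = (LINT y|sg. normal_flux Om b y * (tr v y)^2)"
  and "integrable vol (%x. weak_div Om b x * (v x)^2)" "integrable vol (%x. v x * (b x \<bullet> wgrad v x))"
  and "integrable sg (%y. normal_flux Om b y * (tr v y)^2)"
proof -
 note G = green_square[OF b v]
 have e: "weak_div Om b x * (v x)^2 = (\<Sum>i\<in>UNIV. wgrad (%y. b y $ i) x $ i * (v x)^2)"
  "v x * (b x \<bullet> wgrad v x) = (\<Sum>i\<in>UNIV. b x $ i * v x * wgrad v x $ i)"
  "normal_flux Om b y * (tr v y)^2 = (\<Sum>i\<in>UNIV. tr (%y. b y $ i) y * normal y $ i * (tr v y)^2)" for x y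
  by (simp_all add: weak_div_def normal_flux_def inner_vec_def sum_distrib_left sum_distrib_right mult_ac)
 show "integrable vol (%x. weak_div Om b x * (v x)^2)" "integrable vol (%x. v x * (b x \<bullet> wgrad v x))"
  "integrable sg (%y. normal_flux Om b y * (tr v y)^2)"
  unfolding e by (intro Bochner_Integration.integrable_sum G(2-4))+
 have "(LINT x|vol. wgrad (%y. b y $ i) x $ i * (v x)^2) + 2 * (LINT x|vol. b x $ i * v x * wgrad v x $ i)
   = (LINT y|sg. tr (%y. b y $ i) y * normal y $ i * (tr v y)^2)" for i
  using G(1)[of i i] G(2,3)[of i i] by (simp add: mult.assoc)
 then show "(LINT x|vol. weak_div Om b x * (v x)^2) + 2 * (LINT x|vol. v x * (b x \<bullet> wgrad v x)) = (LINT y|sg. normal_flux Om b y * (tr v y)^2)"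
  unfolding e by (simp only: Bochner_Integration.integral_sum[OF G(2)] Bochner_Integration.integral_sum[OF G(3)]
   Bochner_Integration.integral_sum[OF G(4)] sum_distrib_left sum.distrib[symmetric])
qed

lemma mesh_measurable:
 fixes f :: "real^'n => real"
 assumes mesh: "mesh_of Om \<T>" and f: "!!T. T \<in> \<T> ==> f \<in> borel_measurable (lebesgue_on (interior T))"
 shows "f \<in> borel_measurable vol"
proof (rule borel_measurable_iff_le[THEN iffD2], rule allI)
 fix a
 have fin: "finite \<T>" using mesh by (auto simp: mesh_of_def triangulation_def)
 have T: "convex T" "closed T" if "T \<in> \<T>" for T
  using mesh that by (auto simp: mesh_of_def dest!: simplex_imp_polytope intro: polytope_imp_convex polytope_imp_closed)
 let ?U = "\<Union>T\<in>\<T>. {x \<in> interior T. f x <= a}"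
 let ?N = "\<Union>T\<in>\<T>. frontier T"
 have "{x \<in> interior T. f x <= a} \<in> sets lebesgue" if "T \<in> \<T>" for T
 proof -
  have "{x \<in> space (lebesgue_on (interior T)). f x <= a} \<in> sets (lebesgue_on (interior T))"
   using f[OF that] by measurable
  then show ?thesis by (auto simp: sets_restrict_space_iff)
 qed
 then have U: "?U \<in> sets lebesgue" using fin by blast
 have "negligible ?N" using fin T by (auto intro: negligible_convex_frontier)
 then have "negligible (Om \<inter> {x. f x <= a} - (\<Union>T\<in>\<T>. interior T))"
 proof (rule negligible_subset)
  have "Om \<subseteq> \<Union>\<T>" using mesh in_closure(1) by (auto simp: mesh_of_def)
  then show "Om \<inter> {x. f x <= a} - (\<Union>T\<in>\<T>. interior T) \<subseteq> ?N"
   using T(2) closure_closed by (fastforce simp: frontier_def)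
 qed
 then have N: "Om \<inter> {x. f x <= a} - (\<Union>T\<in>\<T>. interior T) \<in> sets lebesgue" by (rule negligible_imp_sets)
 have eq: "{x \<in> Om. f x <= a} = (Om \<inter> ?U) \<union> (Om \<inter> {x. f x <= a} - (\<Union>T\<in>\<T>. interior T))" by auto
 have "{x \<in> Om. f x <= a} \<in> sets lebesgue" unfolding eq by (intro sets.Un sets.Int Om_sets U N)
 then show "{w \<in> space vol. f w <= a} \<in> sets vol" by (subst sets_restrict_space_iff) (use Om_sets in auto)
qed

lemma coercivity_A:
 assumes mesh: "mesh_of Om \<T>" and A: "diffusion_coefficient Om \<T> A" and bc: "lower_order_coefficients Om b c" and v: "v \<in> H1 Om"
 shows "form_A Om A b c v v \<ge> (energy_norm Om A b c v)^2"
  and "(energy_norm Om A b c v)^2 \<ge> lambda_min Om A * (LINT x|vol. (norm (wgrad v x))^2)"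
proof -
 have b: "(%x. b x $ i) \<in> W1inf Om" for i using bc by (auto simp: lower_order_coefficients_def)
 obtain Cc where c: "c \<in> borel_measurable vol" "AE x in vol. \<bar>c x\<bar> <= Cc"
  using bc by (auto simp: lower_order_coefficients_def Linf_def)
 have s: "AE x in vol. 1/2 * weak_div Om b x + c x \<ge> 0" using bc by (simp add: lower_order_coefficients_def)
 obtain CA al where Asym: "!!x. x \<in> Om ==> transpose (A x) = A x" and CA: "!!x i j. x \<in> Om ==> \<bar>A x $ i $ j\<bar> <= CA"
  and al: "al > 0" "!!x \<xi>. x \<in> Om ==> \<xi> \<bullet> (A x *v \<xi>) \<ge> al * (norm \<xi>)^2"
  using A unfolding diffusion_coefficient_def by blast
 have Am: "(%x. A x $ i $ j) \<in> borel_measurable vol" for i j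
  by (rule mesh_measurable[OF mesh]) (use A in \<open>auto simp: diffusion_coefficient_def W1inf_def Linf_def\<close>)
 let ?g = "wgrad v"
 let ?s = "%x. 1/2 * weak_div Om b x + c x" and ?n = "%y. normal_flux Om b y * (tr v y)^2"
 have g: "(%x. ?g x $ i) \<in> L2 vol" for i by (rule H1_grad_L2[OF v])
 have Ag: "(A x *v ?g x) \<bullet> ?g x = (\<Sum>i\<in>UNIV. \<Sum>j\<in>UNIV. (A x $ i $ j * ?g x $ j) * ?g x $ i)" for x
  by (simp add: matrix_vector_mult_def inner_vec_def sum_distrib_right)
 have iA: "integrable vol (%x. (A x *v ?g x) \<bullet> ?g x)"
  unfolding Ag using AE_vol_in
  by (intro Bochner_Integration.integrable_sum L2_mult_integrable L2_bounded_mult[where C=CA] g Am) (auto elim!: eventually_mono intro: CA)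
 have gg: "(norm (?g x))^2 = (\<Sum>i\<in>UNIV. (?g x $ i)^2)" for x
  unfolding power2_norm_eq_inner inner_vec_def by (simp add: power2_eq_square)
 have ig: "integrable vol (%x. (norm (?g x))^2)" unfolding gg by (intro Bochner_Integration.integrable_sum L2_square g)
 have sq: "AE x in vol. (norm (matrix_sqrt (A x) *v ?g x))^2 = (A x *v ?g x) \<bullet> ?g x"
  using AE_vol_in
 proof eventually_elim
  fix x assume x: "x \<in> Om"
  have "\<xi> \<bullet> (A x *v \<xi>) > 0" if "\<xi> ~= 0" for \<xi>
   using al(2)[OF x, of \<xi>] al(1) that by (intro less_le_trans[OF _ al(2)[OF x]]) simp
  then show "(norm (matrix_sqrt (A x) *v ?g x))^2 = (A x *v ?g x) \<bullet> ?g x"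
   using matrix_sqrt[OF Asym[OF x], of "?g x"] by (simp add: inner_commute)
 qed
 have ms: "(LINT x|vol. (norm (matrix_sqrt (A x) *v ?g x))^2) = (LINT x|vol. (A x *v ?g x) \<bullet> ?g x)"
 proof (rule integral_cong_AE[OF _ _ sq])
  show "(%x. (norm (matrix_sqrt (A x) *v ?g x))^2) \<in> borel_measurable vol"
   by (rule measurable_vol_cong_AE[OF borel_measurable_integrable[OF iA]]) (use sq in \<open>auto elim!: eventually_mono\<close>)
 qed (rule borel_measurable_integrable[OF iA])
 note C = convection_identity[OF b v]
 have ic: "integrable vol (%x. c x * (v x)^2)"
  using L2_mult_integrable[OF L2_bounded_mult[OF H1_L2[OF v] c] H1_L2[OF v]] by (simp add: power2_eq_square mult.assoc)
 have idc: "integrable vol (%x. ?s x * (v x)^2)"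
  using C(2) ic by (simp add: distrib_right mult.assoc)
 have sv: "AE x in vol. (sqrt (?s x) * v x)^2 = ?s x * (v x)^2"
  using s by eventually_elim (simp add: power_mult_distrib)
 have ss: "(LINT x|vol. (sqrt (?s x) * v x)^2) = (LINT x|vol. ?s x * (v x)^2)"
 proof (rule integral_cong_AE[OF _ _ sv])
  show "(%x. (sqrt (?s x) * v x)^2) \<in> borel_measurable vol"
   by (rule measurable_vol_cong_AE[OF borel_measurable_integrable[OF idc]]) (use sv in \<open>auto elim!: eventually_mono\<close>)
 qed (rule borel_measurable_integrable[OF idc])
 have s0: "(LINT x|vol. (sqrt (?s x) * v x)^2) \<ge> 0" by simp
 have E: "(energy_norm Om A b c v)^2 = (LINT x|vol. (norm (matrix_sqrt (A x) *v ?g x))^2) + (LINT x|vol. (sqrt (?s x) * v x)^2)"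
  unfolding energy_norm_def by (intro real_sqrt_pow2 add_nonneg_nonneg) simp_all
 have sum: "(LINT x|vol. ?s x * (v x)^2) = 1/2 * (LINT x|vol. weak_div Om b x * (v x)^2) + (LINT x|vol. c x * (v x)^2)"
  using C(2) ic by (simp add: distrib_right mult.assoc)
 have "(LINT x|vol. (A x *v ?g x - v x *\<^sub>R b x) \<bullet> ?g x) = (LINT x|vol. (A x *v ?g x) \<bullet> ?g x - v x * (b x \<bullet> ?g x))"
  by (simp add: inner_diff_left)
 also have "... = (LINT x|vol. (A x *v ?g x) \<bullet> ?g x) - (LINT x|vol. v x * (b x \<bullet> ?g x))"
  by (rule Bochner_Integration.integral_diff[OF iA C(3)])
 finally have FA: "form_A Om A b c v v = (energy_norm Om A b c v)^2 +
   ((\<integral>x\<in>outflow_boundary Om b. normal_flux Om b x * tr v x * tr v x \<partial>sg) - 1/2 * (LINT y|sg. ?n y))"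
  unfolding form_A_def E ms ss sum C(1)[symmetric] by (simp add: power2_eq_square mult.assoc algebra_simps)
 have bH: "(%x. b x $ i) \<in> H1 Om" for i by (rule W1inf_domain[OF b])
 have fm: "normal_flux Om b \<in> borel_measurable borel"
  by (simp add: normal_flux_def[abs_def] inner_vec_def)
   (intro borel_measurable_sum borel_measurable_times L2_surface_borel[OF trace_L2[OF bH]] normal_nth_measurable)
 have "outflow_boundary Om b = Bd \<inter> {x. normal_flux Om b x \<ge> 0}" by (auto simp: outflow_boundary_def)
 moreover have "{x \<in> space borel. 0 <= normal_flux Om b x} \<in> sets borel" using fm by measurable
 ultimately have om: "outflow_boundary Om b \<in> sets sg" by auto
 have io: "integrable sg (%y. indicator (outflow_boundary Om b) y *\<^sub>R ?n y)"
  by (rule integrable_mult_indicator[OF om C(4)])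
 have "1/2 * (LINT y|sg. ?n y) = (LINT y|sg. 1/2 * ?n y)" by simp
 also have "... <= (LINT y|sg. indicator (outflow_boundary Om b) y *\<^sub>R ?n y)"
 proof (rule integral_mono_AE[OF _ io])
  show "AE y in sg. 1/2 * ?n y <= indicator (outflow_boundary Om b) y *\<^sub>R ?n y"
   using AE_surface
   by eventually_elim (auto simp: indicator_def outflow_boundary_def mult_nonpos_nonneg)
 qed (use C(4) in simp)
 also have "... = (\<integral>x\<in>outflow_boundary Om b. normal_flux Om b x * tr v x * tr v x \<partial>sg)"
  by (simp add: set_lebesgue_integral_def power2_eq_square mult.assoc)
 finally show "form_A Om A b c v v \<ge> (energy_norm Om A b c v)^2" unfolding FA by simp
 have "lambda_min Om A * (LINT x|vol. (norm (?g x))^2) = (LINT x|vol. lambda_min Om A * (norm (?g x))^2)" by simp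
 also have "... <= (LINT x|vol. (A x *v ?g x) \<bullet> ?g x)"
 proof (rule integral_mono_AE[OF _ iA])
  have "bdd_below ((%x. min_eigenvalue (A x)) ` Om)"
  proof (rule bdd_belowI2)
   fix x assume x: "x \<in> Om"
   show "al <= min_eigenvalue (A x)" by (rule min_eigenvalue_ge[OF Asym[OF x] al(2)[OF x]])
  qed
  then have le: "lambda_min Om A <= min_eigenvalue (A x)" if "x \<in> Om" for x
   unfolding lambda_min_def using that by (rule cINF_lower)
  show "AE x in vol. lambda_min Om A * (norm (?g x))^2 <= (A x *v ?g x) \<bullet> ?g x"
   using AE_vol_in
  proof eventually_elim
   fix x assume x: "x \<in> Om"
   have "lambda_min Om A * (norm (?g x))^2 <= min_eigenvalue (A x) * (norm (?g x))^2" by (intro mult_right_mono le x) simp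
   also have "... <= ?g x \<bullet> (A x *v ?g x)" by (rule symmetric_quadratic_form_ge(1)[OF Asym[OF x]])
   finally show "lambda_min Om A * (norm (?g x))^2 <= (A x *v ?g x) \<bullet> ?g x" by (simp add: inner_commute)
  qed
 qed (use ig in simp)
 finally show "(energy_norm Om A b c v)^2 \<ge> lambda_min Om A * (LINT x|vol. (norm (?g x))^2)"
  unfolding E ms using s0 by linarith
qed

end

section \<open>The regularised fundamental solution\<close>

text \<open>The fundamental solution is \<open>newton d (|z|\<^sup>2)\<close>, with gradient \<open>- newton_grad d (|z|\<^sup>2) z\<close>; replacing \<open>|z|\<^sup>2\<close> by \<open>|z|\<^sup>2 + e\<^sup>2\<close> regularises it.\<close>

definition newton :: "nat => real => real" where
 "newton d s = (if d = 2 then - ln s / (4 * pi) else s powr (- 1/2) / (4 * pi))"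

definition newton_grad :: "nat => real => real" where
 "newton_grad d s = (if d = 2 then 1 / (2 * pi) else 1 / (4 * pi)) * s powr (- real d / 2)"

lemma newton_deriv:
 assumes "d \<in> {2, 3}" "s > 0"
 shows "(newton d has_real_derivative - newton_grad d s / 2) (at s)"
proof -
 have "((%s. if d = 2 then - ln s / (4 * pi) else s powr (- 1/2) / (4 * pi)) has_real_derivative - newton_grad d s / 2) (at s)"
 proof (cases "d = 2")
  case True
  have "((%s. - ln s / (4 * pi)) has_real_derivative - (1 / s) / (4 * pi)) (at s)"
   by (intro DERIV_cdivide DERIV_minus DERIV_ln_divide assms(2))
  then show ?thesis using assms(2) True by (simp add: newton_grad_def powr_minus_divide mult.commute mult.left_commute)
 next
  case False
  then have "d = 3" using assms(1) by simp
  then show ?thesis using assms(2) by (auto simp: newton_grad_def divide_simps intro!: derivative_eq_intros)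
 qed
 then show ?thesis by (simp add: newton_def[abs_def])
qed

lemma newton_grad_deriv:
 "s > 0 ==> (newton_grad d has_real_derivative - (real d / 2) * newton_grad d s / s) (at s)"
proof -
 let ?c = "if d = 2 then 1 / (2 * pi) else 1 / (4 * pi)"
 assume s: "s > 0"
 have "?c * (- real d / 2 * s powr (- real d / 2 - 1)) = - (real d / 2) * (?c * s powr (- real d / 2)) / s"
  using s by (simp only: powr_diff powr_one less_imp_le minus_divide_left mult_ac times_divide_eq_right times_divide_eq_left)
 then show ?thesis
  using DERIV_cmult[OF has_real_derivative_powr[OF s, of "- real d / 2"], of ?c] unfolding newton_grad_def[abs_def] by (simp only:)
qed

lemma newton_grad_nonneg: "newton_grad d s \<ge> 0"
 by (simp add: newton_grad_def)

lemma newton_grad_mono: "0 < s ==> s <= t ==> newton_grad d t <= newton_grad d s"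
 unfolding newton_grad_def by (intro mult_left_mono powr_mono2') auto

lemma newton_mono: "0 < s ==> s <= t ==> newton d t <= newton d s"
 by (auto simp: newton_def divide_right_mono powr_mono2')

lemma newton_quarter:
 assumes "d \<in> {2, 3}" "s > 0"
 shows "newton d (s / 4) <= real (d - 1) * newton d s + ln 4" "newton_grad d (s / 4) = 2 ^ d * newton_grad d s"
proof -
 have p: "(1 / 4 :: real) powr - (1/2) = 2" "(1 / 4 :: real) powr - (3/2) = 8"
  using powr_powr[of "1/2 :: real" 2 "- 1/2"] powr_powr[of "1/2 :: real" 2 "- 3/2"] by (simp_all add: power2_eq_square power3_eq_cube powr_minus_divide)
 have l: "ln 4 / (4 * pi) <= ln (4 :: real)" using pi_gt3 by (simp add: divide_le_eq)
 have "newton d (s / 4) = (if d = 2 then newton d s + ln 4 / (4 * pi) else (1/4) powr (- 1/2) * newton d s)"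
  using assms powr_mult[of "1/4" s "- 1/2"] by (auto simp: newton_def ln_div diff_divide_distrib)
 also have "... <= real (d - 1) * newton d s + ln 4" using assms l by (auto simp: p)
 finally show "newton d (s / 4) <= real (d - 1) * newton d s + ln 4" .
 have "newton_grad d (s / 4) = (1/4) powr (- real d / 2) * newton_grad d s"
  using assms powr_mult[of "1/4" s "- real d / 2"] by (simp add: newton_grad_def)
 then show "newton_grad d (s / 4) = 2 ^ d * newton_grad d s" using assms(1) by (auto simp: p)
qed

lemma G_kernel_newton:
 assumes "CARD('n) \<in> {2, 3}" "z ~= (0 :: real^'n)"
 shows "G_kernel z = newton CARD('n) ((norm z)^2)"
 using assms by (auto simp: G_kernel_def newton_def ln_realpow powr_minus_divide powr_half_sqrt)

definition reg_kernel :: "real => real^'n => real" where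
 "reg_kernel e z = newton CARD('n) ((norm z)^2 + e^2)"

definition reg_grad :: "real => real^'n => real" where
 "reg_grad e z = newton_grad CARD('n) ((norm z)^2 + e^2)"

definition approx_delta :: "real => real^'n => real" where
 "approx_delta e z = real CARD('n) * reg_grad e z * e^2 / ((norm z)^2 + e^2)"

lemma norm2_deriv: "((%z. (norm z)^2 + a) has_derivative (%h. 2 * (z \<bullet> h))) (at (z :: real^'n))"
 unfolding power2_norm_eq_inner by (auto intro!: derivative_eq_intros simp: inner_commute)

lemma newton_norm2_deriv:
 assumes "CARD('n) \<in> {2, 3}" "(norm z)^2 + a > 0"
 shows "((%z. newton CARD('n) ((norm z)^2 + a)) has_derivative (%h. - newton_grad CARD('n) ((norm z)^2 + a) * (z \<bullet> h))) (at (z :: real^'n))"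
 using has_derivative_compose[OF norm2_deriv has_field_derivative_imp_has_derivative[OF newton_deriv[OF assms]]]
 by simp

lemma norm2_add_pos: "e > 0 ==> (norm z)^2 + e\<^sup>2 > 0"
 by (simp add: add_nonneg_pos)

lemma smooth_reg_kernel: "e > 0 ==> smooth (reg_kernel e :: real^'n => real)"
 and smooth_reg_grad: "e > 0 ==> smooth (reg_grad e :: real^'n => real)"
proof -
 assume e: "e > 0"
 have s: "smooth (%z :: real^'n. (norm z)^2 + e^2)" by (intro smooth_add smooth_norm2 smooth_const)
 note p = smooth_powr[OF s norm2_add_pos[OF e]]
 show "smooth (reg_kernel e :: real^'n => real)"
  using smooth_mult[OF smooth_const smooth_ln[OF s norm2_add_pos[OF e]], of "- 1 / (4 * pi)"] smooth_mult[OF smooth_const p, of "1 / (4 * pi)" "- 1/2"]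
  by (cases "CARD('n) = 2") (simp_all add: reg_kernel_def[abs_def] newton_def)
 show "smooth (reg_grad e :: real^'n => real)"
  unfolding reg_grad_def[abs_def] newton_grad_def by (rule smooth_mult[OF smooth_const p])
qed

lemma partial_reg_kernel:
 assumes "CARD('n) \<in> {2, 3}" "e > 0"
 shows "partial i (reg_kernel e) (z :: real^'n) = - (z $ i * reg_grad e z)"
 unfolding reg_kernel_def[abs_def] reg_grad_def
 by (subst partial_eqI[OF newton_norm2_deriv[OF assms(1) norm2_add_pos[OF assms(2)]]]) (simp add: inner_axis)

lemma partial_reg_grad:
 assumes "e > 0"
 shows "(\<Sum>i\<in>UNIV. partial i (%z. z $ i * reg_grad e z) (z :: real^'n)) = approx_delta e z"
proof -
 have aux: "x - (x / s) * (s - q) = x * q / s" if "s > 0" for x s q :: real using that by (simp add: field_simps)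
 have aux2: "- (d / 2) * g / s * (2 * x) = - (d * g / s) * x" for d g s x :: real by simp
 let ?s = "(norm z)^2 + e^2" let ?d = "CARD('n)"
 have s: "?s > 0" by (rule norm2_add_pos[OF assms])
 have "((%z. newton_grad ?d ((norm z)^2 + e^2)) has_derivative (%h. - (real ?d * newton_grad ?d ?s / ?s) * (z \<bullet> h))) (at z)"
  using has_derivative_compose[OF norm2_deriv has_field_derivative_imp_has_derivative[OF newton_grad_deriv[OF s]]] by (simp only: aux2)
 from partial_eqI[OF this] have "partial i (reg_grad e) z = - (real ?d * reg_grad e z / ?s) * z $ i" for i
  by (simp add: reg_grad_def[abs_def] inner_axis)
 moreover have "partial i (%z. z $ i * reg_grad e z) z = z $ i * partial i (reg_grad e) z + reg_grad e z" for i
  by (subst partial_mult[OF smooth_coord smooth_reg_grad[OF assms]])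
   (simp add: partial_eqI[OF bounded_linear.has_derivative[OF bounded_linear_vec_nth has_derivative_ident]])
 ultimately have "(\<Sum>i\<in>UNIV. partial i (%z. z $ i * reg_grad e z) z) = real ?d * reg_grad e z - (real ?d * reg_grad e z / ?s) * (\<Sum>i\<in>UNIV. z $ i * z $ i)"
  by (simp add: sum_subtractf sum_distrib_left sum_divide_distrib mult_ac)
 also have "(\<Sum>i\<in>UNIV. z $ i * z $ i) = ?s - e^2" by (simp add: power2_norm_eq_inner inner_vec_def)
 also have "real ?d * reg_grad e z - (real ?d * reg_grad e z / ?s) * (?s - e^2) = real ?d * reg_grad e z * e^2 / ?s"
  using s by (rule aux)
 finally show ?thesis by (simp add: approx_delta_def)
qed

lemma approx_delta_nonneg: "approx_delta e z \<ge> 0"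
 by (simp add: approx_delta_def reg_grad_def newton_grad_nonneg)

lemma approx_delta_scale:
 assumes "e > 0"
 shows "e ^ CARD('n) * approx_delta e (e *\<^sub>R z) = approx_delta 1 (z :: real^'n)"
proof -
 let ?d = "CARD('n)"
 define s where "s = (norm z)^2 + 1"
 have s: "s > 0" by (simp add: s_def add_nonneg_pos)
 have n: "(norm (e *\<^sub>R z))^2 + e^2 = e^2 * s" by (simp add: s_def power_mult_distrib algebra_simps)
 have "(e^2) powr (- real ?d / 2) = inverse (e ^ ?d)"
  using assms by (simp add: powr_powr powr_numeral[symmetric] powr_minus powr_realpow del: powr_numeral)
 then have g: "newton_grad ?d (e^2 * s) = inverse (e ^ ?d) * newton_grad ?d s"
  using assms s by (simp add: newton_grad_def powr_mult)
 show ?thesis unfolding approx_delta_def reg_grad_def n g using assms s by (simp add: s_def[symmetric])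
qed

text \<open>Layer cake: \<open>(1 + r^2)\<^sup>-\<^sup>p\<close> is the integral of \<open>2 p rh (1 + rh^2)\<^sup>-\<^sup>p\<^sup>-\<^sup>1\<close> over \<open>rh \<ge> r\<close>.\<close>

lemma nn_integral_radial_power:
 defines "p \<equiv> real CARD('n) / 2 + 1"
 shows "(\<integral>\<^sup>+z. ennreal (((norm (z :: real^'n))^2 + 1) powr (- p)) \<partial>lborel) = ennreal (unit_ball_vol CARD('n))"
proof -
 let ?d = "CARD('n)"
 define f :: "real => real" where "f rh = 2 * p * rh * (rh^2 + 1) powr (- p - 1)" for rh
 have pos: "(rh :: real)^2 + 1 > 0" for rh by (simp add: add_nonneg_pos)
 have p0: "p > 0" by (simp add: p_def add_nonneg_pos)
 have fm[measurable]: "f \<in> borel_measurable borel" unfolding f_def[abs_def] by measurable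
 have f0: "f rh \<ge> 0" if "rh \<ge> 0" for rh using that p0 by (simp add: f_def)
 have top: "filterlim (%rh :: real. rh^2 + 1) at_top at_top"
 proof (rule filterlim_at_top_mono[OF filterlim_ident])
  have "rh <= rh^2 + 1" for rh :: real using zero_le_power2[of "rh - 1"] by (simp add: power2_diff) (smt (verit) zero_le_power2)
  then show "\<forall>\<^sub>F rh :: real in at_top. rh <= rh^2 + 1" by simp
 qed
 have A: "(\<integral>\<^sup>+rh. ennreal (f rh) * indicator {r..} rh \<partial>lborel) = ennreal ((r^2 + 1) powr (- p))" if r: "r \<ge> 0" for r
 proof -
  have "(\<integral>\<^sup>+rh. ennreal (f rh) * indicator {r..} rh \<partial>lborel) = 0 - - ((r^2 + 1) powr (- p))"
  proof (rule nn_integral_FTC_atLeast[OF fm])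
   show "((%rh. - ((rh^2 + 1) powr (- p))) has_real_derivative f x) (at x)" for x
    using pos[of x] by (auto intro!: derivative_eq_intros simp: f_def powr_diff)
   show "((%rh :: real. - ((rh^2 + 1) powr (- p))) \<longlongrightarrow> 0) at_top"
    using tendsto_minus[OF tendsto_neg_powr[OF _ top, of "- p"]] p0 by simp
  qed (use r f0 in auto)
  then show ?thesis by simp
 qed
 have B: "(\<integral>\<^sup>+rh. ennreal (rh ^ ?d * f rh) * indicator {0..} rh \<partial>lborel) = 1 - ennreal ((%rh. rh ^ (?d + 2) * (rh^2 + 1) powr (- p)) 0)"
 proof (subst nn_integral_FTC_atLeast)
  let ?F = "%rh. rh ^ (?d + 2) * (rh^2 + 1) powr (- p)"
  show "(?F has_real_derivative x ^ ?d * f x) (at x)" for x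
  proof -
   have "(?F has_real_derivative (real (?d + 2) * x ^ (?d + 1) * (x^2 + 1) powr (- p) + x ^ (?d + 2) * (- p * (x^2 + 1) powr (- p - 1) * (2 * x)))) (at x)"
   proof -
    have "((%rh. (rh^2 + 1) powr (- p)) has_real_derivative - p * (x^2 + 1) powr (- p - 1) * (2 * x)) (at x)"
     using pos[of x] by (auto intro!: derivative_eq_intros simp: powr_diff)
    from DERIV_mult[OF DERIV_pow[of "?d + 2" x] this] show ?thesis by (simp add: mult.commute)
   qed
   moreover have P: "(x^2 + 1) powr (- p) = (x^2 + 1) * (x^2 + 1) powr (- p - 1)"
    using pos[of x] by (simp add: powr_diff)
   have Q: "real (?d + 2) = 2 * p" by (simp add: p_def)
   have "real (?d + 2) * x ^ (?d + 1) * (x^2 + 1) powr (- p) + x ^ (?d + 2) * (- p * (x^2 + 1) powr (- p - 1) * (2 * x)) = x ^ ?d * f x"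
    unfolding P Q f_def by (simp add: power2_eq_square algebra_simps)
   ultimately show ?thesis by simp
  qed
  show "(?F \<longlongrightarrow> 1) at_top"
  proof (rule Lim_transform_eventually)
   show "((%rh :: real. (rh^2 / (rh^2 + 1)) powr p) \<longlongrightarrow> 1) at_top"
   proof -
    have "rh^2 / (rh^2 + 1) = 1 - inverse (rh^2 + 1)" for rh :: real using pos[of rh] by (simp add: field_simps)
    then show ?thesis
     using tendsto_powr[OF tendsto_diff[OF tendsto_const tendsto_inverse_0_at_top[OF top]] tendsto_const, of 1 p] by simp
   qed
   have pw: "(rh^2) powr p = rh ^ (?d + 2)" if "rh > 0" for rh :: real
    using that powr_powr[of rh 2 p] powr_realpow[of rh "?d + 2"] by (simp add: p_def add.commute)
   show "\<forall>\<^sub>F rh in at_top. (rh^2 / (rh^2 + 1)) powr p = ?F rh"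
    using eventually_gt_at_top[of 0]
   proof eventually_elim
    fix rh :: real assume "rh > 0"
    from pw[OF this] show "(rh^2 / (rh^2 + 1)) powr p = ?F rh"
     using pos[of rh] by (simp only: powr_divide powr_minus_divide zero_le_power2 less_imp_le) simp
   qed
  qed
 qed (use f0 in auto)
 have "(\<integral>\<^sup>+z. ennreal (((norm (z :: real^'n))^2 + 1) powr (- p)) \<partial>lborel) =
   (\<integral>\<^sup>+z. \<integral>\<^sup>+rh. (if norm (z :: real^'n) <= rh then ennreal (f rh) else 0) \<partial>lborel \<partial>lborel)"
  by (subst A[symmetric]) (auto intro!: nn_integral_cong simp: indicator_def)
 also have "... = (\<integral>\<^sup>+rh. \<integral>\<^sup>+z. (if norm (z :: real^'n) <= rh then ennreal (f rh) else 0) \<partial>lborel \<partial>lborel)"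
  by (rule lborel_swap) measurable
 also have "... = (\<integral>\<^sup>+rh. ennreal (unit_ball_vol ?d) * (ennreal (rh ^ ?d * f rh) * indicator {0..} rh) \<partial>lborel)"
 proof (rule nn_integral_cong)
  fix rh :: real
  have "(\<integral>\<^sup>+z. (if norm (z :: real^'n) <= rh then ennreal (f rh) else 0) \<partial>lborel) = (\<integral>\<^sup>+z. ennreal (f rh) * indicator (cball (0 :: real^'n) rh) z \<partial>lborel)"
   by (intro nn_integral_cong) (auto simp: indicator_def)
  also have "... = ennreal (f rh) * emeasure lborel (cball (0 :: real^'n) rh)" by (rule nn_integral_cmult_indicator) simp
  also have "... = ennreal (unit_ball_vol ?d) * (ennreal (rh ^ ?d * f rh) * indicator {0..} rh)"
   using f0[of rh] by (auto simp: indicator_def emeasure_cball ennreal_mult mult_ac)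
  finally show "(\<integral>\<^sup>+z. (if norm (z :: real^'n) <= rh then ennreal (f rh) else 0) \<partial>lborel) = ennreal (unit_ball_vol ?d) * (ennreal (rh ^ ?d * f rh) * indicator {0..} rh)" .
 qed
 also have "... = ennreal (unit_ball_vol ?d)" using B by (subst nn_integral_cmult) auto
 finally show ?thesis .
qed

lemma approx_delta_integral:
 assumes "CARD('n) \<in> {2, 3}"
 shows "integrable lborel (approx_delta 1 :: real^'n => real)" "(LINT z|lborel. approx_delta 1 (z :: real^'n)) = 1"
proof -
 let ?d = "CARD('n)" let ?c = "real ?d * (if ?d = 2 then 1 / (2 * pi) else 1 / (4 * pi))"
 have e: "approx_delta 1 z = ?c * ((norm z)^2 + 1) powr (- (real ?d / 2 + 1))" for z :: "real^'n"
 proof -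
  have "(norm z)^2 + 1 > 0" by (simp add: add_nonneg_pos)
  then have "((norm z)^2 + 1) powr (- (real ?d / 2 + 1)) = ((norm z)^2 + 1) powr (- real ?d / 2) / ((norm z)^2 + 1)"
   using powr_diff[of "(norm z)^2 + 1" "- real ?d / 2" 1] by (simp only: powr_one minus_add_distrib minus_divide_left) simp
  then show ?thesis by (simp add: approx_delta_def reg_grad_def newton_grad_def)
 qed
 have m: "(%z :: real^'n. ?c * ((norm z)^2 + 1) powr (- (real ?d / 2 + 1))) \<in> borel_measurable borel" by measurable
 have c: "?c * unit_ball_vol (real ?d) = 1"
  using assms by (auto simp: unit_ball_vol_2 unit_ball_vol_3)
 have "(\<integral>\<^sup>+z. ennreal (approx_delta 1 (z :: real^'n)) \<partial>lborel) = (\<integral>\<^sup>+z. ennreal ?c * ennreal (((norm (z :: real^'n))^2 + 1) powr (- (real ?d / 2 + 1))) \<partial>lborel)"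
  unfolding e by (intro nn_integral_cong ennreal_mult) auto
 also have "... = ennreal ?c * ennreal (unit_ball_vol ?d)"
  by (subst nn_integral_cmult) (measurable, simp only: nn_integral_radial_power)
 also have "... = 1" using c by (subst ennreal_mult[symmetric]) auto
 finally have 1: "(\<integral>\<^sup>+z. ennreal (approx_delta 1 (z :: real^'n)) \<partial>lborel) = ennreal 1" by simp
 have m': "(approx_delta 1 :: real^'n => real) \<in> borel_measurable lborel" unfolding e[abs_def] using m by simp
 from nn_integral_eq_integrable[THEN iffD1, OF m' _ _ 1]
 show "integrable lborel (approx_delta 1 :: real^'n => real)" "(LINT z|lborel. approx_delta 1 (z :: real^'n)) = 1"
  by (auto simp: approx_delta_nonneg)
qed

lemma dyadic_integral_bound:
 fixes g :: "real^'n => real"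
 assumes g: "continuous_on UNIV g" and a: "0 <= a" "2 * a <= 2 ^ CARD('n)" and b: "0 <= b" "0 <= M"
  and half: "!!z. g ((1/2) *\<^sub>R z) <= a * g z + b" and ann: "!!z. R / 2 <= norm z ==> norm z <= R ==> g z <= M"
 shows "(LINT z|lborel. indicator (cball 0 R) z * g z) <= 2 * (b + M) * measure lborel (cball (0 :: real^'n) R)"
proof -
 let ?I = "%z :: real^'n. indicator (cball 0 R) z :: real" let ?h = "%z. indicator (cball 0 (R / 2)) z * g z"
 let ?v = "measure lborel (cball (0 :: real^'n) R)" let ?D = "2 ^ CARD('n) :: real"
 let ?J = "LINT z|lborel. ?I z * g z"
 have int: "integrable lborel (%z. indicator (cball 0 r) z * k z)" if "continuous_on UNIV k" for r and k :: "real^'n => real"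
  using borel_integrable_compact[OF compact_cball continuous_on_subset[OF that], of 0 r] by (simp add: mult.commute)
 have c2: "continuous_on UNIV (%z. g ((1/2) *\<^sub>R z))"
  by (rule continuous_on_compose2[OF g]) (auto intro!: continuous_intros)
 have gm: "g \<in> borel_measurable borel" by (rule borel_measurable_continuous_onI[OF g])
 have one: "(LINT z|lborel. ?I z * 1) = ?v" by simp
 have i1: "integrable lborel (%z. ?I z * 1)" by (rule int) (rule continuous_on_const)
 have "(LINT z|lborel. ?h z) = (1 / ?D) * (LINT z|lborel. ?I z * g ((1/2) *\<^sub>R z))"
 proof -
  have "?h \<in> borel_measurable borel" by (intro borel_measurable_times borel_measurable_indicator gm) auto
  from lborel_integral_affine[OF _ this, of "1/2" 0]
  have "(LINT z|lborel. ?h z) = (1 / ?D) * (LINT z|lborel. ?h ((1/2) *\<^sub>R z))" by (simp add: power_divide)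
  also have "(LINT z|lborel. ?h ((1/2) *\<^sub>R z)) = (LINT z|lborel. ?I z * g ((1/2) *\<^sub>R z))"
   by (intro Bochner_Integration.integral_cong refl) (auto simp: indicator_def)
  finally show ?thesis .
 qed
 also have "... <= (1 / ?D) * (LINT z|lborel. a * (?I z * g z) + b * (?I z * 1))"
  using half by (intro mult_left_mono integral_mono int c2 Bochner_Integration.integrable_add integrable_mult_right g i1) (auto simp: indicator_def)
 also have "... = (1 / ?D) * (a * ?J + b * ?v)"
  using int[OF g] i1 one by (subst Bochner_Integration.integral_add) auto
 finally have 1: "(LINT z|lborel. ?h z) <= (a / ?D) * ?J + (1 / ?D) * (b * ?v)" by (simp add: distrib_left)
 have "?J - (LINT z|lborel. ?h z) = (LINT z|lborel. ?I z * g z - ?h z)"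
  by (rule Bochner_Integration.integral_diff[symmetric]) (rule int[OF g])+
 also have "... <= (LINT z|lborel. M * (?I z * 1))"
 proof (rule integral_mono)
  fix z :: "real^'n"
  have sub: "norm z <= R / 2 ==> norm z <= R" using norm_ge_zero[of z] by linarith
  show "?I z * g z - ?h z <= M * (?I z * 1)"
   using ann[of z] b(2) sub by (auto simp: indicator_def)
 qed (use int[OF g] i1 in auto)
 also have "... = M * ?v" using one by simp
 finally have 2: "?J <= (LINT z|lborel. ?h z) + M * ?v" by simp
 have v: "?v \<ge> 0" by simp
 have "(1 / ?D) * (b * ?v) <= 1 * (b * ?v)" using b v by (intro mult_right_mono) auto
 moreover have "(a / ?D) * ?J <= (1/2) * max 0 ?J"
  by (rule order_trans[OF mult_left_mono[OF max.cobounded2] mult_right_mono]) (use a in \<open>auto simp: field_simps\<close>)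
 ultimately have le: "?J <= (1/2) * max 0 ?J + (b + M) * ?v"
  using 1 2 unfolding distrib_right by linarith
 have aux: "x <= 2 * q" if "x <= (1/2) * max 0 x + q" "q \<ge> 0" for x q :: real
  using that by (simp add: max_def split: if_splits)
 have "(b + M) * ?v \<ge> 0" using b v by simp
 from aux[OF le this] show ?thesis by (simp only: mult.assoc)
qed

definition eps :: "nat => real" where "eps k = 1 / real (Suc k)"

lemma eps: "eps k > 0" "eps k <= 1" "k <= l ==> eps l <= eps k" "eps ----> 0"
 using LIMSEQ_Suc[OF lim_1_over_n] by (auto simp: eps_def[abs_def] divide_simps)

locale potential_domain = lipschitz_polyhedron Om for Om :: "(real^'n) set" +
 assumes dim: "CARD('n) \<in> {2, 3}"
begin

abbreviation g :: "nat => real^'n => real" where "g k \<equiv> reg_kernel (eps k)"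
abbreviation p :: "nat => real^'n => real" where "p k \<equiv> reg_grad (eps k)"

lemma reg_mono:
 assumes "k <= l"
 shows "g k z <= g l z" "p k z <= p l z" "p k z \<ge> 0"
 using eps(1)[of l] eps(3)[OF assms] eps(1)[of k] norm2_add_pos[OF eps(1)]
 by (auto simp: reg_kernel_def reg_grad_def newton_grad_nonneg intro!: newton_mono newton_grad_mono add_left_mono power_mono)

lemma smooth_g: "smooth (g k)" and smooth_p: "smooth (p k)"
 by (rule smooth_reg_kernel smooth_reg_grad, rule eps)+

lemma partial_g: "partial i (g k) z = - (z $ i * p k z)"
 by (rule partial_reg_kernel[OF dim eps(1)])

lemma reg_limit:
 assumes "z ~= 0"
 shows "(%k. g k z) ----> G_kernel z" "(%k. p k z) ----> newton_grad CARD('n) ((norm z)^2)"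
proof -
 have s: "(norm z)\<^sup>2 > 0" using assms by simp
 have "(%k. (norm z)^2 + (eps k)^2) ----> (norm z)\<^sup>2 + 0\<^sup>2" by (intro tendsto_add tendsto_const tendsto_power eps)
 then have l: "(%k. (norm z)^2 + (eps k)^2) ----> (norm z)\<^sup>2" by simp
 show "(%k. g k z) ----> G_kernel z" "(%k. p k z) ----> newton_grad CARD('n) ((norm z)^2)"
  unfolding reg_kernel_def reg_grad_def G_kernel_newton[OF dim assms]
  using isCont_tendsto_compose[OF DERIV_isCont[OF newton_deriv[OF dim s]] l] isCont_tendsto_compose[OF DERIV_isCont[OF newton_grad_deriv[OF s]] l] .
qed

lemma closure_radius: obtains R where "R > 0" "!!x. x \<in> closure Om ==> norm x <= R"
proof -
 obtain R where R: "closure Om \<subseteq> cball 0 R" by (rule Om_in_cball)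
 show thesis by (rule that[of "max R 1"]) (use R in auto)
qed

lemma kernel_mass_Cauchy:
 assumes R: "R > 0" and e: "e > 0"
 obtains N where "!!k l. N <= k ==> k <= l ==> (LINT z|lborel. indicator (cball 0 R) z * ((g l z - g k z) + norm z * (p l z - p k z))) < e"
proof -
 let ?d = "CARD('n)"
 let ?h = "%k z. g k z + norm z * p k z"
 define J where "J k = (LINT z|lborel. indicator (cball 0 R) z * ?h k z)" for k
 have cg: "continuous_on UNIV (g k)" and cp: "continuous_on UNIV (%z. norm z * p k z)" for k
  by (rule smooth_continuous_on[OF smooth_g] continuous_on_mult[OF continuous_on_norm[OF continuous_on_id] smooth_continuous_on[OF smooth_p]])+
 have int: "integrable lborel (%z. indicator (cball 0 R) z * f z)" if "continuous_on UNIV f" for f :: "real^'n => real"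
  using borel_integrable_compact[OF compact_cball continuous_on_subset[OF that], of 0 R] by (simp add: mult.commute)
 have ih: "integrable lborel (%z. indicator (cball 0 R) z * ?h k z)" for k
  by (rule int) (intro continuous_on_add cg cp)
 have diff: "(LINT z|lborel. indicator (cball 0 R) z * ((g l z - g k z) + norm z * (p l z - p k z))) = J l - J k" for k l
  unfolding J_def Bochner_Integration.integral_diff[OF ih ih, symmetric] by (simp add: algebra_simps)
 have inc: "J k <= J l" if "k <= l" for k l
  unfolding J_def using reg_mono[OF that] by (intro integral_mono ih) (auto simp: indicator_def intro!: add_mono mult_left_mono)
 let ?v = "measure lborel (cball (0 :: real^'n) R)"
 have quarter: "((norm z)^2 + (eps k)^2) / 4 <= (norm ((1/2) *\<^sub>R z))^2 + (eps k)^2" for z :: "real^'n" and k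
  by (simp add: power_divide)
 have q0: "((norm z)^2 + (eps k)^2) / 4 > 0" for z :: "real^'n" and k using norm2_add_pos[OF eps(1)] by simp
 have ann: "(R / 2)^2 <= (norm z)^2 + (eps k)^2" if "R / 2 <= norm z" for z :: "real^'n" and k
  using power_mono[OF that, of 2] R by (simp add: add_increasing2)
 have R2: "(R / 2)\<^sup>2 > 0" using R by simp
 have b1: "(LINT z|lborel. indicator (cball 0 R) z * g k z) <= 2 * (ln 4 + \<bar>newton ?d ((R / 2)^2)\<bar>) * ?v" for k
 proof (rule dyadic_integral_bound[OF cg])
  show "0 <= real (?d - 1)" "2 * real (?d - 1) <= 2 ^ ?d" "0 <= ln (4 :: real)" "0 <= \<bar>newton ?d ((R / 2)^2)\<bar>" using dim by auto
  show "g k ((1/2) *\<^sub>R z) <= real (?d - 1) * g k z + ln 4" for z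
   unfolding reg_kernel_def using newton_mono[OF q0 quarter] newton_quarter(1)[OF dim norm2_add_pos[OF eps(1)]] by (rule order_trans)
  show "g k z <= \<bar>newton ?d ((R / 2)^2)\<bar>" if "R / 2 <= norm z" for z
   unfolding reg_kernel_def using newton_mono[OF R2 ann[OF that], of ?d k] by linarith
 qed
 have b2: "(LINT z|lborel. indicator (cball 0 R) z * (norm z * p k z)) <= 2 * (0 + R * newton_grad ?d ((R / 2)^2)) * ?v" for k
 proof (rule dyadic_integral_bound[OF cp])
  show "0 <= (2 ^ (?d - 1) :: real)" "2 * (2 ^ (?d - 1) :: real) <= 2 ^ ?d" "0 <= (0 :: real)" "0 <= R * newton_grad ?d ((R / 2)^2)"
   using dim R by (auto simp: newton_grad_nonneg)
  show "norm ((1/2) *\<^sub>R z) * p k ((1/2) *\<^sub>R z) <= 2 ^ (?d - 1) * (norm z * p k z) + 0" for z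
  proof -
   have "p k ((1/2) *\<^sub>R z) <= 2 ^ ?d * p k z"
    unfolding reg_grad_def newton_quarter(2)[OF dim norm2_add_pos[OF eps(1)], symmetric] by (rule newton_grad_mono[OF q0 quarter])
   then have "norm ((1/2) *\<^sub>R z) * p k ((1/2) *\<^sub>R z) <= norm z / 2 * (2 ^ ?d * p k z)" by (simp add: mult_left_mono)
   then show ?thesis using dim by auto
  qed
  show "norm z * p k z <= R * newton_grad ?d ((R / 2)^2)" if "R / 2 <= norm z" "norm z <= R" for z
   unfolding reg_grad_def using newton_grad_mono[OF R2 ann[OF that(1)], of ?d k] that(2)
   by (intro mult_mono newton_grad_nonneg) (use R in auto)
 qed
 let ?B = "2 * (ln 4 + \<bar>newton ?d ((R / 2)^2)\<bar>) * ?v + 2 * (0 + R * newton_grad ?d ((R / 2)^2)) * ?v"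
 have "J k <= ?B" for k
 proof -
  have "J k = (LINT z|lborel. indicator (cball 0 R) z * g k z) + (LINT z|lborel. indicator (cball 0 R) z * (norm z * p k z))"
   unfolding J_def Bochner_Integration.integral_add[OF int[OF cg] int[OF cp], symmetric] by (simp add: distrib_left)
  then show ?thesis using add_mono[OF b1[of k] b2[of k]] by (simp only:)
 qed
 then have bd: "\<forall>k. J k <= ?B" by blast
 have "incseq J" using inc by (simp add: incseq_def)
 then obtain L where "J ----> L" by (rule incseq_convergent[OF _ bd]) (rule that)
 from CauchyD[OF LIMSEQ_imp_Cauchy[OF this] e] obtain N where N: "!!k l. k \<ge> N ==> l \<ge> N ==> norm (J k - J l) < e" by blast
 show thesis
 proof (rule that[of N])
  fix k l assume "N <= k" "k <= l"
  then show "(LINT z|lborel. indicator (cball 0 R) z * ((g l z - g k z) + norm z * (p l z - p k z))) < e"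
   using N[of k l] unfolding diff by simp
 qed
qed

lemma surface_kernel_integrable:
 fixes w k :: "real^'n => real"
 assumes w: "integrable sg w" and k: "continuous_on UNIV k"
 shows "integrable sg (%y. w y * k (x - y))"
proof -
 obtain R where R: "!!x. x \<in> closure Om ==> norm x <= R" by (rule closure_radius) (rule that)
 show ?thesis
  by (rule convolution_integrable[OF sets_surface_measure w _ k, where B=R]) (use AE_surface R in_closure(2) in \<open>auto elim!: eventually_mono\<close>)
qed

lemma const_surface_integrable: "integrable sg (%_. c :: real)"
 by (rule continuous_integrable(2)) (rule continuous_on_const)

lemma kernel_Cauchy:
 assumes e: "e > 0"
 obtains N where "!!k l x. N <= k ==> k <= l ==> x \<in> closure Om ==> (LINT y|sg. g l (x - y) - g k (x - y)) <= e"
proof -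
 obtain C where C: "C > 0" "!!ph. smooth ph ==> (!!x. ph x \<ge> 0) ==> (LINT y|sg. ph y) <= C * (LINT x|vol. ph x + norm (grad ph x))"
  by (rule trace_inequality_L1) blast
 obtain R where R: "R > 0" "!!x. x \<in> closure Om ==> norm x <= R" by (rule closure_radius) (rule that)
 have "2 * R > 0" "e / C > 0" using R e C by auto
 then obtain N where N: "!!k l. N <= k ==> k <= l ==>
   (LINT z|lborel. indicator (cball 0 (2 * R)) z * ((g l z - g k z) + norm z * (p l z - p k z))) < e / C"
  by (rule kernel_mass_Cauchy) (rule that)
 show thesis
 proof (rule that[of N])
  fix k l x assume kl: "N <= k" "k <= l" and x: "x \<in> closure Om"
  let ?ph = "%y. g l (x - y) - g k (x - y)" let ?m = "%z. (g l z - g k z) + norm z * (p l z - p k z)"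
  let ?h = "%z. indicator (cball 0 (2 * R)) z * ?m z"
  note sm = smooth_reflect[OF smooth_g]
  have gr: "norm (grad ?ph y) = norm (x - y) * (p l (x - y) - p k (x - y))" for y
  proof -
   have "grad ?ph y = (p l (x - y) - p k (x - y)) *\<^sub>R (x - y)"
    by (simp add: vec_eq_iff partial_diff[OF sm sm] partial_reflect[OF smooth_g] partial_g algebra_simps)
   then show ?thesis using reg_mono(2)[OF kl(2)] by (simp add: mult.commute)
  qed
  have m: "(%y. ?m (x - y)) \<in> borel_measurable borel" "?m \<in> borel_measurable borel"
   using smooth_measurable[OF smooth_g] smooth_measurable[OF smooth_p] by measurable
  have hm: "?h \<in> borel_measurable borel" using m(2) by (intro borel_measurable_times borel_measurable_indicator) auto
  have cm: "continuous_on UNIV ?m"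
   by (intro continuous_on_add continuous_on_diff continuous_on_mult continuous_on_norm continuous_on_id smooth_continuous_on smooth_g smooth_p)
  have "continuous_on (cball x (2 * R)) (%y. ?m (x - y))"
   by (rule continuous_on_compose2[OF cm]) (auto intro!: continuous_intros)
  then have "integrable lborel (%y. indicator (cball x (2 * R)) y *\<^sub>R ?m (x - y))"
   by (rule borel_integrable_compact[OF compact_cball])
  moreover have "?h (x + (-1) *\<^sub>R y) = indicator (cball x (2 * R)) y *\<^sub>R ?m (x - y)" for y by (simp add: indicator_def dist_norm norm_minus_commute)
  ultimately have ih': "integrable lborel (%y. ?h (x + (-1) *\<^sub>R y))" by (simp only:)
  have "(LINT y|sg. ?ph y) <= C * (LINT y|vol. ?m (x - y))"
   using C(2)[OF smooth_diff[OF sm sm], of l x k x] reg_mono(1)[OF kl(2)] unfolding gr by simp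
  also have "(LINT y|vol. ?m (x - y)) = (LINT y|lborel. indicator Om y * ?m (x - y))"
   by (rule integral_lebesgue_on_borel[OF m(1) Om_borel])
  also have "... <= (LINT y|lborel. ?h (x + (-1) *\<^sub>R y))"
  proof (rule integral_mono'[OF ih'])
   fix y
   have m0: "?m z \<ge> 0" for z using reg_mono[OF kl(2)] by simp
   have "norm (x - y) <= 2 * R" if "y \<in> Om" using R(2)[OF x] R(2)[OF in_closure(1)[OF that]] norm_triangle_ineq4[of x y] by simp
   then show "indicator Om y * ?m (x - y) <= ?h (x + (-1) *\<^sub>R y)" using m0[of "x - y"] by (auto simp: indicator_def)
   show "0 <= ?h (x + (-1) *\<^sub>R y)" using m0 by simp
  qed
  also have "... = (LINT z|lborel. ?h z)" using lborel_integral_affine[OF _ hm, of "-1" x] by simp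
  finally have "(LINT y|sg. ?ph y) <= C * (LINT z|lborel. ?h z)" using C(1) by simp
  also have "... <= C * (e / C)" using N[OF kl] C(1) by (intro mult_left_mono) auto
  finally show "(LINT y|sg. ?ph y) <= e" using C(1) by simp
 qed
qed

definition potential :: "(real^'n => real) => nat => real^'n => real" where
 "potential f k x = (LINT y|sg. f y * g k (x - y))"

lemma bounded_surface_integrable:
 fixes f :: "real^'n => real"
 assumes "f \<in> borel_measurable borel" "!!y. \<bar>f y\<bar> <= C"
 shows "integrable sg f"
proof -
 interpret S: finite_measure sg by (rule finite_surface)
 show ?thesis by (rule S.integrable_const_bound[of _ C]) (use assms in auto)
qed

lemma smooth_potential:
 fixes f :: "real^'n => real"
 assumes f: "f \<in> borel_measurable borel" "!!y. \<bar>f y\<bar> <= C"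
 shows "smooth (potential f k)" "partial i (potential f k) x = (LINT y|sg. f y * ((y - x) $ i * p k (x - y)))"
proof -
 obtain R where R: "!!x. x \<in> closure Om ==> norm x <= R" by (rule closure_radius) (rule that)
 have B: "AE y in sg. f y ~= 0 --> norm y <= R" using AE_surface by eventually_elim (use R in_closure(2) in auto)
 note I = sets_surface_measure bounded_surface_integrable[OF f] B smooth_g
 show "smooth (potential f k)" unfolding potential_def[abs_def] by (rule smooth_convolution[OF I])
 show "partial i (potential f k) x = (LINT y|sg. f y * ((y - x) $ i * p k (x - y)))"
  unfolding potential_def[abs_def] partial_convolution[OF I] partial_g by (simp add: algebra_simps)
qed

lemma potential_Cauchy:
 fixes f :: "real^'n => real"
 assumes f: "f \<in> borel_measurable borel" "!!y. \<bar>f y\<bar> <= C" and e: "e > 0"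
 obtains N where "!!k l x. N <= k ==> N <= l ==> x \<in> closure Om ==> \<bar>potential f k x - potential f l x\<bar> <= e"
proof -
 have C: "C \<ge> 0" using f(2)[of 0] by linarith
 have "e / (C + 1) > 0" using e C by simp
 then obtain N where N: "!!k l x. N <= k ==> k <= l ==> x \<in> closure Om ==> (LINT y|sg. g l (x - y) - g k (x - y)) <= e / (C + 1)"
  by (rule kernel_Cauchy) (rule that)
 note int = surface_kernel_integrable[OF bounded_surface_integrable[OF f] smooth_continuous_on[OF smooth_g]]
 have ig: "integrable sg (%y. g k (x - y))" for k x
  using surface_kernel_integrable[OF const_surface_integrable smooth_continuous_on[OF smooth_g], of 1] by simp
 have le: "\<bar>potential f k x - potential f l x\<bar> <= e" if kl: "N <= k" "k <= l" and x: "x \<in> closure Om" for k l x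
 proof -
  have "potential f l x - potential f k x = (LINT y|sg. f y * g l (x - y) - f y * g k (x - y))"
   unfolding potential_def by (rule Bochner_Integration.integral_diff[OF int int, symmetric])
  also have "\<bar>...\<bar> <= (LINT y|sg. \<bar>f y * g l (x - y) - f y * g k (x - y)\<bar>)" by (rule integral_abs_bound)
  also have "... <= (LINT y|sg. C * (g l (x - y) - g k (x - y)))"
  proof (rule integral_mono)
   fix y
   have "\<bar>f y * g l (x - y) - f y * g k (x - y)\<bar> = \<bar>f y\<bar> * (g l (x - y) - g k (x - y))"
    using reg_mono(1)[OF kl(2), of "x - y"] by (simp add: abs_mult right_diff_distrib[symmetric])
   also have "... <= C * (g l (x - y) - g k (x - y))" using reg_mono(1)[OF kl(2)] by (intro mult_right_mono f) simp
   finally show "\<bar>f y * g l (x - y) - f y * g k (x - y)\<bar> <= C * (g l (x - y) - g k (x - y))" .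
  qed (use int ig in auto)
  also have "... = C * (LINT y|sg. g l (x - y) - g k (x - y))" by simp
  also have "... <= C * (e / (C + 1))" by (intro mult_left_mono N kl x C)
  also have "... <= e" using C e by (simp add: field_simps)
  finally show ?thesis by (simp add: abs_minus_commute)
 qed
 show thesis
 proof (rule that[of N])
  fix k l x assume "N <= k" "N <= l" "x \<in> closure Om"
  then show "\<bar>potential f k x - potential f l x\<bar> <= e"
   using le[of k l x] le[of l k x] by (cases "k <= l") (auto simp: abs_minus_commute)
 qed
qed

lemma single_layer_limit:
 fixes f :: "real^'n => real"
 assumes f: "f \<in> borel_measurable borel" "!!y. \<bar>f y\<bar> <= C" and x: "x \<in> closure Om"
 shows "(%k. potential f k x) ----> single_layer_integral Om f x"
proof -
 have ne: "AE y in sg. y ~= x" by (rule AE_surface_singleton[OF dim_ge_2])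
 have ig: "integrable sg (%y. g k (x - y))" for k x
  using surface_kernel_integrable[OF const_surface_integrable smooth_continuous_on[OF smooth_g], of 1] by simp
 have Gm: "(%y. G_kernel (x - y)) \<in> borel_measurable borel" unfolding G_kernel_def by measurable
 have Gm': "(%y. G_kernel (x - y)) \<in> borel_measurable sg" using Gm by simp
 have lim: "AE y in sg. (%k. g k (x - y)) ----> G_kernel (x - y)"
  using ne by eventually_elim (rule reg_limit, simp)
 have "Cauchy (%k. LINT y|sg. 1 * g k (x - y))"
 proof (rule CauchyI)
  fix e :: real assume "e > 0"
  then have "e / 2 > 0" by simp
  then obtain N where "!!k l x. N <= k ==> N <= l ==> x \<in> closure Om ==> \<bar>potential (%_. 1) k x - potential (%_. 1) l x\<bar> <= e / 2"
   by (rule potential_Cauchy[of "%_. 1" 1, rotated 2]) (auto intro: that)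
  then show "\<exists>N. \<forall>k\<ge>N. \<forall>l\<ge>N. norm ((LINT y|sg. 1 * g k (x - y)) - (LINT y|sg. 1 * g l (x - y))) < e"
   using x \<open>e > 0\<close> unfolding potential_def real_norm_def by (intro exI[of _ N]) force
 qed
 then obtain I where "(%k. LINT y|sg. 1 * g k (x - y)) ----> I" using Cauchy_convergent convergent_def by blast
 then have I: "(%k. LINT y|sg. g k (x - y)) ----> I" by simp
 have iG: "integrable sg (%y. G_kernel (x - y))"
  by (rule integrable_monotone_convergence[OF ig _ lim I Gm']) (auto simp: mono_def reg_mono)
 show ?thesis unfolding potential_def single_layer_integral_def
 proof (rule integral_dominated_convergence)
  show "integrable sg (%y. C * (\<bar>g 0 (x - y)\<bar> + \<bar>G_kernel (x - y)\<bar>))" using ig iG by auto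
  show "AE y in sg. (%k. f y * g k (x - y)) ----> f y * G_kernel (x - y)"
   using lim by eventually_elim (rule tendsto_mult_left)
  show "AE y in sg. norm (f y * g k (x - y)) <= C * (\<bar>g 0 (x - y)\<bar> + \<bar>G_kernel (x - y)\<bar>)" for k
   using lim
  proof eventually_elim
   fix y assume l: "(%k. g k (x - y)) ----> G_kernel (x - y)"
   have "g k (x - y) <= G_kernel (x - y)" by (rule incseq_le[OF _ l]) (auto simp: incseq_def reg_mono)
   moreover have "g 0 (x - y) <= g k (x - y)" by (rule reg_mono) simp
   ultimately have "\<bar>g k (x - y)\<bar> <= \<bar>g 0 (x - y)\<bar> + \<bar>G_kernel (x - y)\<bar>" by linarith
   then show "norm (f y * g k (x - y)) <= C * (\<bar>g 0 (x - y)\<bar> + \<bar>G_kernel (x - y)\<bar>)"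
    unfolding real_norm_def abs_mult using f(2)[of y] by (intro mult_mono) auto
  qed
  show "(%y. f y * g k (x - y)) \<in> borel_measurable sg" for k
   using f(1) borel_measurable_integrable[OF ig] by simp
  show "(%y. f y * G_kernel (x - y)) \<in> borel_measurable sg" using f(1) Gm by simp
 qed
qed

end

section \<open>Layer potentials\<close>

context potential_domain
begin

definition flat_density :: "(real^'n => real) => bool" where
 "flat_density f \<longleftrightarrow> f \<in> borel_measurable borel \<and> (\<exists>C. \<forall>y. \<bar>f y\<bar> <= C) \<and> (\<exists>dl>0. \<forall>y. f y ~= 0 --> flat_at Om dl y)"

lemma Fubini_vol_surface:
 fixes f q w :: "real^'n => real"
 assumes f: "f \<in> borel_measurable borel" "!!x. \<bar>f x\<bar> <= C" "!!x. f x ~= 0 ==> x \<in> Bd"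
  and q: "continuous_on UNIV q" and w: "continuous_on UNIV w"
 shows "(LINT y|vol. (LINT x|sg. f x * q (x - y)) * w y) = (LINT x|sg. f x * (LINT y|vol. q (x - y) * w y))"
  and "integrable sg (%x. f x * (LINT y|vol. q (x - y) * w y))"
proof -
 interpret V: finite_measure vol by (rule finite_vol)
 interpret S: finite_measure sg by (rule finite_surface)
 interpret P: pair_sigma_finite vol sg ..
 interpret PF: finite_measure "vol \<Otimes>\<^sub>M sg" by (rule finite_measure_pair_measure[OF finite_surface finite_vol])
 obtain R where R: "!!x. x \<in> closure Om ==> norm x <= R" by (rule closure_radius) (rule that)
 obtain Q where Q: "!!z. z \<in> cball 0 (2 * R) ==> \<bar>q z\<bar> <= Q" using bounded_on_cball[OF q] by blast
 obtain W where W: "!!y. y \<in> closure Om ==> \<bar>w y\<bar> <= W" using continuous_bounded_closure[OF w] by blast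
 let ?h = "%y x. f x * q (x - y) * w y"
 have idm: "(%y. y) \<in> measurable vol borel" by (intro measurable_restrict_space1 measurable_completion) simp
 have m: "case_prod ?h \<in> borel_measurable (vol \<Otimes>\<^sub>M sg)"
 proof -
  have 1: "fst \<in> measurable (vol \<Otimes>\<^sub>M sg) borel" using measurable_compose[OF measurable_fst[of vol sg] idm] by simp
  have 2: "snd \<in> measurable (vol \<Otimes>\<^sub>M sg) borel" using measurable_snd[of vol sg] by (simp cong: measurable_cong_sets)
  note qm = borel_measurable_continuous_onI[OF q] and wm = borel_measurable_continuous_onI[OF w]
  show ?thesis unfolding split_beta'
   using measurable_compose[OF 2 f(1)] measurable_compose[OF borel_measurable_diff[OF 2 1] qm] measurable_compose[OF 1 wm]
   by (intro borel_measurable_times)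
 qed
 have int: "integrable (vol \<Otimes>\<^sub>M sg) (case_prod ?h)"
 proof (rule PF.integrable_const_bound[OF AE_I2 m])
  fix z assume "z \<in> space (vol \<Otimes>\<^sub>M sg)"
  then obtain y x where z: "z = (y, x)" "y \<in> Om" by (auto simp: space_pair_measure)
  show "norm (case_prod ?h z) <= \<bar>C\<bar> * \<bar>Q\<bar> * \<bar>W\<bar>"
  proof (cases "f x = 0")
   case False
   then have x: "x \<in> closure Om" using f(3) in_closure(2) by blast
   have "norm (x - y) <= 2 * R" using R[OF x] R[OF in_closure(1)[OF z(2)]] norm_triangle_ineq4[of x y] by simp
   then have "\<bar>q (x - y)\<bar> <= \<bar>Q\<bar>" using Q[of "x - y"] by simp
   moreover have "\<bar>w y\<bar> <= \<bar>W\<bar>" "\<bar>f x\<bar> <= \<bar>C\<bar>" using W[OF in_closure(1)[OF z(2)]] f(2)[of x] by auto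
   ultimately show ?thesis unfolding z(1) by (simp add: abs_mult mult_mono)
  qed (simp add: z(1))
 qed
 show "(LINT y|vol. (LINT x|sg. f x * q (x - y)) * w y) = (LINT x|sg. f x * (LINT y|vol. q (x - y) * w y))"
  using P.Fubini_integral[OF int] by (simp add: mult.assoc flip: Bochner_Integration.integral_mult_left_zero)
 show "integrable sg (%x. f x * (LINT y|vol. q (x - y) * w y))"
  using P.integrable_snd[OF int] by (simp add: mult.assoc)
qed

definition interior_part :: "(real^'n => real) => nat => real^'n => real" where
 "interior_part v k x = (LINT y|vol. approx_delta (eps k) (x - y) * v y)"

definition boundary_part :: "(real^'n => real) => nat => real^'n => real" where
 "boundary_part v k x = (LINT y|sg. p k (x - y) * ((x - y) \<bullet> normal y) * v y)"

abbreviation "parts v k x \<equiv> interior_part v k x + boundary_part v k x"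

lemma continuous_grad_kernel: "continuous_on UNIV (%z. z $ i * p k z)"
 by (intro smooth_continuous_on smooth_mult smooth_coord smooth_p)

lemma regularised_representation:
 assumes v: "smooth v"
 shows "(\<Sum>i\<in>UNIV. LINT y|vol. ((x - y) $ i * p k (x - y)) * partial i v y) = parts v k x"
proof -
 let ?q = "%i z. z $ i * p k z"
 have sq: "smooth (?q i)" for i by (intro smooth_mult smooth_coord smooth_p)
 note sm = smooth_reflect[OF sq]
 have c: "continuous_on UNIV v" "continuous_on UNIV (partial i v)" "continuous_on UNIV (%y. ?q i (x - y))" "continuous_on UNIV (partial i (%y. ?q i (x - y)))" for i
  by (intro smooth_continuous_on smooth_partialI v sm)+
 note int = L2_mult_integrable[OF continuous_L2(1) continuous_L2(1)] L2_mult_integrable[OF continuous_L2(2) continuous_L2(2)]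
 have "(\<Sum>i\<in>UNIV. LINT y|vol. ?q i (x - y) * partial i v y) =
   (\<Sum>i\<in>UNIV. (LINT y|sg. ?q i (x - y) * v y * normal y $ i) - (LINT y|vol. partial i (%y. ?q i (x - y)) y * v y))"
 proof (rule sum.cong[OF refl])
  fix i
  show "(LINT y|vol. ?q i (x - y) * partial i v y) = (LINT y|sg. ?q i (x - y) * v y * normal y $ i) - (LINT y|vol. partial i (%y. ?q i (x - y)) y * v y)"
   using divergence_product[OF sm v, of i x i] int(1)[OF c(4) c(1), of i] int(1)[OF c(3) c(2), of i i] by simp
 qed
 also have "... = (LINT y|sg. (\<Sum>i\<in>UNIV. ?q i (x - y) * v y * normal y $ i)) - (LINT y|vol. (\<Sum>i\<in>UNIV. partial i (%y. ?q i (x - y)) y * v y))"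
  unfolding sum_subtractf
  by (subst (1 2) Bochner_Integration.integral_sum) (rule surface_integrable_normal[OF int(2)[OF c(3) c(1)]] int(1)[OF c(4) c(1)] refl)+
 also have "(LINT y|sg. (\<Sum>i\<in>UNIV. ?q i (x - y) * v y * normal y $ i)) = boundary_part v k x"
  unfolding boundary_part_def by (simp add: inner_vec_def sum_distrib_left sum_distrib_right mult_ac)
 also have "(\<Sum>i\<in>UNIV. partial i (%y. ?q i (x - y)) y * v y) = - (approx_delta (eps k) (x - y) * v y)" for y
  by (simp only: partial_reflect[OF sq] mult_minus_left sum_negf sum_distrib_right[symmetric] partial_reg_grad[OF eps(1)])
 then have "(LINT y|vol. (\<Sum>i\<in>UNIV. partial i (%y. ?q i (x - y)) y * v y)) = - interior_part v k x"
  by (simp add: interior_part_def)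
 finally show ?thesis by simp
qed

lemma potential_gradient_pairing:
 assumes f: "flat_density f" and v: "smooth v"
 shows "(\<Sum>i\<in>UNIV. LINT y|vol. partial i (potential f k) y * partial i v y) = (LINT x|sg. f x * parts v k x)"
  and "integrable sg (%x. f x * parts v k x)"
proof -
 obtain C dl where fm: "f \<in> borel_measurable borel" and C: "!!y. \<bar>f y\<bar> <= C" and dl: "!!y. f y ~= 0 ==> flat_at Om dl y"
  using f by (auto simp: flat_density_def)
 have supp: "x \<in> Bd" if "f x ~= 0" for x using dl[OF that] by (simp add: flat_at_def)
 have even: "p k (y - x) = p k (x - y)" for x y by (simp add: reg_grad_def norm_minus_commute)
 have pd: "partial i (potential f k) y = (LINT x|sg. f x * ((x - y) $ i * p k (x - y)))" for y i
  unfolding smooth_potential(2)[OF fm C] even[of y] ..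
 have F: "(LINT y|vol. (LINT x|sg. f x * ((x - y) $ i * p k (x - y))) * partial i v y) = (LINT x|sg. f x * (LINT y|vol. ((x - y) $ i * p k (x - y)) * partial i v y))"
  "integrable sg (%x. f x * (LINT y|vol. ((x - y) $ i * p k (x - y)) * partial i v y))" for i
  by (rule Fubini_vol_surface[OF fm C supp continuous_grad_kernel smooth_continuous_on[OF smooth_partialI[OF v]]], assumption)+
 have e: "f x * parts v k x = (\<Sum>i\<in>UNIV. f x * (LINT y|vol. ((x - y) $ i * p k (x - y)) * partial i v y))" for x
  unfolding regularised_representation[OF v, symmetric] sum_distrib_left ..
 show "integrable sg (%x. f x * parts v k x)"
  unfolding e by (intro Bochner_Integration.integrable_sum F(2))
 show "(\<Sum>i\<in>UNIV. LINT y|vol. partial i (potential f k) y * partial i v y) = (LINT x|sg. f x * parts v k x)"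
  unfolding e Bochner_Integration.integral_sum[OF F(2)] by (rule sum.cong[OF refl], unfold pd, rule F(1))
qed

lemma smooth_approx_delta: "continuous_on UNIV (approx_delta (eps k) :: real^'n => real)"
proof -
 have ne: "(norm (z :: real^'n))^2 + (eps k)^2 ~= 0" for z using norm2_add_pos[OF eps(1)[of k], of z] by linarith
 show ?thesis unfolding approx_delta_def[abs_def]
  by (intro continuous_on_divide continuous_on_mult continuous_on_const smooth_continuous_on smooth_p continuous_on_add continuous_on_power continuous_on_norm continuous_on_id ballI ne)
qed

lemma approx_delta_substitution:
 fixes w :: "real^'n => real"
 assumes w: "w \<in> borel_measurable borel"
 shows "(LINT y|lborel. w y * approx_delta (eps k) (x - y)) = (LINT z|lborel. approx_delta 1 z * w (x + eps k *\<^sub>R z))"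
proof -
 have m: "(%y. w y * approx_delta (eps k) (x - y)) \<in> borel_measurable borel"
  using w borel_measurable_continuous_onI[OF smooth_approx_delta, of k] by measurable
 have ev: "approx_delta (eps k) (- z) = approx_delta (eps k) z" for z :: "real^'n" by (simp add: approx_delta_def reg_grad_def)
 have "(LINT y|lborel. w y * approx_delta (eps k) (x - y)) = (LINT z|lborel. \<bar>eps k\<bar> ^ CARD('n) * (w (x + eps k *\<^sub>R z) * approx_delta (eps k) (x - (x + eps k *\<^sub>R z))))"
  using lborel_integral_affine[OF _ m, of "eps k" x] eps(1)[of k] by simp
 also have "... = (LINT z|lborel. approx_delta 1 z * w (x + eps k *\<^sub>R z))"
  using eps(1)[of k] by (intro Bochner_Integration.integral_cong refl) (simp add: ev approx_delta_scale[OF eps(1), of k, symmetric])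
 finally show ?thesis .
qed

lemma approx_delta_half_space:
 assumes n: "norm (n :: real^'n) = 1"
 shows "(LINT z|lborel. approx_delta 1 z * indicator {z. n \<bullet> z < 0} z) = 1 / 2"
proof -
 let ?a = "approx_delta 1 :: real^'n => real" let ?N = "{z. n \<bullet> z < 0}" let ?P = "{z. 0 < n \<bullet> z}"
 note I = approx_delta_integral[OF dim]
 have am: "?a \<in> borel_measurable borel" using borel_measurable_integrable[OF I(1)] by simp
 have i: "integrable lborel (%z. ?a z * indicator S z)" if "S \<in> sets borel" for S
  using integrable_mult_indicator[of S lborel ?a] that I(1) by (simp add: mult.commute)
 have S: "?N \<in> sets borel" "?P \<in> sets borel" by (auto intro!: borel_open open_halfspace_lt open_halfspace_gt simp: open_halfspace_gt)
 have "(LINT z|lborel. ?a z * indicator ?N z) = (LINT z|lborel. ?a (0 + (-1) *\<^sub>R z) * indicator ?N (0 + (-1) *\<^sub>R z))"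
  using lborel_integral_affine[of "-1" "%z. ?a z * indicator ?N z" 0] am S by simp
 also have "... = (LINT z|lborel. ?a z * indicator ?P z)"
  by (intro Bochner_Integration.integral_cong refl) (simp add: approx_delta_def reg_grad_def indicator_def)
 finally have eq: "(LINT z|lborel. ?a z * indicator ?N z) = (LINT z|lborel. ?a z * indicator ?P z)" .
 have "AE z in lborel. n \<bullet> z ~= 0"
 proof (rule AE_I')
  show "{z. n \<bullet> z = 0} \<in> null_sets lborel"
   using negligible_hyperplane[of n 0] n negligible_iff_null_sets null_sets_completion_iff[of "{z. n \<bullet> z = 0}" lborel] borel_closed[OF closed_hyperplane[of n 0]] by fastforce
 qed auto
 then have "(LINT z|lborel. ?a z * indicator ?N z + ?a z * indicator ?P z) = (LINT z|lborel. ?a z)"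
  using i[OF S(1)] i[OF S(2)] am by (intro integral_cong_AE) (auto elim!: eventually_mono simp: indicator_def)
 then show ?thesis using i[OF S(1)] i[OF S(2)] eq I(2) by simp
qed

lemma interior_part:
 assumes v: "continuous_on UNIV v" and S: "!!y. y \<in> closure Om ==> \<bar>v y\<bar> <= S"
 shows "\<bar>interior_part v k x\<bar> <= S"
  and "flat_at Om dl x ==> dl > 0 ==> (%k. interior_part v k x) ----> v x / 2"
proof -
 let ?w = "%y. indicator Om y * v y"
 let ?y = "%k z. x + eps k *\<^sub>R z"
 have vm: "v \<in> borel_measurable borel" by (rule borel_measurable_continuous_onI[OF v])
 have wm: "?w \<in> borel_measurable borel" using vm Om_borel by measurable
 obtain y0 where "y0 \<in> Om" using nonempty_Om by blast
 then have S0: "S \<ge> 0" using S[OF in_closure(1), of y0] by linarith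
 have wS: "\<bar>?w y\<bar> <= S" for y using S[OF in_closure(1), of y] S0 by (auto simp: indicator_def)
 note I = approx_delta_integral[OF dim]
 have am: "(approx_delta 1 :: real^'n => real) \<in> borel_measurable borel" using borel_measurable_integrable[OF I(1)] by simp
 have e: "interior_part v k x = (LINT z|lborel. approx_delta 1 z * ?w (?y k z))" for k
 proof -
  have "interior_part v k x = (LINT y|lborel. indicator Om y * (approx_delta (eps k) (x - y) * v y))"
   unfolding interior_part_def
   by (rule integral_lebesgue_on_borel[OF _ Om_borel]) (use vm borel_measurable_continuous_onI[OF smooth_approx_delta, of k] in measurable)
  also have "... = (LINT y|lborel. ?w y * approx_delta (eps k) (x - y))" by (simp add: mult_ac)
  finally show ?thesis unfolding approx_delta_substitution[OF wm] .
 qed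
 have m: "(%z. approx_delta 1 z * ?w (?y k z)) \<in> borel_measurable lborel" for k
  using am measurable_compose[of "%z. x + eps k *\<^sub>R z" borel borel ?w borel] wm by simp
 have bd: "norm (approx_delta 1 z * ?w (?y k z)) <= approx_delta 1 z * S" for z k
  unfolding real_norm_def abs_mult abs_of_nonneg[OF approx_delta_nonneg] by (intro mult_left_mono wS[unfolded abs_mult] approx_delta_nonneg)
 have iS: "integrable lborel (%z. approx_delta 1 (z :: real^'n) * S)" using I(1) by simp
 have "\<bar>interior_part v k x\<bar> <= (LINT z|lborel. \<bar>approx_delta 1 z * ?w (?y k z)\<bar>)" unfolding e by (rule integral_abs_bound)
 also have "... <= (LINT z|lborel. approx_delta 1 (z :: real^'n) * S)"
  by (rule integral_mono[OF integrable_abs[OF Bochner_Integration.integrable_bound[OF iS m]] iS])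
   (use bd in \<open>auto intro!: AE_I2 intro: order_trans[OF _ abs_ge_self]\<close>)
 finally show "\<bar>interior_part v k x\<bar> <= S" using I by simp
 assume fl: "flat_at Om dl x" "dl > 0"
 note n = flat_atD[OF fl]
 have "(%k. LINT z|lborel. approx_delta 1 z * ?w (?y k z)) ----> (LINT z|lborel. (approx_delta 1 z * indicator {z. normal x \<bullet> z < 0} z) * v x)"
 proof (rule integral_dominated_convergence[OF _ m iS _ AE_I2])
  show "AE z in lborel. (%k. approx_delta 1 z * ?w (?y k z)) ----> (approx_delta 1 z * indicator {z. normal x \<bullet> z < 0} z) * v x"
  proof (rule AE_I2)
   fix z :: "real^'n"
   have l0: "(%k. x + eps k *\<^sub>R z) ----> x + 0 *\<^sub>R z" by (intro tendsto_intros eps)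
   then have l: "(%k. x + eps k *\<^sub>R z) ----> x" by simp
   have "(%k. v (?y k z)) ----> v x"
    by (rule isCont_tendsto_compose[OF _ l]) (use v in \<open>simp add: continuous_on_eq_continuous_at\<close>)
   then have "(%k. approx_delta 1 z * (indicator {z. normal x \<bullet> z < 0} z * v (?y k z))) ----> approx_delta 1 z * (indicator {z. normal x \<bullet> z < 0} z * v x)"
    by (intro tendsto_mult_left)
   moreover have "\<forall>\<^sub>F k in sequentially. x + eps k *\<^sub>R z \<in> ball x dl"
    using topological_tendstoD[OF l open_ball[of x dl]] fl(2) by simp
   then have "\<forall>\<^sub>F k in sequentially. approx_delta 1 z * (indicator {z. normal x \<bullet> z < 0} z * v (?y k z)) = approx_delta 1 z * ?w (?y k z)"
   proof eventually_elim
    fix k assume "x + eps k *\<^sub>R z \<in> ball x dl"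
    then have "x + eps k *\<^sub>R z \<in> Om \<longleftrightarrow> eps k * (normal x \<bullet> z) < 0" using n(3)[of "x + eps k *\<^sub>R z"] by simp
    then show "approx_delta 1 z * (indicator {z. normal x \<bullet> z < 0} z * v (?y k z)) = approx_delta 1 z * ?w (?y k z)"
     using eps(1)[of k] by (auto simp: indicator_def mult_less_0_iff)
   qed
   ultimately show "(%k. approx_delta 1 z * ?w (?y k z)) ----> (approx_delta 1 z * indicator {z. normal x \<bullet> z < 0} z) * v x"
    unfolding mult.assoc by (rule Lim_transform_eventually)
  qed
  show "(%z. approx_delta 1 z * indicator {z. normal x \<bullet> z < 0} z * v x) \<in> borel_measurable lborel"
   using am by measurable
 qed (rule bd)
 also have "(LINT z|lborel. (approx_delta 1 z * indicator {z. normal x \<bullet> z < 0} z) * v x) = v x / 2"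
  using approx_delta_half_space[OF n(1)] by simp
 finally show "(%k. interior_part v k x) ----> v x / 2" unfolding e .
qed

lemma G_kernel_normal_derivative:
 assumes "x ~= y"
 shows "frechet_derivative (%y. G_kernel (x - y)) (at y) n = newton_grad CARD('n) ((norm (x - y))^2) * ((x - y) \<bullet> (n :: real^'n))"
proof -
 have z: "(norm (x - y))^2 + 0 > 0" using assms by simp
 have d: "((%y. x - y) has_derivative (%h. - h)) (at y)" by (auto intro!: derivative_eq_intros)
 have "((%y. newton CARD('n) ((norm (x - y))^2 + 0)) has_derivative (%h. newton_grad CARD('n) ((norm (x - y))^2) * ((x - y) \<bullet> h))) (at y)"
  using has_derivative_compose[OF d newton_norm2_deriv[OF dim z]] by simp
 then have "((%y. G_kernel (x - y)) has_derivative (%h. newton_grad CARD('n) ((norm (x - y))^2) * ((x - y) \<bullet> h))) (at y)"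
  by (rule has_derivative_transform_within_open[OF _ open_Compl[OF closed_singleton[of x]]]) (use assms G_kernel_newton[OF dim] in auto)
 then show ?thesis by (simp add: frechet_derivative_at[symmetric])
qed

lemma boundary_part:
 assumes v: "continuous_on UNIV v" and S: "!!y. y \<in> closure Om ==> \<bar>v y\<bar> <= S" and dl: "dl > 0"
  and R: "!!y. y \<in> closure Om ==> norm y <= R" and fl: "flat_at Om dl x"
 shows "\<bar>boundary_part v k x\<bar> <= (2 * R * newton_grad CARD('n) (dl^2)) * S * measure sg UNIV"
  and "(%k. boundary_part v k x) ----> double_layer_integral Om v x"
proof -
 interpret F: finite_measure sg by (rule finite_surface)
 let ?h = "%k y. p k (x - y) * ((x - y) \<bullet> normal y) * v y"
 let ?D = "2 * R * newton_grad CARD('n) (dl^2)"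
 have xBd: "x \<in> Bd" using fl by (simp add: flat_at_def)
 have zero: "(x - y) \<bullet> normal y = 0" if "y \<in> Bd" "dist x y < dl" for y
  using flat_at_frontier[OF fl dl that(1) _ open_Om] that(2) by (simp add: inner_diff_right inner_diff_left inner_commute)
 have S0: "S \<ge> 0" using S[OF in_closure(2)[OF xBd]] by linarith
 have bd: "AE y in sg. norm (?h k y) <= ?D * S" for k
  using AE_surface
 proof eventually_elim
  fix y assume y: "y \<in> Bd"
  have R0: "R \<ge> 0" using R[OF in_closure(2)[OF y]] norm_ge_zero[of y] by linarith
  show "norm (?h k y) <= ?D * S"
  proof (cases "dist x y < dl")
   case True
   then show ?thesis using zero[OF y] S0 R0 by (simp add: newton_grad_nonneg)
  next
   case False
   then have "dl^2 <= (norm (x - y))^2 + (eps k)^2" using dl power_mono[of dl "norm (x - y)" 2] by (simp add: dist_norm add_increasing2)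
   then have "p k (x - y) <= newton_grad CARD('n) (dl^2)" unfolding reg_grad_def using dl by (intro newton_grad_mono) simp_all
   moreover have "\<bar>(x - y) \<bullet> normal y\<bar> <= 2 * R"
   proof -
    have "\<bar>(x - y) \<bullet> normal y\<bar> <= norm (x - y) * norm (normal y)" by (rule Cauchy_Schwarz_ineq2)
    also have "... <= norm (x - y) * 1" by (intro mult_left_mono norm_outward_normal_le) simp
    also have "... <= 2 * R" using R[OF in_closure(2)[OF y]] R[OF in_closure(2)[OF xBd]] norm_triangle_ineq4[of x y] by simp
    finally show ?thesis .
   qed
   ultimately have "p k (x - y) * \<bar>(x - y) \<bullet> normal y\<bar> * \<bar>v y\<bar> <= newton_grad CARD('n) (dl^2) * (2 * R) * S"
    using S[OF in_closure(2)[OF y]] reg_mono(3)[of k k "x - y"] S0 R0 by (intro mult_mono) (auto simp: newton_grad_nonneg)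
   then show ?thesis using reg_mono(3)[of k k "x - y"] by (simp add: abs_mult mult_ac)
  qed
 qed
 have nm: "normal \<in> borel_measurable borel" by (rule normal_measurable)
 have vm: "v \<in> borel_measurable borel" by (rule borel_measurable_continuous_onI[OF v])
 have m: "?h k \<in> borel_measurable sg" for k
  using smooth_measurable[OF smooth_p, of k] nm vm by measurable
 have iD: "integrable sg (%_. ?D * S)" by simp
 have "\<bar>boundary_part v k x\<bar> <= (LINT y|sg. \<bar>?h k y\<bar>)" unfolding boundary_part_def by (rule integral_abs_bound)
 also have "... <= (LINT y|sg. ?D * S)"
  by (rule integral_mono_AE[OF integrable_abs[OF F.integrable_const_bound[OF bd m]] iD]) (use bd[of k] in simp)
 finally show "\<bar>boundary_part v k x\<bar> <= ?D * S * measure sg UNIV" by (simp add: mult_ac)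
 let ?H = "%y. v y * frechet_derivative (%y. G_kernel (x - y)) (at y) (normal y)"
 let ?H' = "%y. newton_grad CARD('n) ((norm (x - y))^2) * ((x - y) \<bullet> normal y) * v y"
 have ne: "AE y in sg. y ~= x" by (rule AE_surface_singleton[OF dim_ge_2])
 have H: "?H = (%y. if y = x then ?H x else ?H' y)" by (rule ext) (simp add: G_kernel_normal_derivative)
 have Hm: "?H \<in> borel_measurable sg" by (subst H, unfold newton_grad_def) (use nm vm in measurable)
 show "(%k. boundary_part v k x) ----> double_layer_integral Om v x"
  unfolding double_layer_integral_def boundary_part_def
 proof (rule integral_dominated_convergence[OF _ m iD])
  show "AE y in sg. (%k. ?h k y) ----> ?H y"
   using ne
  proof eventually_elim
   fix y assume y: "y ~= x"
   then show "(%k. ?h k y) ----> ?H y"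
    using tendsto_mult_right[OF tendsto_mult_right[OF reg_limit(2)[of "x - y"], of "(x - y) \<bullet> normal y"], of "v y"]
    by (simp add: G_kernel_normal_derivative mult_ac)
  qed
 qed (rule Hm bd)+
qed

end

context lipschitz_polyhedron
begin

lemma smooth_H1_limit:
 assumes ph: "!!k. smooth (ph k)" and u: "L2_lim vol ph u" and G: "!!i. L2_lim vol (%k. partial i (ph k)) (G i)"
 shows "H1_lim ph u"
proof -
 have "has_weak_grad Om u (%x. \<chi> i. G i x)"
  unfolding has_weak_grad_def
 proof (intro conjI allI impI)
  show "locally_integrable Om u" "locally_integrable Om (%x. (\<chi> i. G i x) $ i)" for i
   using L2_locally_integrable[OF L2_limD(2)[OF u]] L2_locally_integrable[OF L2_limD(2)[OF G]] by simp_all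
  fix ps i assume ps: "test_function Om ps"
  then have sm: "smooth ps" by (rule test_function_smooth)
  have c: "ps \<in> L2 vol" "partial i ps \<in> L2 vol" by (intro continuous_L2(1) smooth_continuous_on smooth_partialI sm)+
  have "(LINT x|vol. ph k x * partial i ps x) = - (LINT x|vol. partial i (ph k) x * ps x)" for k
   using has_weak_grad_smooth[OF ph] ps by (simp add: has_weak_grad_def)
  then have "(%k. LINT x|vol. ph k x * partial i ps x) ----> - (LINT x|vol. G i x * ps x)"
   using tendsto_minus[OF L2_lim_integral_mult1[OF G c(1)]] by simp
  from LIMSEQ_unique[OF L2_lim_integral_mult1[OF u c(2)] this]
  show "(LINT x|vol. u x * partial i ps x) = - (LINT x|vol. (\<chi> i. G i x) $ i * ps x)" by simp
 qed
 note H = H1I[OF L2_limD(2)[OF u] this]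
 have G2: "(%x. (\<chi> i. G i x) $ i) \<in> L2 vol" for i using L2_limD(2)[OF G] by simp
 show ?thesis
 proof (rule H1_lim_smoothI[OF ph H(1)[OF G2] u])
  fix i
  show "L2_lim vol (%k x. partial i (ph k) x) (%x. wgrad u x $ i)"
  proof (rule L2_lim_cong_AE[OF G])
   show "AE x in vol. G i x = wgrad u x $ i" using H(2)[OF G2] by eventually_elim simp
  qed (use L2_measurable[OF L2_limD(1)[OF G]] L2_measurable[OF H1_grad_L2[OF H(1)[OF G2]]] in auto)
 qed
qed

lemma double_layer_adjoint_Hmhalf:
 assumes K: "double_layer_operator Om K" and ps: "ps \<in> Hmhalf Om"
 shows "(%g. ps (%x. 1/2 * g x + K g x)) \<in> Hmhalf Om"
proof -
 have KH: "K g \<in> Hhalf Om" if "g \<in> Hhalf Om" for g using K that by (simp add: double_layer_operator_def)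
 have T: "(%x. 1/2 * g x + K g x) \<in> Hhalf Om" if "g \<in> Hhalf Om" for g by (rule Hhalf_add_scale[OF that KH[OF that]])
 obtain C where C: "!!g. g \<in> Hhalf Om ==> Hhalf_norm Om (K g) <= C * Hhalf_norm Om g"
  using K unfolding double_layer_operator_def by blast
 obtain P where P: "P \<ge> 0" "!!g. g \<in> Hhalf Om ==> \<bar>ps g\<bar> <= P * Hhalf_norm Om g" by (rule Hmhalf_E[OF ps]) (rule that)
 have "ps (%x. 1/2 * (a * g x + h x) + K (%x. a * g x + h x) x) = a * ps (%x. 1/2 * g x + K g x) + ps (%x. 1/2 * h x + K h x)"
  if g: "g \<in> Hhalf Om" and h: "h \<in> Hhalf Om" for g h a
 proof -
  have "AE x in sg. K (%y. a * g y + h y) x = a * K g x + K h x" using K g h by (simp add: double_layer_operator_def)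
  then have "AE x in sg. 1/2 * (a * g x + h x) + K (%x. a * g x + h x) x = a * (1/2 * g x + K g x) + (1/2 * h x + K h x)"
   by eventually_elim (simp add: algebra_simps)
  then have "ps (%x. 1/2 * (a * g x + h x) + K (%x. a * g x + h x) x) = ps (%x. a * (1/2 * g x + K g x) + (1/2 * h x + K h x))"
   by (rule Hmhalf_cong[OF ps T[OF Hhalf_add_scale[OF g h]] Hhalf_add_scale[OF T[OF g] T[OF h]]])
  then show ?thesis unfolding Hmhalf_linear[OF ps T[OF g] T[OF h]] .
 qed
 moreover have "\<bar>ps (%x. 1/2 * g x + K g x)\<bar> <= (P / 2 + P * C) * Hhalf_norm Om g" if g: "g \<in> Hhalf Om" for g
 proof -
  have "\<bar>ps (K g)\<bar> <= P * (C * Hhalf_norm Om g)"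
   using P(2)[OF KH[OF g]] mult_left_mono[OF C[OF g] P(1)] by linarith
  then show ?thesis unfolding Hmhalf_linear[OF ps g KH[OF g]] using P(2)[OF g] by (simp add: algebra_simps)
 qed
 ultimately show ?thesis unfolding Hmhalf_def by blast
qed

end

context potential_domain
begin

lemma pairing_bound:
 assumes f: "flat_density f"
 obtains M where "M > 0" "!!v S k. smooth v ==> (!!y. y \<in> closure Om ==> \<bar>v y\<bar> <= S) ==>
  (\<forall>x. \<bar>f x * parts v k x\<bar> <= M * S) \<and>
  \<bar>LINT x|sg. f x * parts v k x\<bar> <= M * S"
proof -
 interpret F: finite_measure sg by (rule finite_surface)
 obtain C dl where C: "!!y. \<bar>f y\<bar> <= C" and dl: "dl > 0" "!!y. f y ~= 0 ==> flat_at Om dl y"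
  using f by (auto simp: flat_density_def)
 obtain R where R: "R > 0" "!!x. x \<in> closure Om ==> norm x <= R" by (rule closure_radius) (rule that)
 let ?m = "measure sg UNIV" let ?D = "2 * R * newton_grad CARD('n) (dl^2)"
 have D0: "?D \<ge> 0" using R(1) by (simp add: newton_grad_nonneg)
 have C0: "C \<ge> 0" using C[of 0] by linarith
 let ?M0 = "C * (1 + ?D * ?m)"
 have M0: "?M0 \<ge> 0" using D0 C0 by simp
 have pw: "\<bar>f x * parts v k x\<bar> <= ?M0 * S"
  if v: "smooth v" and S: "!!y. y \<in> closure Om ==> \<bar>v y\<bar> <= S" for v S k x
 proof (cases "f x = 0")
  case True
  obtain y where "y \<in> Om" using nonempty_Om by blast
  then have "S \<ge> 0" using S[OF in_closure(1), of y] by linarith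
  then show ?thesis using True M0 by simp
 next
  case False
  note fl = dl(2)[OF False]
  have "\<bar>parts v k x\<bar> <= S + ?D * S * ?m"
   using interior_part(1)[OF smooth_continuous_on[OF v] S, of k x] boundary_part(1)[OF smooth_continuous_on[OF v] S dl(1) R(2) fl, of k] by linarith
  also have "... = (1 + ?D * ?m) * S" by (simp add: algebra_simps)
  finally show ?thesis unfolding abs_mult using mult_mono[OF C[of x] _ C0 abs_ge_zero] by (simp only: mult.assoc)
 qed
 have "0 < (?M0 + 1) * (1 + ?m)" using M0 by (intro mult_pos_pos add_nonneg_pos add_pos_nonneg) auto
 then show thesis
 proof (rule that)
  fix v S k assume v: "smooth v" and S: "!!y. y \<in> closure Om ==> \<bar>v y\<bar> <= S"
  obtain y where "y \<in> Om" using nonempty_Om by blast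
  then have S0: "S \<ge> 0" using S[OF in_closure(1), of y] by linarith
  have "?M0 * S * 1 <= ((?M0 + 1) * S) * (1 + ?m)" "?M0 * S * ?m <= ((?M0 + 1) * S) * (1 + ?m)"
   using S0 M0 by (intro mult_mono mult_right_mono; simp)+
  then have le: "?M0 * S <= (?M0 + 1) * (1 + ?m) * S" "?M0 * S * ?m <= (?M0 + 1) * (1 + ?m) * S" by (simp_all only: mult_ac mult_1)
  have "\<bar>LINT x|sg. f x * parts v k x\<bar> <= (LINT x|sg. \<bar>f x * parts v k x\<bar>)"
   by (rule integral_abs_bound)
  also have "... <= (LINT x|sg. ?M0 * S)"
   by (rule integral_mono[OF integrable_abs[OF potential_gradient_pairing(2)[OF f v]]]) (use pw[OF v S] in auto)
  also have "... = ?M0 * S * ?m" by (simp add: mult.commute)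
  finally show "(\<forall>x. \<bar>f x * parts v k x\<bar> <= (?M0 + 1) * (1 + ?m) * S) \<and>
   \<bar>LINT x|sg. f x * parts v k x\<bar> <= (?M0 + 1) * (1 + ?m) * S"
   using le pw[OF v S] by (meson order_trans)
 qed
qed

lemma potential_H1_limit:
 assumes f: "flat_density f"
 obtains u where "H1_lim (potential f) u"
proof -
 interpret V: finite_measure vol by (rule finite_vol)
 obtain C where fm: "f \<in> borel_measurable borel" and C: "!!y. \<bar>f y\<bar> <= C" using f by (auto simp: flat_density_def)
 obtain M where M: "M > 0" "!!v S k. smooth v ==> (!!y. y \<in> closure Om ==> \<bar>v y\<bar> <= S) ==>
  (\<forall>x. \<bar>f x * parts v k x\<bar> <= M * S) \<and>
  \<bar>LINT x|sg. f x * parts v k x\<bar> <= M * S"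
  by (rule pairing_bound[OF f]) blast
 let ?u = "potential f"
 have sm: "smooth (?u k)" for k by (rule smooth_potential(1)[OF fm C])
 have sp: "smooth (partial i (?u k))" for i k by (rule smooth_partialI[OF sm])
 have L2: "ph \<in> L2 vol" if "smooth ph" for ph by (rule continuous_L2(1)[OF smooth_continuous_on[OF that]])
 let ?v = "measure vol (space vol)"
 have "\<exists>u. L2_lim vol ?u u"
 proof (rule V.L2_complete[of ?u])
  fix e :: real assume e: "e > 0"
  let ?r = "sqrt (e / (2 * (?v + 1)))"
  have v0: "?v + 1 > 0" by (simp add: add_nonneg_pos)
  then have "?r > 0" using e by simp
  then obtain N where N: "!!k l x. N <= k ==> N <= l ==> x \<in> closure Om ==> \<bar>?u k x - ?u l x\<bar> <= ?r"
   by (rule potential_Cauchy[OF fm C]) (rule that)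
  have "(LINT x|vol. (?u m x - ?u n x)^2) < e" if mn: "m \<ge> N" "n \<ge> N" for m n
  proof -
   have "(LINT x|vol. (?u m x - ?u n x)^2) <= (LINT x|vol. ?r^2)"
   proof (rule integral_mono_AE[OF L2_square[OF L2_diff[OF L2[OF sm] L2[OF sm]]]])
    show "AE x in vol. (?u m x - ?u n x)^2 <= ?r^2"
     using AE_vol_in by eventually_elim (intro abs_le_square_iff[THEN iffD1], use N[OF mn in_closure(1)] \<open>?r > 0\<close> in auto)
   qed simp
   also have "... = (e / 2) * (?v / (?v + 1))" using e v0 by (simp add: field_simps)
   also have "... <= (e / 2) * 1" using e v0 by (intro mult_left_mono) auto
   also have "... < e" using e by simp
   finally show ?thesis .
  qed
  then show "\<exists>N. \<forall>m\<ge>N. \<forall>n\<ge>N. (LINT x|vol. (?u m x - ?u n x)^2) < e" by blast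
 qed (use L2[OF sm] in blast)+
 then obtain u where u: "L2_lim vol ?u u" by blast
 have "\<exists>G. L2_lim vol (%k. partial i (?u k)) G" for i
 proof (rule V.L2_complete[of "%k. partial i (?u k)"])
  fix e :: real assume e: "e > 0"
  let ?r = "e / (4 * M)"
  have "?r > 0" using e M by simp
  then obtain N where N: "!!k l x. N <= k ==> N <= l ==> x \<in> closure Om ==> \<bar>?u k x - ?u l x\<bar> <= ?r"
   by (rule potential_Cauchy[OF fm C]) (rule that)
  have "(LINT x|vol. (partial i (?u m) x - partial i (?u n) x)^2) < e" if mn: "m \<ge> N" "n \<ge> N" for m n
  proof -
   let ?d = "%x. ?u m x - ?u n x"
   have sd: "smooth ?d" by (rule smooth_diff[OF sm sm])
   note int = L2_mult_integrable[OF L2[OF sp] L2[OF smooth_partialI[OF sd]]]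
   let ?J = "%k. LINT x|sg. f x * parts ?d k x"
   have "(LINT x|vol. (partial i (?u m) x - partial i (?u n) x)^2) <= (\<Sum>j\<in>UNIV. LINT x|vol. (partial j (?u m) x - partial j (?u n) x)^2)"
    by (rule member_le_sum) auto
   also have "... = (\<Sum>j\<in>UNIV. (LINT x|vol. partial j (?u m) x * partial j ?d x) - (LINT x|vol. partial j (?u n) x * partial j ?d x))"
   proof (rule sum.cong[OF refl])
    fix j
    have "(partial j (?u m) x - partial j (?u n) x)^2 = partial j (?u m) x * partial j ?d x - partial j (?u n) x * partial j ?d x" for x
     by (simp add: partial_diff[OF sm sm] power2_eq_square algebra_simps)
    then show "(LINT x|vol. (partial j (?u m) x - partial j (?u n) x)^2) = (LINT x|vol. partial j (?u m) x * partial j ?d x) - (LINT x|vol. partial j (?u n) x * partial j ?d x)"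
     using int by simp
   qed
   also have "... = ?J m - ?J n"
    unfolding sum_subtractf potential_gradient_pairing(1)[OF f sd] ..
   also have "... <= M * ?r + M * ?r"
    using M(2)[OF sd N[OF mn], of m] M(2)[OF sd N[OF mn], of n] by linarith
   also have "... < e" using e M by simp
   finally show ?thesis .
  qed
  then show "\<exists>N. \<forall>m\<ge>N. \<forall>n\<ge>N. (LINT x|vol. (partial i (?u m) x - partial i (?u n) x)^2) < e" by blast
 qed (use L2[OF sp] in blast)+
 then have "\<forall>i. \<exists>G. L2_lim vol (%k. partial i (?u k)) G" by blast
 from choice[OF this] obtain G where G: "!!i. L2_lim vol (%k. partial i (?u k)) (G i)" by blast
 show thesis by (rule that[OF smooth_H1_limit[OF sm u G]])
qed

lemma potential_trace:
 assumes f: "flat_density f" and u: "H1_lim (potential f) u" and h: "h \<in> L2 sg" "AE x in sg. h x = single_layer_integral Om f x"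
 shows "AE x in sg. tr u x = h x"
proof -
 interpret F: finite_measure sg by (rule finite_surface)
 obtain C where fm: "f \<in> borel_measurable borel" and C: "!!y. \<bar>f y\<bar> <= C" using f by (auto simp: flat_density_def)
 let ?u = "potential f"
 have sm: "smooth (?u k)" for k by (rule smooth_potential(1)[OF fm C])
 have L2: "?u k \<in> L2 sg" for k by (rule continuous_L2(2)[OF smooth_continuous_on[OF sm]])
 show ?thesis
 proof (rule trace_eqI[OF sm u], unfold L2_lim_def, intro conjI allI L2 h(1) LIMSEQ_I)
  fix r :: real assume r: "r > 0"
  let ?m = "measure sg (space sg)" let ?e = "sqrt (r / (2 * (?m + 1)))"
  have m0: "?m + 1 > 0" by (simp add: add_nonneg_pos)
  then have e: "?e > 0" using r by simp
  then obtain N where N: "!!k l x. N <= k ==> N <= l ==> x \<in> closure Om ==> \<bar>?u k x - ?u l x\<bar> <= ?e"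
   by (rule potential_Cauchy[OF fm C]) (rule that)
  have "norm ((LINT x|sg. (?u k x - h x)^2) - 0) < r" if k: "k \<ge> N" for k
  proof -
   have "(LINT x|sg. (?u k x - h x)^2) <= (LINT x|sg. ?e^2)"
   proof (rule integral_mono_AE[OF L2_square[OF L2_diff[OF L2 h(1)]]])
    show "AE x in sg. (?u k x - h x)^2 <= ?e^2"
     using AE_surface h(2)
    proof eventually_elim
     fix x assume x: "x \<in> Bd" and hx: "h x = single_layer_integral Om f x"
     have "(%l. \<bar>?u k x - ?u l x\<bar>) ----> \<bar>?u k x - h x\<bar>"
      unfolding hx by (intro tendsto_rabs tendsto_diff tendsto_const single_layer_limit[OF fm C in_closure(2)[OF x]])
     then have "\<bar>?u k x - h x\<bar> <= ?e"
      by (rule LIMSEQ_le_const2) (use N[OF k _ in_closure(2)[OF x]] in blast)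
     then show "(?u k x - h x)^2 <= ?e^2" using e by (intro abs_le_square_iff[THEN iffD1]) simp
    qed
   qed simp
   also have "... = (r / 2) * (?m / (?m + 1))" using r m0 by (simp add: field_simps)
   also have "... <= (r / 2) * 1" using r m0 by (intro mult_left_mono) auto
   also have "... < r" using r by simp
   finally show ?thesis by simp
  qed
  then show "\<exists>N. \<forall>k\<ge>N. norm ((LINT x|sg. (?u k x - h x)^2) - 0) < r" by blast
 qed
qed

lemma flat_density_L2:
 assumes "flat_density f"
 shows "f \<in> L2 sg"
proof -
 obtain C where "f \<in> borel_measurable borel" "!!y. \<bar>f y\<bar> <= C" using assms by (auto simp: flat_density_def)
 then show ?thesis by (intro finite_measure.L2_bounded[OF finite_surface, of f C]) simp_all
qed

lemma potential_gradient_smooth: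
 assumes f: "flat_density f" and u: "H1_lim (potential f) u" and v: "smooth v"
  and k: "k \<in> borel_measurable sg" "AE x in sg. k x = double_layer_integral Om v x"
 shows "(\<Sum>i\<in>UNIV. LINT x|vol. wgrad u x $ i * partial i v x) = (LINT x|sg. f x * (1/2 * v x + k x))"
proof -
 interpret F: finite_measure sg by (rule finite_surface)
 obtain C dl where fm: "f \<in> borel_measurable borel" and C: "!!y. \<bar>f y\<bar> <= C" and dl: "dl > 0" "!!y. f y ~= 0 ==> flat_at Om dl y"
  using f by (auto simp: flat_density_def)
 obtain R where R: "R > 0" "!!x. x \<in> closure Om ==> norm x <= R" by (rule closure_radius) (rule that)
 obtain M where M: "M > 0" "!!v S k. smooth v ==> (!!y. y \<in> closure Om ==> \<bar>v y\<bar> <= S) ==>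
  (\<forall>x. \<bar>f x * parts v k x\<bar> <= M * S) \<and>
  \<bar>LINT x|sg. f x * parts v k x\<bar> <= M * S"
  by (rule pairing_bound[OF f]) blast
 note cv = smooth_continuous_on[OF v]
 obtain S where S: "!!y. y \<in> closure Om ==> \<bar>v y\<bar> <= S" using continuous_bounded_closure[OF cv] by blast
 have sm: "smooth (potential f k)" for k by (rule smooth_potential(1)[OF fm C])
 have "(%k. \<Sum>i\<in>UNIV. LINT x|vol. partial i (potential f k) x * partial i v x) ----> (\<Sum>i\<in>UNIV. LINT x|vol. wgrad u x $ i * partial i v x)"
  by (intro tendsto_sum L2_lim_integral_mult1 H1_lim_smoothD sm u continuous_L2(1) smooth_continuous_on smooth_partialI v)
 then have l1: "(%k. LINT x|sg. f x * parts v k x) ----> (\<Sum>i\<in>UNIV. LINT x|vol. wgrad u x $ i * partial i v x)"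
  unfolding potential_gradient_pairing(1)[OF f v] .
 have l2: "(%k. LINT x|sg. f x * parts v k x) ----> (LINT x|sg. f x * (1/2 * v x + k x))"
 proof (rule integral_dominated_convergence[where w="%_. M * S"])
  show "AE x in sg. (%k. f x * parts v k x) ----> f x * (1/2 * v x + k x)"
   using k(2)
  proof eventually_elim
   fix x assume kx: "k x = double_layer_integral Om v x"
   show "(%k. f x * parts v k x) ----> f x * (1/2 * v x + k x)"
   proof (cases "f x = 0")
    case False
    from tendsto_mult_left[OF tendsto_add[OF interior_part(2)[OF cv S dl(2)[OF False] dl(1)] boundary_part(2)[OF cv S dl(1) R(2) dl(2)[OF False]]], of "f x"]
    show ?thesis by (simp add: kx)
   qed simp
  qed
  show "(%x. f x * (1/2 * v x + k x)) \<in> borel_measurable sg"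
   using fm smooth_measurable[OF v] k(1) by measurable
  show "AE x in sg. norm (f x * parts v k x) <= M * S" for k
   using M(2)[OF v S, of k] by simp
  show "(%x. f x * parts v k x) \<in> borel_measurable sg" for k
   by (rule borel_measurable_integrable[OF potential_gradient_pairing(2)[OF f v]])
 qed simp
 show ?thesis by (rule LIMSEQ_unique[OF l1 l2])
qed

theorem layer_potential:
 assumes f: "flat_density f" and V: "single_layer_operator Om V" and K: "double_layer_operator Om K"
 obtains u where "u \<in> H1 Om" "AE x in sg. tr u x = V (density_functional f) x"
  "!!v. v \<in> H1 Om ==> (\<Sum>i\<in>UNIV. LINT x|vol. wgrad u x $ i * wgrad v x $ i) = density_functional f (%x. 1/2 * tr v x + K (tr v) x)"
proof -
 obtain u where u: "H1_lim (potential f) u" by (rule potential_H1_limit[OF f])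
 have df: "density_functional f \<in> Hmhalf Om" by (rule density_functional_Hmhalf[OF flat_density_L2[OF f]])
 have "f \<in> Linf sg" using f by (auto simp: flat_density_def Linf_def)
 then have Vf: "AE x in sg. V (density_functional f) x = single_layer_integral Om f x" "V (density_functional f) \<in> Hhalf Om"
  using V df by (auto simp: single_layer_operator_def)
 let ?\<chi> = "%g. density_functional f (%x. 1/2 * g x + K g x)"
 have \<chi>: "?\<chi> \<in> Hmhalf Om" by (rule double_layer_adjoint_Hmhalf[OF K df])
 have "(\<Sum>i\<in>UNIV. LINT x|vol. wgrad u x $ i * wgrad v x $ i) = ?\<chi> (tr v)" if v: "v \<in> H1 Om" for v
 proof -
  obtain ph where ph: "!!k. smooth (ph k)" "H1_lim ph v" by (rule smooth_dense_H1[OF v]) (rule that)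
  have "(\<Sum>i\<in>UNIV. LINT x|vol. wgrad u x $ i * partial i (ph k) x) = ?\<chi> (tr (ph k))" for k
  proof -
   have "K (ph k) \<in> Hhalf Om" "AE x in sg. K (ph k) x = double_layer_integral Om (ph k) x"
    using K smooth_Hhalf[OF ph(1)] ph(1) by (simp_all add: double_layer_operator_def)
   then have "(\<Sum>i\<in>UNIV. LINT x|vol. wgrad u x $ i * partial i (ph k) x) = ?\<chi> (ph k)"
    by (intro potential_gradient_smooth[OF f u ph(1)] L2_measurable[OF Hhalf_L2])
   also have "... = ?\<chi> (tr (ph k))"
    by (rule Hmhalf_cong[OF \<chi> smooth_Hhalf[OF ph(1)] trace_Hhalf[OF smooth_H1(1)[OF ph(1)]]])
     (use trace_smooth[OF ph(1)[of k]] in \<open>auto elim!: eventually_mono\<close>)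
   finally show ?thesis .
  qed
  then have "(%k. \<Sum>i\<in>UNIV. LINT x|vol. wgrad u x $ i * partial i (ph k) x) ----> ?\<chi> (tr v)"
   using Hmhalf_trace_limit[OF \<chi> ph(2)] by simp
  moreover have "(%k. \<Sum>i\<in>UNIV. LINT x|vol. partial i (ph k) x * wgrad u x $ i) ----> (\<Sum>i\<in>UNIV. LINT x|vol. wgrad v x $ i * wgrad u x $ i)"
   by (intro tendsto_sum L2_lim_integral_mult1 H1_lim_smoothD ph H1_grad_L2 H1_limD(2)[OF u])
  ultimately show ?thesis using LIMSEQ_unique by (simp add: mult.commute) blast
 qed
 moreover have "AE x in sg. tr u x = V (density_functional f) x"
  by (rule potential_trace[OF f u Hhalf_L2[OF Vf(2)] Vf(1)])
 ultimately show thesis using that[OF H1_limD(2)[OF u]] by blast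
qed

end

section \<open>The double layer pairing\<close>

locale boundary_operators = potential_domain Om for Om :: "(real^'n) set" +
 fixes V :: "((real^'n => real) => real) => real^'n => real" and K :: "(real^'n => real) => real^'n => real" and C\<^sub>K :: real
 assumes V: "single_layer_operator Om V" "symmetric_elliptic Om V" and K: "double_layer_operator Om K"
  and C\<^sub>K: "contraction_constant Om V K C\<^sub>K"
begin

abbreviation q :: "((real^'n => real) => real) => real" where "q ps \<equiv> ps (V ps)"
abbreviation T :: "(real^'n => real) => real^'n => real" where "T th \<equiv> %x. 1/2 * th x + K th x"
abbreviation H :: "((real^'n => real) => real) set" where "H \<equiv> Hmhalf Om"
abbreviation \<D> :: "(real^'n => real) => (real^'n => real) => real" where "\<D> \<equiv> density_functional"

lemma V_Hhalf: "ps \<in> H ==> V ps \<in> Hhalf Om"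
 and K_Hhalf: "th \<in> Hhalf Om ==> K th \<in> Hhalf Om"
 and V_symmetric: "ph \<in> H ==> ps \<in> H ==> ph (V ps) = ps (V ph)"
 using V K by (auto simp: single_layer_operator_def double_layer_operator_def symmetric_elliptic_def)

lemma T_Hhalf: "th \<in> Hhalf Om ==> T th \<in> Hhalf Om"
 by (rule Hhalf_add_scale[OF _ K_Hhalf])

lemma q_nonneg: "ps \<in> H ==> q ps \<ge> 0"
 and q_bound: "\<exists>al>0. \<forall>ps\<in>H. \<forall>th\<in>Hhalf Om. \<bar>ps th\<bar> <= sqrt (q ps / al) * Hhalf_norm Om th"
proof -
 obtain al where al: "al > 0" "!!ps. ps \<in> H ==> q ps \<ge> al * (Hmhalf_norm Om ps)^2"
  using V(2) by (auto simp: symmetric_elliptic_def)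
 show "q ps \<ge> 0" if "ps \<in> H" for ps
  using al(2)[OF that] al(1) by (meson mult_nonneg_nonneg less_imp_le order_trans zero_le_power2)
 have "\<bar>ps th\<bar> <= sqrt (q ps / al) * Hhalf_norm Om th" if ps: "ps \<in> H" and th: "th \<in> Hhalf Om" for ps th
 proof -
  have "(Hmhalf_norm Om ps)^2 <= q ps / al" using al(2)[OF ps] al(1) by (simp add: pos_le_divide_eq mult.commute)
  then have "Hmhalf_norm Om ps <= sqrt (q ps / al)" by (rule real_le_rsqrt)
  then show ?thesis using Hmhalf_bound[OF ps th] mult_right_mono[OF _ Hhalf_norm_nonneg[OF th]] by (meson order_trans)
 qed
 then show "\<exists>al>0. \<forall>ps\<in>H. \<forall>th\<in>Hhalf Om. \<bar>ps th\<bar> <= sqrt (q ps / al) * Hhalf_norm Om th" using al(1) by blast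
qed

lemma functional_V_lincomb:
 assumes ze: "ze \<in> H" and ph: "ph \<in> H" and ps: "ps \<in> H"
 shows "ze (V (%th. a * ph th + ps th)) = a * ze (V ph) + ze (V ps)"
proof -
 have "AE x in sg. V (%th. a * ph th + ps th) x = a * V ph x + V ps x" using V(1) ph ps by (simp add: single_layer_operator_def)
 then have "ze (V (%th. a * ph th + ps th)) = ze (%x. a * V ph x + V ps x)"
  by (rule Hmhalf_cong[OF ze V_Hhalf[OF Hmhalf_lincomb[OF ph ps]] Hhalf_add_scale[OF V_Hhalf[OF ph] V_Hhalf[OF ps]]])
 then show ?thesis unfolding Hmhalf_linear[OF ze V_Hhalf[OF ph] V_Hhalf[OF ps]] .
qed

lemma q_lincomb:
 assumes ph: "ph \<in> H" and ps: "ps \<in> H"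
 shows "q (%th. a * ph th + ps th) = a^2 * q ph + 2 * a * ps (V ph) + q ps"
 unfolding functional_V_lincomb[OF Hmhalf_lincomb[OF ph ps] ph ps] V_symmetric[OF ph ps]
 by (simp add: power2_eq_square algebra_simps V_symmetric[OF ph ps])

lemma nonneg_quadratic_discriminant:
 fixes a b c :: real
 assumes q: "!!t. 0 <= t^2 * a + 2 * t * b + c" and a: "a \<ge> 0"
 shows "b^2 <= a * c"
proof (cases "a = 0")
 case True
 have "b = 0"
 proof (rule ccontr)
  assume "b ~= 0"
  then show False using q[of "- (c + 1) / (2 * b)"] True by (simp add: field_simps)
 qed
 then show ?thesis using True by simp
next
 case False
 have "0 <= (- b / a)^2 * a + 2 * (- b / a) * b + c" by (rule q)
 also have "... = c - b^2 / a" using False by (simp add: power2_eq_square)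
 finally show ?thesis using False a by (simp add: pos_divide_le_eq mult.commute)
qed

lemma q_Cauchy_Schwarz:
 assumes ph: "ph \<in> H" and ps: "ps \<in> H"
 shows "(ps (V ph))^2 <= q ph * q ps"
 by (rule nonneg_quadratic_discriminant) (use q_nonneg[OF Hmhalf_lincomb[OF ph ps]] q_lincomb[OF ph ps] q_nonneg[OF ph] in auto)

lemma q_eq_0:
 assumes "ps \<in> H" "q ps = 0" "th \<in> Hhalf Om"
 shows "ps th = 0"
 using q_bound assms by fastforce

lemma V_zero:
 assumes ps: "ps \<in> H" and 0: "AE x in sg. V ps x = 0" and th: "th \<in> Hhalf Om"
 shows "ps th = 0"
proof -
 have z: "(%x. 0 :: real) \<in> Hhalf Om" by (rule smooth_Hhalf[OF smooth_const])
 have "q ps = ps (%x. 0)" by (rule Hmhalf_cong[OF ps V_Hhalf[OF ps] z 0])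
 also have "... = 0" using Hmhalf_linear[OF ps z z, of 1] by simp
 finally show ?thesis by (rule q_eq_0[OF ps _ th])
qed

lemma V_inverse_norm_V:
 assumes ps: "ps \<in> H" and th: "th \<in> Hhalf Om" "AE x in sg. V ps x = th x"
 shows "V_inverse_norm Om V th = sqrt (q ps)"
proof -
 let ?ph = "V_inverse Om V th"
 have "?ph \<in> H \<and> (AE x in sg. V ?ph x = th x)"
  unfolding V_inverse_def by (rule someI[of _ ps]) (use ps th in blast)
 then have ph: "?ph \<in> H" "AE x in sg. V ?ph x = th x" by blast+
 have "AE x in sg. V (%th. -1 * ps th + ?ph th) x = -1 * V ps x + V ?ph x" using V(1) ph(1) ps unfolding single_layer_operator_def by blast
 then have "AE x in sg. V (%th. -1 * ps th + ?ph th) x = 0" using th(2) ph(2) by eventually_elim simp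
 then have "-1 * ps th + ?ph th = 0" by (rule V_zero[OF Hmhalf_lincomb[OF ps ph(1)] _ th(1)])
 moreover have "ps th = q ps" by (rule Hmhalf_cong[OF ps th(1) V_Hhalf[OF ps]]) (use th(2) in \<open>auto elim!: eventually_mono\<close>)
 ultimately show ?thesis by (simp add: V_inverse_norm_def)
qed

lemma flat_D: "flat_density f ==> \<D> f \<in> H"
 by (rule density_functional_Hmhalf[OF flat_density_L2])

lemma flat_density_separates:
 assumes h: "h \<in> Hhalf Om" and 0: "!!f. flat_density f ==> \<D> f h = 0"
 shows "AE x in sg. h x = 0"
proof -
 interpret F: finite_measure sg by (rule finite_surface)
 have hm: "h \<in> borel_measurable borel" using h by (simp add: Hhalf_def)
 let ?S = "%m :: nat. {y. flat_at Om (1 / real (Suc m)) y}"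
 have "AE x in sg. x \<in> ?S m --> h x = 0" for m
 proof -
  let ?f = "%x. indicator (?S m) x * sgn (h x)"
  have S: "?S m \<in> sets borel" by (intro borel_closed closed_flat_at open_Om) simp
  have "?f \<in> borel_measurable borel"
   using hm S by (intro borel_measurable_times borel_measurable_indicator) (auto simp: sgn_if[abs_def])
  then have fl: "flat_density ?f"
   unfolding flat_density_def
   by (intro conjI exI[of _ "1 :: real"] exI[of _ "1 / real (Suc m)"]) (simp_all add: indicator_def abs_sgn_eq)
  have i: "integrable sg (%x. ?f x * h x)" by (rule L2_mult_integrable[OF flat_density_L2[OF fl] Hhalf_L2[OF h]])
  have n: "?f x * h x = indicator (?S m) x * \<bar>h x\<bar>" for x by (simp only: mult.assoc mult.commute[of "sgn (h x)" "h x"] abs_sgn)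
  have "(LINT x|sg. ?f x * h x) = 0" by (rule 0[OF fl])
  then have "AE x in sg. ?f x * h x = 0"
   using integral_nonneg_eq_0_iff_AE[OF i] unfolding n by simp
  then show ?thesis unfolding n by eventually_elim (auto simp: indicator_def)
 qed
 then have "AE x in sg. \<forall>m. x \<in> ?S m --> h x = 0" by (subst AE_all_countable) (rule allI)
 then show ?thesis
  using AE_normal
 proof eventually_elim
  fix x assume a: "\<forall>m. x \<in> ?S m --> h x = 0" and n: "is_outward_normal Om x (normal x) \<and>
   (\<forall>n be. norm n = 1 --> plane n be \<in> boundary_planes Om --> x \<in> plane n be --> normal x \<in> {n, - n})"
  obtain dl where dl: "dl > 0" "flat_at Om dl x" by (rule is_outward_normal_flat[OF conjunct1[OF n] open_Om])
  obtain m where "1 / real (Suc m) < dl" using nat_approx_posE[OF dl(1)] by blast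
  then have "flat_at Om (1 / real (Suc m)) x" by (intro flat_at_mono[OF dl(2)]) simp
  then show "h x = 0" using a by blast
 qed
qed

lemma adjoint_H: "ps \<in> H ==> (%th. ps (T th)) \<in> H"
 by (rule double_layer_adjoint_Hmhalf[OF K])

text \<open>Both sides of the symmetry \<open>V T' = T V\<close> are the Dirichlet inner product of two single layer potentials.\<close>

lemma V_adjoint:
 assumes f: "flat_density f"
 shows "AE x in sg. V (%th. \<D> f (T th)) x = T (V (\<D> f)) x"
proof -
 note D = flat_D[OF f]
 let ?ze = "%th. \<D> f (T th)"
 have h: "(%x. V ?ze x - T (V (\<D> f)) x) \<in> Hhalf Om"
  by (intro Hhalf_diff V_Hhalf adjoint_H T_Hhalf D)
 obtain u where u: "u \<in> H1 Om" "AE x in sg. tr u x = V (\<D> f) x"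
  "!!v. v \<in> H1 Om ==> (\<Sum>i\<in>UNIV. LINT x|vol. wgrad u x $ i * wgrad v x $ i) = \<D> f (T (tr v))"
  by (rule layer_potential[OF f V(1) K]) (rule that)
 have "\<D> f' (%x. V ?ze x - T (V (\<D> f)) x) = 0" if f': "flat_density f'" for f'
 proof -
  note D' = flat_D[OF f']
  obtain u' where u': "u' \<in> H1 Om" "AE x in sg. tr u' x = V (\<D> f') x"
   "!!v. v \<in> H1 Om ==> (\<Sum>i\<in>UNIV. LINT x|vol. wgrad u' x $ i * wgrad v x $ i) = \<D> f' (T (tr v))"
   by (rule layer_potential[OF f' V(1) K]) (rule that)
  have "\<D> f' (V ?ze) = ?ze (V (\<D> f'))" by (rule V_symmetric[OF D' adjoint_H[OF D]])
  also have "... = ?ze (tr u')"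
   by (rule Hmhalf_cong[OF adjoint_H[OF D] V_Hhalf[OF D'] trace_Hhalf[OF u'(1)]]) (use u'(2) in \<open>auto elim!: eventually_mono\<close>)
  also have "... = (\<Sum>i\<in>UNIV. LINT x|vol. wgrad u x $ i * wgrad u' x $ i)" by (rule u(3)[OF u'(1), symmetric])
  also have "... = (\<Sum>i\<in>UNIV. LINT x|vol. wgrad u' x $ i * wgrad u x $ i)" by (simp only: mult.commute)
  also have "... = \<D> f' (T (tr u))" by (rule u'(3)[OF u(1)])
  also have "... = \<D> f' (T (V (\<D> f)))"
   by (rule Hmhalf_cong[OF adjoint_H[OF D'] trace_Hhalf[OF u(1)] V_Hhalf[OF D] u(2)])
  finally show ?thesis unfolding Hmhalf_diff[OF D' V_Hhalf[OF adjoint_H[OF D]] T_Hhalf[OF V_Hhalf[OF D]]] by simp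
 qed
 then have "AE x in sg. V ?ze x - T (V (\<D> f)) x = 0" by (rule flat_density_separates[OF h])
 then show ?thesis by eventually_elim simp
qed

lemma flat_pairing_bound:
 assumes f: "flat_density f" and v: "v \<in> H1 Om"
 shows "(\<D> f (T (tr v)))^2 <= C\<^sub>K * q (\<D> f) * (LINT x|vol. (norm (wgrad v x))^2)"
proof -
 note D = flat_D[OF f]
 let ?ze = "%th. \<D> f (T th)"
 note ze = adjoint_H[OF D]
 have CK: "C\<^sub>K > 0" "!!th. th \<in> Hhalf Om ==> V_inverse_norm Om V (T th) <= C\<^sub>K * V_inverse_norm Om V th"
  using C\<^sub>K by (auto simp: contraction_constant_def)
 obtain u where u: "u \<in> H1 Om" "AE x in sg. tr u x = V (\<D> f) x"
  "!!v. v \<in> H1 Om ==> (\<Sum>i\<in>UNIV. LINT x|vol. wgrad u x $ i * wgrad v x $ i) = \<D> f (T (tr v))"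
  by (rule layer_potential[OF f V(1) K]) (rule that)
 have "sqrt (q ?ze) <= C\<^sub>K * sqrt (q (\<D> f))"
  using CK(2)[OF V_Hhalf[OF D]] V_inverse_norm_V[OF D V_Hhalf[OF D] AE_I2[OF refl]] V_inverse_norm_V[OF ze T_Hhalf[OF V_Hhalf[OF D]] V_adjoint[OF f]]
  by simp
 from sqrt_le_D[OF this] have sq: "q ?ze <= C\<^sub>K\<^sup>2 * q (\<D> f)"
  using q_nonneg[OF D] by (simp add: power_mult_distrib)
 let ?G = "%u v. \<Sum>i\<in>UNIV. LINT x|vol. wgrad u x $ i * wgrad v x $ i"
 have "(?ze (V (\<D> f)))^2 <= q (\<D> f) * q ?ze" by (rule q_Cauchy_Schwarz[OF D ze])
 also have "... <= q (\<D> f) * (C\<^sub>K\<^sup>2 * q (\<D> f))" by (rule mult_left_mono[OF sq q_nonneg[OF D]])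
 also have "... = (C\<^sub>K * q (\<D> f))^2" by (simp add: power2_eq_square mult_ac)
 finally have "?ze (V (\<D> f)) <= C\<^sub>K * q (\<D> f)"
  by (rule power2_le_imp_le) (use CK(1) q_nonneg[OF D] in simp)
 moreover have "?G u u = ?ze (V (\<D> f))"
  unfolding u(3)[OF u(1)] by (rule Hmhalf_cong[OF ze trace_Hhalf[OF u(1)] V_Hhalf[OF D] u(2)])
 ultimately have uu: "?G u u <= C\<^sub>K * q (\<D> f)" by simp
 have int: "integrable vol (%x. wgrad w x $ i * wgrad w' x $ i)" if "w \<in> H1 Om" "w' \<in> H1 Om" for w w' i
  by (rule L2_mult_integrable[OF H1_grad_L2[OF that(1)] H1_grad_L2[OF that(2)]])
 have vv: "?G v v = (LINT x|vol. (norm (wgrad v x))^2)"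
  unfolding power2_norm_eq_inner inner_vec_def by (subst Bochner_Integration.integral_sum) (use int[OF v v] in auto)
 have "0 <= t^2 * ?G u u + 2 * t * ?G u v + ?G v v" for t
 proof -
  have e: "(LINT x|vol. (t * wgrad u x $ i + wgrad v x $ i)^2) = t^2 * (LINT x|vol. wgrad u x $ i * wgrad u x $ i)
    + 2 * t * (LINT x|vol. wgrad u x $ i * wgrad v x $ i) + (LINT x|vol. wgrad v x $ i * wgrad v x $ i)" for i
  proof -
   have "(t * wgrad u x $ i + wgrad v x $ i)^2 = t^2 * (wgrad u x $ i * wgrad u x $ i) + 2 * t * (wgrad u x $ i * wgrad v x $ i) + wgrad v x $ i * wgrad v x $ i" for x
    by (simp add: power2_eq_square algebra_simps)
   then show ?thesis using int[OF u(1) u(1)] int[OF u(1) v] int[OF v v] by simp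
  qed
  have "0 <= (\<Sum>i\<in>UNIV. LINT x|vol. (t * wgrad u x $ i + wgrad v x $ i)^2)" by (intro sum_nonneg) simp
  then show ?thesis unfolding e by (simp only: sum.distrib sum_distrib_left[symmetric])
 qed
 then have "(?G u v)^2 <= ?G u u * ?G v v"
  by (rule nonneg_quadratic_discriminant) (intro sum_nonneg, simp)
 also have "... <= C\<^sub>K * q (\<D> f) * ?G v v" by (rule mult_right_mono[OF uu]) (simp add: vv)
 finally show ?thesis unfolding u(3)[OF v] vv .
qed

lemma flat_density_lincomb:
 assumes "flat_density f" "flat_density f'"
 shows "flat_density (%x. a * f x + f' x)"
proof -
 obtain C dl where f: "f \<in> borel_measurable borel" "!!y. \<bar>f y\<bar> <= C" "dl > 0" "!!y. f y ~= 0 ==> flat_at Om dl y"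
  using assms(1) by (auto simp: flat_density_def)
 obtain C' dl' where f': "f' \<in> borel_measurable borel" "!!y. \<bar>f' y\<bar> <= C'" "dl' > 0" "!!y. f' y ~= 0 ==> flat_at Om dl' y"
  using assms(2) by (auto simp: flat_density_def)
 have "\<bar>a * f y + f' y\<bar> <= \<bar>a\<bar> * C + C'" for y
  using mult_left_mono[OF f(2)[of y] abs_ge_zero[of a]] f'(2)[of y] by (simp add: abs_mult[symmetric])
 moreover have "flat_at Om (min dl dl') y" if "a * f y + f' y ~= 0" for y
  using that f(4)[of y] f'(4)[of y] flat_at_mono[of Om dl y "min dl dl'"] flat_at_mono[of Om dl' y "min dl dl'"] by (cases "f y = 0") auto
 ultimately show ?thesis unfolding flat_density_def using f(1,3) f'(1,3)
  by (intro conjI borel_measurable_add borel_measurable_times borel_measurable_const exI[of _ "\<bar>a\<bar> * C + C'"] exI[of _ "min dl dl'"]) auto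
qed

lemma D_lincomb:
 assumes "flat_density f" "flat_density f'" "th \<in> Hhalf Om"
 shows "\<D> (%x. a * f x + f' x) th = a * \<D> f th + \<D> f' th"
proof -
 have "(LINT x|sg. (a * f x + f' x) * th x) = (LINT x|sg. a * (f x * th x) + f' x * th x)" by (simp add: algebra_simps)
 then show ?thesis
  using L2_mult_integrable[OF flat_density_L2[OF assms(1)] Hhalf_L2[OF assms(3)]] L2_mult_integrable[OF flat_density_L2[OF assms(2)] Hhalf_L2[OF assms(3)]]
  by simp
qed

lemma q_cong:
 assumes "ph \<in> H" "ps \<in> H" "!!th. th \<in> Hhalf Om ==> ph th = ps th"
 shows "q ph = q ps"
 using assms(3)[OF V_Hhalf[OF assms(1)]] assms(3)[OF V_Hhalf[OF assms(2)]] V_symmetric[OF assms(1,2)] by simp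

text \<open>The distances \<open>ps - f\<^sub>k\<close> of a minimising sequence of flat densities converge to a functional that vanishes on the potentials
 of all flat densities, hence to 0.\<close>

lemma flat_density_approximation:
 assumes ps: "ps \<in> H"
 obtains F where "!!k. flat_density (F k)" "!!th. th \<in> Hhalf Om ==> (%k. \<D> (F k) th) ----> ps th"
  "!!k f. flat_density f ==> (ps (V (\<D> f)) - \<D> (F k) (V (\<D> f)))^2 <= q (\<D> f) * (eps k)^2"
proof -
 let ?r = "%f th. -1 * \<D> f th + ps th"
 have rH: "?r f \<in> H" if "flat_density f" for f by (rule Hmhalf_lincomb[OF flat_D[OF that] ps])
 define m where "m = (INF f\<in>Collect flat_density. q (?r f))"
 have bdd: "bdd_below ((%f. q (?r f)) ` Collect flat_density)"
  using q_nonneg[OF rH] by (intro bdd_belowI2[of _ 0]) simp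
 have fl0: "flat_density (%_. 0)" by (auto simp: flat_density_def intro: exI[of _ 1])
 have m: "m <= q (?r f)" if "flat_density f" for f
  unfolding m_def by (rule cINF_lower[OF bdd]) (use that in simp)
 have "\<exists>f. flat_density f \<and> q (?r f) < m + (eps k)^2" for k
 proof -
  have "m < m + (eps k)^2" using eps(1)[of k] by simp
  then show ?thesis unfolding m_def using fl0 by (subst (asm) (1) cINF_less_iff[OF _ bdd]) (auto simp: m_def)
 qed
 then have "\<forall>k. \<exists>f. flat_density f \<and> q (?r f) < m + (eps k)^2" by blast
 from choice[OF this] obtain F where F: "!!k. flat_density (F k)" "!!k. q (?r (F k)) < m + (eps k)^2" by blast
 define r where "r k = ?r (F k)" for k
 have r: "r k \<in> H" "q (r k) < m + (eps k)^2" for k using rH[OF F(1)] F(2) by (simp_all add: r_def)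
 have orth: "(r k (V (\<D> f)))^2 <= q (\<D> f) * (eps k)^2" if f: "flat_density f" for f k
 proof -
  have "0 <= t^2 * q (\<D> f) + 2 * t * r k (V (\<D> f)) + (q (r k) - m)" for t
  proof -
   let ?f = "%x. (-t) * f x + F k x"
   have fl: "flat_density ?f" by (rule flat_density_lincomb[OF f F(1)])
   have "m <= q (?r ?f)" by (rule m[OF fl])
   also have "... = q (%th. t * \<D> f th + r k th)"
    by (rule q_cong[OF rH[OF fl] Hmhalf_lincomb[OF flat_D[OF f] r(1)]]) (simp only: D_lincomb[OF f F(1)] r_def, simp)
   also have "... = t^2 * q (\<D> f) + 2 * t * r k (V (\<D> f)) + q (r k)" by (rule q_lincomb[OF flat_D[OF f] r(1)])
   finally show ?thesis by simp
  qed
  from nonneg_quadratic_discriminant[OF this q_nonneg[OF flat_D[OF f]]]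
  have "(r k (V (\<D> f)))^2 <= q (\<D> f) * (q (r k) - m)" .
  also have "... <= q (\<D> f) * (eps k)^2" using r(2)[of k] by (intro mult_left_mono q_nonneg[OF flat_D[OF f]]) simp
  finally show ?thesis .
 qed
 have orth': "\<bar>r k (V (\<D> f))\<bar> <= sqrt (q (\<D> f)) * eps k" if f: "flat_density f" for f k
  using real_sqrt_le_mono[OF orth[OF f, of k]] eps(1)[of k] by (simp add: real_sqrt_mult)
 obtain al where al: "al > 0" "!!ph th. ph \<in> H ==> th \<in> Hhalf Om ==> \<bar>ph th\<bar> <= sqrt (q ph / al) * Hhalf_norm Om th"
  using q_bound by blast
 have diff: "\<bar>r k th - r l th\<bar> <= (eps k + eps l) * (Hhalf_norm Om th / sqrt al)" if th: "th \<in> Hhalf Om" for k l th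
 proof -
  let ?f = "%x. -1 * F k x + F l x"
  have fl: "flat_density ?f" by (rule flat_density_lincomb[OF F(1) F(1)])
  have e: "\<D> ?f th = r k th - r l th" if "th \<in> Hhalf Om" for th
   by (simp only: D_lincomb[OF F(1) F(1) that] r_def)
  let ?s = "sqrt (q (\<D> ?f))"
  have s0: "?s \<ge> 0" by (rule real_sqrt_ge_zero[OF q_nonneg[OF flat_D[OF fl]]])
  have "?s * ?s = q (\<D> ?f)" by (simp only: real_sqrt_mult_self abs_of_nonneg[OF q_nonneg[OF flat_D[OF fl]]])
  also have "... = r k (V (\<D> ?f)) - r l (V (\<D> ?f))" by (rule e[OF V_Hhalf[OF flat_D[OF fl]]])
  also have "... <= ?s * eps k + ?s * eps l" using orth'[OF fl, of k] orth'[OF fl, of l] by linarith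
  finally have ss: "?s * ?s <= ?s * (eps k + eps l)" by (simp only: distrib_left)
  have le: "?s <= eps k + eps l"
  proof (cases "?s = 0")
   case True
   then show ?thesis using eps(1)[of k] eps(1)[of l] by linarith
  next
   case False
   then have "?s > 0" using s0 by linarith
   then show ?thesis by (rule mult_left_le_imp_le[OF ss])
  qed
  have "\<bar>r k th - r l th\<bar> <= sqrt (q (\<D> ?f) / al) * Hhalf_norm Om th"
   using al(2)[OF flat_D[OF fl] th] unfolding e[OF th] .
  also have "... = ?s * (Hhalf_norm Om th / sqrt al)" by (simp only: real_sqrt_divide times_divide_eq_left times_divide_eq_right)
  also have "... <= (eps k + eps l) * (Hhalf_norm Om th / sqrt al)"
   using al(1) by (intro mult_right_mono le) (simp add: Hhalf_norm_nonneg[OF th])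
  finally show ?thesis .
 qed
 define R where "R th = lim (%k. r k th)" for th
 have R: "(%k. r k th) ----> R th" if th: "th \<in> Hhalf Om" for th
 proof -
  define c where "c = Hhalf_norm Om th / sqrt al"
  have c: "c \<ge> 0" using al(1) by (simp add: c_def Hhalf_norm_nonneg[OF th])
  have "Cauchy (%k. r k th)"
  proof (rule CauchyI)
   fix e :: real assume e: "e > 0"
   then have "e / (2 * (c + 1)) > 0" using c by simp
   from LIMSEQ_D[OF eps(4) this] obtain N where N: "!!k. k \<ge> N ==> norm (eps k - 0) < e / (2 * (c + 1))" by blast
   have "norm (r k th - r l th) < e" if kl: "k \<ge> N" "l \<ge> N" for k l
   proof -
    have "eps k + eps l <= 2 * (e / (2 * (c + 1)))" using N[OF kl(1)] N[OF kl(2)] unfolding real_norm_def by linarith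
    also have "... = e / (c + 1)" using c by (simp add: divide_simps)
    finally have "eps k + eps l <= e / (c + 1)" .
    then have "(eps k + eps l) * c <= e / (c + 1) * c" by (rule mult_right_mono[OF _ c])
    also have "... < e" using e c by (simp add: pos_divide_less_eq algebra_simps)
    finally show ?thesis using diff[OF th, of k l] by (simp add: c_def)
   qed
   then show "\<exists>N. \<forall>k\<ge>N. \<forall>l\<ge>N. norm (r k th - r l th) < e" by blast
  qed
  then show ?thesis unfolding R_def by (simp add: real_Cauchy_convergent convergent_LIMSEQ_iff[symmetric])
 qed
 have RH: "R \<in> H"
 proof -
  have "R (%x. a * th x + h x) = a * R th + R h" if th: "th \<in> Hhalf Om" "h \<in> Hhalf Om" for th h a
  proof -
   have "(%k. r k (%x. a * th x + h x)) ----> a * R th + R h"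
    unfolding Hmhalf_linear[OF r(1) th] by (intro tendsto_add tendsto_mult_left R th)
   with R[OF Hhalf_add_scale[OF th]] show ?thesis by (rule LIMSEQ_unique)
  qed
  moreover have "\<bar>R th\<bar> <= sqrt ((m + 1) / al) * Hhalf_norm Om th" if th: "th \<in> Hhalf Om" for th
  proof (rule LIMSEQ_le_const2[OF tendsto_rabs[OF R[OF th]]], rule exI[of _ 0], intro allI impI)
   fix k
   have "(eps k)^2 <= 1\<^sup>2" using eps(1)[of k] eps(2)[of k] by (intro power_mono) auto
   then have "q (r k) / al <= (m + 1) / al" using r(2)[of k] al(1) by (intro divide_right_mono) auto
   then have "sqrt (q (r k) / al) * Hhalf_norm Om th <= sqrt ((m + 1) / al) * Hhalf_norm Om th"
    by (intro mult_right_mono real_sqrt_le_mono Hhalf_norm_nonneg th)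
   then show "\<bar>r k th\<bar> <= sqrt ((m + 1) / al) * Hhalf_norm Om th" using al(2)[OF r(1)[of k] th] by linarith
  qed
  ultimately show ?thesis unfolding Hmhalf_def by blast
 qed
 have "\<D> f (V R) = 0" if f: "flat_density f" for f
 proof -
  have "(%k. sqrt (q (\<D> f)) * eps k) ----> sqrt (q (\<D> f)) * 0" by (intro tendsto_mult_left eps)
  then have "(%k. \<bar>r k (V (\<D> f))\<bar>) ----> 0"
   by (intro LIMSEQ_squeeze_0[OF _ abs_ge_zero orth'[OF f]]) simp
  then have "(%k. r k (V (\<D> f))) ----> 0" by (simp only: tendsto_rabs_zero_iff)
  from LIMSEQ_unique[OF R[OF V_Hhalf[OF flat_D[OF f]]] this] show ?thesis
   using V_symmetric[OF flat_D[OF f] RH] by simp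
 qed
 then have "AE x in sg. V R x = 0" by (rule flat_density_separates[OF V_Hhalf[OF RH]])
 then have R0: "R th = 0" if "th \<in> Hhalf Om" for th by (rule V_zero[OF RH _ that])
 have Dr: "\<D> (F k) th = ps th - r k th" for k th by (simp add: r_def)
 show thesis
 proof (rule that[OF F(1)])
  show "(%k. \<D> (F k) th) ----> ps th" if th: "th \<in> Hhalf Om" for th
   unfolding Dr using tendsto_diff[OF tendsto_const R[OF th], of "ps th"] by (simp add: R0[OF th])
  show "(ps (V (\<D> f)) - \<D> (F k) (V (\<D> f)))^2 <= q (\<D> f) * (eps k)^2" if "flat_density f" for k f
   unfolding Dr using orth[OF that, of k] by simp
 qed
qed

theorem double_layer_pairing_bound:
 assumes ps: "ps \<in> H" and v: "v \<in> H1 Om"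
 shows "(ps (T (tr v)))^2 <= C\<^sub>K * q ps * (LINT x|vol. (norm (wgrad v x))^2)"
proof -
 obtain F where F: "!!k. flat_density (F k)" "!!th. th \<in> Hhalf Om ==> (%k. \<D> (F k) th) ----> ps th"
  "!!k f. flat_density f ==> (ps (V (\<D> f)) - \<D> (F k) (V (\<D> f)))^2 <= q (\<D> f) * (eps k)^2"
  by (rule flat_density_approximation[OF ps]) (rule that)
 let ?x = "%k. q (\<D> (F k))" let ?A = "%k. \<D> (F k) (V ps)" let ?D = "LINT x|vol. (norm (wgrad v x))^2"
 have CK: "C\<^sub>K \<ge> 0" using C\<^sub>K by (simp add: contraction_constant_def)
 have D: "?D \<ge> 0" by simp
 have x: "?x k <= (?A k + eps k / 2) / (1 - eps k / 2)" for k
 proof -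
  note DF = flat_D[OF F(1)[of k]]
  have "\<bar>ps (V (\<D> (F k))) - ?x k\<bar> <= sqrt (?x k) * eps k"
   using real_sqrt_le_mono[OF F(3)[OF F(1)[of k], of k]] eps(1)[of k] by (simp add: real_sqrt_mult)
  moreover have "sqrt (?x k) * eps k <= (?x k + 1) / 2 * eps k"
  proof (rule mult_right_mono)
   have "0 <= (sqrt (?x k) - 1)^2" by simp
   then show "sqrt (?x k) <= (?x k + 1) / 2" using q_nonneg[OF DF] by (simp add: power2_diff)
  qed (use eps(1)[of k] in simp)
  ultimately have "?x k <= ?A k + (?x k + 1) / 2 * eps k" using V_symmetric[OF DF ps] by linarith
  then have "?x k * (1 - eps k / 2) <= ?A k + eps k / 2" by (simp add: field_simps)
  moreover have "1 - eps k / 2 > 0" using eps(2)[of k] by simp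
  ultimately show ?thesis by (simp only: pos_le_divide_eq)
 qed
 have "(%k. (?A k + eps k / 2) / (1 - eps k / 2)) ----> (q ps + 0 / 2) / (1 - 0 / 2)"
  by (intro tendsto_divide tendsto_add tendsto_diff tendsto_const eps F(2) V_Hhalf ps) simp_all
 then have lim: "(%k. C\<^sub>K * ((?A k + eps k / 2) / (1 - eps k / 2)) * ?D) ----> C\<^sub>K * q ps * ?D"
  by (intro tendsto_mult_right tendsto_mult_left) simp
 have le: "(\<D> (F k) (T (tr v)))^2 <= C\<^sub>K * ((?A k + eps k / 2) / (1 - eps k / 2)) * ?D" for k
  using flat_pairing_bound[OF F(1)[of k] v] mult_right_mono[OF mult_left_mono[OF x[of k] CK] D] by linarith
 have lhs: "(%k. (\<D> (F k) (T (tr v)))^2) ----> (ps (T (tr v)))\<^sup>2"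
  by (intro tendsto_power F(2) T_Hhalf trace_Hhalf v)
 show ?thesis by (rule LIMSEQ_le[OF lhs lim]) (use le in blast)
qed

end

lemma C_harm_quadratic_form:
 fixes a p mu C :: real
 assumes "C \<ge> 0"
 defines "S \<equiv> sqrt ((mu - 1)^2 + C)"
 shows "1/2 * (mu + 1 - S) * (a^2 + p^2) <= mu * a^2 - sqrt C * (a * p) + p^2"
proof -
 have S2: "S^2 = (mu - 1)^2 + C" using assms(1) by (simp add: S_def)
 have "\<bar>mu - 1\<bar> <= S" unfolding S_def using assms(1) by (intro real_le_rsqrt) simp
 then have pos: "0 <= S + (mu - 1)" "0 <= S - (mu - 1)" by linarith+
 let ?X = "sqrt ((S + (mu - 1)) / 2)" let ?Y = "sqrt ((S - (mu - 1)) / 2)"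
 have "?X * ?Y = sqrt (C / 4)"
  unfolding real_sqrt_mult[symmetric] using S2 by (intro arg_cong[of _ _ sqrt]) (simp add: power2_eq_square algebra_simps)
 then have XY: "2 * (?X * ?Y) = sqrt C" by (simp add: real_sqrt_divide)
 have "0 <= (?X * a - ?Y * p)^2" by simp
 also have "... = ?X^2 * a^2 - 2 * (?X * ?Y) * (a * p) + ?Y^2 * p^2" by (simp add: power2_eq_square algebra_simps)
 also have "... = (S + (mu - 1)) / 2 * a^2 - sqrt C * (a * p) + (S - (mu - 1)) / 2 * p^2"
  unfolding XY using pos by simp
 finally show ?thesis by (simp add: algebra_simps add_divide_distrib diff_divide_distrib)
qed

theorem lemma2:
  fixes \<Omega> :: "(real^'n) set"
    and \<T> :: "(real^'n) set set"
    and A :: "real^'n \<Rightarrow> real^'n^'n"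
    and b :: "real^'n \<Rightarrow> real^'n"
    and c :: "real^'n \<Rightarrow> real"
    and V :: "((real^'n \<Rightarrow> real) \<Rightarrow> real) \<Rightarrow> real^'n \<Rightarrow> real"
    and K :: "(real^'n \<Rightarrow> real) \<Rightarrow> real^'n \<Rightarrow> real"
    and C\<^sub>K \<epsilon> :: real
    and v :: "real^'n \<Rightarrow> real"
    and \<psi> :: "(real^'n \<Rightarrow> real) \<Rightarrow> real"
  assumes dim: "CARD('n) \<in> {2, 3}"
    and domain: "polyhedral_lipschitz_domain \<Omega>"
    and diam: "CARD('n) = 2 \<Longrightarrow> diameter \<Omega> < 1"
    and mesh: "mesh_of \<Omega> \<T>"
    and A: "diffusion_coefficient \<Omega> \<T> A"
    and bc: "lower_order_coefficients \<Omega> b c"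
    and V: "single_layer_operator \<Omega> V" "symmetric_elliptic \<Omega> V"
    and K: "double_layer_operator \<Omega> K"
    and C\<^sub>K: "contraction_constant \<Omega> V K C\<^sub>K"
    and eps: "0 < \<epsilon>" "\<epsilon> < 1"
    and ellipticity: "(1 - \<epsilon>) * lambda_min \<Omega> A - 1/4 * C\<^sub>K > 0"
    and v: "v \<in> H1 \<Omega>"
    and \<psi>: "\<psi> \<in> Hmhalf \<Omega>"
  shows "form_B \<Omega> A b c V K (v, \<psi>) (v, \<psi>) \<ge>
    min \<epsilon> (C_harm \<epsilon> (lambda_min \<Omega> A) C\<^sub>K) * ((energy_norm \<Omega> A b c v)\<^sup>2 + (V_norm V \<psi>)\<^sup>2)"
proof -
 interpret boundary_operators \<Omega> V K C\<^sub>K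
 proof
  show "CARD('n) \<ge> 2" using dim by auto
 qed (fact domain dim V K C\<^sub>K)+
 let ?E = "(energy_norm \<Omega> A b c v)\<^sup>2" and ?D = "LINT x|lebesgue_on \<Omega>. (norm (weak_grad \<Omega> v x))\<^sup>2"
 let ?l = "lambda_min \<Omega> A" and ?P = "\<psi> (%x. 1/2 * bd_trace \<Omega> v x + K (bd_trace \<Omega> v) x)"
 note t = trace_Hhalf[OF v] and CA = coercivity_A[OF mesh A bc v]
 have CK: "C\<^sub>K \<ge> 0" using C\<^sub>K by (simp add: contraction_constant_def)
 have q: "\<psi> (V \<psi>) \<ge> 0" by (rule q_nonneg[OF \<psi>])
 have D: "?D \<ge> 0" by simp
 have "\<psi> (%x. 1/2 * bd_trace \<Omega> v x - K (bd_trace \<Omega> v) x) = \<psi> (%x. bd_trace \<Omega> v x - (1/2 * bd_trace \<Omega> v x + K (bd_trace \<Omega> v) x))"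
  by (rule arg_cong[where f=\<psi>]) (auto simp: algebra_simps)
 also have "... = \<psi> (bd_trace \<Omega> v) - ?P" by (rule Hmhalf_diff[OF \<psi> t T_Hhalf[OF t]])
 finally have B: "form_B \<Omega> A b c V K (v, \<psi>) (v, \<psi>) = form_A \<Omega> A b c v v - ?P + \<psi> (V \<psi>)" by simp
 have "sqrt (?P\<^sup>2) <= sqrt (C\<^sub>K * \<psi> (V \<psi>) * ?D)" by (rule real_sqrt_le_mono[OF double_layer_pairing_bound[OF \<psi> v]])
 then have P: "?P <= sqrt C\<^sub>K * (sqrt ?D * sqrt (\<psi> (V \<psi>)))" by (simp add: real_sqrt_mult mult_ac)
 have "C_harm \<epsilon> ?l C\<^sub>K * ((sqrt ?D)\<^sup>2 + (sqrt (\<psi> (V \<psi>)))\<^sup>2) <=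
   (1 - \<epsilon>) * ?l * (sqrt ?D)\<^sup>2 - sqrt C\<^sub>K * (sqrt ?D * sqrt (\<psi> (V \<psi>))) + (sqrt (\<psi> (V \<psi>)))\<^sup>2"
  unfolding C_harm_def by (rule C_harm_quadratic_form[OF CK])
 then have form: "C_harm \<epsilon> ?l C\<^sub>K * (?D + \<psi> (V \<psi>)) <= (1 - \<epsilon>) * (?l * ?D) - ?P + \<psi> (V \<psi>)"
  using P by (simp add: q mult.assoc)
 have "((1 - \<epsilon>) * ?l - 1)\<^sup>2 + C\<^sub>K <= ((1 - \<epsilon>) * ?l + 1)\<^sup>2"
  using ellipticity by (simp add: power2_eq_square algebra_simps)
 then have "sqrt (((1 - \<epsilon>) * ?l - 1)\<^sup>2 + C\<^sub>K) <= (1 - \<epsilon>) * ?l + 1"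
  using ellipticity CK by (intro real_le_lsqrt) auto
 then have C0: "C_harm \<epsilon> ?l C\<^sub>K \<ge> 0" by (simp add: C_harm_def)
 have "min \<epsilon> (C_harm \<epsilon> ?l C\<^sub>K) * (?E + \<psi> (V \<psi>)) <= \<epsilon> * ?E + C_harm \<epsilon> ?l C\<^sub>K * \<psi> (V \<psi>)"
  unfolding distrib_left using q by (intro add_mono mult_right_mono) auto
 also have "... <= \<epsilon> * ?E + C_harm \<epsilon> ?l C\<^sub>K * (?D + \<psi> (V \<psi>))"
  using C0 D by (intro add_left_mono mult_left_mono) auto
 also have "... <= \<epsilon> * ?E + ((1 - \<epsilon>) * (?l * ?D) - ?P + \<psi> (V \<psi>))" using form by simp
 also have "... <= \<epsilon> * ?E + ((1 - \<epsilon>) * ?E - ?P + \<psi> (V \<psi>))"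
  using mult_left_mono[OF CA(2), of "1 - \<epsilon>"] eps by simp
 also have "... = ?E - ?P + \<psi> (V \<psi>)" by (simp add: algebra_simps)
 also have "... <= form_B \<Omega> A b c V K (v, \<psi>) (v, \<psi>)" unfolding B using CA(1) by simp
 finally show ?thesis using q by (simp add: V_norm_def)
qed

end
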